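(* Let $F$ be a Minkowski norm on an $(n+1)$-dimensional real vector space $V^{n+1}$, with indicatrix $M^n$, and let $S(M^n)=\int_{M^n}\xi\lrcorner dV_{B-H}$ be the affine volume of $M^n$. Then $$S(M^n)\le (n+1)\,\omega_{n+1},$$ with equality if and only if $F$ is a Randers norm.
   Context: A Minkowski norm $F$ on $V^{n+1}$ is a function to $[0,\infty)$, smooth off $0$, positively $1$-homogeneous, with $g_{AB}(y)=\frac12\frac{\partial^2F^2}{\partial y^A\partial y^B}(y)$ positive definite for $y\ne0$ (linear coordinates $y^1,\dots,y^{n+1}$); its indicatrix is $M^n=\{F=1\}$. $\omega_{n+1}=\pi^{(n+1)/2}/\Gamma(\frac{n+3}{2})$ is the volume of the Euclidean unit $(n+1)$-ball. The Busemann–Hausdorff volume form is $dV_{B-H}=\sigma_F\,dy^1\wedge\cdots\wedge dy^{n+1}$ with $\sigma_F=\omega_{n+1}/\mathrm{Vol}_{\mathbb R^{n+1}}(\{F<1\})$. $\xi$ is the affine normal (Blaschke normal) field of $M^n$ relative to the volume form $dV_{B-H}$. Equivalently, in local parameters $\theta^1,\dots,\theta^n$ of $M^n$, $\xi\lrcorner dV_{B-H}=\sqrt{\det(G_{ij})}\,d\theta^1\wedge\cdots\wedge d\theta^n$ with Blaschke metric $G_{ij}=[\sigma_F^2/\det(g_{AB})]^{1/(n+2)}h_{ij}$, where $h_{ij}=h_{AB}\frac{\partial r^A}{\partial\theta^i}\frac{\partial r^B}{\partial\theta^j}$, $h_{AB}=g_{AB}-\frac{\partial F}{\partial y^A}\frac{\partial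 F}{\partial y^B}$ and $r(\theta)$ is the position vector of $M^n$. A Randers norm is $\alpha+\beta$ with $\alpha$ Euclidean and $\|\beta\|_\alpha<1$. *)

theory Defs
  imports "HOL-Analysis.Analysis"
begin

text \<open>The vector space V^{n+1} is modelled as real^'n, where CARD('n) = n+1.
  Linear coordinates y^A are the components y $ A.\<close>

fun iter_dirder :: "(real^'n) list \<Rightarrow> (real^'n \<Rightarrow> real) \<Rightarrow> real^'n \<Rightarrow> real" where
  "iter_dirder [] f = f"
| "iter_dirder (u # us) f = (\<lambda>y. frechet_derivative (iter_dirder us f) (at y) u)"

definition smooth_on_set :: "(real^'n \<Rightarrow> real) \<Rightarrow> (real^'n) set \<Rightarrow> bool" where
  "smooth_on_set f S \<longleftrightarrow> open S \<and> (\<forall>us. \<forall>y\<in>S. iter_dirder us f differentiable (at y))"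

definition dF :: "(real^'n \<Rightarrow> real) \<Rightarrow> real^'n \<Rightarrow> real^'n \<Rightarrow> real" where
  "dF F y u = frechet_derivative F (at y) u"

definition fund_g :: "(real^'n \<Rightarrow> real) \<Rightarrow> real^'n \<Rightarrow> real^'n \<Rightarrow> real^'n \<Rightarrow> real" where
  "fund_g F y u v = (1/2) * iter_dirder [v, u] (\<lambda>x. (F x)\<^sup>2) y"

definition g_matrix :: "(real^'n \<Rightarrow> real) \<Rightarrow> real^'n \<Rightarrow> real^'n^'n" where
  "g_matrix F y = (\<chi> A B. fund_g F y (axis A 1) (axis B 1))"

definition minkowski_norm :: "(real^'n \<Rightarrow> real) \<Rightarrow> bool" where
  "minkowski_norm F \<longleftrightarrow>
     (\<forall>y. F y \<ge> 0) \<and>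
     smooth_on_set F (UNIV - {0}) \<and>
     (\<forall>c y. c > 0 \<longrightarrow> F (c *\<^sub>R y) = c * F y) \<and>
     (\<forall>y. y \<noteq> 0 \<longrightarrow> (\<forall>u. u \<noteq> 0 \<longrightarrow> fund_g F y u u > 0))"

definition indicatrix :: "(real^'n \<Rightarrow> real) \<Rightarrow> (real^'n) set" where
  "indicatrix F = {y. F y = 1}"

text \<open>omega_{n+1}: volume of the Euclidean unit (n+1)-ball, n+1 = CARD('n).\<close>
definition omega :: "nat \<Rightarrow> real" where
  "omega N = pi powr (real N / 2) / Gamma ((real N + 2) / 2)"

definition sigma_BH :: "(real^'n \<Rightarrow> real) \<Rightarrow> real" where
  "sigma_BH F = omega CARD('n) / measure lebesgue {y. F y < 1}"

definition h_form :: "(real^'n \<Rightarrow> real) \<Rightarrow> real^'n \<Rightarrow> real^'n \<Rightarrow> real^'n \<Rightarrow> real" where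
  "h_form F y u v = fund_g F y u v - dF F y u * dF F y v"

definition blaschke_metric :: "(real^'n \<Rightarrow> real) \<Rightarrow> real^'n \<Rightarrow> real^'n \<Rightarrow> real^'n \<Rightarrow> real" where
  "blaschke_metric F y u v =
     ((sigma_BH F)\<^sup>2 / det (g_matrix F y)) powr (1 / (real CARD('n) + 1)) * h_form F y u v"

text \<open>A frame at y in M: w i0 = y (position vector), and the remaining n vectors
  w i (i ~= i0) form a basis of the tangent space T_y M = ker dF_y.\<close>
definition adapted_frame ::
  "(real^'n \<Rightarrow> real) \<Rightarrow> real^'n \<Rightarrow> 'n \<Rightarrow> ('n \<Rightarrow> real^'n) \<Rightarrow> bool" where
  "adapted_frame F y i0 w \<longleftrightarrow>
     w i0 = y \<and> (\<forall>i. i \<noteq> i0 \<longrightarrow> dF F y (w i) = 0) \<and> det (\<chi> i. w i) \<noteq> 0"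

text \<open>det(G_ij) for the tangent vectors w i, i ~= i0 (computed as an n+1 by n+1
  block determinant with a 1 in the i0 slot).\<close>
definition blaschke_gram_det ::
  "(real^'n \<Rightarrow> real) \<Rightarrow> real^'n \<Rightarrow> 'n \<Rightarrow> ('n \<Rightarrow> real^'n) \<Rightarrow> real" where
  "blaschke_gram_det F y i0 w =
     det (\<chi> i j. if i = i0 \<or> j = i0 then (if i = j then 1 else 0)
                 else blaschke_metric F y (w i) (w j))"

text \<open>Density of the n-form xi _| dV_{B-H} = sqrt(det G_ij) d theta relative to the cone
  form r _| dy^1 ^ ... ^ dy^{n+1} on M: evaluated on a tangent basis v, it is
  sqrt(det G(v_i,v_j)) / |det(r, v_1, ..., v_n)|.\<close>
definition affine_density :: "(real^'n \<Rightarrow> real) \<Rightarrow> real^'n \<Rightarrow> real" where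
  "affine_density F y =
     (let i0 = (SOME i::'n. True); w = (SOME w. adapted_frame F y i0 w)
      in sqrt (blaschke_gram_det F y i0 w) / \<bar>det (\<chi> i. w i)\<bar>)"

text \<open>Affine volume S(M) = int_M xi _| dV_{B-H}.  An n-form rho (r _| dy) on M
  integrates to (n+1) int_{F<1} rho(y/F(y)) dy (cone-measure formula).\<close>
definition affine_volume :: "(real^'n \<Rightarrow> real) \<Rightarrow> real" where
  "affine_volume F =
     real CARD('n) * integral {y. F y < 1} (\<lambda>y. affine_density F ((1 / F y) *\<^sub>R y))"

definition randers_norm :: "(real^'n \<Rightarrow> real) \<Rightarrow> bool" where
  "randers_norm F \<longleftrightarrow>
     (\<exists>(A::real^'n^'n) (b::real^'n).
        transpose A = A \<and> (\<forall>y. y \<noteq> 0 \<longrightarrow> y \<bullet> (A *v y) > 0) \<and>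
        Sup {\<bar>b \<bullet> y\<bar> | y. sqrt (y \<bullet> (A *v y)) = 1} < 1 \<and>
        (\<forall>y. F y = sqrt (y \<bullet> (A *v y)) + b \<bullet> y))"

end

theory Submission
  imports Defs "HOL-Probability.Probability"
begin

text \<open>Put N = CARD('n), K = {F < 1}, V = vol K and D = det (g_AB). The density of the affine volume
  form with respect to the cone form is sigma^((N-1)/(N+1)) D^(1/(N+1)), so the affine volume is
  N sigma^((N-1)/(N+1)) times the integral of D^(1/(N+1)) over K. The latter integral does not change
  when the origin is moved to another interior point of K, hence K may be assumed to be centered.

  The Legendre transformation y \<mapsto> F dF has Jacobian D and turns exp (- F^2 / 2) into a Gaussian of
  the dual norm. The functional Blaschke-Santalo inequality therefore bounds the integral of D over K
  by omega^2 / V = sigma^2 V, and concavity of t \<mapsto> t^(1/(N+1)) gives the bound. The Blaschke-Santalo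
  inequality is proved following Lehec: split the space by a hyperplane into two halves of equal mass,
  use induction on the dimension together with a one-dimensional Prekopa-Leindler inequality on each
  half, and remove the resulting translation by an exponential tilt.

  Equality forces D = sigma^2 for the centered body. By Deicke's theorem the g_AB are then constant, so
  the translated norm is Euclidean; the norms whose unit ball is an off-center ellipsoid around the
  origin are the Randers norms.\<close>

section \<open>A one-dimensional Gaussian duality inequality\<close>

text \<open>The integral of D over K is the volume of the polar body, and the bound by omega^2 fails
  when the origin is badly placed; so the origin has to be moved first. This is possible because N
  times the integral of D^(1/(N+1)) over K is the equiaffine surface area of the indicatrix: on F =
  1 one has D = kappa / (nu . y)^(N+1), with Gauss curvature kappa and outer unit normal nu, and the
  exponent 1/(N+1) cancels the support function nu . y of the cone measure. A Minkowski norm is only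
  positively homogeneous, hence Santalo's inequality is needed for bodies without symmetry. Its
  functional form fits because the Gaussians of F and of the dual norm are related by a single
  change of variables. Lehec's induction treats its two functions asymmetrically: the splitting
  point comes from one of them while the other one is centered. This is what allows the tilt to
  close the induction. Equality is read off from the concavity step, where it makes D constant; this
  is the hypothesis of Deicke's theorem.\<close>

lemma emeasure_sumset_ge:
  fixes A B D :: "real set"
  assumes A: "A \<in> sets borel" "bounded A" "A \<noteq> {}"
    and B: "B \<in> sets borel" "bounded B" "B \<noteq> {}"
    and D: "D \<in> sets borel" "\<And>a b. a \<in> A \<Longrightarrow> b \<in> B \<Longrightarrow> a + b \<in> D"
  shows "emeasure lborel A + emeasure lborel B \<le> emeasure lborel D"
proof (rule ennreal_le_epsilon)
  fix e :: real assume e: "0 < e"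
  define \<alpha> \<beta> where "\<alpha> = Sup A" and "\<beta> = Inf B"
  have bA: "bdd_above A" and bB: "bdd_below B"
    using bounded_imp_bdd_above[OF A(2)] bounded_imp_bdd_below[OF B(2)] by auto
  obtain a where a: "a \<in> A" "\<alpha> - e/2 < a"
    using less_cSup_iff[OF A(3) bA, of "\<alpha> - e/2"] e by (auto simp: \<alpha>_def)
  obtain b where b: "b \<in> B" "b < \<beta> + e/2"
    using cInf_less_iff[OF B(3) bB, of "\<beta> + e/2"] e by (auto simp: \<beta>_def)
  \<comment> \<open>The translates A + b and a + B both lie in D. As a is close to sup A and b to
    inf B, they overlap in an interval of length at most e, so their measures almost add up.\<close>
  define A' where "A' = (\<lambda>x. x - b) -` A"
  define B' where "B' = (\<lambda>x. x - a) -` B"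
  have mA': "A' \<in> sets borel" and mB': "B' \<in> sets borel"
    unfolding A'_def B'_def using A B by (auto intro!: borel_measurable_vimage measurable_sets_borel[of _ borel])
  have shift: "emeasure lborel ((\<lambda>x. x - c) -` S) = emeasure lborel S" if "S \<in> sets borel" for c and S :: "real set"
  proof -
    have "emeasure lborel S = emeasure (distr lborel borel ((+) (- c))) S"
      using lborel_distr_plus[of "-c"] by simp
    also have "\<dots> = emeasure lborel (((+) (- c)) -` S)"
      using that by (subst emeasure_distr) auto
    also have "((+) (- c)) -` S = (\<lambda>x. x - c) -` S" by auto
    finally show ?thesis by simp
  qed
  have eA: "emeasure lborel A' = emeasure lborel A" and eB: "emeasure lborel B' = emeasure lborel B"
    unfolding A'_def B'_def using shift A B by auto
  have inter: "A' \<inter> B' \<subseteq> {a + \<beta>..b + \<alpha>}"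
    using cSup_upper[OF _ bA] cInf_lower[OF _ bB] by (force simp: A'_def B'_def \<alpha>_def \<beta>_def)
  have "emeasure lborel (A' \<inter> B') \<le> emeasure lborel {a + \<beta>..b + \<alpha>}"
    by (intro emeasure_mono inter) auto
  also have "\<dots> \<le> ennreal e"
    using a b e by (auto simp: emeasure_lborel_Icc_eq intro!: ennreal_leI)
  finally have small: "emeasure lborel (A' \<inter> B') \<le> ennreal e" .
  have sub: "A' \<union> B' \<subseteq> D"
  proof
    fix x assume "x \<in> A' \<union> B'"
    then show "x \<in> D"
      using D(2)[of "x - b" b] D(2)[of a "x - a"] a b by (auto simp: A'_def B'_def)
  qed
  have eA': "emeasure lborel A' = emeasure lborel (A' \<inter> B') + emeasure lborel (A' - B')"
    using mA' mB' by (subst plus_emeasure) (auto simp: Int_Diff_Un)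
  have "emeasure lborel A' + emeasure lborel B'
      = emeasure lborel (A' \<inter> B') + (emeasure lborel (A' - B') + emeasure lborel B')"
    by (simp add: eA' add.assoc)
  also have "emeasure lborel (A' - B') + emeasure lborel B' = emeasure lborel (A' \<union> B')"
    using mA' mB' by (subst plus_emeasure) (auto simp: Un_commute)
  also have "\<dots> \<le> emeasure lborel D"
    using sub D by (intro emeasure_mono) auto
  also have "emeasure lborel (A' \<inter> B') + emeasure lborel D \<le> emeasure lborel D + ennreal e"
    using small by (simp add: add.commute add_left_mono)
  finally show "emeasure lborel A + emeasure lborel B \<le> emeasure lborel D + ennreal e"
    by (simp add: eA eB add_left_mono)
qed

text \<open>With both suprema equal to 1, the level sets of u and v are nonempty for the same t < 1.
  The one-dimensional Brunn-Minkowski inequality then applies level by level, and it bounds the sum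
  of the integrals rather than their geometric mean.\<close>

lemma prekopa_leindler_bounded:
  fixes u v h :: "real \<Rightarrow> real"
  assumes [measurable]: "u \<in> borel_measurable borel" "v \<in> borel_measurable borel" "h \<in> borel_measurable borel"
    and nn: "\<And>x. 0 \<le> u x" "\<And>x. 0 \<le> v x" "\<And>x. 0 \<le> h x"
    and supp: "\<And>x. R < \<bar>x\<bar> \<Longrightarrow> u x = 0" "\<And>x. R < \<bar>x\<bar> \<Longrightarrow> v x = 0"
    and sup: "\<And>x. u x \<le> 1" "\<And>x. v x \<le> 1"
      "\<And>t. t < 1 \<Longrightarrow> \<exists>x. t < u x" "\<And>t. t < 1 \<Longrightarrow> \<exists>x. t < v x"
    and uvh: "\<And>a b. u a * v b \<le> (h ((a + b) / 2))\<^sup>2"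
  shows "(\<integral>\<^sup>+x. u x \<partial>lborel) + (\<integral>\<^sup>+x. v x \<partial>lborel) \<le> 2 * (\<integral>\<^sup>+x. h x \<partial>lborel)"
proof -
  have layer: "(\<integral>\<^sup>+x. ennreal (f x) \<partial>lborel) = (\<integral>\<^sup>+t. indicator {0<..} t * emeasure lborel {x. t < f x} \<partial>lborel)"
    if [measurable]: "f \<in> borel_measurable borel" and f: "\<And>x. 0 \<le> f x" for f :: "real \<Rightarrow> real"
  proof -
    have "(\<integral>\<^sup>+x. ennreal (f x) \<partial>lborel) = (\<integral>\<^sup>+x. (\<integral>\<^sup>+t. indicator {0<..<f x} t \<partial>lborel) \<partial>lborel)"
      using f by simp
    also have "\<dots> = (\<integral>\<^sup>+x. (\<integral>\<^sup>+t. indicator {p. 0 < snd p \<and> snd p < f (fst p)} (x, t) \<partial>lborel) \<partial>lborel)"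
      by (intro nn_integral_cong) (auto simp: indicator_def)
    also have "\<dots> = (\<integral>\<^sup>+t. (\<integral>\<^sup>+x. indicator {p. 0 < snd p \<and> snd p < f (fst p)} (x, t) \<partial>lborel) \<partial>lborel)"
      by (rule lborel_pair.Fubini'[symmetric]) measurable
    also have "\<dots> = (\<integral>\<^sup>+t. (\<integral>\<^sup>+x. indicator {0<..} t * indicator {x. t < f x} x \<partial>lborel) \<partial>lborel)"
      by (intro nn_integral_cong) (auto simp: indicator_def)
    also have "\<dots> = (\<integral>\<^sup>+t. indicator {0<..} t * emeasure lborel {x. t < f x} \<partial>lborel)"
      by (intro nn_integral_cong) (subst nn_integral_cmult; simp)
    finally show ?thesis .
  qed
  have *: "indicator {0<..} t * emeasure lborel {x. t < u x} + indicator {0<..} t * emeasure lborel {x. t < v x}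
      \<le> 2 * (indicator {0<..} t * emeasure lborel {x. t < h x})" for t :: real
  proof (cases "0 < t \<and> t < 1")
    case True
    have bd: "bounded {x. t < u x}" "bounded {x. t < v x}"
      using True supp by (auto intro!: boundedI[where B=R] simp: not_less[symmetric]; force)+
    have "emeasure lborel {x. t < u x} + emeasure lborel {x. t < v x} \<le> emeasure lborel ((\<lambda>x. x / 2) -` {x. t < h x})"
    proof (rule emeasure_sumset_ge)
      fix a b assume "a \<in> {x. t < u x}" "b \<in> {x. t < v x}"
      then have "t * t < u a * v b"
        using True by (intro mult_strict_mono) auto
      also have "\<dots> \<le> (h ((a + b) / 2))\<^sup>2" by (rule uvh)
      finally show "a + b \<in> (\<lambda>x. x / 2) -` {x. t < h x}"
        using True nn(3) by (auto simp: power2_eq_square[symmetric] intro: power2_less_imp_less)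
    qed (use bd sup(3,4) True in auto)
    also have "\<dots> = 2 * emeasure lborel {x. t < h x}"
    proof -
      have "emeasure lborel ((\<lambda>x. x / 2) -` {x. t < h x})
          = emeasure (density (distr lborel borel (\<lambda>x. 2 * x)) (\<lambda>_. 2)) ((\<lambda>x. x / 2) -` {x. t < h x})"
        using lborel_real_affine[of 2 0] by simp
      also have "\<dots> = 2 * emeasure lborel {x. t < h x}"
        by (subst emeasure_density_const) (auto simp: emeasure_distr vimage_def)
      finally show ?thesis .
    qed
    finally show ?thesis using True by simp
  next
    case False
    then have "{x. t < u x} = {} \<or> t \<le> 0" "{x. t < v x} = {} \<or> t \<le> 0"
      using sup(1,2) by (auto simp: not_less intro: order_trans)
    then show ?thesis by (auto simp: indicator_def)
  qed
  have "(\<integral>\<^sup>+x. u x \<partial>lborel) + (\<integral>\<^sup>+x. v x \<partial>lborel)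
      = (\<integral>\<^sup>+t. indicator {0<..} t * emeasure lborel {x. t < u x} + indicator {0<..} t * emeasure lborel {x. t < v x} \<partial>lborel)"
    using nn by (subst (1 2) layer) (auto simp: nn_integral_add)
  also have "\<dots> \<le> (\<integral>\<^sup>+t. 2 * (indicator {0<..} t * emeasure lborel {x. t < h x}) \<partial>lborel)"
    by (intro nn_integral_mono *)
  also have "\<dots> = 2 * (\<integral>\<^sup>+x. h x \<partial>lborel)"
    using nn by (subst layer) (auto simp: nn_integral_cmult)
  finally show ?thesis .
qed

lemma nn_integral_UN_incseq:
  assumes [measurable]: "f \<in> borel_measurable M" "\<And>n. A n \<in> sets M" and "incseq A"
  shows "(\<integral>\<^sup>+x. f x * indicator (\<Union>n::nat. A n) x \<partial>M) = (SUP n. \<integral>\<^sup>+x. f x * indicator (A n) x \<partial>M)"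
proof -
  have "(SUP n. emeasure (density M f) (A n)) = emeasure (density M f) (\<Union>n. A n)"
    using assms(3) by (intro SUP_emeasure_incseq) auto
  then show ?thesis by (simp add: emeasure_density)
qed

text \<open>The substitution x = exp a is made on the compact intervals from -n to n, which exhaust
  the line; monotone convergence passes to the limit.\<close>

lemma nn_integral_exp_substitution:
  fixes u :: "real \<Rightarrow> real"
  assumes [measurable]: "u \<in> borel_measurable borel" and nn: "\<And>x. 0 \<le> u x"
  shows "(\<integral>\<^sup>+a. ennreal (u (exp a) * exp a) \<partial>lborel) = (\<integral>\<^sup>+x. ennreal (u x) * indicator {0<..} x \<partial>lborel)"
proof -
  have mono: "incseq (\<lambda>n::nat. {- real n..real n})" "incseq (\<lambda>n::nat. {exp (- real n)..exp (real n)})"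
    by (auto simp: incseq_def)
  have U1: "(\<Union>n::nat. {- real n..real n}) = UNIV"
  proof -
    have "\<exists>n::nat. - real n \<le> x \<and> x \<le> real n" for x
      using real_arch_simple[of "\<bar>x\<bar>"] by (auto simp: abs_le_iff) (metis minus_le_iff)
    then show ?thesis by auto
  qed
  have U2: "(\<Union>n::nat. {exp (- real n)..exp (real n)}) = {0<..}"
  proof -
    have "\<exists>n::nat. exp (- real n) \<le> x \<and> x \<le> exp (real n)" if "0 < x" for x
    proof -
      have "ln x \<in> (\<Union>n::nat. {- real n..real n})" unfolding U1 by simp
      then obtain n :: nat where "- real n \<le> ln x" "ln x \<le> real n" by auto
      then show ?thesis using that by (metis exp_le_cancel_iff exp_ln)
    qed
    moreover have "0 < x" if "exp (- real n) \<le> x" for x :: real and n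
      using that by (meson exp_gt_zero less_le_trans)
    ultimately show ?thesis by auto
  qed
  have "(\<integral>\<^sup>+a. ennreal (u (exp a) * exp a) \<partial>lborel)
      = (\<integral>\<^sup>+a. ennreal (u (exp a) * exp a) * indicator (\<Union>n::nat. {- real n..real n}) a \<partial>lborel)"
    by (simp add: U1)
  also have "\<dots> = (SUP n. \<integral>\<^sup>+a. ennreal (u (exp a) * exp a) * indicator {- real n..real n} a \<partial>lborel)"
    by (intro nn_integral_UN_incseq mono) measurable
  also have "\<dots> = (SUP n. \<integral>\<^sup>+x. ennreal (u x) * indicator {exp (- real n)..exp (real n)} x \<partial>lborel)"
  proof (intro SUP_cong refl)
    fix n :: nat
    have "(\<integral>\<^sup>+x. ennreal (u x * indicator {exp (- real n)..exp (real n)} x) \<partial>lborel)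
        = (\<integral>\<^sup>+a. ennreal (u (exp a) * exp a * indicator {- real n..real n} a) \<partial>lborel)"
      by (rule nn_integral_substitution) (auto simp: set_borel_measurable_def intro!: derivative_eq_intros continuous_intros)
    then show "(\<integral>\<^sup>+a. ennreal (u (exp a) * exp a) * indicator {- real n..real n} a \<partial>lborel)
        = (\<integral>\<^sup>+x. ennreal (u x) * indicator {exp (- real n)..exp (real n)} x \<partial>lborel)"
      by (simp add: ennreal_mult'' nn ennreal_indicator)
  qed
  also have "\<dots> = (\<integral>\<^sup>+x. ennreal (u x) * indicator {0<..} x \<partial>lborel)"
    unfolding U2[symmetric] using mono
    by (intro nn_integral_UN_incseq[symmetric]) measurable
  finally show ?thesis .
qed

lemma nn_integral_half_gaussian:
  "(\<integral>\<^sup>+x. ennreal (exp (- (x\<^sup>2 / 2))) * indicator {0<..} x \<partial>lborel) = ennreal (sqrt (pi / 2))"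
proof -
  have g: "(\<integral>\<^sup>+x. ennreal (indicator {0..} x *\<^sub>R exp (- x\<^sup>2)) \<partial>lborel) = ennreal (sqrt pi / 2)"
    using gaussian_moment_0
    by (subst nn_integral_eq_integral) (auto simp: has_bochner_integral_iff)
  have "(\<integral>\<^sup>+x. ennreal (exp (- (x\<^sup>2 / 2))) * indicator {0<..} x \<partial>lborel)
      = (\<integral>\<^sup>+x. ennreal (indicator {0..} x * exp (- (x\<^sup>2 / 2))) \<partial>lborel)"
  proof (intro nn_integral_cong_AE)
    have "AE x in lborel. x \<noteq> (0::real)" by (rule AE_lborel_singleton)
    then show "AE x in lborel. ennreal (exp (- (x\<^sup>2 / 2))) * indicator {0<..} x
        = ennreal (indicator {0..} x * exp (- (x\<^sup>2 / 2)))"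
      by eventually_elim (auto simp: indicator_def)
  qed
  also have "\<dots> = sqrt 2 * (\<integral>\<^sup>+x. ennreal (indicator {0..} (0 + sqrt 2 * x) * exp (- ((0 + sqrt 2 * x)\<^sup>2 / 2))) \<partial>lborel)"
    by (subst nn_integral_real_affine[where c="sqrt 2" and t=0]) auto
  also have "\<dots> = sqrt 2 * (\<integral>\<^sup>+x. ennreal (indicator {0..} x *\<^sub>R exp (- x\<^sup>2)) \<partial>lborel)"
    by (intro arg_cong2[where f="(*)"] nn_integral_cong refl)
       (auto simp: indicator_def power_mult_distrib zero_le_mult_iff)
  also have "\<dots> = ennreal (sqrt 2 * (sqrt pi / 2))"
    by (subst g) (simp add: ennreal_mult'' del: times_divide_eq_right)
  also have "sqrt 2 * (sqrt pi / 2) = sqrt (pi / 2)"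
    by (simp add: real_sqrt_divide field_simps)
  finally show ?thesis .
qed

text \<open>In logarithmic coordinates the geometric mean of s and t becomes a midpoint, and exp (-
  s t) is the square of exp (- x^2 / 2) at x = sqrt (s t). This turns the hypothesis into that of
  Prekopa-Leindler. The constant pi / 2 is the square of the Gaussian integral over the half
  line.\<close>

lemma gaussian_duality_1d_bounded:
  fixes u v :: "real \<Rightarrow> real"
  assumes [measurable]: "u \<in> borel_measurable borel" "v \<in> borel_measurable borel"
    and nn: "\<And>x. 0 \<le> u x" "\<And>x. 0 \<le> v x"
    and bd: "\<And>x. u x \<le> B" "\<And>x. v x \<le> B"
    and R: "1 < R" "\<And>x. x \<notin> {1/R..R} \<Longrightarrow> u x = 0" "\<And>x. x \<notin> {1/R..R} \<Longrightarrow> v x = 0"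
    and c: "0 < c"
    and uv: "\<And>s t. 0 < s \<Longrightarrow> 0 < t \<Longrightarrow> u s * v t \<le> c * exp (- (s * t))"
  shows "(\<integral>\<^sup>+x. u x \<partial>lborel) * (\<integral>\<^sup>+x. v x \<partial>lborel) \<le> ennreal (c * (pi / 2))"
proof (cases "(\<forall>x. u x = 0) \<or> (\<forall>x. v x = 0)")
  case True
  then show ?thesis by auto
next
  case False
  define U V where "U = (\<lambda>a. u (exp a) * exp a)" and "V = (\<lambda>a. v (exp a) * exp a)"
  define mu mv where "mu = (SUP a. U a)" and "mv = (SUP a. V a)"
  have [measurable]: "U \<in> borel_measurable borel" "V \<in> borel_measurable borel"
    unfolding U_def V_def by measurable
  have B0: "0 \<le> B" using nn(1) bd(1) order_trans by blast
  have UVB: "0 \<le> U a" "U a \<le> B * R" "0 \<le> V a" "V a \<le> B * R" for a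
  proof -
    have "u (exp a) * exp a \<le> B * R"
      using R(1) R(2)[of "exp a"] nn bd B0 by (cases "exp a \<in> {1/R..R}") (auto intro!: mult_mono)
    moreover have "v (exp a) * exp a \<le> B * R"
      using R(1) R(3)[of "exp a"] nn bd B0 by (cases "exp a \<in> {1/R..R}") (auto intro!: mult_mono)
    ultimately show "0 \<le> U a" "U a \<le> B * R" "0 \<le> V a" "V a \<le> B * R"
      using nn by (auto simp: U_def V_def)
  qed
  have bddU: "bdd_above (range U)" and bddV: "bdd_above (range V)"
    using UVB by (auto intro!: bdd_aboveI[where M="B * R"])
  have mu: "U a \<le> mu" "V a \<le> mv" for a
    unfolding mu_def mv_def by (intro cSUP_upper bddU bddV; simp)+
  have "0 < mu"
  proof -
    obtain x where "u x \<noteq> 0" using False by auto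
    moreover have "0 < x" using R calculation
      by (metis atLeastAtMost_iff less_le_trans zero_less_divide_1_iff less_trans zero_less_one)
    ultimately have "0 < U (ln x)" using nn(1)[of x] by (auto simp: U_def)
    then show ?thesis using mu(1) less_le_trans by blast
  qed
  have "0 < mv"
  proof -
    obtain x where "v x \<noteq> 0" using False by auto
    moreover have "0 < x" using R calculation
      by (metis atLeastAtMost_iff less_le_trans zero_less_divide_1_iff less_trans zero_less_one)
    ultimately have "0 < V (ln x)" using nn(2)[of x] by (auto simp: V_def)
    then show ?thesis using mu(2) less_le_trans by blast
  qed
  \<comment> \<open>The factor \<open>sqrt (c / (mu * mv))\<close> accounts for c and for dividing U
    and V by their suprema.\<close>
  define h where "h = (\<lambda>a. sqrt (c / (mu * mv)) * (exp (- ((exp a)\<^sup>2 / 2)) * exp a))"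
  have PL: "(\<integral>\<^sup>+x. U x / mu \<partial>lborel) + (\<integral>\<^sup>+x. V x / mv \<partial>lborel) \<le> 2 * (\<integral>\<^sup>+x. h x \<partial>lborel)"
  proof (rule prekopa_leindler_bounded[where R="ln R"])
    show "h \<in> borel_measurable borel" unfolding h_def by measurable
    fix x :: real assume x: "ln R < \<bar>x\<bar>"
    have "exp x \<notin> {1/R..R}"
    proof
      assume "exp x \<in> {1/R..R}"
      then have "ln (1/R) \<le> ln (exp x)" "ln (exp x) \<le> ln R"
        using R(1) by (auto simp del: ln_exp intro!: ln_mono)
      then show False using x R(1) by (simp add: ln_div)
    qed
    then show "U x / mu = 0" "V x / mv = 0"
      using R by (auto simp: U_def V_def)
  next
    fix t :: real assume "t < 1"
    then have "t * mu < mu" "t * mv < mv" using \<open>0 < mu\<close> \<open>0 < mv\<close> by auto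
    then obtain x y where "t * mu < U x" "t * mv < V y"
      unfolding mu_def mv_def using less_cSUP_iff[OF _ bddU] less_cSUP_iff[OF _ bddV] by auto
    then show "\<exists>x. t < U x / mu" "\<exists>x. t < V x / mv"
      using \<open>0 < mu\<close> \<open>0 < mv\<close> by (auto simp: pos_less_divide_eq)
  next
    fix a b :: real
    have "U a * V b \<le> c * exp (- (exp a * exp b)) * (exp a * exp b)"
      using mult_right_mono[OF uv[of "exp a" "exp b"], of "exp a * exp b"]
      by (simp add: U_def V_def mult.assoc mult.left_commute)
    moreover have "(h ((a + b) / 2))\<^sup>2 = c / (mu * mv) * (exp (- (exp a * exp b)) * (exp a * exp b))"
    proof -
      have e: "(exp ((a + b) / 2))\<^sup>2 = exp a * exp b"
        by (simp add: power2_eq_square exp_add[symmetric])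
      have "(exp (- (exp a * exp b / 2)))\<^sup>2 = exp (- (exp a * exp b))"
        by (simp add: power2_eq_square exp_add[symmetric])
      then show ?thesis
        using \<open>0 < mu\<close> \<open>0 < mv\<close> c unfolding h_def power_mult_distrib e by simp
    qed
    ultimately show "U a / mu * (V b / mv) \<le> (h ((a + b) / 2))\<^sup>2"
      using \<open>0 < mu\<close> \<open>0 < mv\<close> by (simp add: divide_simps mult.assoc)
  qed (use UVB mu \<open>0 < mu\<close> \<open>0 < mv\<close> c in \<open>auto simp: h_def\<close>)
  have H: "(\<integral>\<^sup>+x. h x \<partial>lborel) = ennreal (sqrt (c / (mu * mv)) * sqrt (pi / 2))"
  proof -
    have "(\<integral>\<^sup>+x. h x \<partial>lborel) = ennreal (sqrt (c / (mu * mv))) * (\<integral>\<^sup>+a. ennreal (exp (- ((exp a)\<^sup>2 / 2)) * exp a) \<partial>lborel)"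
      unfolding h_def using c \<open>0 < mu\<close> \<open>0 < mv\<close>
      by (subst nn_integral_cmult[symmetric]) (auto simp: ennreal_mult'')
    also have "\<dots> = ennreal (sqrt (c / (mu * mv))) * ennreal (sqrt (pi / 2))"
      by (subst nn_integral_exp_substitution) (auto simp: nn_integral_half_gaussian)
    finally show ?thesis using c \<open>0 < mu\<close> \<open>0 < mv\<close> by (simp add: ennreal_mult'')
  qed
  define P Q where "P = (\<integral>\<^sup>+x. u x \<partial>lborel)" and "Q = (\<integral>\<^sup>+x. v x \<partial>lborel)"
  have sub: "(\<integral>\<^sup>+x. w (exp x) * exp x / m \<partial>lborel) = (\<integral>\<^sup>+x. w x \<partial>lborel) / ennreal m"
    if [measurable]: "w \<in> borel_measurable borel" and w: "\<And>x. 0 \<le> w x" "\<And>x. x \<notin> {1/R..R} \<Longrightarrow> w x = 0" and m: "0 < m"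
    for w :: "real \<Rightarrow> real" and m :: real
  proof -
    have "(\<integral>\<^sup>+x. w (exp x) * exp x / m \<partial>lborel) = (\<integral>\<^sup>+x. ennreal (w (exp x) * exp x) \<partial>lborel) / ennreal m"
      using w m by (subst nn_integral_divide[symmetric]) (auto simp: divide_ennreal)
    also have "(\<integral>\<^sup>+x. ennreal (w (exp x) * exp x) \<partial>lborel) = (\<integral>\<^sup>+x. ennreal (w x) * indicator {0<..} x \<partial>lborel)"
      using w by (intro nn_integral_exp_substitution) auto
    also have "\<dots> = (\<integral>\<^sup>+x. ennreal (w x) \<partial>lborel)"
    proof (intro nn_integral_cong)
      fix x :: real
      have "w x = 0" if "x \<le> 0"
        using that R(1) by (intro w(2)) (auto simp: not_le intro: le_less_trans)
      then show "ennreal (w x) * indicator {0<..} x = ennreal (w x)"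
        by (cases "0 < x") auto
    qed
    finally show ?thesis .
  qed
  have main: "P / ennreal mu + Q / ennreal mv \<le> ennreal (2 * (sqrt (c / (mu * mv)) * sqrt (pi / 2)))"
    using PL R nn \<open>0 < mu\<close> \<open>0 < mv\<close> unfolding H U_def V_def P_def Q_def
    by (subst (asm) (1 2) sub) (auto simp: ennreal_mult')
  have "P / ennreal mu < \<infinity>" "Q / ennreal mv < \<infinity>"
    using main by (auto simp: top_unique less_top[symmetric])
  then have "P < \<infinity>" "Q < \<infinity>"
    using \<open>0 < mu\<close> \<open>0 < mv\<close> by (auto simp: ennreal_top_divide less_top[symmetric])
  then obtain p q where p: "P = ennreal p" "0 \<le> p" and q: "Q = ennreal q" "0 \<le> q"
    by (metis ennreal_cases infinity_ennreal_def less_irrefl)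
  have "p / mu + q / mv \<le> 2 * (sqrt (c / (mu * mv)) * sqrt (pi / 2))"
    using main p q \<open>0 < mu\<close> \<open>0 < mv\<close> c by (simp add: divide_ennreal flip: ennreal_plus)
  then have "(p / mu + q / mv)\<^sup>2 \<le> (2 * (sqrt (c / (mu * mv)) * sqrt (pi / 2)))\<^sup>2"
    using p q \<open>0 < mu\<close> \<open>0 < mv\<close> by (intro power_mono) auto
  also have "\<dots> = 4 * (c / (mu * mv) * (pi / 2))"
    using c \<open>0 < mu\<close> \<open>0 < mv\<close> by (simp add: power_mult_distrib)
  \<comment> \<open>The arithmetic-geometric mean inequality passes from the sum to the product, in
    which \<open>mu\<close> and \<open>mv\<close> cancel.\<close>
  finally have "4 * ((p / mu) * (q / mv)) \<le> 4 * (c / (mu * mv) * (pi / 2))"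
    using sum_squares_bound[of "p / mu" "q / mv"] by (simp add: power2_sum)
  then have "p * q \<le> c * (pi / 2)"
    using \<open>0 < mu\<close> \<open>0 < mv\<close> by (simp add: divide_simps mult.commute)
  then have "ennreal (p * q) \<le> ennreal (c * (pi / 2))" by (rule ennreal_leI)
  then show ?thesis
    using p q unfolding P_def[symmetric] Q_def[symmetric] by (simp add: ennreal_mult)
qed

text \<open>Truncation in height and support reduces to the bounded case; it only decreases u and v,
  so the hypothesis survives, and monotone convergence removes it.\<close>

lemma gaussian_duality_1d:
  fixes u v :: "real \<Rightarrow> ennreal"
  assumes [measurable]: "u \<in> borel_measurable borel" "v \<in> borel_measurable borel"
    and c: "0 < c"
    and uv: "\<And>s t. 0 < s \<Longrightarrow> 0 < t \<Longrightarrow> u s * v t \<le> ennreal (c * exp (- (s * t)))"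
  shows "(\<integral>\<^sup>+x. u x * indicator {0<..} x \<partial>lborel) * (\<integral>\<^sup>+x. v x * indicator {0<..} x \<partial>lborel)
    \<le> ennreal (c * (pi / 2))"
proof -
  \<comment> \<open>The offset 2 keeps the right end of the interval above 1 also for n = 0, as the
    bounded case demands.\<close>
  define T where "T = (\<lambda>w (n::nat) x. enn2real (min (w x) (of_nat n)) * indicator {1 / (real n + 2)..real n + 2} x)"
  have fin: "ennreal (enn2real (min y (of_nat n))) = min y (of_nat n)" for y :: ennreal and n
    by (intro ennreal_enn2real) (simp add: min_less_iff_disj ennreal_of_nat_eq_real_of_nat)
  have T_eq: "ennreal (T w n x) = min (w x) (of_nat n) * indicator {1 / (real n + 2)..real n + 2} x" for w n x
    by (simp add: T_def fin ennreal_mult' ennreal_indicator)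
  have pos: "0 < x" if "x \<in> {1 / (real n + 2)..real n + 2}" for x n
    using that by (auto intro: less_le_trans[of 0 "1 / (real n + 2)"])
  have T_le: "ennreal (T w n x) \<le> w x * indicator {0<..} x" for w n x
    using pos[of x n] by (auto simp: T_eq indicator_def)
  have T_mono: "ennreal (T w n x) \<le> ennreal (T w m x)" if "n \<le> m" for w n m x
  proof -
    have "1 / (real m + 2) \<le> 1 / (real n + 2)" using that by (simp add: frac_le)
    then have "{1 / (real n + 2)..real n + 2} \<subseteq> {1 / (real m + 2)..real m + 2}"
      using that by auto
    moreover have "min (w x) (of_nat n) \<le> min (w x) (of_nat m)"
      using that by (intro min.mono) (auto simp: ennreal_of_nat_eq_real_of_nat)
    ultimately show ?thesis
      unfolding T_eq by (intro mult_mono) (auto simp: indicator_def)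
  qed
  have meas[measurable]: "T w n \<in> borel_measurable borel" if [measurable]: "w \<in> borel_measurable borel" for w n
    unfolding T_def by measurable
  have T_SUP: "(SUP n. ennreal (T w n x)) = w x * indicator {0<..} x" for w :: "real \<Rightarrow> ennreal" and x
  proof (cases "0 < x")
    case False
    then have "x \<notin> {1 / (real n + 2)..real n + 2}" for n using pos by blast
    then have "T w n x = 0" for n by (simp add: T_def)
    then show ?thesis using False by simp
  next
    case True
    obtain k :: nat where k: "max x (1/x) \<le> real k" using real_arch_simple by blast
    have eq: "ennreal (T w n x) = min (w x) (of_nat n)" if "k \<le> n" for n
    proof -
      have "1 / x \<le> real n + 2" "x \<le> real n + 2" using k that by auto
      then have "x \<in> {1 / (real n + 2)..real n + 2}" using True by (auto simp: field_simps)
      then show ?thesis by (simp add: T_eq)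
    qed
    have "w x \<le> (SUP n. ennreal (T w n x))"
    proof (cases "w x")
      case (real r)
      obtain m :: nat where m: "r \<le> real m" using real_arch_simple by blast
      have "ennreal (T w (max k m) x) = w x"
        using m real by (subst eq) (auto simp: min_def ennreal_of_nat_eq_real_of_nat max_def split: if_splits)
      then show ?thesis by (metis SUP_upper UNIV_I)
    next
      case top
      have "of_nat n \<le> (SUP n. ennreal (T w n x))" for n
      proof -
        have "of_nat n \<le> ennreal (T w (max k n) x)"
          using top by (subst eq) (auto simp: min_def ennreal_of_nat_eq_real_of_nat)
        also have "\<dots> \<le> (SUP n. ennreal (T w n x))" by (intro SUP_upper) auto
        finally show ?thesis .
      qed
      then have "(SUP n::nat. of_nat n) \<le> (SUP n. ennreal (T w n x))" by (intro SUP_least)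
      then show ?thesis unfolding ennreal_SUP_of_nat_eq_top by (simp add: top top_unique)
    qed
    then show ?thesis using T_le[of w _ x] True by (intro antisym SUP_least) auto
  qed
  define I where "I = (\<lambda>w n. \<integral>\<^sup>+x. ennreal (T w n x) \<partial>lborel)"
  have I_SUP: "(\<integral>\<^sup>+x. w x * indicator {0<..} x \<partial>lborel) = (SUP n. I w n)"
    if [measurable]: "w \<in> borel_measurable borel" for w
    unfolding I_def T_SUP[symmetric]
    by (intro nn_integral_monotone_convergence_SUP) (auto simp: incseq_def le_fun_def T_mono)
  have diag: "I u n * I v n \<le> ennreal (c * (pi / 2))" for n
    unfolding I_def
  proof (rule gaussian_duality_1d_bounded[where B="real n" and R="real n + 2"])
    fix s t :: real assume st: "0 < s" "0 < t"
    have "ennreal (T u n s * T v n t) \<le> u s * v t"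
      using T_le[of u n s] T_le[of v n t] st by (auto simp: ennreal_mult'' T_def intro!: mult_mono)
    also have "\<dots> \<le> ennreal (c * exp (- (s * t)))" by (rule uv[OF st])
    finally show "T u n s * T v n t \<le> c * exp (- (s * t))"
      using c by (subst (asm) ennreal_le_iff) auto
  next
    have "enn2real (min (w x) (of_nat n)) \<le> real n" for w :: "real \<Rightarrow> ennreal" and x
      using enn2real_mono[of "min (w x) (of_nat n)" "of_nat n"] by (simp add: ennreal_of_nat_eq_real_of_nat)
    then show "T u n x \<le> real n" "T v n x \<le> real n" for x by (auto simp: T_def indicator_def)
  qed (use c in \<open>auto simp: T_def\<close>)
  have mono: "I w n \<le> I w m" if "n \<le> m" for w n m
    unfolding I_def using that by (intro nn_integral_mono T_mono)
  \<comment> \<open>The product of two suprema is a double supremum; by monotonicity its terms are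
    dominated by the diagonal ones, which are already bounded.\<close>
  have "(SUP n. I u n) * (SUP m. I v m) = (SUP m. SUP n. I u n * I v m)"
    by (simp add: SUP_mult_left_ennreal SUP_mult_right_ennreal)
  also have "\<dots> \<le> ennreal (c * (pi / 2))"
  proof (intro SUP_least)
    fix n m
    have "I u n * I v m \<le> I u (max n m) * I v (max n m)" by (intro mult_mono mono) auto
    also have "\<dots> \<le> ennreal (c * (pi / 2))" by (rule diag)
    finally show "I u n * I v m \<le> ennreal (c * (pi / 2))" .
  qed
  finally show ?thesis by (simp add: I_SUP)
qed

section \<open>The functional Blaschke-Santalo inequality\<close>

text \<open>Lebesgue measure on the span of a list of basis vectors, as a measure on the whole space. The
  dimension becomes the length of a list, which makes induction on it possible.\<close>

fun subspace_lebesgue :: "'a::euclidean_space list \<Rightarrow> 'a measure" where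
  "subspace_lebesgue [] = return borel 0"
| "subspace_lebesgue (k # ks) = distr (subspace_lebesgue ks \<Otimes>\<^sub>M lborel) borel (\<lambda>(x, s). x + s *\<^sub>R k)"

definition coord_subspace :: "'a::euclidean_space list \<Rightarrow> 'a set" where
  "coord_subspace ks = {x. \<forall>b\<in>Basis - set ks. x \<bullet> b = 0}"

lemma sets_subspace_lebesgue [simp, measurable_cong]: "sets (subspace_lebesgue ks) = sets borel"
  by (cases ks) auto

lemma space_subspace_lebesgue [simp]: "space (subspace_lebesgue ks) = UNIV"
  by (cases ks) auto

lemma nn_integral_subspace_lebesgue_Cons:
  assumes [measurable]: "f \<in> borel_measurable borel"
  shows "(\<integral>\<^sup>+x. f x \<partial>subspace_lebesgue (k # ks)) = (\<integral>\<^sup>+x. \<integral>\<^sup>+s. f (x + s *\<^sub>R k) \<partial>lborel \<partial>subspace_lebesgue ks)"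
  by (simp add: nn_integral_distr lborel.nn_integral_fst[symmetric] split_beta')

lemma AE_coord_subspace:
  assumes "distinct ks" "set ks \<subseteq> Basis"
  shows "AE x in subspace_lebesgue ks. x \<in> coord_subspace ks"
  using assms
proof (induction ks)
  case Nil
  have "AE x in return borel (0::'a). x \<in> coord_subspace []"
    by (subst AE_return) (auto simp: coord_subspace_def)
  then show ?case unfolding subspace_lebesgue.simps .
next
  case (Cons k ks)
  have m: "{x. x \<in> coord_subspace ks'} \<in> sets borel" for ks' :: "'a list"
    unfolding coord_subspace_def by measurable
  have [measurable]: "Measurable.pred borel (\<lambda>x. x \<in> coord_subspace ks')" for ks' :: "'a list"
    using m by (simp add: pred_def)
  have kb: "x + s *\<^sub>R k \<in> coord_subspace (k # ks)" if "x \<in> coord_subspace ks" for x s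
    using that Cons.prems by (auto simp: coord_subspace_def inner_add_left inner_Basis)
  have "AE x in subspace_lebesgue ks. x \<in> coord_subspace ks" using Cons by simp
  then have *: "AE x in subspace_lebesgue ks. (\<integral>\<^sup>+s. indicator (- coord_subspace (k # ks)) (x + s *\<^sub>R k) \<partial>lborel) = 0"
    by (rule eventually_mono) (simp add: kb)
  have [measurable]: "- coord_subspace (k # ks) \<in> sets borel" using m[of "k # ks"] by auto
  have "(\<integral>\<^sup>+x. indicator (- coord_subspace (k # ks)) x \<partial>subspace_lebesgue (k # ks)) = 0"
    using * by (subst nn_integral_subspace_lebesgue_Cons) (auto simp: nn_integral_0_iff_AE)
  then have "AE x in subspace_lebesgue (k # ks). indicator (- coord_subspace (k # ks)) x = (0::ennreal)"
    by (subst (asm) nn_integral_0_iff_AE) auto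
  then show ?case by (rule eventually_mono) (auto simp: indicator_def split: if_splits)
qed

text \<open>The values on boxes give finiteness on bounded sets, and they identify the measure with
  \<open>lborel\<close> once \<open>ks\<close> lists the whole basis.\<close>

lemma nn_integral_subspace_lebesgue_box:
  assumes "distinct ks" "set ks \<subseteq> Basis" "\<And>b. b \<in> set ks \<Longrightarrow> l b \<le> (u b :: real)"
  shows "(\<integral>\<^sup>+x. (\<Prod>b\<in>set ks. indicator {l b<..<u b} (x \<bullet> b)) \<partial>subspace_lebesgue ks) = (\<Prod>b\<in>set ks. ennreal (u b - l b))"
  using assms
proof (induction ks)
  case Nil
  then show ?case by (simp add: nn_integral_return)
next
  case (Cons k ks)
  have [simp]: "k \<bullet> k = 1" using Cons.prems by simp
  have *: "(\<integral>\<^sup>+s. (\<Prod>b\<in>set (k # ks). indicator {l b<..<u b} ((x + s *\<^sub>R k) \<bullet> b)) \<partial>lborel)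
      = ennreal (u k - l k) * (\<Prod>b\<in>set ks. indicator {l b<..<u b} (x \<bullet> b))" if "x \<in> coord_subspace ks" for x
  proof -
    have xk: "x \<bullet> k = 0" using that Cons.prems by (auto simp: coord_subspace_def)
    have "(\<Prod>b\<in>set (k # ks). indicator {l b<..<u b} ((x + s *\<^sub>R k) \<bullet> b))
        = (indicator {l k<..<u k} s * (\<Prod>b\<in>set ks. indicator {l b<..<u b} (x \<bullet> b)) :: ennreal)" for s
    proof -
      have "k \<bullet> b = 0" if "b \<in> set ks" for b
        using that Cons.prems by (auto simp: inner_Basis)
      then have "(\<Prod>b\<in>set ks. indicator {l b<..<u b} ((x + s *\<^sub>R k) \<bullet> b))
          = (\<Prod>b\<in>set ks. indicator {l b<..<u b} (x \<bullet> b) :: ennreal)"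
        by (intro prod.cong) (auto simp: inner_add_left)
      then show ?thesis using Cons.prems by (simp add: inner_add_left xk)
    qed
    then show ?thesis using Cons.prems by (simp add: nn_integral_multc)
  qed
  have "(\<integral>\<^sup>+x. (\<Prod>b\<in>set (k # ks). indicator {l b<..<u b} (x \<bullet> b)) \<partial>subspace_lebesgue (k # ks))
      = (\<integral>\<^sup>+x. ennreal (u k - l k) * (\<Prod>b\<in>set ks. indicator {l b<..<u b} (x \<bullet> b)) \<partial>subspace_lebesgue ks)"
  proof (subst nn_integral_subspace_lebesgue_Cons)
    have "AE x in subspace_lebesgue ks. x \<in> coord_subspace ks"
      using Cons.prems by (intro AE_coord_subspace) auto
    then show "(\<integral>\<^sup>+x. \<integral>\<^sup>+s. (\<Prod>b\<in>set (k # ks). indicator {l b<..<u b} ((x + s *\<^sub>R k) \<bullet> b)) \<partial>lborel \<partial>subspace_lebesgue ks)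
      = (\<integral>\<^sup>+x. ennreal (u k - l k) * (\<Prod>b\<in>set ks. indicator {l b<..<u b} (x \<bullet> b)) \<partial>subspace_lebesgue ks)"
      by (intro nn_integral_cong_AE) (auto elim!: eventually_mono simp only: *)
  qed measurable
  then show ?case
    using Cons by (simp add: nn_integral_cmult)
qed

lemma emeasure_subspace_lebesgue_cbox_finite:
  assumes "distinct ks" "set ks \<subseteq> Basis" "bounded S" "S \<in> sets borel"
  shows "emeasure (subspace_lebesgue ks) S < \<infinity>"
proof -
  obtain R where R: "\<And>x. x \<in> S \<Longrightarrow> norm x \<le> R" "0 < R"
    using assms(3) bounded_pos by blast
  have ind: "indicator S x \<le> (\<Prod>b\<in>set ks. indicator {-(R+1)<..<R+1} (x \<bullet> b) :: ennreal)" for x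
  proof (cases "x \<in> S")
    case True
    have "x \<bullet> b \<in> {-(R+1)<..<R+1}" if "b \<in> set ks" for b
      using R(1)[OF True] Basis_le_norm[of b x] that assms(2) by auto
    then show ?thesis using True by simp
  qed simp
  have "emeasure (subspace_lebesgue ks) S = (\<integral>\<^sup>+x. indicator S x \<partial>subspace_lebesgue ks)"
    using assms(4) by simp
  also have "\<dots> \<le> (\<integral>\<^sup>+x. (\<Prod>b\<in>set ks. indicator {-(R+1)<..<R+1} (x \<bullet> b)) \<partial>subspace_lebesgue ks)"
    by (intro nn_integral_mono ind)
  also have "\<dots> = (\<Prod>b\<in>set ks. ennreal (R + 1 - - (R + 1)))"
    using assms R by (intro nn_integral_subspace_lebesgue_box) auto
  also have "\<dots> < \<infinity>" by (simp add: ennreal_power[symmetric] power_less_top_ennreal)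
  finally show ?thesis .
qed

lemma sigma_finite_subspace_lebesgue:
  assumes "distinct ks" "set ks \<subseteq> Basis"
  shows "sigma_finite_measure (subspace_lebesgue ks)"
proof
  define A :: "nat \<Rightarrow> 'a set" where "A = (\<lambda>n. cball 0 (real n))"
  have "emeasure (subspace_lebesgue ks) (A n) \<noteq> \<infinity>" for n
    using emeasure_subspace_lebesgue_cbox_finite[OF assms, of "A n"] by (auto simp: A_def)
  moreover have "\<Union>(range A) = UNIV"
    using real_arch_simple by (auto simp: A_def)
  ultimately show "\<exists>A. countable A \<and> A \<subseteq> sets (subspace_lebesgue ks) \<and> \<Union>A = space (subspace_lebesgue ks)
      \<and> (\<forall>a\<in>A. emeasure (subspace_lebesgue ks) a \<noteq> \<infinity>)"
    by (intro exI[of _ "range A"]) (auto simp: A_def)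
qed

lemma subspace_lebesgue_eq_lborel:
  assumes "distinct ks" "set ks = (Basis :: 'a::euclidean_space set)"
  shows "subspace_lebesgue ks = (lborel :: 'a measure)"
proof (rule lborel_eqI[symmetric])
  fix l u :: 'a assume lu: "\<And>b. b \<in> Basis \<Longrightarrow> l \<bullet> b \<le> u \<bullet> b"
  have "indicator (box l u) x = (\<Prod>b\<in>set ks. indicator {l \<bullet> b<..<u \<bullet> b} (x \<bullet> b) :: ennreal)" for x
    unfolding assms(2) by (auto simp: indicator_def mem_box)
  then have ind: "indicator (box l u) = (\<lambda>x. \<Prod>b\<in>set ks. indicator {l \<bullet> b<..<u \<bullet> b} (x \<bullet> b) :: ennreal)" by auto
  have "emeasure (subspace_lebesgue ks) (box l u) = (\<integral>\<^sup>+x. indicator (box l u) x \<partial>subspace_lebesgue ks)"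
    by simp
  also have "\<dots> = (\<integral>\<^sup>+x. (\<Prod>b\<in>set ks. indicator {l \<bullet> b<..<u \<bullet> b} (x \<bullet> b)) \<partial>subspace_lebesgue ks)"
    unfolding ind ..
  also have "\<dots> = ennreal (\<Prod>b\<in>Basis. (u - l) \<bullet> b)"
    using assms lu by (subst nn_integral_subspace_lebesgue_box) (auto simp: prod_ennreal inner_diff_left)
  finally show "emeasure (subspace_lebesgue ks) (box l u) = ennreal (\<Prod>b\<in>Basis. (u - l) \<bullet> b)" .
qed simp

lemma nn_integral_subspace_lebesgue_translate:
  assumes "distinct ks" "set ks \<subseteq> Basis" "c \<in> coord_subspace ks" "f \<in> borel_measurable borel"
  shows "(\<integral>\<^sup>+x. f (x + c) \<partial>subspace_lebesgue ks) = (\<integral>\<^sup>+x. f x \<partial>subspace_lebesgue ks)"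
  using assms
proof (induction ks arbitrary: c f)
  case Nil
  have "c = 0" using Nil(3) by (simp add: coord_subspace_def euclidean_eq_iff[of c])
  then show ?case by simp
next
  case (Cons k ks)
  note [measurable] = \<open>f \<in> borel_measurable borel\<close>
  define c' where "c' = c - (c \<bullet> k) *\<^sub>R k"
  have c': "c' \<in> coord_subspace ks"
    using Cons.prems by (auto simp: coord_subspace_def c'_def inner_diff_left inner_Basis)
  have "(\<integral>\<^sup>+x. f (x + c) \<partial>subspace_lebesgue (k # ks))
      = (\<integral>\<^sup>+x. \<integral>\<^sup>+s. f (x + s *\<^sub>R k + c) \<partial>lborel \<partial>subspace_lebesgue ks)"
    by (rule nn_integral_subspace_lebesgue_Cons) measurable
  also have "\<dots> = (\<integral>\<^sup>+x. \<integral>\<^sup>+s. f ((x + c') + s *\<^sub>R k) \<partial>lborel \<partial>subspace_lebesgue ks)"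
  proof (rule nn_integral_cong)
    fix x
    show "(\<integral>\<^sup>+s. f (x + s *\<^sub>R k + c) \<partial>lborel) = (\<integral>\<^sup>+s. f ((x + c') + s *\<^sub>R k) \<partial>lborel)"
      by (subst nn_integral_real_affine[where c=1 and t="- (c \<bullet> k)"])
         (auto simp: c'_def algebra_simps)
  qed
  also have "\<dots> = (\<integral>\<^sup>+x. \<integral>\<^sup>+s. f (x + s *\<^sub>R k) \<partial>lborel \<partial>subspace_lebesgue ks)"
    using Cons.prems c' by (intro Cons.IH[where f="\<lambda>x. \<integral>\<^sup>+s. f (x + s *\<^sub>R k) \<partial>lborel"]) auto
  also have "\<dots> = (\<integral>\<^sup>+x. f x \<partial>subspace_lebesgue (k # ks))"
    by (rule nn_integral_subspace_lebesgue_Cons[symmetric]) measurable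
  finally show ?case .
qed

text \<open>The k-component of v is 1 or -1, so replacing the axis k by the oblique direction v and
  moving the base point to z preserves volume: for fixed s the remaining change is a translation
  inside the span of \<open>ks\<close>.\<close>

lemma nn_integral_subspace_lebesgue_shear:
  assumes ks: "distinct (k # ks)" "set (k # ks) \<subseteq> Basis"
    and zv: "z \<in> coord_subspace (k # ks)" "v \<in> coord_subspace (k # ks)" "v \<bullet> k = e" "\<bar>e\<bar> = 1"
    and [measurable]: "f \<in> borel_measurable borel"
  shows "(\<integral>\<^sup>+x. f x \<partial>subspace_lebesgue (k # ks)) = (\<integral>\<^sup>+x. \<integral>\<^sup>+s. f (z + x + s *\<^sub>R v) \<partial>lborel \<partial>subspace_lebesgue ks)"
proof -
  interpret S: sigma_finite_measure "subspace_lebesgue ks"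
    using ks by (intro sigma_finite_subspace_lebesgue) auto
  interpret P: pair_sigma_finite "subspace_lebesgue ks" "lborel :: real measure" ..
  define c where "c = (\<lambda>s. z + s *\<^sub>R v - ((z + s *\<^sub>R v) \<bullet> k) *\<^sub>R k)"
  have c: "c s \<in> coord_subspace ks" for s
    using ks zv by (auto simp: coord_subspace_def c_def inner_diff_left inner_add_left inner_Basis)
  have "(\<integral>\<^sup>+x. f x \<partial>subspace_lebesgue (k # ks))
      = (\<integral>\<^sup>+x. \<integral>\<^sup>+s. f (x + s *\<^sub>R k) \<partial>lborel \<partial>subspace_lebesgue ks)"
    by (rule nn_integral_subspace_lebesgue_Cons) measurable
  also have "\<dots> = (\<integral>\<^sup>+x. \<integral>\<^sup>+s. f (x + ((z + s *\<^sub>R v) \<bullet> k) *\<^sub>R k) \<partial>lborel \<partial>subspace_lebesgue ks)"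
  proof (rule nn_integral_cong)
    fix x
    have "(\<integral>\<^sup>+s. f (x + s *\<^sub>R k) \<partial>lborel) = \<bar>e\<bar> * (\<integral>\<^sup>+s. f (x + (z \<bullet> k + e * s) *\<^sub>R k) \<partial>lborel)"
      using zv(4) by (intro nn_integral_real_affine) auto
    then show "(\<integral>\<^sup>+s. f (x + s *\<^sub>R k) \<partial>lborel) = (\<integral>\<^sup>+s. f (x + ((z + s *\<^sub>R v) \<bullet> k) *\<^sub>R k) \<partial>lborel)"
      using zv(3,4) by (simp add: inner_add_left mult.commute)
  qed
  also have "\<dots> = (\<integral>\<^sup>+s. \<integral>\<^sup>+x. f (x + ((z + s *\<^sub>R v) \<bullet> k) *\<^sub>R k) \<partial>subspace_lebesgue ks \<partial>lborel)"
    by (rule P.Fubini'[symmetric]) measurable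
  also have "\<dots> = (\<integral>\<^sup>+s. \<integral>\<^sup>+x. f (z + x + s *\<^sub>R v) \<partial>subspace_lebesgue ks \<partial>lborel)"
  proof (rule nn_integral_cong)
    fix s
    have "(\<integral>\<^sup>+x. f (x + ((z + s *\<^sub>R v) \<bullet> k) *\<^sub>R k) \<partial>subspace_lebesgue ks)
        = (\<integral>\<^sup>+x. f ((x + c s) + ((z + s *\<^sub>R v) \<bullet> k) *\<^sub>R k) \<partial>subspace_lebesgue ks)"
      using ks c by (intro nn_integral_subspace_lebesgue_translate[symmetric]) auto
    then show "(\<integral>\<^sup>+x. f (x + ((z + s *\<^sub>R v) \<bullet> k) *\<^sub>R k) \<partial>subspace_lebesgue ks)
        = (\<integral>\<^sup>+x. f (z + x + s *\<^sub>R v) \<partial>subspace_lebesgue ks)"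
      by (simp add: c_def algebra_simps)
  qed
  also have "\<dots> = (\<integral>\<^sup>+x. \<integral>\<^sup>+s. f (z + x + s *\<^sub>R v) \<partial>lborel \<partial>subspace_lebesgue ks)"
    by (rule P.Fubini') measurable
  finally show ?thesis .
qed

text \<open>As an equality of measures the change of coordinates also transports integrability and
  Bochner integrals, in particular barycenters.\<close>

lemma subspace_lebesgue_shear:
  assumes ks: "distinct (k # ks)" "set (k # ks) \<subseteq> Basis"
    and zv: "z \<in> coord_subspace (k # ks)" "v \<in> coord_subspace (k # ks)" "v \<bullet> k = e" "\<bar>e\<bar> = 1"
  shows "subspace_lebesgue (k # ks) = distr (subspace_lebesgue ks \<Otimes>\<^sub>M lborel) borel (\<lambda>(x, s). z + x + s *\<^sub>R v)"
proof (rule measure_eqI)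
  fix A assume "A \<in> sets (subspace_lebesgue (k # ks))"
  then have [measurable]: "A \<in> sets borel" by simp
  have "emeasure (subspace_lebesgue (k # ks)) A = (\<integral>\<^sup>+x. indicator A x \<partial>subspace_lebesgue (k # ks))"
    by (subst nn_integral_indicator) auto
  also have "\<dots> = (\<integral>\<^sup>+x. \<integral>\<^sup>+s. indicator A (z + x + s *\<^sub>R v) \<partial>lborel \<partial>subspace_lebesgue ks)"
    by (rule nn_integral_subspace_lebesgue_shear[OF ks zv]) simp
  also have "\<dots> = (\<integral>\<^sup>+x. indicator A x \<partial>distr (subspace_lebesgue ks \<Otimes>\<^sub>M lborel) borel (\<lambda>(x, s). z + x + s *\<^sub>R v))"
    by (simp add: nn_integral_distr lborel.nn_integral_fst[symmetric] split_beta' del: nn_integral_indicator)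
  finally show "emeasure (subspace_lebesgue (k # ks)) A
      = emeasure (distr (subspace_lebesgue ks \<Otimes>\<^sub>M lborel) borel (\<lambda>(x, s). z + x + s *\<^sub>R v)) A"
    by (subst (asm) nn_integral_indicator) auto
qed simp

lemma subspace_coord_subspace: "subspace (coord_subspace ks)"
  by (auto simp: subspace_def coord_subspace_def inner_add_left)

lemma borel_coord_subspace [measurable]: "coord_subspace ks \<in> sets borel"
  by (intro borel_closed closed_subspace subspace_coord_subspace)

text \<open>On the right negative values are cut off to 0. The lemma serves integrands such as g y *
  (1 + z . y), whose sign may change.\<close>

lemma ennreal_integral_le_nn_integral:
  fixes f :: "'a \<Rightarrow> real"
  assumes "integrable M f"
  shows "ennreal (\<integral>x. f x \<partial>M) \<le> (\<integral>\<^sup>+x. ennreal (f x) \<partial>M)"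
proof -
  have "(\<integral>x. f x \<partial>M) \<le> (\<integral>x. max 0 (f x) \<partial>M)"
    using assms by (intro integral_mono) auto
  then have "ennreal (\<integral>x. f x \<partial>M) \<le> ennreal (\<integral>x. max 0 (f x) \<partial>M)" by (rule ennreal_leI)
  also have "\<dots> = (\<integral>\<^sup>+x. ennreal (max 0 (f x)) \<partial>M)"
    using assms by (intro nn_integral_eq_integral[symmetric]) auto
  also have "\<dots> = (\<integral>\<^sup>+x. ennreal (f x) \<partial>M)"
    by (intro nn_integral_cong) (auto simp: max_def ennreal_neg)
  finally show ?thesis .
qed

text \<open>The statement is asymmetric on purpose: g is centered and integrable, f merely
  measurable, and the duality condition is imposed on the span of \<open>ks\<close> only. The
  constant is the one attained by f = g = exp (- |x|^2 / 2).\<close>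

definition gaussian_santalo :: "'a::euclidean_space list \<Rightarrow> bool" where
  "gaussian_santalo ks \<longleftrightarrow> (\<forall>(f :: 'a \<Rightarrow> ennreal) (g :: 'a \<Rightarrow> real).
     f \<in> borel_measurable borel \<longrightarrow> (\<forall>x. 0 \<le> g x) \<longrightarrow>
     integrable (subspace_lebesgue ks) g \<longrightarrow> integrable (subspace_lebesgue ks) (\<lambda>x. g x *\<^sub>R x) \<longrightarrow>
     (\<integral>x. g x *\<^sub>R x \<partial>subspace_lebesgue ks) = 0 \<longrightarrow>
     (\<forall>x\<in>coord_subspace ks. \<forall>y\<in>coord_subspace ks. f y * ennreal (g x) \<le> ennreal (exp (- (x \<bullet> y)))) \<longrightarrow>
     (\<integral>\<^sup>+y. f y \<partial>subspace_lebesgue ks) * (\<integral>\<^sup>+x. g x \<partial>subspace_lebesgue ks) \<le> ennreal ((2 * pi) ^ length ks))"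

text \<open>With w the projection of v along k, the substitutions x \<mapsto> z + x + s v and
  y \<mapsto> y + e (t - w \<bullet> y) k turn the pairing into x \<bullet> y + s t. Integrating out s and t by the
  one-dimensional inequality leaves an instance of the induction hypothesis.\<close>

lemma gaussian_santalo_half_space:
  fixes f :: "'a::euclidean_space \<Rightarrow> ennreal" and g :: "'a \<Rightarrow> real"
  assumes IH: "gaussian_santalo ks"
    and ks: "distinct (k # ks)" "set (k # ks) \<subseteq> Basis"
    and zv: "z \<in> coord_subspace (k # ks)" "v \<in> coord_subspace (k # ks)" "v \<bullet> k = e" "\<bar>e\<bar> = 1"
    and [measurable]: "f \<in> borel_measurable borel"
    and g: "\<And>x. 0 \<le> g x" "integrable (subspace_lebesgue (k # ks)) g"
      "integrable (subspace_lebesgue (k # ks)) (\<lambda>x. g x *\<^sub>R x)"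
    and H: "H = {x. 0 < e * ((x - z) \<bullet> k)}"
    and bary: "(\<integral>x. (indicator H x * g x) *\<^sub>R (x - z - (e * ((x - z) \<bullet> k)) *\<^sub>R v) \<partial>subspace_lebesgue (k # ks)) = 0"
    and fg: "\<And>x y. x \<in> coord_subspace (k # ks) \<Longrightarrow> y \<in> coord_subspace (k # ks) \<Longrightarrow>
      f y * ennreal (g (z + x)) \<le> ennreal (exp (- (x \<bullet> y)))"
  shows "(\<integral>\<^sup>+y. f y * indicator {y. 0 < y \<bullet> v} y \<partial>subspace_lebesgue (k # ks)) *
      (\<integral>\<^sup>+x. indicator H x * g x \<partial>subspace_lebesgue (k # ks)) \<le> ennreal (pi / 2 * (2 * pi) ^ length ks)"
proof -
  let ?L = "subspace_lebesgue ks" and ?L' = "subspace_lebesgue (k # ks)"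
  let ?P = "?L \<Otimes>\<^sub>M (lborel :: real measure)"
  interpret S: sigma_finite_measure ?L
    using ks by (intro sigma_finite_subspace_lebesgue) auto
  interpret P: pair_sigma_finite ?L "lborel :: real measure" ..
  have [measurable]: "g \<in> borel_measurable borel"
    using g(2) borel_measurable_integrable by (metis measurable_cong_sets sets_subspace_lebesgue)
  have [measurable]: "H \<in> sets borel" unfolding H by measurable
  have [simp]: "k \<bullet> k = 1" using ks by simp
  have ee: "e * e = 1" using zv(4) by (metis abs_mult_self_eq mult_1)
  define w where "w = v - e *\<^sub>R k"
  have w: "w \<in> coord_subspace ks"
    using ks zv by (auto simp: coord_subspace_def w_def inner_diff_left inner_Basis)
  have VV: "coord_subspace ks \<subseteq> coord_subspace (k # ks)" by (auto simp: coord_subspace_def)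
  have Vk: "x \<bullet> k = 0" if "x \<in> coord_subspace ks" for x
    using that ks by (auto simp: coord_subspace_def)
  have AEV: "AE x in ?L. x \<in> coord_subspace ks"
    using ks by (intro AE_coord_subspace) auto
  have shear: "?L' = distr ?P borel (\<lambda>(x, s). z + x + s *\<^sub>R v)"
    by (rule subspace_lebesgue_shear[OF ks zv])
  define G where "G = (\<lambda>x s. indicator {0<..} s * g (z + x + s *\<^sub>R v))"
  have [measurable]: "case_prod G \<in> borel_measurable ?P" unfolding G_def by measurable
  define Gp where "Gp = (\<lambda>x. \<integral>s. G x s \<partial>lborel)"
  have GH: "indicator H (z + x + s *\<^sub>R v) * g (z + x + s *\<^sub>R v) = G x s" if "x \<in> coord_subspace ks" for x s
    using Vk[OF that] zv(3) ee by (auto simp: H G_def indicator_def inner_add_left mult.left_commute[of e])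
  have AEP: "AE p in ?P. fst p \<in> coord_subspace ks"
  proof (rule P.AE_pair_measure)
    have [measurable]: "Measurable.pred borel (\<lambda>x. x \<in> coord_subspace ks)" by (simp add: pred_def)
    show "{p \<in> space ?P. fst p \<in> coord_subspace ks} \<in> sets ?P" by measurable
  qed (use AEV in auto)
  have intHg: "integrable ?L' (\<lambda>x. indicator H x * g x)"
    using integrable_mult_indicator[of H ?L' g] g(2) by simp
  have intG: "integrable ?P (case_prod G)" and IG: "(\<integral>p. case_prod G p \<partial>?P) = (\<integral>x. indicator H x * g x \<partial>?L')"
  proof -
    have ae: "AE p in ?P. (case p of (x, s) \<Rightarrow> indicator H (z + x + s *\<^sub>R v) * g (z + x + s *\<^sub>R v)) = case_prod G p"
      using AEP by eventually_elim (auto simp: GH)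
    have "integrable ?P (\<lambda>(x, s). indicator H (z + x + s *\<^sub>R v) * g (z + x + s *\<^sub>R v))"
      using intHg unfolding shear by (subst (asm) integrable_distr_eq) (auto simp: split_beta')
    then show "integrable ?P (case_prod G)"
      using ae by (subst (asm) integrable_cong_AE) auto
    have "(\<integral>x. indicator H x * g x \<partial>?L') = (\<integral>p. (case p of (x, s) \<Rightarrow> indicator H (z + x + s *\<^sub>R v) * g (z + x + s *\<^sub>R v)) \<partial>?P)"
      unfolding shear by (subst integral_distr) (auto simp: split_beta')
    also have "\<dots> = (\<integral>p. case_prod G p \<partial>?P)"
      using ae by (intro integral_cong_AE) auto
    finally show "(\<integral>p. case_prod G p \<partial>?P) = (\<integral>x. indicator H x * g x \<partial>?L')" ..
  qed
  \<comment> \<open>The vector factor is the projection of x - z along v to the hyperplane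
    orthogonal to k. In the coordinates (x, s) it is simply x, so \<open>bary\<close> says that the
    marginal \<open>Gp\<close> is centered.\<close>
  define q where "q = (\<lambda>x. (indicator H x * g x) *\<^sub>R (x - z - (e * ((x - z) \<bullet> k)) *\<^sub>R v))"
  have [measurable]: "q \<in> borel_measurable borel" unfolding q_def by measurable
  have intq: "integrable ?L' q"
  proof -
    have "integrable ?L' (\<lambda>x. g x *\<^sub>R (x - z - (e * ((x - z) \<bullet> k)) *\<^sub>R v))"
    proof -
      have i: "integrable ?L' (\<lambda>x. e *\<^sub>R ((g x *\<^sub>R x) \<bullet> k) *\<^sub>R v)"
        by (intro integrable_scaleR_left integrable_scaleR_right integrable_inner_left g(3))
      then have "integrable ?L' (\<lambda>x. g x *\<^sub>R x - g x *\<^sub>R z - e *\<^sub>R ((g x *\<^sub>R x) \<bullet> k) *\<^sub>R v + g x *\<^sub>R (e * (z \<bullet> k)) *\<^sub>R v)"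
        by (intro Bochner_Integration.integrable_add Bochner_Integration.integrable_diff i
            integrable_scaleR_left g)
      then show ?thesis by (simp add: algebra_simps inner_diff_left)
    qed
    then have "integrable ?L' (\<lambda>x. indicator H x *\<^sub>R (g x *\<^sub>R (x - z - (e * ((x - z) \<bullet> k)) *\<^sub>R v)))"
      by (intro integrable_mult_indicator) auto
    then show ?thesis by (simp add: q_def)
  qed
  have qG: "q (z + x + s *\<^sub>R v) = G x s *\<^sub>R x" if "x \<in> coord_subspace ks" for x s
  proof -
    have "e * ((z + x + s *\<^sub>R v - z) \<bullet> k) = s"
      using Vk[OF that] zv(3) ee by (simp add: inner_add_left mult.left_commute[of e])
    then show ?thesis unfolding q_def GH[OF that] by simp
  qed
  have intGx: "integrable ?P (\<lambda>(x, s). G x s *\<^sub>R x)" and IGx: "(\<integral>p. (case p of (x, s) \<Rightarrow> G x s *\<^sub>R x) \<partial>?P) = 0"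
  proof -
    have ae: "AE p in ?P. (case p of (x, s) \<Rightarrow> q (z + x + s *\<^sub>R v)) = (case p of (x, s) \<Rightarrow> G x s *\<^sub>R x)"
      using AEP by eventually_elim (auto simp: qG)
    have "integrable ?P (\<lambda>(x, s). q (z + x + s *\<^sub>R v))"
      using intq unfolding shear by (subst (asm) integrable_distr_eq) (auto simp: split_beta')
    then show "integrable ?P (\<lambda>(x, s). G x s *\<^sub>R x)"
      using ae by (subst (asm) integrable_cong_AE) auto
    have "0 = (\<integral>x. q x \<partial>?L')" using bary by (simp add: q_def)
    also have "\<dots> = (\<integral>p. (case p of (x, s) \<Rightarrow> q (z + x + s *\<^sub>R v)) \<partial>?P)"
      unfolding shear by (subst integral_distr) (auto simp: split_beta')
    also have "\<dots> = (\<integral>p. (case p of (x, s) \<Rightarrow> G x s *\<^sub>R x) \<partial>?P)"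
      using ae by (intro integral_cong_AE) auto
    finally show "(\<integral>p. (case p of (x, s) \<Rightarrow> G x s *\<^sub>R x) \<partial>?P) = 0" ..
  qed
  have [measurable]: "Gp \<in> borel_measurable borel"
  proof -
    have "Gp \<in> borel_measurable ?L" unfolding Gp_def by measurable
    then show ?thesis by simp
  qed
  have Gp_nn: "0 \<le> Gp x" for x
    unfolding Gp_def G_def using g(1) by (intro Bochner_Integration.integral_nonneg) auto
  have intGp: "integrable ?L Gp"
    unfolding Gp_def using lborel_pair.integrable_fst P.integrable_fst[OF intG] by simp
  have IGp: "(\<integral>x. Gp x \<partial>?L) = (\<integral>x. indicator H x * g x \<partial>?L')"
    unfolding Gp_def IG[symmetric] using P.integral_fst[OF intG] by simp
  have aeG: "AE x in ?L. (\<integral>s. G x s *\<^sub>R x \<partial>lborel) = Gp x *\<^sub>R x"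
    using P.AE_integrable_fst[OF intG] by eventually_elim (simp add: Gp_def)
  have intGpx: "integrable ?L (\<lambda>x. Gp x *\<^sub>R x)"
    using P.integrable_fst[OF intGx] aeG by (subst (asm) integrable_cong_AE) auto
  have IGpx: "(\<integral>x. Gp x *\<^sub>R x \<partial>?L) = 0"
  proof -
    have "(\<integral>x. Gp x *\<^sub>R x \<partial>?L) = (\<integral>x. \<integral>s. G x s *\<^sub>R x \<partial>lborel \<partial>?L)"
      using aeG by (intro integral_cong_AE) auto
    also have "\<dots> = 0" using P.integral_fst[OF intGx] IGx by simp
    finally show ?thesis .
  qed
  \<comment> \<open>The factor 2 / pi offsets the constant pi / 2 of the one-dimensional inequality,
    so that \<open>Fp\<close> and \<open>Gp\<close> satisfy the duality condition exactly.\<close>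
  define Fp where "Fp = (\<lambda>y. ennreal (2 / pi) * (\<integral>\<^sup>+t. f (y + (e * (t - w \<bullet> y)) *\<^sub>R k) * indicator {0<..} t \<partial>lborel))"
  have [measurable]: "Fp \<in> borel_measurable borel" unfolding Fp_def by measurable
  have cond: "Fp y * ennreal (Gp x) \<le> ennreal (exp (- (x \<bullet> y)))"
    if x: "x \<in> coord_subspace ks" and y: "y \<in> coord_subspace ks" for x y
  proof -
    let ?u = "\<lambda>t. f (y + (e * (t - w \<bullet> y)) *\<^sub>R k)" and ?v = "\<lambda>s. ennreal (g (z + x + s *\<^sub>R v))"
    have 1: "(\<integral>\<^sup>+t. ?u t * indicator {0<..} t \<partial>lborel) * (\<integral>\<^sup>+s. ?v s * indicator {0<..} s \<partial>lborel)
        \<le> ennreal (exp (- (x \<bullet> y)) * (pi / 2))"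
    proof (rule gaussian_duality_1d)
      fix s t :: real
      define X Y where "X = x + t *\<^sub>R v" and "Y = y + (e * (s - w \<bullet> y)) *\<^sub>R k"
      have XY: "X \<in> coord_subspace (k # ks)" "Y \<in> coord_subspace (k # ks)"
        using x y zv(2) VV ks
        by (auto simp: X_def Y_def coord_subspace_def inner_add_left inner_Basis)
      have vy: "v \<bullet> y = w \<bullet> y"
        using Vk[OF y] by (simp add: w_def inner_diff_left inner_commute[of k])
      have "X \<bullet> Y = x \<bullet> y + t * (w \<bullet> y) + t * (e * (s - w \<bullet> y)) * e"
        using Vk[OF x] zv(3) by (simp add: X_def Y_def inner_add_left inner_add_right vy algebra_simps)
      also have "\<dots> = x \<bullet> y + t * (w \<bullet> y) + t * (s - w \<bullet> y) * (e * e)" by (simp add: algebra_simps)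
      also have "\<dots> = x \<bullet> y + s * t" by (simp add: ee algebra_simps)
      finally have XdY: "X \<bullet> Y = x \<bullet> y + s * t" .
      have "?u s * ?v t = f Y * ennreal (g (z + X))" by (simp add: X_def Y_def add.assoc)
      also have "\<dots> \<le> ennreal (exp (- (X \<bullet> Y)))" by (rule fg[OF XY])
      finally show "?u s * ?v t \<le> ennreal (exp (- (x \<bullet> y)) * exp (- (s * t)))"
        by (simp add: XdY exp_add[symmetric])
    qed auto
    \<comment> \<open>Where \<open>G x\<close> is not integrable, the Bochner integral
      \<open>Gp x\<close> is 0 by convention and the bound is trivial.\<close>
    have 2: "ennreal (Gp x) \<le> (\<integral>\<^sup>+s. ?v s * indicator {0<..} s \<partial>lborel)"
    proof (cases "integrable lborel (G x)")
      case True
      then have "ennreal (Gp x) = (\<integral>\<^sup>+s. G x s \<partial>lborel)"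
        unfolding Gp_def using g(1) by (intro nn_integral_eq_integral[symmetric]) (auto simp: G_def)
      also have "\<dots> = (\<integral>\<^sup>+s. ?v s * indicator {0<..} s \<partial>lborel)"
        by (intro nn_integral_cong) (auto simp: G_def indicator_def)
      finally show ?thesis by simp
    qed (simp add: Gp_def not_integrable_integral_eq)
    have "Fp y * ennreal (Gp x) \<le> ennreal (2 / pi) * ((\<integral>\<^sup>+t. ?u t * indicator {0<..} t \<partial>lborel) * (\<integral>\<^sup>+s. ?v s * indicator {0<..} s \<partial>lborel))"
      unfolding Fp_def using 2 by (simp add: mult.assoc mult_left_mono)
    also have "\<dots> \<le> ennreal (2 / pi) * ennreal (exp (- (x \<bullet> y)) * (pi / 2))"
      by (intro mult_left_mono 1) simp
    also have "\<dots> = ennreal (exp (- (x \<bullet> y)))"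
      by (simp add: ennreal_mult''[symmetric])
    finally show ?thesis .
  qed
  have IHapp: "(\<integral>\<^sup>+y. Fp y \<partial>?L) * (\<integral>\<^sup>+x. Gp x \<partial>?L) \<le> ennreal ((2 * pi) ^ length ks)"
    using IH[unfolded gaussian_santalo_def, rule_format, of Fp Gp] Gp_nn intGp intGpx IGpx cond by auto
  have Gint: "(\<integral>\<^sup>+x. Gp x \<partial>?L) = (\<integral>\<^sup>+x. indicator H x * g x \<partial>?L')"
    using intGp intHg Gp_nn g(1) IGp by (simp add: nn_integral_eq_integral)
  have Fint: "(\<integral>\<^sup>+y. Fp y \<partial>?L) = ennreal (2 / pi) * (\<integral>\<^sup>+y. f y * indicator {y. 0 < y \<bullet> v} y \<partial>?L')"
  proof -
    have "(\<integral>\<^sup>+y. f y * indicator {y. 0 < y \<bullet> v} y \<partial>?L')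
        = (\<integral>\<^sup>+y. \<integral>\<^sup>+s. f (y + s *\<^sub>R k) * indicator {y. 0 < y \<bullet> v} (y + s *\<^sub>R k) \<partial>lborel \<partial>?L)"
      by (rule nn_integral_subspace_lebesgue_Cons) measurable
    also have "\<dots> = (\<integral>\<^sup>+y. \<integral>\<^sup>+t. f (y + (e * (t - w \<bullet> y)) *\<^sub>R k) * indicator {0<..} t \<partial>lborel \<partial>?L)"
    proof (rule nn_integral_cong_AE)
      show "AE y in ?L. (\<integral>\<^sup>+s. f (y + s *\<^sub>R k) * indicator {y. 0 < y \<bullet> v} (y + s *\<^sub>R k) \<partial>lborel)
          = (\<integral>\<^sup>+t. f (y + (e * (t - w \<bullet> y)) *\<^sub>R k) * indicator {0<..} t \<partial>lborel)"
        using AEV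
      proof eventually_elim
        case (elim y)
        \<comment> \<open>The inner product of the shifted point with v is t, because e * e = 1; the
          half space thus becomes the half line t > 0.\<close>
        have ind: "(0 < (y + (- (e * (w \<bullet> y)) + e * t) *\<^sub>R k) \<bullet> v) = (0 < t)" for t
        proof -
          have "y \<bullet> v = w \<bullet> y"
            using Vk[OF elim] by (simp add: w_def inner_diff_left inner_diff_right inner_commute)
          then have "(y + (- (e * (w \<bullet> y)) + e * t) *\<^sub>R k) \<bullet> v = w \<bullet> y + (- (w \<bullet> y) + t) * (e * e)"
            using zv(3) by (simp add: inner_add_left inner_commute[of k] algebra_simps)
          then show ?thesis by (simp add: ee)
        qed
        have "(\<integral>\<^sup>+s. f (y + s *\<^sub>R k) * indicator {y. 0 < y \<bullet> v} (y + s *\<^sub>R k) \<partial>lborel)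
            = \<bar>e\<bar> * (\<integral>\<^sup>+t. f (y + (- (e * (w \<bullet> y)) + e * t) *\<^sub>R k) * indicator {y. 0 < y \<bullet> v} (y + (- (e * (w \<bullet> y)) + e * t) *\<^sub>R k) \<partial>lborel)"
          using zv(4) by (intro nn_integral_real_affine) auto
        also have "\<dots> = (\<integral>\<^sup>+t. f (y + (e * (t - w \<bullet> y)) *\<^sub>R k) * indicator {0<..} t \<partial>lborel)"
          using zv(4) ind by (simp add: indicator_def algebra_simps)
        finally show ?case .
      qed
    qed
    finally show ?thesis unfolding Fp_def by (simp add: nn_integral_cmult)
  qed
  let ?A = "\<integral>\<^sup>+y. f y * indicator {y. 0 < y \<bullet> v} y \<partial>?L'" and ?B = "\<integral>\<^sup>+x. indicator H x * g x \<partial>?L'"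
  have "?A * ?B = ennreal (pi / 2) * (ennreal (2 / pi) * ?A * ?B)"
    by (simp add: mult.assoc[symmetric] ennreal_mult''[symmetric])
  also have "\<dots> \<le> ennreal (pi / 2) * ennreal ((2 * pi) ^ length ks)"
    using IHapp unfolding Fint Gint by (intro mult_left_mono) auto
  also have "\<dots> = ennreal (pi / 2 * (2 * pi) ^ length ks)" by (rule ennreal_mult''[symmetric]) simp
  finally show ?thesis .
qed

lemma gaussian_santalo_base: "gaussian_santalo []"
  unfolding gaussian_santalo_def
proof (intro allI impI)
    fix f :: "'a \<Rightarrow> ennreal" and g :: "'a \<Rightarrow> real"
    assume f: "f \<in> borel_measurable borel" and i: "integrable (subspace_lebesgue []) g"
      and c: "\<forall>x\<in>coord_subspace []. \<forall>y\<in>coord_subspace []. f y * ennreal (g x) \<le> ennreal (exp (- (x \<bullet> y)))"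
    have [measurable]: "g \<in> borel_measurable borel"
      using i borel_measurable_integrable by (metis measurable_cong_sets sets_subspace_lebesgue)
    have "f 0 * ennreal (g 0) \<le> ennreal (exp (- ((0::'a) \<bullet> 0)))"
      using c[rule_format, of 0 0] by (simp add: coord_subspace_def)
    then show "(\<integral>\<^sup>+y. f y \<partial>subspace_lebesgue []) * (\<integral>\<^sup>+x. g x \<partial>subspace_lebesgue []) \<le> ennreal ((2 * pi) ^ length ([] :: 'a list))"
      using f by (simp add: nn_integral_return)
  qed

text \<open>Hyperplanes orthogonal to k are null, so the distribution function of x . k under the
  density g has no jumps and attains half of the total mass. The dividing hyperplane has no mass
  itself, hence both open half spaces receive exactly one half.\<close>

lemma median_exists:
  fixes g :: "'a::euclidean_space \<Rightarrow> real"
  assumes sets: "sets M = sets borel"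
    and g: "\<And>x. 0 \<le> g x" "integrable M g" and pos: "0 < (\<integral>x. g x \<partial>M)"
    and null: "\<And>m. emeasure M {x. x \<bullet> k = m} = 0"
  shows "\<exists>m. (\<integral>x. indicator {x. x \<bullet> k < m} x * g x \<partial>M) = (\<integral>x. g x \<partial>M) / 2
    \<and> (\<integral>x. indicator {x. m < x \<bullet> k} x * g x \<partial>M) = (\<integral>x. g x \<partial>M) / 2"
proof -
  note [measurable_cong] = sets
  have [measurable]: "g \<in> borel_measurable M" using g(2) by auto
  define D where "D = distr (density M g) borel (\<lambda>x. x \<bullet> k)"
  define G where "G = (\<integral>x. g x \<partial>M)"
  have int: "integrable M (\<lambda>x. indicator A x * g x)" if "A \<in> sets borel" for A
    using integrable_mult_indicator[of A M g] g(2) that sets by simp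
  have emD: "emeasure D A = ennreal (\<integral>x. indicator {x. x \<bullet> k \<in> A} x * g x \<partial>M)" if [measurable]: "A \<in> sets borel" for A
  proof -
    have "emeasure D A = (\<integral>\<^sup>+x. g x * indicator {x. x \<bullet> k \<in> A} x \<partial>M)"
      unfolding D_def using sets sets_eq_imp_space_eq[OF sets]
      by (subst emeasure_distr) (auto simp: emeasure_density vimage_def intro!: nn_integral_cong split: split_indicator)
    also have "\<dots> = (\<integral>\<^sup>+x. ennreal (indicator {x. x \<bullet> k \<in> A} x * g x) \<partial>M)"
      by (intro nn_integral_cong) (auto simp: indicator_def)
    also have "\<dots> = ennreal (\<integral>x. indicator {x. x \<bullet> k \<in> A} x * g x \<partial>M)"
      using g(1) by (intro nn_integral_eq_integral int) auto
    finally show ?thesis .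
  qed
  have mD: "measure D A = (\<integral>x. indicator {x. x \<bullet> k \<in> A} x * g x \<partial>M)" if "A \<in> sets borel" for A
    using emD[OF that] g(1) by (simp add: measure_def integral_nonneg_AE)
  have DU: "measure D UNIV = G" by (subst mD) (auto simp: G_def)
  interpret D: finite_borel_measure D
  proof (rule finite_borel_measure.intro)
    show "finite_measure D" using emD[of UNIV] by (intro finite_measureI) (simp add: D_def)
    show "finite_borel_measure_axioms D" by (simp add: finite_borel_measure_axioms_def D_def)
  qed
  have sg: "measure D {m} = 0" for m
  proof -
    have "AE x in M. x \<bullet> k \<noteq> m"
      using null[of m] by (subst AE_iff_measurable[where N="{x. x \<bullet> k = m}"]) (auto simp: sets sets_eq_imp_space_eq[OF sets])
    then have "AE x in M. indicator {x. x \<bullet> k \<in> {m}} x * g x = 0" by eventually_elim auto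
    then have "(\<integral>x. indicator {x. x \<bullet> k \<in> {m}} x * g x \<partial>M) = 0" by (intro integral_eq_zero_AE)
    then show ?thesis by (subst mD) auto
  qed
  have cont: "isCont (cdf D) x" for x using D.isCont_cdf sg by simp
  have G: "0 < G" using pos by (simp add: G_def)
  have spaceD: "space D = UNIV" by (simp add: D_def)
  have "eventually (\<lambda>x. cdf D x < G / 2) at_bot"
    using D.cdf_lim_at_bot G by (intro order_tendstoD) auto
  then obtain a where a: "cdf D a < G / 2" by (meson eventually_at_bot_linorder order_refl)
  have "eventually (\<lambda>x. G / 2 < cdf D x) at_top"
    using D.cdf_lim_at_top G DU spaceD by (intro order_tendstoD) auto
  then obtain b where b: "G / 2 < cdf D b" by (meson eventually_at_top_linorder order_refl)
  have "a \<le> b" using a b D.cdf_nondecreasing[of b a] by (meson less_le_trans less_trans not_le order_less_irrefl less_imp_le)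
  then obtain m where m: "cdf D m = G / 2"
    using IVT'[of "cdf D" a "G / 2" b] a b cont by (auto intro: continuous_at_imp_continuous_on)
  have le: "measure D {..m} = G / 2" using m by (simp add: cdf_def)
  have "measure D {..<m} = G / 2"
  proof -
    have "{..m} = {..<m} \<union> {m}" by auto
    then have "measure D {..m} = measure D {..<m} + measure D {m}"
      using D.finite_measure_Union[of "{..<m}" "{m}"] by (auto simp: D_def)
    then show ?thesis using le sg by simp
  qed
  moreover have "measure D {m<..} = G / 2"
  proof -
    have "{..m} \<union> {m<..} = UNIV" "{..m} \<inter> {m<..} = {}" by auto
    then have "measure D UNIV = measure D {..m} + measure D {m<..}"
      using D.finite_measure_Union[of "{..m}" "{m<..}"] by (simp add: D_def)
    then show ?thesis using le DU by simp
  qed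
  ultimately show ?thesis
    using mD[of "{..<m}"] mD[of "{m<..}"] by (intro exI[of _ m]) (auto simp: G_def)
qed

text \<open>The point z is where the line through the barycenters of the two halves meets the median
  hyperplane.\<close>

lemma gaussian_santalo_split_point:
  fixes g :: "'a::euclidean_space \<Rightarrow> real"
  assumes IH: "gaussian_santalo ks"
    and ks: "distinct (k # ks)" "set (k # ks) \<subseteq> Basis"
    and g: "\<And>x. 0 \<le> g x" "integrable (subspace_lebesgue (k # ks)) g"
      "integrable (subspace_lebesgue (k # ks)) (\<lambda>x. g x *\<^sub>R x)"
    and pos: "0 < (\<integral>x. g x \<partial>subspace_lebesgue (k # ks))"
  shows "\<exists>z\<in>coord_subspace (k # ks). \<forall>f. f \<in> borel_measurable borel \<longrightarrow>
      (\<forall>x\<in>coord_subspace (k # ks). \<forall>y\<in>coord_subspace (k # ks). f y * ennreal (g (z + x)) \<le> ennreal (exp (- (x \<bullet> y)))) \<longrightarrow>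
      (\<integral>\<^sup>+y. f y \<partial>subspace_lebesgue (k # ks)) * (\<integral>\<^sup>+x. g x \<partial>subspace_lebesgue (k # ks)) \<le> ennreal ((2 * pi) ^ length (k # ks))"
proof -
  define L where "L = subspace_lebesgue (k # ks)"
  define V where "V = coord_subspace (k # ks)"
  note fold = L_def[symmetric] V_def[symmetric]
  have setsL[measurable_cong]: "sets L = sets borel" and spL: "space L = UNIV" by (simp_all add: L_def del: subspace_lebesgue.simps)
  note g = g[unfolded fold] and pos = pos[unfolded fold]
  have [measurable]: "g \<in> borel_measurable borel"
    using g(2) borel_measurable_integrable setsL by (metis measurable_cong_sets)
  have [simp]: "k \<bullet> k = 1" using ks by simp
  have AEV: "AE x in L. x \<in> V" unfolding L_def V_def using AE_coord_subspace[OF ks] .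
  have plane: "emeasure L {x. x \<bullet> k = m} = 0" for m
  proof -
    have "emeasure L {x. x \<bullet> k = m} = (\<integral>\<^sup>+x. indicator {x. x \<bullet> k = m} x \<partial>L)" by (subst nn_integral_indicator) auto
    also have "\<dots> = (\<integral>\<^sup>+x. \<integral>\<^sup>+s. indicator {x. x \<bullet> k = m} (x + s *\<^sub>R k) \<partial>lborel \<partial>subspace_lebesgue ks)"
      unfolding L_def by (rule nn_integral_subspace_lebesgue_Cons) measurable
    also have "\<dots> = (\<integral>\<^sup>+x. \<integral>\<^sup>+s. indicator {m - x \<bullet> k} s \<partial>lborel \<partial>subspace_lebesgue ks)"
      by (rule nn_integral_cong, rule nn_integral_cong) (auto simp: indicator_def inner_add_left)
    also have "\<dots> = 0" by simp
    finally show ?thesis .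
  qed
  define G where "G = (\<integral>x. g x \<partial>L)"
  have G0: "0 < G" using pos by (simp add: G_def)
  obtain m where m: "(\<integral>x. indicator {x. x \<bullet> k < m} x * g x \<partial>L) = G / 2"
    "(\<integral>x. indicator {x. m < x \<bullet> k} x * g x \<partial>L) = G / 2"
    using median_exists[OF setsL g(1,2) pos plane] unfolding G_def by blast
  have int: "integrable L (\<lambda>x. indicator A x * g x)" "integrable L (\<lambda>x. (indicator A x * g x) *\<^sub>R x)" if "A \<in> sets borel" for A
    using integrable_mult_indicator[of A L g] integrable_mult_indicator[of A L "\<lambda>x. g x *\<^sub>R x"] g(2,3) that setsL by simp_all
  \<comment> \<open>For the two half spaces this is the barycenter, since each of them carries the
    mass G / 2.\<close>
  define bc where "bc = (\<lambda>A. (2 / G) *\<^sub>R (\<integral>x. (indicator A x * g x) *\<^sub>R x \<partial>L))"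
  have bc: "(\<integral>x. (indicator A x * g x) *\<^sub>R x \<partial>L) = (G / 2) *\<^sub>R bc A" for A
    using G0 by (simp add: bc_def)
  have bcV: "bc A \<in> V" if "A \<in> sets borel" for A
  proof -
    have "(\<integral>x. (indicator A x * g x) *\<^sub>R x \<partial>L) \<bullet> b = 0" if b: "b \<in> Basis - set (k # ks)" for b
    proof -
      have "(\<integral>x. (indicator A x * g x) *\<^sub>R x \<partial>L) \<bullet> b = (\<integral>x. ((indicator A x * g x) *\<^sub>R x) \<bullet> b \<partial>L)"
        using int(2)[OF \<open>A \<in> sets borel\<close>] by (intro integral_inner_left[symmetric])
      also have "\<dots> = 0"
        using AEV b by (intro integral_eq_zero_AE) (auto elim!: eventually_mono simp: V_def coord_subspace_def)
      finally show ?thesis .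
    qed
    then show ?thesis by (simp add: bc_def V_def coord_subspace_def)
  qed
  define Hp Hm where "Hp = {x::'a. m < x \<bullet> k}" and "Hm = {x::'a. x \<bullet> k < m}"
  have [measurable]: "Hp \<in> sets borel" "Hm \<in> sets borel" unfolding Hp_def Hm_def by measurable
  have mHp: "(\<integral>x. indicator Hp x * g x \<partial>L) = G / 2" and mHm: "(\<integral>x. indicator Hm x * g x \<partial>L) = G / 2"
    using m by (simp_all add: Hp_def Hm_def)
  have bck: "(\<integral>x. indicator A x * g x * (x \<bullet> k - m) \<partial>L) = (G / 2) * (bc A \<bullet> k - m)"
    if [measurable]: "A \<in> sets borel" and A: "(\<integral>x. indicator A x * g x \<partial>L) = G / 2" for A
  proof -
    have "(\<integral>x. indicator A x * g x * (x \<bullet> k - m) \<partial>L) = (\<integral>x. ((indicator A x * g x) *\<^sub>R x) \<bullet> k - (indicator A x * g x) * m \<partial>L)"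
      by (simp add: algebra_simps)
    also have "\<dots> = (G / 2) * (bc A \<bullet> k) - (G / 2) * m"
    proof -
      have "(\<integral>x. ((indicator A x * g x) *\<^sub>R x) \<bullet> k \<partial>L) = (G / 2) * (bc A \<bullet> k)"
        using integral_inner_left[of k L "\<lambda>x. (indicator A x * g x) *\<^sub>R x"] int(2)[of A] by (simp add: bc)
      moreover have "(\<integral>x. (indicator A x * g x) * m \<partial>L) = (G / 2) * m"
        using A by simp
      ultimately show ?thesis
        using int[of A] by (subst Bochner_Integration.integral_diff)
          (auto intro!: integrable_inner_left simp del: inner_scaleR_left)
    qed
    finally show ?thesis by (simp add: algebra_simps)
  qed
  have ik: "integrable L (\<lambda>x. indicator A x * g x * (x \<bullet> k - m))" if "A \<in> sets borel" for A
  proof -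
    have "integrable L (\<lambda>x. ((indicator A x * g x) *\<^sub>R x) \<bullet> k - (indicator A x * g x) * m)"
      using int[OF that] by (intro Bochner_Integration.integrable_diff integrable_inner_left integrable_mult_left) auto
    then show ?thesis by (simp add: algebra_simps)
  qed
  \<comment> \<open>A half of positive mass has its barycenter strictly on its own side. Hence the
    line through the two barycenters is transversal to the hyperplane, and v can be scaled to v . k
    = 1.\<close>
  have strict: "(\<integral>x. indicator A x * g x * (e * (x \<bullet> k - m)) \<partial>L) > 0"
    if [measurable]: "A \<in> sets borel" and A: "(\<integral>x. indicator A x * g x \<partial>L) = G / 2" "\<And>x. x \<in> A \<Longrightarrow> 0 < e * (x \<bullet> k - m)" for A and e :: real
  proof (rule ccontr)
    assume neg: "\<not> 0 < (\<integral>x. indicator A x * g x * (e * (x \<bullet> k - m)) \<partial>L)"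
    have nn: "0 \<le> indicator A x * g x * (e * (x \<bullet> k - m))" for x
      using A(2)[of x] g(1)[of x] by (auto simp: indicator_def)
    have ie: "integrable L (\<lambda>x. indicator A x * g x * (e * (x \<bullet> k - m)))"
      using integrable_mult_right[OF ik[OF that(1)], of e] by (simp add: algebra_simps)
    have "(\<integral>x. indicator A x * g x * (e * (x \<bullet> k - m)) \<partial>L) = 0"
    proof (rule antisym)
      show "0 \<le> (\<integral>x. indicator A x * g x * (e * (x \<bullet> k - m)) \<partial>L)"
        by (intro Bochner_Integration.integral_nonneg nn)
    qed (use neg in linarith)
    then have "AE x in L. indicator A x * g x * (e * (x \<bullet> k - m)) = 0"
      using integral_nonneg_eq_0_iff_AE[OF ie] nn by auto
    then have "AE x in L. indicator A x * g x = 0"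
      by eventually_elim (use A(2) in \<open>force simp: indicator_def\<close>)
    then have "(\<integral>x. indicator A x * g x \<partial>L) = 0" by (intro integral_eq_zero_AE)
    then show False using A G0 by simp
  qed
  define bp bm where "bp = bc Hp" and "bm = bc Hm"
  have "0 < bp \<bullet> k - m"
    using strict[of Hp 1] bck[of Hp] mHp G0 by (auto simp: Hp_def[symmetric] bp_def zero_less_mult_iff) (auto simp: Hp_def)
  moreover have "bm \<bullet> k - m < 0"
  proof -
    have "0 < (\<integral>x. indicator Hm x * g x * ((-1) * (x \<bullet> k - m)) \<partial>L)"
      using mHm by (intro strict) (auto simp: Hm_def)
    also have "\<dots> = (\<integral>x. - (indicator Hm x * g x * (x \<bullet> k - m)) \<partial>L)"
      by (simp add: algebra_simps)
    also have "\<dots> = - ((G / 2) * (bm \<bullet> k - m))"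
      unfolding Bochner_Integration.integral_minus using bck[of Hm] mHm by (simp add: bm_def)
    finally show ?thesis using G0 by (simp add: zero_less_mult_iff mult_less_0_iff)
  qed
  ultimately have \<beta>0: "0 < (bp - bm) \<bullet> k" by (simp add: inner_diff_left)
  define \<beta> where "\<beta> = (bp - bm) \<bullet> k"
  define v where "v = (1 / \<beta>) *\<^sub>R (bp - bm)"
  define z where "z = bp - (bp \<bullet> k - m) *\<^sub>R v"
  have \<beta>: "0 < \<beta>" "bp - bm = \<beta> *\<^sub>R v" "\<beta> = bp \<bullet> k - bm \<bullet> k"
    using \<beta>0 by (auto simp: \<beta>_def v_def inner_diff_left)
  have vk: "v \<bullet> k = 1" using \<beta>0 by (simp add: v_def \<beta>_def)
  have zk: "z \<bullet> k = m" by (simp add: z_def inner_diff_left vk)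
  have subV: "subspace V" unfolding V_def by (rule subspace_coord_subspace)
  have vV: "v \<in> V" "- v \<in> V" and zV: "z \<in> V"
    unfolding v_def z_def bp_def bm_def
    by (intro subspace_scale subspace_diff subspace_neg subV bcV; simp)+
  \<comment> \<open>Both barycenters lie on the line z + t v, so one projection along v sends both
    of them to z. This is the centering that the induction hypothesis asks of each marginal.\<close>
  have bp0: "bp - z - (bp \<bullet> k - m) *\<^sub>R v = 0" by (simp add: z_def)
  have bm0: "bm - z - (bm \<bullet> k - m) *\<^sub>R v = 0"
  proof -
    have "bm = bp - \<beta> *\<^sub>R v" using \<beta>(2) by (simp add: algebra_simps)
    then show ?thesis by (simp add: z_def \<beta>(3) algebra_simps)
  qed
  have bary: "(\<integral>x. (indicator A x * g x) *\<^sub>R (x - z - (x \<bullet> k - m) *\<^sub>R v) \<partial>L) = (G / 2) *\<^sub>R (bc A - z - (bc A \<bullet> k - m) *\<^sub>R v)"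
    if "A \<in> sets borel" "(\<integral>x. indicator A x * g x \<partial>L) = G / 2" for A
  proof -
    have "(\<integral>x. (indicator A x * g x) *\<^sub>R (x - z - (x \<bullet> k - m) *\<^sub>R v) \<partial>L)
        = (\<integral>x. (indicator A x * g x) *\<^sub>R x - (indicator A x * g x) *\<^sub>R z - (indicator A x * g x * (x \<bullet> k - m)) *\<^sub>R v \<partial>L)"
      by (simp add: algebra_simps)
    also have "\<dots> = (G / 2) *\<^sub>R bc A - (G / 2) *\<^sub>R z - ((G / 2) * (bc A \<bullet> k - m)) *\<^sub>R v"
      using int[OF that(1)] ik[OF that(1)] bc that(2) bck[OF that]
      by (subst Bochner_Integration.integral_diff, auto)+
    finally show ?thesis by (simp add: algebra_simps)
  qed
  show ?thesis
    unfolding fold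
  proof (intro bexI[OF _ zV] allI impI)
    fix f :: "'a \<Rightarrow> ennreal"
    assume [measurable]: "f \<in> borel_measurable borel"
      and fg: "\<forall>x\<in>V. \<forall>y\<in>V. f y * ennreal (g (z + x)) \<le> ennreal (exp (- (x \<bullet> y)))"
    have HS: "(\<integral>\<^sup>+y. f y * indicator {y. 0 < y \<bullet> v'} y \<partial>L) * ennreal (G / 2) \<le> ennreal (pi / 2 * (2 * pi) ^ length ks)"
      if e: "v' \<in> V" "v' \<bullet> k = e" "\<bar>e\<bar> = 1" and A: "A = {x. 0 < e * ((x - z) \<bullet> k)}" "(\<integral>x. indicator A x * g x \<partial>L) = G / 2"
        and b: "(\<integral>x. (indicator A x * g x) *\<^sub>R (x - z - (e * ((x - z) \<bullet> k)) *\<^sub>R v') \<partial>L) = 0" for A e v'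
    proof -
      have [measurable]: "A \<in> sets borel" unfolding A by measurable
      have "(\<integral>\<^sup>+x. indicator A x * g x \<partial>L) = ennreal (G / 2)"
        unfolding A(2)[symmetric] using int(1)[of A] g(1) by (intro nn_integral_eq_integral) auto
      then show ?thesis
        using gaussian_santalo_half_space[OF IH ks, unfolded fold, OF zV e \<open>f \<in> borel_measurable borel\<close> g A(1) b] fg by auto
    qed
    have 1: "(\<integral>\<^sup>+y. f y * indicator {y. 0 < y \<bullet> v} y \<partial>L) * ennreal (G / 2) \<le> ennreal (pi / 2 * (2 * pi) ^ length ks)"
    proof (rule HS[where A=Hp and e=1, OF vV(1) vk])
      show "Hp = {x. 0 < 1 * ((x - z) \<bullet> k)}" by (auto simp: Hp_def inner_diff_left zk)
      have "(\<integral>x. (indicator Hp x * g x) *\<^sub>R (x - z - (x \<bullet> k - m) *\<^sub>R v) \<partial>L) = 0"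
        by (subst bary) (use mHp bp0 in \<open>simp_all add: bp_def\<close>)
      then show "(\<integral>x. (indicator Hp x * g x) *\<^sub>R (x - z - (1 * ((x - z) \<bullet> k)) *\<^sub>R v) \<partial>L) = 0"
        by (simp add: inner_diff_left zk)
    qed (use mHp in simp_all)
    have 2: "(\<integral>\<^sup>+y. f y * indicator {y. 0 < y \<bullet> (- v)} y \<partial>L) * ennreal (G / 2) \<le> ennreal (pi / 2 * (2 * pi) ^ length ks)"
    proof (rule HS[where A=Hm and e="-1", OF vV(2)])
      show "Hm = {x. 0 < - 1 * ((x - z) \<bullet> k)}" by (auto simp: Hm_def inner_diff_left zk)
      have "(\<integral>x. (indicator Hm x * g x) *\<^sub>R (x - z - (x \<bullet> k - m) *\<^sub>R v) \<partial>L) = 0"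
        by (subst bary) (use mHm bm0 in \<open>simp_all add: bm_def\<close>)
      then show "(\<integral>x. (indicator Hm x * g x) *\<^sub>R (x - z - (- 1 * ((x - z) \<bullet> k)) *\<^sub>R - v) \<partial>L) = 0"
        by (simp add: inner_diff_left zk algebra_simps)
    qed (use mHm vk in simp_all)
    \<comment> \<open>The hyperplane orthogonal to v is null, so the two half spaces account for the
      whole integral of f.\<close>
    have nullv: "AE y in L. y \<bullet> v \<noteq> 0"
    proof -
      have "(\<integral>\<^sup>+y. indicator {y. y \<bullet> v = 0} y \<partial>L) = (\<integral>\<^sup>+y. \<integral>\<^sup>+s. indicator {y. y \<bullet> v = 0} (y + s *\<^sub>R k) \<partial>lborel \<partial>subspace_lebesgue ks)"
        unfolding L_def by (rule nn_integral_subspace_lebesgue_Cons) measurable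
      also have "\<dots> = (\<integral>\<^sup>+y. \<integral>\<^sup>+s. indicator {- (y \<bullet> v)} s \<partial>lborel \<partial>subspace_lebesgue ks)"
        using vk by (intro nn_integral_cong) (auto simp: indicator_def inner_add_left inner_commute[of k v])
      also have "\<dots> = 0" by simp
      finally have "AE y in L. indicator {y. y \<bullet> v = 0} y = (0::ennreal)"
        by (subst (asm) nn_integral_0_iff_AE) auto
      then show ?thesis by eventually_elim (auto simp: indicator_def split: if_splits)
    qed
    have "(\<integral>\<^sup>+y. f y \<partial>L) = (\<integral>\<^sup>+y. f y * indicator {y. 0 < y \<bullet> v} y + f y * indicator {y. 0 < y \<bullet> (- v)} y \<partial>L)"
      using nullv by (intro nn_integral_cong_AE) (auto elim!: eventually_mono simp: indicator_def)
    also have "\<dots> = (\<integral>\<^sup>+y. f y * indicator {y. 0 < y \<bullet> v} y \<partial>L) + (\<integral>\<^sup>+y. f y * indicator {y. 0 < y \<bullet> (- v)} y \<partial>L)"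
      by (intro nn_integral_add) auto
    \<comment> \<open>Each half of f is paired with the mass G / 2 only. Adding the halves and
      doubling that mass gives 2 * 2 * (pi / 2) = 2 * pi, the factor of one more dimension.\<close>
    finally have "(\<integral>\<^sup>+y. f y \<partial>L) * ennreal (G / 2) \<le> ennreal (pi / 2 * (2 * pi) ^ length ks) + ennreal (pi / 2 * (2 * pi) ^ length ks)"
      using add_mono[OF 1 2] by (simp add: distrib_right)
    also have "\<dots> = ennreal (pi * (2 * pi) ^ length ks)"
      by (subst ennreal_plus[symmetric]) auto
    finally have "2 * ((\<integral>\<^sup>+y. f y \<partial>L) * ennreal (G / 2)) \<le> 2 * ennreal (pi * (2 * pi) ^ length ks)"
      by (intro mult_left_mono) auto
    moreover have "(\<integral>\<^sup>+x. g x \<partial>L) = 2 * ennreal (G / 2)"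
      using g(1,2) G0 by (simp add: nn_integral_eq_integral G_def ennreal_mult''[symmetric] flip: ennreal_numeral)
    moreover have "2 * ennreal (pi * (2 * pi) ^ length ks) = ennreal ((2 * pi) ^ length (k # ks))"
      by (simp add: ennreal_mult''[symmetric] mult.assoc flip: ennreal_numeral)
    ultimately show "(\<integral>\<^sup>+y. f y \<partial>L) * (\<integral>\<^sup>+x. g x \<partial>L) \<le> ennreal ((2 * pi) ^ length (k # ks))"
      by (simp add: mult.left_commute)
  qed
qed

text \<open>The tilt by exp (z . y) moves the free point of the splitting lemma to the barycenter:
  it does not decrease the integral of a centered function.\<close>

lemma gaussian_santalo_Cons:
  assumes IH: "gaussian_santalo ks"
    and ks: "distinct (k # ks)" "set (k # ks) \<subseteq> (Basis :: 'a::euclidean_space set)"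
  shows "gaussian_santalo (k # ks)"
  unfolding gaussian_santalo_def
proof (intro allI impI)
  define L where "L = subspace_lebesgue (k # ks)"
  define V where "V = coord_subspace (k # ks)"
  note fold = L_def[symmetric] V_def[symmetric]
  have setsL[measurable_cong]: "sets L = sets borel" and spL: "space L = UNIV" by (simp_all add: L_def del: subspace_lebesgue.simps)
  fix f :: "'a \<Rightarrow> ennreal" and g :: "'a \<Rightarrow> real"
  assume [measurable]: "f \<in> borel_measurable borel" and g0: "\<forall>x. 0 \<le> g x"
    and g: "integrable (subspace_lebesgue (k # ks)) g" "integrable (subspace_lebesgue (k # ks)) (\<lambda>x. g x *\<^sub>R x)"
      "(\<integral>x. g x *\<^sub>R x \<partial>subspace_lebesgue (k # ks)) = 0"
    and fg: "\<forall>x\<in>coord_subspace (k # ks). \<forall>y\<in>coord_subspace (k # ks). f y * ennreal (g x) \<le> ennreal (exp (- (x \<bullet> y)))"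
  note g = g[unfolded fold] and fg = fg[unfolded fold]
  have [measurable]: "g \<in> borel_measurable borel"
    using g(1) borel_measurable_integrable setsL by (metis measurable_cong_sets)
  \<comment> \<open>The splitting lemma will be applied to f, about which only measurability is
    known. Truncation in height and support provides integrability and a first moment.\<close>
  define T where "T = (\<lambda>(n::nat) y. enn2real (min (f y) (of_nat n)) * indicator (cball 0 (real n)) y)"
  have [measurable]: "cball (0::'a) r \<in> sets borel" for r by simp
  have [measurable]: "T n \<in> borel_measurable borel" for n unfolding T_def
    by (intro borel_measurable_times borel_measurable_indicator borel_measurable_enn2real) (simp_all, measurable)
  have fin: "ennreal (enn2real (min y (of_nat n))) = min y (of_nat n)" for y :: ennreal and n
    by (intro ennreal_enn2real) (simp add: min_less_iff_disj ennreal_of_nat_eq_real_of_nat)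
  have T_eq: "ennreal (T n y) = min (f y) (of_nat n) * indicator (cball 0 (real n)) y" for n y
    by (simp add: T_def fin ennreal_mult' ennreal_indicator)
  have T_nn: "0 \<le> T n y" for n y by (simp add: T_def)
  have T_le: "ennreal (T n y) \<le> f y" for n y by (auto simp: T_eq indicator_def)
  have T_n: "T n y \<le> real n * indicator (cball 0 (real n)) y" for n y
    using enn2real_mono[of "min (f y) (of_nat n)" "of_nat n"]
    by (auto simp: T_def indicator_def ennreal_of_nat_eq_real_of_nat)
  have int_ball: "integrable L (\<lambda>y. indicator (cball 0 (real n)) y :: real)" for n
    using emeasure_subspace_lebesgue_cbox_finite[OF ks, of "cball 0 (real n)", unfolded fold]
    by (intro integrable_real_indicator) auto
  have T_int: "integrable L (T n)" for n
    using T_n T_nn by (intro Bochner_Integration.integrable_bound[OF integrable_mult_right[OF int_ball[of n], of "real n"]]) auto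
  have T_int1: "integrable L (\<lambda>y. T n y *\<^sub>R y)" for n
  proof (rule Bochner_Integration.integrable_bound[OF integrable_mult_right[OF int_ball[of n], of "real n * real n"]])
    show "AE y in L. norm (T n y *\<^sub>R y) \<le> norm (real n * real n * indicator (cball 0 (real n)) y)"
    proof (intro AE_I2)
      fix y
      show "norm (T n y *\<^sub>R y) \<le> norm (real n * real n * indicator (cball 0 (real n)) y)"
        using T_n[of n y] T_nn[of n y] by (auto simp: indicator_def intro!: mult_mono)
    qed
  qed measurable
  have mono: "incseq (\<lambda>n y. ennreal (T n y))"
  proof (intro incseq_SucI le_funI)
    fix n y
    have "min (f y) (of_nat n) \<le> min (f y) (of_nat (Suc n))"
      by (intro min.mono) (auto simp: ennreal_of_nat_eq_real_of_nat simp del: of_nat_Suc)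
    then show "ennreal (T n y) \<le> ennreal (T (Suc n) y)"
      unfolding T_eq by (intro mult_mono) (auto simp: indicator_def)
  qed
  have SUP: "(SUP n. ennreal (T n y)) = f y" for y
  proof (rule antisym)
    show "(SUP n. ennreal (T n y)) \<le> f y" by (intro SUP_least T_le)
    obtain k :: nat where k: "norm y \<le> real k" using real_arch_simple by blast
    have *: "min (f y) (of_nat n) \<le> (SUP n. ennreal (T n y))" for n
    proof -
      have "min (f y) (of_nat n) \<le> min (f y) (of_nat (max k n))"
        by (intro min.mono) (auto simp: ennreal_of_nat_eq_real_of_nat)
      also have "\<dots> = ennreal (T (max k n) y)" using k by (simp add: T_eq)
      also have "\<dots> \<le> (SUP n. ennreal (T n y))" by (intro SUP_upper) auto
      finally show ?thesis .
    qed
    have "f y = (SUP n::nat. min (f y) (of_nat n))"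
    proof (rule antisym)
      show "f y \<le> (SUP n::nat. min (f y) (of_nat n))"
      proof (cases "f y")
        case (real r)
        obtain m :: nat where "r \<le> real m" using real_arch_simple by blast
        then have "f y = min (f y) (of_nat m)"
          using real by (simp add: min_def ennreal_of_nat_eq_real_of_nat)
        then show ?thesis by (metis SUP_upper UNIV_I)
      next
        case top
        then show ?thesis by (simp add: ennreal_SUP_of_nat_eq_top min_def top_unique)
      qed
    qed (auto intro!: SUP_least)
    also have "\<dots> \<le> (SUP n. ennreal (T n y))" by (intro SUP_least *)
    finally show "f y \<le> (SUP n. ennreal (T n y))" .
  qed
  have bound: "(\<integral>\<^sup>+y. T n y \<partial>L) * (\<integral>\<^sup>+x. g x \<partial>L) \<le> ennreal ((2 * pi) ^ length (k # ks))" for n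
  proof (cases "0 < (\<integral>y. T n y \<partial>L)")
    case False
    moreover have "0 \<le> (\<integral>y. T n y \<partial>L)" by (intro Bochner_Integration.integral_nonneg T_nn)
    ultimately have "(\<integral>y. T n y \<partial>L) = 0" by linarith
    then have "(\<integral>\<^sup>+y. T n y \<partial>L) = 0"
      using T_int T_nn by (simp add: nn_integral_eq_integral)
    then show ?thesis by simp
  next
    case True
    obtain z where z: "z \<in> V" and zf: "\<And>h. h \<in> borel_measurable borel \<Longrightarrow>
        (\<And>x y. x \<in> V \<Longrightarrow> y \<in> V \<Longrightarrow> h y * ennreal (T n (z + x)) \<le> ennreal (exp (- (x \<bullet> y)))) \<Longrightarrow>
        (\<integral>\<^sup>+y. h y \<partial>L) * (\<integral>\<^sup>+x. T n x \<partial>L) \<le> ennreal ((2 * pi) ^ length (k # ks))"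
      using gaussian_santalo_split_point[OF IH ks, unfolded fold, of "T n", OF T_nn T_int T_int1 True] by metis
    define h where "h = (\<lambda>y. ennreal (g y * exp (z \<bullet> y)))"
    have "(\<integral>\<^sup>+y. h y \<partial>L) * (\<integral>\<^sup>+x. T n x \<partial>L) \<le> ennreal ((2 * pi) ^ length (k # ks))"
    proof (rule zf)
      show "h \<in> borel_measurable borel" unfolding h_def by measurable
      fix x y assume x: "x \<in> V" and y: "y \<in> V"
      have zx: "z + x \<in> V" using z x unfolding V_def by (intro subspace_add subspace_coord_subspace)
      have "h y * ennreal (T n (z + x)) \<le> h y * f (z + x)" by (intro mult_left_mono T_le) auto
      also have "\<dots> = ennreal (exp (z \<bullet> y)) * (f (z + x) * ennreal (g y))"
        using g0 by (simp add: h_def ennreal_mult ac_simps)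
      also have "\<dots> \<le> ennreal (exp (z \<bullet> y)) * ennreal (exp (- (y \<bullet> (z + x))))"
        using fg y zx by (intro mult_left_mono) auto
      also have "\<dots> = ennreal (exp (- (x \<bullet> y)))"
        by (simp add: ennreal_mult''[symmetric] exp_add[symmetric] inner_add_right inner_commute)
      finally show "h y * ennreal (T n (z + x)) \<le> ennreal (exp (- (x \<bullet> y)))" .
    qed
    \<comment> \<open>By \<open>exp t \<ge> 1 + t\<close> the tilted integral dominates the integral
      of g y * (1 + z . y), whose linear part vanishes because g is centered.\<close>
    moreover have "(\<integral>\<^sup>+x. g x \<partial>L) \<le> (\<integral>\<^sup>+y. h y \<partial>L)"
    proof -
      have i: "integrable L (\<lambda>y. g y + z \<bullet> (g y *\<^sub>R y))"
        by (intro Bochner_Integration.integrable_add integrable_inner_right g)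
      have "(\<integral>\<^sup>+x. g x \<partial>L) = ennreal (\<integral>y. g y \<partial>L)"
        using g g0 by (intro nn_integral_eq_integral) auto
      also have "(\<integral>y. g y \<partial>L) = (\<integral>y. g y + z \<bullet> (g y *\<^sub>R y) \<partial>L)"
        using g integral_inner_right[of z L "\<lambda>y. g y *\<^sub>R y"]
        by (subst Bochner_Integration.integral_add) (auto intro!: integrable_inner_right simp del: inner_scaleR_right)
      also have "ennreal \<dots> \<le> (\<integral>\<^sup>+y. ennreal (g y + z \<bullet> (g y *\<^sub>R y)) \<partial>L)"
        by (rule ennreal_integral_le_nn_integral[OF i])
      also have "\<dots> \<le> (\<integral>\<^sup>+y. h y \<partial>L)"
        unfolding h_def
      proof (intro nn_integral_mono ennreal_leI)
        fix y
        have "g y * (1 + z \<bullet> y) \<le> g y * exp (z \<bullet> y)"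
          using g0 by (intro mult_left_mono exp_ge_add_one_self) auto
        then show "g y + z \<bullet> (g y *\<^sub>R y) \<le> g y * exp (z \<bullet> y)" by (simp add: algebra_simps)
      qed
      finally show ?thesis .
    qed
    ultimately show ?thesis
      using mult_right_mono[of "\<integral>\<^sup>+x. g x \<partial>L" "\<integral>\<^sup>+y. h y \<partial>L" "\<integral>\<^sup>+x. T n x \<partial>L"]
      by (simp add: mult.commute)
  qed
  have "(\<integral>\<^sup>+y. f y \<partial>L) * (\<integral>\<^sup>+x. g x \<partial>L) = (SUP n. (\<integral>\<^sup>+y. T n y \<partial>L)) * (\<integral>\<^sup>+x. g x \<partial>L)"
    using nn_integral_monotone_convergence_SUP[OF mono, of L] by (simp add: SUP)
  also have "\<dots> = (SUP n. (\<integral>\<^sup>+y. T n y \<partial>L) * (\<integral>\<^sup>+x. g x \<partial>L))"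
    by (simp add: SUP_mult_right_ennreal)
  also have "\<dots> \<le> ennreal ((2 * pi) ^ length (k # ks))" by (intro SUP_least bound)
  finally show "(\<integral>\<^sup>+y. f y \<partial>subspace_lebesgue (k # ks)) * (\<integral>\<^sup>+x. g x \<partial>subspace_lebesgue (k # ks)) \<le> ennreal ((2 * pi) ^ length (k # ks))"
    unfolding fold .
qed

theorem functional_santalo:
  fixes f :: "'a::euclidean_space \<Rightarrow> ennreal" and g :: "'a \<Rightarrow> real"
  assumes "f \<in> borel_measurable borel" "\<And>x. 0 \<le> g x" "integrable lborel g" "integrable lborel (\<lambda>x. g x *\<^sub>R x)"
    and "(\<integral>x. g x *\<^sub>R x \<partial>lborel) = 0"
    and "\<And>x y. f y * ennreal (g x) \<le> ennreal (exp (- (x \<bullet> y)))"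
  shows "(\<integral>\<^sup>+y. f y \<partial>lborel) * (\<integral>\<^sup>+x. g x \<partial>lborel) \<le> ennreal ((2 * pi) ^ DIM('a))"
proof -
  obtain ks :: "'a list" where ks: "set ks = Basis" "distinct ks"
    using finite_distinct_list[OF finite_Basis] by blast
  have "gaussian_santalo ks'" if "distinct ks'" "set ks' \<subseteq> Basis" for ks' :: "'a list"
    using that by (induction ks') (simp_all add: gaussian_santalo_base gaussian_santalo_Cons)
  then have "gaussian_santalo ks" using ks by simp
  then show ?thesis
    using assms distinct_card[OF ks(2)] subspace_lebesgue_eq_lborel[OF ks(2,1)] ks(1)
    unfolding gaussian_santalo_def by auto
qed

section \<open>Smooth functions and Minkowski norms\<close>

abbreviation dirder :: "real^'n \<Rightarrow> (real^'n \<Rightarrow> real) \<Rightarrow> real^'n \<Rightarrow> real" where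
  "dirder u f \<equiv> (\<lambda>y. frechet_derivative f (at y) u)"

lemma iter_dirder_snoc: "iter_dirder (us @ [u]) f = iter_dirder us (dirder u f)"
  by (induction us) auto

lemma dirder_eq: "(f has_derivative f') (at y) \<Longrightarrow> dirder u f y = f' u"
  using frechet_derivative_at by metis

lemma dirder_cong_open:
  assumes "open S" "\<And>x. x \<in> S \<Longrightarrow> f x = g x" "y \<in> S"
  shows "dirder u f y = dirder u g y" and "f differentiable (at y) \<longleftrightarrow> g differentiable (at y)"
proof -
  have *: "(f has_derivative D) (at y) \<longleftrightarrow> (g has_derivative D) (at y)" for D
    using assms has_derivative_transform_within_open[of f D y UNIV S g]
      has_derivative_transform_within_open[of g D y UNIV S f] by auto
  then show "dirder u f y = dirder u g y" by (simp add: frechet_derivative_def)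
  show "f differentiable (at y) \<longleftrightarrow> g differentiable (at y)" using * by (simp add: differentiable_def)
qed

lemma smooth_on_set_open: "smooth_on_set f S \<Longrightarrow> open S"
  by (simp add: smooth_on_set_def)

lemma smooth_on_set_differentiable: "smooth_on_set f S \<Longrightarrow> y \<in> S \<Longrightarrow> f differentiable (at y)"
  unfolding smooth_on_set_def by (metis iter_dirder.simps(1))

lemma smooth_on_set_has_derivative:
  "smooth_on_set f S \<Longrightarrow> y \<in> S \<Longrightarrow> (f has_derivative (\<lambda>u. dirder u f y)) (at y)"
  using smooth_on_set_differentiable frechet_derivative_works by blast

lemma smooth_on_set_dirder: "smooth_on_set f S \<Longrightarrow> smooth_on_set (dirder u f) S"
  unfolding smooth_on_set_def by (metis iter_dirder_snoc)

lemma smooth_on_set_continuous_on: "smooth_on_set f S \<Longrightarrow> continuous_on S f"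
  by (meson continuous_at_imp_continuous_on differentiable_imp_continuous_within smooth_on_set_differentiable)

lemma smooth_on_set_isCont: "smooth_on_set f S \<Longrightarrow> y \<in> S \<Longrightarrow> isCont f y"
  using differentiable_imp_continuous_within smooth_on_set_differentiable by blast

lemma dirder_linear:
  assumes "f differentiable (at y)"
  shows "linear (\<lambda>u. dirder u f y)"
  using assms linear_frechet_derivative by blast

text \<open>Smoothness quantifies over all iterated derivatives. An invariant class avoids formulas
  for them: closure under one derivative is enough, and agreement on S suffices because derivatives
  are local and S is open.\<close>

lemma smooth_on_set_coinduct:
  assumes "open S" "h \<in> H" "\<And>h y. h \<in> H \<Longrightarrow> y \<in> S \<Longrightarrow> h differentiable (at y)"
    and step: "\<And>h u. h \<in> H \<Longrightarrow> \<exists>h'\<in>H. \<forall>y\<in>S. dirder u h y = h' y"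
  shows "smooth_on_set h S"
proof -
  have *: "\<exists>h'\<in>H. \<forall>y\<in>S. iter_dirder us h y = h' y" for us
  proof (induction us)
    case Nil
    then show ?case using assms(2) by auto
  next
    case (Cons u us)
    then obtain h1 where h1: "h1 \<in> H" "\<forall>y\<in>S. iter_dirder us h y = h1 y" by blast
    obtain h2 where h2: "h2 \<in> H" "\<forall>y\<in>S. dirder u h1 y = h2 y" using step[OF h1(1)] by blast
    have "\<forall>y\<in>S. iter_dirder (u # us) h y = h2 y"
      using dirder_cong_open(1)[OF assms(1), of "iter_dirder us h" h1] h1 h2 by auto
    then show ?case using h2 by blast
  qed
  have "iter_dirder us h differentiable (at y)" if "y \<in> S" for us y
    using *[of us] dirder_cong_open(2)[OF assms(1), of "iter_dirder us h" _ y] that assms(3) by metis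
  then show ?thesis using assms(1) by (auto simp: smooth_on_set_def)
qed

text \<open>Products and inverses are not stable under differentiation, but the algebra they
  generate together with the smooth functions is. It is the invariant class for the preceding
  coinduction rule.\<close>

inductive_set smooth_algebra :: "(real^'n) set \<Rightarrow> (real^'n \<Rightarrow> real) set" for S where
  base: "smooth_on_set f S \<Longrightarrow> f \<in> smooth_algebra S"
| const: "(\<lambda>y. c) \<in> smooth_algebra S"
| add: "f \<in> smooth_algebra S \<Longrightarrow> g \<in> smooth_algebra S \<Longrightarrow> (\<lambda>y. f y + g y) \<in> smooth_algebra S"
| mult: "f \<in> smooth_algebra S \<Longrightarrow> g \<in> smooth_algebra S \<Longrightarrow> (\<lambda>y. f y * g y) \<in> smooth_algebra S"
| inverse: "f \<in> smooth_algebra S \<Longrightarrow> (\<And>y. y \<in> S \<Longrightarrow> f y \<noteq> 0) \<Longrightarrow> (\<lambda>y. inverse (f y)) \<in> smooth_algebra S"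

lemma smooth_algebra_smooth:
  assumes "open S" "h \<in> smooth_algebra S"
  shows "smooth_on_set h S"
proof -
  have *: "(\<forall>y\<in>S. h differentiable (at y)) \<and> (\<forall>u. \<exists>h'\<in>smooth_algebra S. \<forall>y\<in>S. dirder u h y = h' y)"
    if "h \<in> smooth_algebra S" for h
    using that
  proof induction
    case (base f)
    then show ?case
      using smooth_on_set_differentiable[OF base] smooth_algebra.base[OF smooth_on_set_dirder[OF base]] by (intro conjI allI) auto
  next
    case (const c)
    have "dirder u (\<lambda>y. c) y = 0" for u and y :: "real^'n" by (simp add: dirder_eq[OF has_derivative_const])
    then show ?case using smooth_algebra.const[of 0 S] by auto
  next
    case (add f g)
    have "dirder u (\<lambda>y. f y + g y) y = dirder u f y + dirder u g y" if y: "y \<in> S" for u y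
    proof -
      have "(f has_derivative (\<lambda>u. dirder u f y)) (at y)" "(g has_derivative (\<lambda>u. dirder u g y)) (at y)"
        using add.IH y by (simp_all add: frechet_derivative_works)
      from dirder_eq[OF has_derivative_add[OF this]] show ?thesis .
    qed
    moreover have "\<exists>h'\<in>smooth_algebra S. \<forall>y\<in>S. dirder u f y + dirder u g y = h' y" for u
    proof -
      obtain f' g' where "f' \<in> smooth_algebra S" "\<forall>y\<in>S. dirder u f y = f' y" "g' \<in> smooth_algebra S" "\<forall>y\<in>S. dirder u g y = g' y"
        using add.IH by meson
      then show ?thesis by (intro bexI[of _ "\<lambda>y. f' y + g' y"]) (auto intro: smooth_algebra.intros)
    qed
    ultimately show ?case using add.IH by (auto intro: differentiable_add)
  next
    case (mult f g)
    have D: "dirder u (\<lambda>y. f y * g y) y = f y * dirder u g y + dirder u f y * g y" if "y \<in> S" for u y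
      using mult.IH that
      by (intro dirder_eq[OF has_derivative_mult[of f "\<lambda>u. dirder u f y" _ _ g "\<lambda>u. dirder u g y"]]) (auto simp: frechet_derivative_works)
    have "\<exists>h'\<in>smooth_algebra S. \<forall>y\<in>S. dirder u (\<lambda>y. f y * g y) y = h' y" for u
    proof -
      obtain f' g' where "f' \<in> smooth_algebra S" "\<forall>y\<in>S. dirder u f y = f' y" "g' \<in> smooth_algebra S" "\<forall>y\<in>S. dirder u g y = g' y"
        using mult.IH by meson
      then show ?thesis
        using mult.hyps by (intro bexI[of _ "\<lambda>y. f y * g' y + f' y * g y"]) (auto simp: D intro: smooth_algebra.intros)
    qed
    then show ?case using mult.IH by (auto intro: differentiable_mult)
  next
    case (inverse f)
    have D: "((\<lambda>y. inverse (f y)) has_derivative (\<lambda>u. - (inverse (f y) * dirder u f y * inverse (f y)))) (at y)" if "y \<in> S" for y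
      using inverse that by (intro Deriv.has_derivative_inverse) (auto simp: frechet_derivative_works)
    have "\<exists>h'\<in>smooth_algebra S. \<forall>y\<in>S. dirder u (\<lambda>y. inverse (f y)) y = h' y" for u
    proof -
      obtain f' where f': "f' \<in> smooth_algebra S" "\<forall>y\<in>S. dirder u f y = f' y"
        using inverse.IH by meson
      have "(\<lambda>y. (-1) * (inverse (f y) * f' y * inverse (f y))) \<in> smooth_algebra S"
        using f'(1) inverse.hyps by (intro smooth_algebra.mult smooth_algebra.const smooth_algebra.inverse) auto
      then show ?thesis
        using f'(2) by (intro bexI[rotated]) (auto simp: dirder_eq[OF D])
    qed
    then show ?case using D by (auto simp: differentiable_def)
  qed
  show ?thesis
    by (rule smooth_on_set_coinduct[OF assms]) (use * in auto)
qed

lemma smooth_on_set_add: "smooth_on_set f S \<Longrightarrow> smooth_on_set g S \<Longrightarrow> smooth_on_set (\<lambda>y. f y + g y) S"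
  by (rule smooth_algebra_smooth[OF smooth_on_set_open smooth_algebra.add[OF smooth_algebra.base smooth_algebra.base]])

lemma smooth_on_set_mult: "smooth_on_set f S \<Longrightarrow> smooth_on_set g S \<Longrightarrow> smooth_on_set (\<lambda>y. f y * g y) S"
  by (rule smooth_algebra_smooth[OF smooth_on_set_open smooth_algebra.mult[OF smooth_algebra.base smooth_algebra.base]])

lemma smooth_on_set_const: "open S \<Longrightarrow> smooth_on_set (\<lambda>y. c) S"
  by (rule smooth_algebra_smooth[OF _ smooth_algebra.const])

lemma smooth_on_set_inverse:
  "smooth_on_set f S \<Longrightarrow> (\<And>y. y \<in> S \<Longrightarrow> f y \<noteq> 0) \<Longrightarrow> smooth_on_set (\<lambda>y. inverse (f y)) S"
  by (rule smooth_algebra_smooth[OF smooth_on_set_open smooth_algebra.inverse[OF smooth_algebra.base]])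

lemma smooth_on_set_line_derivative:
  assumes "smooth_on_set f S" "p + s *\<^sub>R u \<in> S"
  shows "((\<lambda>s. f (p + s *\<^sub>R u)) has_real_derivative dirder u f (p + s *\<^sub>R u)) (at s)"
proof -
  have "((\<lambda>s. p + s *\<^sub>R u) has_derivative (\<lambda>s. s *\<^sub>R u)) (at s)"
    using has_derivative_add[OF has_derivative_const has_derivative_scaleR_left[OF has_derivative_ident]] by simp
  then have "((\<lambda>s. f (p + s *\<^sub>R u)) has_derivative (\<lambda>t. dirder (t *\<^sub>R u) f (p + s *\<^sub>R u))) (at s)"
    by (rule has_derivative_compose) (rule smooth_on_set_has_derivative[OF assms])
  moreover have "(\<lambda>t. dirder (t *\<^sub>R u) f (p + s *\<^sub>R u)) = (\<lambda>t. t * dirder u f (p + s *\<^sub>R u))"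
    using linear_scale[OF dirder_linear[OF smooth_on_set_differentiable[OF assms]]] by auto
  ultimately show ?thesis
    by (simp add: has_field_derivative_def mult_commute_abs)
qed

text \<open>The second difference is symmetric in u and v. Two applications of the mean value
  theorem express it through either mixed derivative, so that small h forces the two to
  agree.\<close>

lemma second_difference_mvt:
  assumes f: "smooth_on_set f S" and h: "0 < h"
    and S: "\<And>s t. 0 \<le> s \<Longrightarrow> s \<le> h \<Longrightarrow> 0 \<le> t \<Longrightarrow> t \<le> h \<Longrightarrow> y + s *\<^sub>R u + t *\<^sub>R v \<in> S"
  shows "\<exists>s t. 0 < s \<and> s < h \<and> 0 < t \<and> t < h \<and>
    f (y + h *\<^sub>R u + h *\<^sub>R v) - f (y + h *\<^sub>R u) - f (y + h *\<^sub>R v) + f y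
      = h * h * dirder v (dirder u f) (y + s *\<^sub>R u + t *\<^sub>R v)"
proof -
  define \<phi> where "\<phi> = (\<lambda>s. f ((y + h *\<^sub>R v) + s *\<^sub>R u) - f (y + s *\<^sub>R u))"
  have "\<exists>s. 0 < s \<and> s < h \<and> \<phi> h - \<phi> 0 = (h - 0) * (dirder u f ((y + h *\<^sub>R v) + s *\<^sub>R u) - dirder u f (y + s *\<^sub>R u))"
    unfolding \<phi>_def
    using h S[of _ h] S[of _ 0]
    by (intro MVT2 derivative_intros smooth_on_set_line_derivative[OF f]) (auto simp: add_ac)
  then obtain s where s: "0 < s" "s < h" "\<phi> h - \<phi> 0 = h * (dirder u f ((y + h *\<^sub>R v) + s *\<^sub>R u) - dirder u f (y + s *\<^sub>R u))"
    by auto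
  have "\<exists>t. 0 < t \<and> t < h \<and> dirder u f ((y + s *\<^sub>R u) + h *\<^sub>R v) - dirder u f ((y + s *\<^sub>R u) + 0 *\<^sub>R v)
      = (h - 0) * dirder v (dirder u f) ((y + s *\<^sub>R u) + t *\<^sub>R v)"
    using h S[of s] s
    by (intro MVT2[of 0 h "\<lambda>t. dirder u f ((y + s *\<^sub>R u) + t *\<^sub>R v)"] smooth_on_set_line_derivative[OF smooth_on_set_dirder[OF f]]) auto
  then obtain t where t: "0 < t" "t < h" "dirder u f ((y + s *\<^sub>R u) + h *\<^sub>R v) - dirder u f (y + s *\<^sub>R u)
      = h * dirder v (dirder u f) (y + s *\<^sub>R u + t *\<^sub>R v)"
    by auto
  have swap: "(y + h *\<^sub>R v) + s *\<^sub>R u = (y + s *\<^sub>R u) + h *\<^sub>R v" by simp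
  have "\<phi> h - \<phi> 0 = h * h * dirder v (dirder u f) (y + s *\<^sub>R u + t *\<^sub>R v)"
    using s(3) t(3) unfolding swap by simp
  then show ?thesis
    using s(1,2) t(1,2) by (intro exI[of _ s] exI[of _ t]) (simp add: \<phi>_def add_ac)
qed

lemma dirder_commute:
  assumes f: "smooth_on_set f S" and y: "y \<in> S"
  shows "dirder v (dirder u f) y = dirder u (dirder v f) y"
proof (rule ccontr)
  let ?A = "dirder v (dirder u f)" and ?B = "dirder u (dirder v f)"
  assume ne: "?A y \<noteq> ?B y"
  define e where "e = \<bar>?A y - ?B y\<bar> / 2"
  have e: "0 < e" using ne by (simp add: e_def)
  have "isCont ?A y" "isCont ?B y"
    using f y by (auto intro!: smooth_on_set_isCont smooth_on_set_dirder)
  then obtain d1 d2 where d: "0 < d1" "\<And>x. dist x y < d1 \<Longrightarrow> dist (?A x) (?A y) < e"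
    "0 < d2" "\<And>x. dist x y < d2 \<Longrightarrow> dist (?B x) (?B y) < e"
    using e unfolding continuous_at_eps_delta by metis
  obtain d3 where d3: "0 < d3" "\<And>x. dist x y < d3 \<Longrightarrow> x \<in> S"
    using smooth_on_set_open[OF f] y unfolding open_dist by metis
  define d where "d = min d1 (min d2 d3)"
  define h where "h = d / (2 * (norm u + norm v + 1))"
  have dpos: "0 < d" using d d3 by (simp add: d_def)
  have hpos: "0 < h" using dpos by (simp add: h_def pos_add_strict add_nonneg_pos)
  have near: "dist (y + s *\<^sub>R u + t *\<^sub>R v) y < d" if "0 \<le> s" "s \<le> h" "0 \<le> t" "t \<le> h" for s t
  proof -
    have "dist (y + s *\<^sub>R u + t *\<^sub>R v) y \<le> s * norm u + t * norm v"
      using norm_triangle_ineq[of "s *\<^sub>R u" "t *\<^sub>R v"] that by (simp add: dist_norm add.assoc)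
    also have "\<dots> \<le> h * norm u + h * norm v" using that by (intro add_mono mult_right_mono) auto
    also have "\<dots> < d"
    proof -
      have "h * (norm u + norm v) \<le> h * (norm u + norm v + 1)" using hpos by simp
      also have "\<dots> = d / 2"
        using norm_ge_zero[of u] norm_ge_zero[of v] by (simp add: h_def field_simps add_nonneg_eq_0_iff)
      finally show ?thesis using dpos by (simp add: algebra_simps)
    qed
    finally show ?thesis .
  qed
  have inS: "y + s *\<^sub>R u + t *\<^sub>R v \<in> S" "y + s *\<^sub>R v + t *\<^sub>R u \<in> S" if "0 \<le> s" "s \<le> h" "0 \<le> t" "t \<le> h" for s t
    using near[of s t] near[of t s] that d3(2) by (auto simp: d_def add_ac)
  obtain s t where st: "0 < s" "s < h" "0 < t" "t < h"
      "f (y + h *\<^sub>R u + h *\<^sub>R v) - f (y + h *\<^sub>R u) - f (y + h *\<^sub>R v) + f y = h * h * ?A (y + s *\<^sub>R u + t *\<^sub>R v)"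
    using second_difference_mvt[OF f hpos inS(1)] by blast
  obtain s' t' where st': "0 < s'" "s' < h" "0 < t'" "t' < h"
      "f (y + h *\<^sub>R v + h *\<^sub>R u) - f (y + h *\<^sub>R v) - f (y + h *\<^sub>R u) + f y = h * h * ?B (y + s' *\<^sub>R v + t' *\<^sub>R u)"
    using second_difference_mvt[OF f hpos inS(2)] by blast
  have "h * h * ?A (y + s *\<^sub>R u + t *\<^sub>R v) = h * h * ?B (y + s' *\<^sub>R v + t' *\<^sub>R u)"
  proof -
    have "y + h *\<^sub>R v + h *\<^sub>R u = y + h *\<^sub>R u + h *\<^sub>R v" by simp
    then show ?thesis using st(5) st'(5) by (simp only:)
  qed
  then have eq: "?A (y + s *\<^sub>R u + t *\<^sub>R v) = ?B (y + s' *\<^sub>R v + t' *\<^sub>R u)" using hpos by simp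
  have "dist (?A (y + s *\<^sub>R u + t *\<^sub>R v)) (?A y) < e"
    using near[of s t] st by (intro d) (auto simp: d_def)
  moreover have "dist (?B (y + s' *\<^sub>R v + t' *\<^sub>R u)) (?B y) < e"
    using near[of t' s'] st' by (intro d) (auto simp: d_def add_ac)
  ultimately have "\<bar>?A y - ?B y\<bar> < 2 * e" using eq by (simp add: dist_real_def)
  then show False by (simp add: e_def)
qed

section \<open>Homogeneity, convexity and the unit ball of a Minkowski norm\<close>

locale minkowski =
  fixes F :: "real^'n \<Rightarrow> real"
  assumes minkowski_norm: "minkowski_norm F"
begin

abbreviation U :: "(real^'n) set" where "U \<equiv> UNIV - {0}"
abbreviation q :: "real^'n \<Rightarrow> real" where "q \<equiv> (\<lambda>x. (F x)\<^sup>2)"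

lemma F_nonneg: "0 \<le> F y" and smooth_F: "smooth_on_set F U"
  and F_scale_pos: "0 < c \<Longrightarrow> F (c *\<^sub>R y) = c * F y"
  and fund_g_pos: "y \<noteq> 0 \<Longrightarrow> u \<noteq> 0 \<Longrightarrow> 0 < fund_g F y u u"
  using minkowski_norm by (auto simp: minkowski_norm_def)

lemma F_zero [simp]: "F 0 = 0"
  using F_scale_pos[of 2 0] by simp

lemma F_scale: "0 \<le> c \<Longrightarrow> F (c *\<^sub>R y) = c * F y"
  using F_scale_pos[of c y] by (cases "c = 0") auto

lemma smooth_q: "smooth_on_set q U"
  using smooth_on_set_mult[OF smooth_F smooth_F] by (simp add: power2_eq_square)

lemma fund_g_dirder: "fund_g F y u v = (1/2) * dirder v (dirder u q) y"
  by (simp add: fund_g_def)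

lemma dF_dirder: "dF F y u = dirder u F y"
  by (simp add: dF_def)

lemma linear_dF: "y \<noteq> 0 \<Longrightarrow> linear (dF F y)"
  using dirder_linear[OF smooth_on_set_differentiable[OF smooth_F]] by (auto simp: dF_def[abs_def])

lemma F_has_derivative: "y \<noteq> 0 \<Longrightarrow> (F has_derivative dF F y) (at y)"
  using smooth_on_set_has_derivative[OF smooth_F] by (auto simp: dF_def[abs_def])

lemma dF_scale:
  assumes "0 < c" "y \<noteq> 0"
  shows "dF F (c *\<^sub>R y) u = dF F y u"
proof -
  have "((\<lambda>x. F (c *\<^sub>R x)) has_derivative (\<lambda>u. dF F (c *\<^sub>R y) (c *\<^sub>R u))) (at y)"
    using assms by (intro has_derivative_compose[where f="\<lambda>x. c *\<^sub>R x", OF has_derivative_scaleR_right[OF has_derivative_ident]] F_has_derivative) auto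
  moreover have "((\<lambda>x. F (c *\<^sub>R x)) has_derivative (\<lambda>u. c * dF F y u)) (at y)"
    using F_has_derivative[OF assms(2)] by (simp add: F_scale_pos[OF assms(1)] has_derivative_mult_right)
  ultimately have "dF F (c *\<^sub>R y) (c *\<^sub>R u) = c * dF F y u"
    using has_derivative_unique by metis
  then show ?thesis
    using assms linear_scale[OF linear_dF, of "c *\<^sub>R y" c u] by simp
qed

lemma dF_self: "y \<noteq> 0 \<Longrightarrow> dF F y y = F y"
proof -
  assume y: "y \<noteq> 0"
  have "((\<lambda>s. F (0 + s *\<^sub>R y)) has_real_derivative dirder y F (0 + 1 *\<^sub>R y)) (at 1)"
    using y by (intro smooth_on_set_line_derivative[OF smooth_F]) auto
  then have "((\<lambda>s. F (s *\<^sub>R y)) has_real_derivative dF F y y) (at 1)" by (simp add: dF_dirder)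
  moreover have "((\<lambda>s. F (s *\<^sub>R y)) has_real_derivative F y) (at 1)"
  proof (rule has_field_derivative_transform_within_open)
    show "((\<lambda>s. s * F y) has_real_derivative F y) (at 1)" by (auto intro!: derivative_eq_intros)
    show "open {0::real<..}" "(1::real) \<in> {0<..}" by auto
  qed (simp add: F_scale_pos)
  ultimately show ?thesis using DERIV_unique by blast
qed

lemma dirder_q: "y \<noteq> 0 \<Longrightarrow> dirder u q y = 2 * F y * dF F y u"
proof -
  assume y: "y \<noteq> 0"
  have "(q has_derivative (\<lambda>u. 2 * F y * dF F y u)) (at y)"
    using F_has_derivative[OF y] by (auto intro!: derivative_eq_intros)
  then show ?thesis by (rule dirder_eq)
qed

lemma smooth_dF: "smooth_on_set (\<lambda>y. dF F y u) U"
  using smooth_on_set_dirder[OF smooth_F] by (simp add: dF_dirder)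

lemma fund_g_dF:
  assumes "y \<noteq> 0"
  shows "fund_g F y u v = dF F y u * dF F y v + F y * dirder v (\<lambda>x. dF F x u) y"
proof -
  have "dirder v (dirder u q) y = dirder v (\<lambda>x. 2 * F x * dF F x u) y"
    using assms by (intro dirder_cong_open(1)[where S=U]) (auto simp: dirder_q)
  also have "\<dots> = 2 * (F y * dirder v (\<lambda>x. dF F x u) y + dF F y v * dF F y u)"
  proof -
    have "((\<lambda>x. 2 * F x * dF F x u) has_derivative (\<lambda>v. 2 * F y * dirder v (\<lambda>x. dF F x u) y + (2 * dF F y v) * dF F y u)) (at y)"
      using assms by (intro has_derivative_mult F_has_derivative smooth_on_set_has_derivative[OF smooth_dF] has_derivative_mult_right) auto
    then show ?thesis by (simp add: dirder_eq algebra_simps)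
  qed
  finally show ?thesis by (simp add: fund_g_dirder algebra_simps)
qed

lemma fund_g_commute: "y \<noteq> 0 \<Longrightarrow> fund_g F y u v = fund_g F y v u"
  using dirder_commute[OF smooth_q] by (simp add: fund_g_dirder)

lemma linear_fund_g_right: "y \<noteq> 0 \<Longrightarrow> linear (fund_g F y u)"
proof -
  assume "y \<noteq> 0"
  then have "linear (\<lambda>v. dirder v (dirder u q) y)"
    by (intro dirder_linear smooth_on_set_differentiable[OF smooth_on_set_dirder[OF smooth_q]]) auto
  then have "linear (\<lambda>v. (1/2) *\<^sub>R dirder v (dirder u q) y)" by (rule linear_compose_scale_right)
  then show ?thesis by (simp add: fund_g_dirder[abs_def])
qed

lemma linear_fund_g_left: "y \<noteq> 0 \<Longrightarrow> linear (\<lambda>u. fund_g F y u v)"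
proof -
  assume y: "y \<noteq> 0"
  have "(\<lambda>u. fund_g F y u v) = fund_g F y v" using fund_g_commute[OF y] by blast
  then show ?thesis using linear_fund_g_right[OF y] by simp
qed

text \<open>By homogeneity of degree 0, dF is constant along the ray through y.\<close>

lemma dirder_dF_self:
  assumes "y \<noteq> 0"
  shows "dirder y (\<lambda>x. dF F x u) y = 0"
proof -
  have "((\<lambda>s. dF F (0 + s *\<^sub>R y) u) has_real_derivative dirder y (\<lambda>x. dF F x u) (0 + 1 *\<^sub>R y)) (at 1)"
    using assms by (intro smooth_on_set_line_derivative[OF smooth_dF]) auto
  then have "((\<lambda>s. dF F (s *\<^sub>R y) u) has_real_derivative dirder y (\<lambda>x. dF F x u) y) (at 1)" by simp
  moreover have "((\<lambda>s. dF F (s *\<^sub>R y) u) has_real_derivative 0) (at 1)"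
  proof (rule has_field_derivative_transform_within_open)
    show "((\<lambda>s. dF F y u) has_real_derivative 0) (at 1)" by auto
    show "open {0::real<..}" "(1::real) \<in> {0<..}" by auto
  qed (use assms in \<open>simp add: dF_scale\<close>)
  ultimately show ?thesis using DERIV_unique by blast
qed

lemma fund_g_self: "y \<noteq> 0 \<Longrightarrow> fund_g F y u y = F y * dF F y u"
  by (simp add: fund_g_dF dirder_dF_self dF_self)

lemma F_pos: "y \<noteq> 0 \<Longrightarrow> 0 < F y"
proof -
  assume y: "y \<noteq> 0"
  then have "0 < F y * F y" using fund_g_pos[of y y] by (simp add: fund_g_self dF_self)
  then show ?thesis using F_nonneg[of y] by (cases "F y = 0") auto
qed

lemma fund_g_scale:
  assumes "0 < c" "y \<noteq> 0"
  shows "fund_g F (c *\<^sub>R y) u v = fund_g F y u v"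
proof -
  let ?h = "\<lambda>x. dF F x u"
  have "((\<lambda>x. ?h (c *\<^sub>R x)) has_derivative (\<lambda>v. dirder (c *\<^sub>R v) ?h (c *\<^sub>R y))) (at y)"
    using assms by (intro has_derivative_compose[where f="\<lambda>x. c *\<^sub>R x", OF has_derivative_scaleR_right[OF has_derivative_ident]] smooth_on_set_has_derivative[OF smooth_dF]) auto
  then have "dirder v (\<lambda>x. ?h (c *\<^sub>R x)) y = dirder (c *\<^sub>R v) ?h (c *\<^sub>R y)" by (rule dirder_eq)
  also have "dirder v (\<lambda>x. ?h (c *\<^sub>R x)) y = dirder v ?h y"
    using assms by (intro dirder_cong_open(1)[where S=U]) (auto simp: dF_scale)
  also have "dirder (c *\<^sub>R v) ?h (c *\<^sub>R y) = c * dirder v ?h (c *\<^sub>R y)"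
    using assms linear_scale[OF dirder_linear[OF smooth_on_set_differentiable[OF smooth_dF]], of "c *\<^sub>R y"] by auto
  finally show ?thesis using assms by (simp add: fund_g_dF dF_scale F_scale_pos)
qed

text \<open>The mean value theorem is applied twice along the segment, with g as second derivative.
  The segment has to avoid the origin, off which alone F is smooth.\<close>

lemma q_strict_convex:
  assumes ne: "x \<noteq> y" and seg: "\<And>t. 0 \<le> t \<Longrightarrow> t \<le> 1 \<Longrightarrow> x + t *\<^sub>R (y - x) \<noteq> 0"
  shows "q x + dirder (y - x) q x < q y"
proof -
  let ?d = "y - x"
  have "\<exists>s. 0 < s \<and> s < 1 \<and> q (x + 1 *\<^sub>R ?d) - q (x + 0 *\<^sub>R ?d) = (1 - 0) * dirder ?d q (x + s *\<^sub>R ?d)"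
    using seg by (intro MVT2[of 0 1 "\<lambda>s. q (x + s *\<^sub>R ?d)"] smooth_on_set_line_derivative[OF smooth_q]) auto
  then obtain s where s: "0 < s" "s < 1" "q y - q x = dirder ?d q (x + s *\<^sub>R ?d)" by auto
  have "\<exists>r. 0 < r \<and> r < s \<and> dirder ?d q (x + s *\<^sub>R ?d) - dirder ?d q (x + 0 *\<^sub>R ?d) = (s - 0) * dirder ?d (dirder ?d q) (x + r *\<^sub>R ?d)"
    using seg s by (intro MVT2[of 0 s "\<lambda>s. dirder ?d q (x + s *\<^sub>R ?d)"] smooth_on_set_line_derivative[OF smooth_on_set_dirder[OF smooth_q]]) auto
  then obtain r where r: "0 < r" "r < s" "dirder ?d q (x + s *\<^sub>R ?d) - dirder ?d q x = s * (2 * fund_g F (x + r *\<^sub>R ?d) ?d ?d)"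
    by (auto simp: fund_g_dirder)
  have "0 < fund_g F (x + r *\<^sub>R ?d) ?d ?d" using seg[of r] r s ne by (intro fund_g_pos) auto
  then show ?thesis using r s by (smt (verit) mult_pos_pos)
qed

text \<open>The fundamental inequality. After y is scaled to the level of x, strict convexity of F^2
  makes the derivative at x towards y negative; linear independence keeps the segment between them
  away from the origin.\<close>

lemma dF_less:
  assumes x: "x \<noteq> 0" and np: "\<nexists>c. y = c *\<^sub>R x"
  shows "dF F x y < F y"
proof -
  have y: "y \<noteq> 0" using np by (metis scaleR_zero_left)
  define c where "c = F x / F y"
  have c: "0 < c" using F_pos x y by (simp add: c_def)
  define y' where "y' = c *\<^sub>R y"
  have np': "y' \<noteq> a *\<^sub>R x" for a
  proof
    assume "y' = a *\<^sub>R x"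
    then have "y = (a / c) *\<^sub>R x" using c by (simp add: y'_def vector_fraction_eq_iff divide_inverse_commute) (metis (no_types) scaleR_scaleR inverse_eq_divide right_inverse scaleR_one less_irrefl mult.commute)
    then show False using np by blast
  qed
  have Fy': "F y' = F x" using c F_pos[OF y] by (simp add: y'_def F_scale_pos c_def)
  have "q x + dirder (y' - x) q x < q y'"
  proof (rule q_strict_convex)
    show "x \<noteq> y'" using np'[of 1] by auto
    fix t :: real assume t: "0 \<le> t" "t \<le> 1"
    show "x + t *\<^sub>R (y' - x) \<noteq> 0"
    proof
      assume eq: "x + t *\<^sub>R (y' - x) = 0"
      then have "t \<noteq> 0" using x by auto
      have "t *\<^sub>R y' = (t - 1) *\<^sub>R x" using eq by (simp add: algebra_simps)
      then have "y' = ((t - 1) / t) *\<^sub>R x"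
        using \<open>t \<noteq> 0\<close> by (metis divide_inverse_commute scaleR_one scaleR_scaleR left_inverse)
      then show False using np' by blast
    qed
  qed
  then have "2 * F x * dF F x (y' - x) < 0" by (simp add: Fy' dirder_q[OF x])
  then have "dF F x (y' - x) < 0" using F_pos[OF x] by (simp add: mult_less_0_iff)
  then have "c * dF F x y < F x"
    using linear_dF[OF x] by (simp add: y'_def linear_diff linear_scale dF_self[OF x])
  then show ?thesis using c F_pos[OF x] F_pos[OF y] by (simp add: c_def field_simps)
qed

lemma dF_le: "x \<noteq> 0 \<Longrightarrow> dF F x y \<le> F y"
proof (cases "\<exists>c. y = c *\<^sub>R x")
  case True
  assume x: "x \<noteq> 0"
  from True obtain c where c: "y = c *\<^sub>R x" by blast
  then have "dF F x y = c * F x" using linear_dF[OF x] by (simp add: linear_scale dF_self[OF x])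
  moreover have "c * F x \<le> F y"
  proof (cases "0 \<le> c")
    case False
    then have "c * F x \<le> 0" using F_nonneg[of x] by (simp add: mult_nonpos_nonneg)
    then show ?thesis using F_nonneg[of y] by linarith
  qed (simp add: c F_scale)
  ultimately show ?thesis by simp
qed (use dF_less in \<open>force intro: less_imp_le\<close>)

lemma dF_eq_imp:
  assumes "x \<noteq> 0" "dF F x y = F y"
  shows "\<exists>c\<ge>0. y = c *\<^sub>R x"
proof -
  obtain c where c: "y = c *\<^sub>R x" using dF_less[OF assms(1), of y] assms(2) by force
  then have "c * F x = F y" using assms linear_dF[OF assms(1)] by (simp add: linear_scale dF_self)
  then have "0 \<le> c" using F_pos[OF assms(1)] F_nonneg[of y] by (metis mult_neg_pos not_le order.strict_trans2 less_irrefl)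
  then show ?thesis using c by blast
qed

text \<open>The differential of F at x + y is a linear functional below F that agrees with F at x +
  y.\<close>

lemma F_triangle: "F (x + y) \<le> F x + F y"
proof (cases "x + y = 0")
  case False
  then have "F (x + y) = dF F (x + y) x + dF F (x + y) y"
    using dF_self[OF False] linear_dF[OF False] by (metis linear_add)
  then show ?thesis using dF_le[OF False, of x] dF_le[OF False, of y] by linarith
qed (simp add: F_nonneg)

lemma F_bounds: "\<exists>m M. 0 < m \<and> 0 < M \<and> (\<forall>y. m * norm y \<le> F y \<and> F y \<le> M * norm y)"
proof -
  let ?S = "sphere (0::real^'n) 1"
  have cont: "continuous_on ?S F"
    by (rule continuous_on_subset[OF smooth_on_set_continuous_on[OF smooth_F]]) auto
  have ne: "?S \<noteq> {}" by simp
  obtain a where a: "a \<in> ?S" "\<And>y. y \<in> ?S \<Longrightarrow> F a \<le> F y"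
    using continuous_attains_inf[OF compact_sphere ne cont] by blast
  obtain b where b: "b \<in> ?S" "\<And>y. y \<in> ?S \<Longrightarrow> F y \<le> F b"
    using continuous_attains_sup[OF compact_sphere ne cont] by blast
  have "F a * norm y \<le> F y \<and> F y \<le> F b * norm y" for y
  proof (cases "y = 0")
    case False
    have "F y = norm y * F ((1 / norm y) *\<^sub>R y)" using False by (simp add: F_scale)
    moreover have "(1 / norm y) *\<^sub>R y \<in> ?S" using False by simp
    ultimately show ?thesis using a(2) b(2) by (metis mult.commute mult_left_mono norm_ge_zero)
  qed simp
  moreover have "0 < F a" "0 < F b" using a b by (auto intro!: F_pos)
  ultimately show ?thesis by blast
qed

lemma continuous_F: "continuous_on UNIV F"
proof (rule continuous_at_imp_continuous_on, rule ballI)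
  fix x :: "real^'n"
  show "isCont F x"
  proof (cases "x = 0")
    case True
    obtain M where M: "0 < M" "\<And>y. F y \<le> M * norm y" using F_bounds by blast
    have "(F \<longlongrightarrow> 0) (at 0)"
    proof (rule tendsto_sandwich[where f="\<lambda>_. 0" and h="\<lambda>y. M * norm y"])
      show "((\<lambda>y::real^'n. M * norm y) \<longlongrightarrow> 0) (at 0)" by (auto intro!: tendsto_eq_intros)
    qed (auto simp: F_nonneg M intro!: always_eventually)
    then show ?thesis using True by (simp add: isCont_def)
  qed (use smooth_on_set_isCont[OF smooth_F] in auto)
qed

lemma borel_F [measurable]: "F \<in> borel_measurable borel"
  by (intro borel_measurable_continuous_onI continuous_F)

definition K :: "(real^'n) set" where "K = {y. F y < 1}"

lemma open_K: "open K"
proof -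
  have "K = F -` {..<1}" by (auto simp: K_def)
  then show ?thesis using continuous_F by (simp add: open_vimage)
qed

lemma bounded_K: "bounded K"
proof -
  obtain m where m: "0 < m" "\<And>y. m * norm y \<le> F y" using F_bounds by blast
  have "norm y \<le> 1 / m" if "y \<in> K" for y
    using m(1) m(2)[of y] that by (simp add: K_def field_simps)
  then show ?thesis by (auto simp: bounded_iff)
qed

lemma borel_K [measurable]: "K \<in> sets borel"
  using open_K by simp

lemma emeasure_K: "emeasure lborel K = ennreal (measure lborel K)" "0 < measure lborel K"
proof -
  have fin: "emeasure lborel K < \<infinity>" using bounded_K by (rule emeasure_bounded_finite)
  then show "emeasure lborel K = ennreal (measure lborel K)"
    by (simp add: emeasure_eq_ennreal_measure less_top)
  have "emeasure lborel K \<noteq> 0"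
  proof
    assume "emeasure lborel K = 0"
    then have "K \<in> null_sets lborel" by auto
    then have "negligible K" by (simp add: negligible_iff_null_sets null_sets_completionI)
    moreover have "0 \<in> K" by (simp add: K_def)
    ultimately show False using open_not_negligible[OF open_K] by blast
  qed
  then show "0 < measure lborel K" using fin by (simp add: measure_def enn2real_positive_iff zero_less_iff_neq_zero)
qed

end

section \<open>Change of variables and Gaussian integrals\<close>

text \<open>The change of variables theorems of the library require a well-ordered index type.
  A copy of a finite type, ordered along an arbitrary enumeration, removes this restriction.\<close>

typedef 'a ordered_copy = "UNIV :: 'a set"
  by simp

lemma bij_Rep_ordered_copy: "bij Rep_ordered_copy"
  by (metis Abs_ordered_copy_inverse Rep_ordered_copy_inverse UNIV_I bij_iff)

lemma bij_Abs_ordered_copy: "bij Abs_ordered_copy"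
  by (metis Abs_ordered_copy_inverse Rep_ordered_copy_inverse UNIV_I bij_iff)

definition enum_ordered_copy :: "'a::finite ordered_copy \<Rightarrow> nat" where
  "enum_ordered_copy x = (SOME f :: 'a \<Rightarrow> nat. inj f) (Rep_ordered_copy x)"

lemma inj_enum_ordered_copy: "inj (enum_ordered_copy :: 'a::finite ordered_copy \<Rightarrow> nat)"
proof -
  have "\<exists>f :: 'a \<Rightarrow> nat. inj f"
    using finite_imp_inj_to_nat_seg[OF finite_class.finite_UNIV] by auto
  then have "inj (SOME f :: 'a \<Rightarrow> nat. inj f)" by (rule someI_ex)
  then have "x = y" if "enum_ordered_copy x = enum_ordered_copy y" for x y :: "'a ordered_copy"
    using that unfolding enum_ordered_copy_def by (meson Rep_ordered_copy_inject injD)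
  then show ?thesis by (intro injI)
qed

instance ordered_copy :: (finite) finite
proof
  have "(UNIV :: 'a ordered_copy set) = range Abs_ordered_copy"
    by (metis Rep_ordered_copy_inverse surjI)
  then show "finite (UNIV :: 'a ordered_copy set)" by (metis finite finite_imageI)
qed

instantiation ordered_copy :: (finite) wellorder
begin

definition less_eq_ordered_copy :: "'a ordered_copy \<Rightarrow> 'a ordered_copy \<Rightarrow> bool" where
  "less_eq_ordered_copy x y \<longleftrightarrow> enum_ordered_copy x \<le> enum_ordered_copy y"

definition less_ordered_copy :: "'a ordered_copy \<Rightarrow> 'a ordered_copy \<Rightarrow> bool" where
  "less_ordered_copy x y \<longleftrightarrow> enum_ordered_copy x < enum_ordered_copy y"

instance
proof
  fix P :: "'a ordered_copy \<Rightarrow> bool" and a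
  assume step: "\<And>x. (\<And>y. y < x \<Longrightarrow> P y) \<Longrightarrow> P x"
  show "P a"
  proof (induction a rule: measure_induct_rule[of enum_ordered_copy])
    case (less x)
    show ?case by (rule step, rule less) (simp add: less_ordered_copy_def)
  qed
next
  fix x y z :: "'a ordered_copy"
  show "x < y \<longleftrightarrow> x \<le> y \<and> \<not> y \<le> x" "x \<le> x" "x \<le> y \<Longrightarrow> y \<le> z \<Longrightarrow> x \<le> z" "x \<le> y \<or> y \<le> x"
    by (auto simp: less_eq_ordered_copy_def less_ordered_copy_def)
  show "x \<le> y \<Longrightarrow> y \<le> x \<Longrightarrow> x = y"
    unfolding less_eq_ordered_copy_def using injD[OF inj_enum_ordered_copy] by (metis antisym)
qed

end

definition relabel :: "real^'n \<Rightarrow> real^('n::finite ordered_copy)" where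
  "relabel x = (\<chi> i. x $ Rep_ordered_copy i)"

definition unlabel :: "real^('n::finite ordered_copy) \<Rightarrow> real^'n" where
  "unlabel x = (\<chi> i. x $ Abs_ordered_copy i)"

lemma unlabel_relabel [simp]: "unlabel (relabel x) = x" and relabel_unlabel [simp]: "relabel (unlabel y) = y"
  by (simp_all add: relabel_def unlabel_def vec_eq_iff Abs_ordered_copy_inverse Rep_ordered_copy_inverse)

lemma linear_relabel: "linear relabel" and linear_unlabel: "linear unlabel"
  by (auto simp: linear_iff relabel_def unlabel_def vec_eq_iff)

lemma bounded_linear_relabel: "bounded_linear relabel" and bounded_linear_unlabel: "bounded_linear unlabel"
  using linear_relabel linear_unlabel by (simp_all add: linear_conv_bounded_linear)

lemma borel_relabel [measurable]: "relabel \<in> borel_measurable borel" "unlabel \<in> borel_measurable borel"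
  by (intro borel_measurable_continuous_onI linear_continuous_on bounded_linear_relabel bounded_linear_unlabel)+

lemma lborel_relabel: "(lborel :: (real^('n::finite ordered_copy)) measure) = distr lborel borel relabel"
proof (rule lborel_eqI)
  fix l u :: "real^('n ordered_copy)"
  assume lu: "\<And>b. b \<in> Basis \<Longrightarrow> l \<bullet> b \<le> u \<bullet> b"
  have le: "l $ i \<le> u $ i" for i using lu[of "axis i 1"] by (simp add: axis_in_Basis_iff inner_axis)
  have "relabel -` box l u = box (unlabel l) (unlabel u)"
    by (auto simp: mem_box_cart relabel_def unlabel_def) (metis Abs_ordered_copy_inverse UNIV_I, metis Abs_ordered_copy_inverse UNIV_I, metis Rep_ordered_copy_inverse, metis Rep_ordered_copy_inverse)
  then have "emeasure (distr lborel borel relabel) (box l u) = emeasure lborel (box (unlabel l) (unlabel u))"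
    by (subst emeasure_distr) auto
  also have "\<dots> = ennreal (\<Prod>b\<in>Basis. (unlabel u - unlabel l) \<bullet> b)"
    using le by (intro emeasure_lborel_box) (auto simp: Basis_vec_def inner_axis unlabel_def)
  also have "(\<Prod>b\<in>Basis. (unlabel u - unlabel l) \<bullet> b) = (\<Prod>i\<in>UNIV. u $ Abs_ordered_copy i - l $ Abs_ordered_copy i)"
    by (simp add: Basis_vec_def UNION_singleton_eq_range prod.reindex inj_on_def axis_eq_axis inner_axis unlabel_def)
  also have "\<dots> = (\<Prod>i\<in>UNIV. u $ i - l $ i)"
    by (rule prod.reindex_bij_witness[of _ Rep_ordered_copy Abs_ordered_copy])
       (auto simp: Abs_ordered_copy_inverse Rep_ordered_copy_inverse)
  also have "\<dots> = (\<Prod>b\<in>Basis. (u - l) \<bullet> b)"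
    by (simp add: Basis_vec_def UNION_singleton_eq_range prod.reindex inj_on_def axis_eq_axis inner_axis)
  finally show "emeasure (distr lborel borel relabel) (box l u) = ennreal (\<Prod>b\<in>Basis. (u - l) \<bullet> b)" .
qed simp

text \<open>Induction over transpositions: conjugation by the relabelling turns the transposition of
  two indices into that of their copies.\<close>

lemma sign_relabel:
  fixes p :: "'n::finite \<Rightarrow> 'n"
  assumes "p permutes UNIV"
  shows "sign (Abs_ordered_copy \<circ> p \<circ> Rep_ordered_copy) = sign p"
  using assms finite_class.finite_UNIV
proof (induction rule: permutes_induct)
  case id
  have "Abs_ordered_copy \<circ> id \<circ> Rep_ordered_copy = (id :: 'n ordered_copy \<Rightarrow> _)"
    by (simp add: fun_eq_iff Rep_ordered_copy_inverse)
  then show ?case by (simp add: sign_id)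
next
  case (swap a b p)
  let ?c = "\<lambda>p. Abs_ordered_copy \<circ> p \<circ> Rep_ordered_copy :: 'n ordered_copy \<Rightarrow> _"
  have 1: "?c (Transposition.transpose a b \<circ> p) = Transposition.transpose (Abs_ordered_copy a) (Abs_ordered_copy b) \<circ> ?c p"
    by (auto simp: fun_eq_iff Transposition.transpose_def Abs_ordered_copy_inject)
  have "bij p" using swap by (simp add: permutes_bij)
  then have "bij (?c p)" by (intro bij_comp bij_Abs_ordered_copy bij_Rep_ordered_copy)
  then have "permutation (?c p)" "permutation p" using \<open>bij p\<close> by (simp_all add: permutation)
  then show ?case
    using swap unfolding 1
    by (subst (1 2) sign_compose) (auto simp: permutation_swap_id sign_swap_id Abs_ordered_copy_inject o_def)
qed

lemma det_relabel:
  fixes A :: "real^'n^'n"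
  shows "det (\<chi> i j. A $ Rep_ordered_copy i $ Rep_ordered_copy j :: real^('n ordered_copy)^('n ordered_copy)) = det A"
proof -
  let ?R = "Rep_ordered_copy :: 'n ordered_copy \<Rightarrow> 'n" and ?A = "Abs_ordered_copy :: 'n \<Rightarrow> 'n ordered_copy"
  have perm: "(?A \<circ> p \<circ> ?R) permutes UNIV" if "p permutes UNIV" for p
    using that by (intro bij_imp_permutes bij_comp bij_Abs_ordered_copy bij_Rep_ordered_copy) (auto simp: permutes_bij)
  have perm': "(?R \<circ> r \<circ> ?A) permutes UNIV" if "r permutes UNIV" for r
    using that by (intro bij_imp_permutes bij_comp bij_Abs_ordered_copy bij_Rep_ordered_copy) (auto simp: permutes_bij)
  have "det A = (\<Sum>p | p permutes UNIV. of_int (sign p) * (\<Prod>i\<in>UNIV. A $ i $ p i))"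
    by (simp add: det_def)
  also have "\<dots> = (\<Sum>r | r permutes UNIV. of_int (sign r) * (\<Prod>i\<in>UNIV. A $ ?R i $ ?R (r i)))"
  proof (rule sum.reindex_bij_witness[of _ "\<lambda>r. ?R \<circ> r \<circ> ?A" "\<lambda>p. ?A \<circ> p \<circ> ?R"])
    fix p :: "'n \<Rightarrow> 'n" assume p: "p \<in> {p. p permutes UNIV}"
    show "?R \<circ> (?A \<circ> p \<circ> ?R) \<circ> ?A = p" by (simp add: fun_eq_iff Abs_ordered_copy_inverse)
    show "?A \<circ> p \<circ> ?R \<in> {r. r permutes UNIV}" using p perm by simp
    have eq: "(\<Prod>i\<in>UNIV. A $ ?R i $ p (?R i)) = (\<Prod>i\<in>UNIV. A $ i $ p i)"
      by (rule prod.reindex_bij_witness[of _ ?A ?R])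
         (auto simp: Abs_ordered_copy_inverse Rep_ordered_copy_inverse)
    show "of_int (sign (?A \<circ> p \<circ> ?R)) * (\<Prod>i\<in>UNIV. A $ ?R i $ ?R ((?A \<circ> p \<circ> ?R) i)) = of_int (sign p) * (\<Prod>i\<in>UNIV. A $ i $ p i)"
    proof -
      have "?R ((?A \<circ> p \<circ> ?R) i) = p (?R i)" for i by (simp add: Abs_ordered_copy_inverse)
      then have "(\<Prod>i\<in>UNIV. A $ ?R i $ ?R ((?A \<circ> p \<circ> ?R) i)) = (\<Prod>i\<in>UNIV. A $ i $ p i)"
        by (simp only: eq)
      then show ?thesis using p by (simp only: sign_relabel mem_Collect_eq)
    qed
  next
    fix r :: "'n ordered_copy \<Rightarrow> 'n ordered_copy" assume r: "r \<in> {r. r permutes UNIV}"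
    show "?A \<circ> (?R \<circ> r \<circ> ?A) \<circ> ?R = r" by (simp add: fun_eq_iff Rep_ordered_copy_inverse)
    show "?R \<circ> r \<circ> ?A \<in> {p. p permutes UNIV}" using r perm' by simp
  qed
  finally show ?thesis by (simp add: det_def)
qed

lemma emeasure_differentiable_image_wellorder:
  fixes g :: "real^'m::{finite,wellorder} \<Rightarrow> real^'m::_"
  assumes T: "T \<in> sets borel" "g ` T \<in> sets borel"
    and der: "\<And>x. x \<in> T \<Longrightarrow> (g has_derivative g' x) (at x)" and inj: "inj_on g T"
    and meas: "(\<lambda>x. indicator T x * \<bar>det (matrix (g' x))\<bar>) \<in> borel_measurable borel"
  shows "emeasure lborel (g ` T) = (\<integral>\<^sup>+x. ennreal (indicator T x * \<bar>det (matrix (g' x))\<bar>) \<partial>lborel)"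
proof -
  let ?d = "\<lambda>x. indicator T x * \<bar>det (matrix (g' x))\<bar>"
  have key: "g ` T \<in> lmeasurable \<and> measure lebesgue (g ` T) = m \<longleftrightarrow> ((\<lambda>x. \<bar>det (matrix (g' x))\<bar>) has_integral m) T" for m
    using T(1) der inj by (intro has_measure_differentiable_image) (auto intro: has_derivative_at_withinI)
  have hi: "((\<lambda>x. \<bar>det (matrix (g' x))\<bar>) has_integral m) T \<longleftrightarrow> (?d has_integral m) UNIV" for m
  proof -
    have "?d = (\<lambda>x. if x \<in> T then \<bar>det (matrix (g' x))\<bar> else 0)" by (auto simp: indicator_def)
    then show ?thesis by (simp only: has_integral_restrict_UNIV)
  qed
  show ?thesis
  proof (cases "(\<integral>\<^sup>+x. ennreal (?d x) \<partial>lborel) < \<infinity>")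
    case True
    then obtain m where m: "(\<integral>\<^sup>+x. ennreal (?d x) \<partial>lborel) = ennreal m" "0 \<le> m"
      by (cases "\<integral>\<^sup>+x. ennreal (?d x) \<partial>lborel") auto
    have "(?d has_integral m) UNIV"
      using m meas by (intro nn_integral_has_integral) auto
    then have "g ` T \<in> lmeasurable" "measure lebesgue (g ` T) = m" using key hi by auto
    then have "emeasure lebesgue (g ` T) = ennreal m"
      by (metis emeasure_eq_measure2)
    then show ?thesis using m T(2) by simp
  next
    case False
    \<comment> \<open>The equivalence \<open>key\<close> speaks of finite values. If the integral is
      infinite, so is the measure of the image, because a finite measure would be the value of the
      integral.\<close>
    have "\<not> emeasure lborel (g ` T) < \<infinity>"
    proof
      assume fin: "emeasure lborel (g ` T) < \<infinity>"
      then have "g ` T \<in> lmeasurable" using T(2) by (auto simp: fmeasurable_def)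
      then have "(?d has_integral (measure lebesgue (g ` T))) UNIV" using key hi by blast
      then have "(\<integral>\<^sup>+x. ennreal (?d x) \<partial>lborel) = ennreal (measure lebesgue (g ` T))"
        using meas by (intro nn_integral_has_integral_lborel) auto
      then show False using False by simp
    qed
    then show ?thesis using False by (simp add: less_top[symmetric])
  qed
qed

lemma emeasure_differentiable_image:
  fixes g :: "real^'n \<Rightarrow> real^'n"
  assumes T: "T \<in> sets borel" "g ` T \<in> sets borel"
    and der: "\<And>x. x \<in> T \<Longrightarrow> (g has_derivative g' x) (at x)" and inj: "inj_on g T"
    and meas [measurable]: "(\<lambda>x. indicator T x * \<bar>det (matrix (g' x))\<bar>) \<in> borel_measurable borel"
  shows "emeasure lborel (g ` T) = (\<integral>\<^sup>+x. ennreal (indicator T x * \<bar>det (matrix (g' x))\<bar>) \<partial>lborel)"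
proof -
  define h where "h = relabel \<circ> g \<circ> unlabel"
  define h' where "h' = (\<lambda>x. relabel \<circ> g' (unlabel x) \<circ> unlabel)"
  have vim: "relabel ` S = unlabel -` S" for S :: "(real^'n) set"
    by (auto simp: image_iff) (metis relabel_unlabel)
  have vim': "relabel -` (relabel ` S) = S" for S :: "(real^'n) set"
    by (auto simp: image_iff) (metis unlabel_relabel)
  have bor: "relabel ` S \<in> sets borel" if "S \<in> sets borel" for S :: "(real^'n) set"
    unfolding vim by (rule measurable_sets_borel[OF borel_relabel(2) that])
  have hT: "h ` (relabel ` T) = relabel ` (g ` T)" by (auto simp: h_def image_iff)
  have det: "det (matrix (h' x)) = det (matrix (g' (unlabel x)))" if "linear (g' (unlabel x))" for x
  proof -
    have unl: "unlabel (axis j 1) = (axis (Rep_ordered_copy j) 1 :: real^'n)" for j :: "'n ordered_copy"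
      by (auto simp: unlabel_def axis_def vec_eq_iff Abs_ordered_copy_inverse Rep_ordered_copy_inverse)
    have "matrix (h' x) = (\<chi> i j. matrix (g' (unlabel x)) $ Rep_ordered_copy i $ Rep_ordered_copy j)"
      by (simp add: matrix_def h'_def relabel_def unl)
    then show ?thesis by (simp add: det_relabel)
  qed
  have D: "indicator (relabel ` T) x * \<bar>det (matrix (h' x))\<bar> = indicator T (unlabel x) * \<bar>det (matrix (g' (unlabel x)))\<bar>" for x
  proof (cases "unlabel x \<in> T")
    case True
    have "linear (g' (unlabel x))" using der[OF True] has_derivative_linear by blast
    then show ?thesis using True by (simp add: det vim)
  qed (simp add: vim)
  have "emeasure lborel (h ` (relabel ` T)) = (\<integral>\<^sup>+x. ennreal (indicator (relabel ` T) x * \<bar>det (matrix (h' x))\<bar>) \<partial>lborel)"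
  proof (rule emeasure_differentiable_image_wellorder)
    show "relabel ` T \<in> sets borel" "h ` (relabel ` T) \<in> sets borel"
      unfolding hT using T bor by auto
    show "inj_on h (relabel ` T)"
      using inj by (auto simp: inj_on_def h_def) (metis unlabel_relabel)
    show "(h has_derivative h' x) (at x)" if "x \<in> relabel ` T" for x
    proof -
      have "unlabel x \<in> T" using that vim by auto
      then show ?thesis
        unfolding h_def h'_def o_def
        by (intro has_derivative_compose[OF has_derivative_compose[OF bounded_linear_imp_has_derivative[OF bounded_linear_unlabel] der]
              bounded_linear_imp_has_derivative[OF bounded_linear_relabel]])
    qed
    have "(\<lambda>x. indicator T (unlabel x) * \<bar>det (matrix (g' (unlabel x)))\<bar>) \<in> borel_measurable borel"
      using measurable_compose[OF borel_relabel(2) meas] by simp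
    then show "(\<lambda>x. indicator (relabel ` T) x * \<bar>det (matrix (h' x))\<bar>) \<in> borel_measurable borel"
      by (simp add: D)
  qed
  also have "\<dots> = (\<integral>\<^sup>+x. ennreal (indicator T x * \<bar>det (matrix (g' x))\<bar>) \<partial>lborel)"
    unfolding D using meas by (subst lborel_relabel) (simp add: nn_integral_distr)
  also have "emeasure lborel (h ` (relabel ` T)) = emeasure lborel (g ` T)"
    unfolding hT using bor[OF T(2)] by (subst lborel_relabel) (simp add: emeasure_distr vim')
  finally show ?thesis .
qed

text \<open>The claim is an equality of measures: the density |det g'| on S is pushed forward to
  Lebesgue measure on the image. On a Borel set A it is the volume formula for the image of the part
  of S that g maps into A. Invariance of domain makes the image of S open, hence Borel.\<close>

lemma nn_integral_change_of_variables:
  fixes g :: "real^'n \<Rightarrow> real^'n"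
  assumes S: "open S" and inj: "inj_on g S"
    and der: "\<And>x. x \<in> S \<Longrightarrow> (g has_derivative g' x) (at x)"
    and contd: "continuous_on S (\<lambda>x. det (matrix (g' x)))"
    and [measurable]: "f \<in> borel_measurable borel"
  shows "open (g ` S)"
    and "(\<integral>\<^sup>+y. f y * indicator (g ` S) y \<partial>lborel) = (\<integral>\<^sup>+x. f (g x) * ennreal \<bar>det (matrix (g' x))\<bar> * indicator S x \<partial>lborel)"
proof -
  have contg: "continuous_on S g"
    using der by (meson continuous_at_imp_continuous_on has_derivative_continuous)
  show gS: "open (g ` S)" by (rule invariance_of_domain[OF contg S inj])
  have bS [measurable]: "S \<in> sets borel" "g ` S \<in> sets borel" using S gS by auto
  \<comment> \<open>Extension by 0 turns g and its Jacobian, which are continuous on S only, into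
    Borel functions on the whole space.\<close>
  define g0 where "g0 = (\<lambda>x. if x \<in> S then g x else 0)"
  define d where "d = (\<lambda>x. indicator S x * \<bar>det (matrix (g' x))\<bar>)"
  have [measurable]: "g0 \<in> borel_measurable borel"
    using borel_measurable_continuous_on_indicator[OF bS(1) contg]
    by (simp add: g0_def indicator_scaleR_eq_if)
  have [measurable]: "d \<in> borel_measurable borel"
    using borel_measurable_continuous_on_indicator[OF bS(1), of "\<lambda>x. \<bar>det (matrix (g' x))\<bar>"] contd
    by (simp add: d_def continuous_on_rabs)
  let ?M = "distr (density lborel (\<lambda>x. ennreal (d x))) borel g0" and ?N = "density lborel (indicator (g ` S))"
  have "?M = ?N"
  proof (rule measure_eqI)
    fix A assume "A \<in> sets ?M"
    then have [measurable]: "A \<in> sets borel" by simp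
    define T where "T = S \<inter> g0 -` A"
    have [measurable]: "T \<in> sets borel" unfolding T_def using measurable_sets_borel[of g0 borel A] by auto
    have gT: "g ` T = g ` S \<inter> A" by (auto simp: T_def g0_def)
    have dT: "indicator T x * \<bar>det (matrix (g' x))\<bar> = d x * indicator (g0 -` A) x" for x
      by (auto simp: d_def T_def indicator_def)
    have "emeasure lborel (g ` T) = (\<integral>\<^sup>+x. ennreal (indicator T x * \<bar>det (matrix (g' x))\<bar>) \<partial>lborel)"
    proof (rule emeasure_differentiable_image)
      show "(\<lambda>x. indicator T x * \<bar>det (matrix (g' x))\<bar>) \<in> borel_measurable borel"
        unfolding dT by measurable
      show "g ` T \<in> sets borel" unfolding gT by measurable
      show "inj_on g T" using inj by (rule inj_on_subset) (auto simp: T_def)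
    qed (auto simp: T_def intro: der)
    also have "\<dots> = (\<integral>\<^sup>+x. ennreal (d x) * indicator (g0 -` A) x \<partial>lborel)"
      unfolding dT by (intro nn_integral_cong) (auto simp: indicator_def)
    also have "\<dots> = emeasure ?M A"
    proof -
      have [measurable]: "g0 -` A \<in> sets borel" by (rule measurable_sets_borel[of g0 borel A]) auto
      show ?thesis by (subst emeasure_distr) (auto simp: emeasure_density)
    qed
    finally have 1: "emeasure ?M A = emeasure lborel (g ` T)" ..
    have "emeasure ?N A = (\<integral>\<^sup>+y. indicator (g ` S) y * indicator A y \<partial>lborel)"
      by (subst emeasure_density) auto
    also have "\<dots> = (\<integral>\<^sup>+y. indicator (g ` S \<inter> A) y \<partial>lborel)"
      by (intro nn_integral_cong) (auto simp: indicator_def)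
    also have "\<dots> = emeasure lborel (g ` T)" unfolding gT by (rule nn_integral_indicator) auto
    finally show "emeasure ?M A = emeasure ?N A" using 1 by simp
  qed simp
  have "(\<integral>\<^sup>+y. f y * indicator (g ` S) y \<partial>lborel) = (\<integral>\<^sup>+y. f y \<partial>?N)"
    by (simp add: nn_integral_density mult.commute)
  also have "\<dots> = (\<integral>\<^sup>+x. ennreal (d x) * f (g0 x) \<partial>lborel)"
    unfolding \<open>?M = ?N\<close>[symmetric] by (simp add: nn_integral_distr nn_integral_density)
  also have "\<dots> = (\<integral>\<^sup>+x. f (g x) * ennreal \<bar>det (matrix (g' x))\<bar> * indicator S x \<partial>lborel)"
    by (intro nn_integral_cong) (auto simp: d_def g0_def indicator_def mult.commute)
  finally show "(\<integral>\<^sup>+y. f y * indicator (g ` S) y \<partial>lborel) = (\<integral>\<^sup>+x. f (g x) * ennreal \<bar>det (matrix (g' x))\<bar> * indicator S x \<partial>lborel)" .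
qed

section \<open>Gaussian integrals of homogeneous functions\<close>

lemma nn_integral_gaussian_1d: "(\<integral>\<^sup>+s. ennreal (exp (- (s\<^sup>2 / 2))) \<partial>lborel) = ennreal (sqrt (2 * pi))"
proof -
  let ?g = "\<lambda>s::real. ennreal (exp (- (s\<^sup>2 / 2)))"
  have "(\<integral>\<^sup>+s. ?g s \<partial>lborel) = (\<integral>\<^sup>+s. ?g s * indicator {0<..} s + ?g s * indicator {..<0} s \<partial>lborel)"
    using AE_lborel_singleton[of 0] by (intro nn_integral_cong_AE) (auto elim!: eventually_mono simp: indicator_def)
  also have "\<dots> = (\<integral>\<^sup>+s. ?g s * indicator {0<..} s \<partial>lborel) + (\<integral>\<^sup>+s. ?g s * indicator {..<0} s \<partial>lborel)"
    by (intro nn_integral_add) auto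
  also have "(\<integral>\<^sup>+s. ?g s * indicator {..<0} s \<partial>lborel) = ennreal \<bar>-1\<bar> * (\<integral>\<^sup>+s. ?g (0 + (-1) * s) * indicator {..<0} (0 + (-1) * s) \<partial>lborel)"
    by (rule nn_integral_real_affine) auto
  also have "\<dots> = (\<integral>\<^sup>+s. ?g s * indicator {0<..} s \<partial>lborel)"
    by (simp add: indicator_def)
  finally have "(\<integral>\<^sup>+s. ?g s \<partial>lborel) = ennreal (sqrt (pi / 2) + sqrt (pi / 2))"
    by (simp add: nn_integral_half_gaussian ennreal_plus[symmetric] del: ennreal_plus)
  also have "sqrt (pi / 2) + sqrt (pi / 2) = sqrt (4 * (pi / 2))"
    unfolding real_sqrt_mult by simp
  finally show ?thesis by simp
qed

lemma nn_integral_gaussian: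
  "(\<integral>\<^sup>+x. ennreal (exp (- ((norm x)\<^sup>2 / 2))) \<partial>(lborel :: 'a::euclidean_space measure)) = ennreal (sqrt (2 * pi) ^ DIM('a))"
proof -
  have "(\<integral>\<^sup>+x. ennreal (exp (- ((norm x)\<^sup>2 / 2))) \<partial>subspace_lebesgue ks) = ennreal (sqrt (2 * pi) ^ length ks)"
    if "distinct ks" "set ks \<subseteq> Basis" for ks :: "'a list"
    using that
  proof (induction ks)
    case Nil
    then show ?case by (simp add: nn_integral_return)
  next
    case (Cons k ks)
    have AE: "AE x in subspace_lebesgue ks. x \<in> coord_subspace ks"
      using Cons.prems by (intro AE_coord_subspace) auto
    have *: "(\<integral>\<^sup>+s. ennreal (exp (- ((norm (x + s *\<^sub>R k))\<^sup>2 / 2))) \<partial>lborel) = ennreal (sqrt (2 * pi)) * ennreal (exp (- ((norm x)\<^sup>2 / 2)))"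
      if "x \<in> coord_subspace ks" for x
    proof -
      have "x \<bullet> k = 0" "k \<bullet> k = 1" using that Cons.prems by (auto simp: coord_subspace_def)
      then have "(norm (x + s *\<^sub>R k))\<^sup>2 = s\<^sup>2 + (norm x)\<^sup>2" for s
        unfolding power2_norm_eq_inner power2_eq_square[of s]
        by (simp add: inner_add_left inner_add_right inner_commute[of k x])
      then have "(\<integral>\<^sup>+s. ennreal (exp (- ((norm (x + s *\<^sub>R k))\<^sup>2 / 2))) \<partial>lborel)
          = (\<integral>\<^sup>+s. ennreal (exp (- (s\<^sup>2 / 2))) * ennreal (exp (- ((norm x)\<^sup>2 / 2))) \<partial>lborel)"
        by (simp add: add_divide_distrib exp_add[symmetric] ennreal_mult''[symmetric])
      then show ?thesis by (simp add: nn_integral_multc nn_integral_gaussian_1d)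
    qed
    have "(\<integral>\<^sup>+x. ennreal (exp (- ((norm x)\<^sup>2 / 2))) \<partial>subspace_lebesgue (k # ks))
        = (\<integral>\<^sup>+x. \<integral>\<^sup>+s. ennreal (exp (- ((norm (x + s *\<^sub>R k))\<^sup>2 / 2))) \<partial>lborel \<partial>subspace_lebesgue ks)"
      by (rule nn_integral_subspace_lebesgue_Cons) measurable
    also have "\<dots> = (\<integral>\<^sup>+x. ennreal (sqrt (2 * pi)) * ennreal (exp (- ((norm x)\<^sup>2 / 2))) \<partial>subspace_lebesgue ks)"
      by (rule nn_integral_cong_AE, rule eventually_mono[OF AE *])
    also have "\<dots> = ennreal (sqrt (2 * pi) ^ length (k # ks))"
      using Cons by (simp add: nn_integral_cmult ennreal_mult'')
    finally show ?case .
  qed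
  moreover obtain ks :: "'a list" where ks: "set ks = Basis" "distinct ks"
    using finite_distinct_list[OF finite_Basis] by blast
  ultimately show ?thesis
    using distinct_card[OF ks(2)] subspace_lebesgue_eq_lborel[OF ks(2,1)] ks by force
qed

text \<open>The value is 2^(m/2) Gamma (m/2 + 1). The integrand is kept as a product: t^m comes from
  scaling, and t * exp (- t^2 / 2) is minus the derivative of exp (- t^2 / 2).\<close>

definition radial_gaussian_moment :: "nat \<Rightarrow> ennreal" where
  "radial_gaussian_moment m = (\<integral>\<^sup>+t. ennreal (t ^ m * (t * exp (- (t\<^sup>2 / 2)))) * indicator {0<..} t \<partial>lborel)"

lemma radial_gaussian_moment_finite: "radial_gaussian_moment m < \<infinity>"
proof -
  have "integrable lborel (\<lambda>x. std_normal_density x * \<bar>x ^ Suc m\<bar>)"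
    using integrable_abs[OF integrable_std_normal_moment[of "Suc m"]] by (simp add: abs_mult)
  then have "integrable lborel (\<lambda>x. sqrt (2 * pi) * (std_normal_density x * \<bar>x ^ Suc m\<bar>))" by (rule integrable_mult_right)
  then have fin: "(\<integral>\<^sup>+x. ennreal (sqrt (2 * pi) * (std_normal_density x * \<bar>x ^ Suc m\<bar>)) \<partial>lborel) < \<infinity>"
    using integrableD(2) by (subst nn_integral_eq_integral) auto
  have "radial_gaussian_moment m \<le> (\<integral>\<^sup>+x. ennreal (sqrt (2 * pi) * (std_normal_density x * \<bar>x ^ Suc m\<bar>)) \<partial>lborel)"
    unfolding radial_gaussian_moment_def
    by (intro nn_integral_mono) (auto simp: indicator_def std_normal_density_def abs_mult mult_ac)
  then show ?thesis using fin by (rule le_less_trans)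
qed

lemma nn_integral_scale:
  fixes f :: "'a::euclidean_space \<Rightarrow> ennreal"
  assumes [measurable]: "f \<in> borel_measurable borel" and c: "0 < c"
  shows "(\<integral>\<^sup>+x. f x \<partial>lborel) = ennreal (c ^ DIM('a)) * (\<integral>\<^sup>+x. f (c *\<^sub>R x) \<partial>lborel)"
proof -
  have "(\<integral>\<^sup>+x. f x \<partial>lborel) = (\<integral>\<^sup>+x. f x \<partial>density (distr lborel borel (\<lambda>x. 0 + c *\<^sub>R x)) (\<lambda>_. \<bar>c\<bar> ^ DIM('a)))"
    using lborel_affine[of c "0::'a"] c by simp
  then show ?thesis using c by (simp add: nn_integral_density nn_integral_distr nn_integral_cmult)
qed

text \<open>The Gaussian exp (- G^2 / 2) is a superposition of indicators of the balls {G < t}, and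
  homogeneity reduces each ball to the unit ball. Gaussian integrals and integrals over {G < 1}
  therefore differ by a constant that depends on dimension and degree only, not on G.\<close>

lemma nn_integral_exp_homogeneous:
  fixes G :: "'a::euclidean_space \<Rightarrow> real" and k :: "'a \<Rightarrow> ennreal"
  assumes [measurable]: "G \<in> borel_measurable borel" "k \<in> borel_measurable borel"
    and G: "\<And>x. 0 \<le> G x" "\<And>c x. 0 < c \<Longrightarrow> G (c *\<^sub>R x) = c * G x"
    and k: "\<And>c x. 0 < c \<Longrightarrow> k (c *\<^sub>R x) = ennreal (c ^ d) * k x"
  shows "(\<integral>\<^sup>+x. ennreal (exp (- ((G x)\<^sup>2 / 2))) * k x \<partial>lborel)
    = radial_gaussian_moment (DIM('a) + d) * (\<integral>\<^sup>+x. k x * indicator {x. G x < 1} x \<partial>lborel)"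
proof -
  let ?e = "\<lambda>t::real. ennreal (t * exp (- (t\<^sup>2 / 2)))"
  have tail: "ennreal (exp (- (r\<^sup>2 / 2))) = (\<integral>\<^sup>+t. ?e t * indicator {r<..} t \<partial>lborel)" if "0 \<le> r" for r :: real
  proof -
    have "(\<integral>\<^sup>+t. ?e t * indicator {r..} t \<partial>lborel) = ennreal (0 - - exp (- (r\<^sup>2 / 2)))"
    proof (rule nn_integral_FTC_atLeast)
      fix t :: real assume "r \<le> t"
      show "((\<lambda>t. - exp (- (t\<^sup>2 / 2))) has_real_derivative t * exp (- (t\<^sup>2 / 2))) (at t)"
        by (auto intro!: derivative_eq_intros)
      show "0 \<le> t * exp (- (t\<^sup>2 / 2))" using that \<open>r \<le> t\<close> by simp
    next
      have "LIM t at_top. (t::real)\<^sup>2 / 2 :> at_top"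
        by (intro filterlim_tendsto_pos_mult_at_top[where c="1/2" and f="\<lambda>_. 1/2", simplified] filterlim_pow_at_top filterlim_ident tendsto_const) auto
      then have "((\<lambda>t::real. exp (- (t\<^sup>2 / 2))) \<longlongrightarrow> 0) at_top"
        by (intro filterlim_compose[OF exp_at_bot]) (simp add: filterlim_uminus_at_bot)
      then show "((\<lambda>t::real. - exp (- (t\<^sup>2 / 2))) \<longlongrightarrow> 0) at_top" using tendsto_minus by fastforce
    qed simp
    moreover have "(\<integral>\<^sup>+t. ?e t * indicator {r..} t \<partial>lborel) = (\<integral>\<^sup>+t. ?e t * indicator {r<..} t \<partial>lborel)"
      using AE_lborel_singleton[of r] by (intro nn_integral_cong_AE) (auto elim!: eventually_mono simp: indicator_def)
    ultimately show ?thesis by simp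
  qed
  have "(\<integral>\<^sup>+x. ennreal (exp (- ((G x)\<^sup>2 / 2))) * k x \<partial>lborel)
      = (\<integral>\<^sup>+x. \<integral>\<^sup>+t. ?e t * indicator {G x<..} t * k x \<partial>lborel \<partial>lborel)"
    using G by (intro nn_integral_cong) (simp add: tail nn_integral_multc)
  also have "\<dots> = (\<integral>\<^sup>+x. \<integral>\<^sup>+t. ?e t * indicator {p. G (fst p) < snd p} (x, t) * k x \<partial>lborel \<partial>lborel)"
    by (rule nn_integral_cong, rule nn_integral_cong) (auto simp: indicator_def)
  also have "\<dots> = (\<integral>\<^sup>+t. \<integral>\<^sup>+x. ?e t * indicator {p. G (fst p) < snd p} (x, t) * k x \<partial>lborel \<partial>lborel)"
    by (rule lborel_pair.Fubini'[symmetric]) measurable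
  also have "\<dots> = (\<integral>\<^sup>+t. ennreal (t ^ (DIM('a) + d) * (t * exp (- (t\<^sup>2 / 2)))) * indicator {0<..} t * (\<integral>\<^sup>+x. k x * indicator {x. G x < 1} x \<partial>lborel) \<partial>lborel)"
  proof (rule nn_integral_cong)
    fix t :: real
    show "(\<integral>\<^sup>+x. ?e t * indicator {p. G (fst p) < snd p} (x, t) * k x \<partial>lborel)
        = ennreal (t ^ (DIM('a) + d) * (t * exp (- (t\<^sup>2 / 2)))) * indicator {0<..} t * (\<integral>\<^sup>+x. k x * indicator {x. G x < 1} x \<partial>lborel)"
    proof (cases "0 < t")
      case False
      then have "\<not> G x < t" for x using G(1)[of x] by linarith
      then show ?thesis using False by simp
    next
      case True
      have "(\<integral>\<^sup>+x. ?e t * indicator {p. G (fst p) < snd p} (x, t) * k x \<partial>lborel) = ?e t * (\<integral>\<^sup>+x. k x * indicator {x. G x < t} x \<partial>lborel)"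
        by (subst nn_integral_cmult[symmetric]) (auto intro!: nn_integral_cong simp: indicator_def)
      also have "(\<integral>\<^sup>+x. k x * indicator {x. G x < t} x \<partial>lborel) = ennreal (t ^ DIM('a)) * (\<integral>\<^sup>+x. k (t *\<^sub>R x) * indicator {x. G x < t} (t *\<^sub>R x) \<partial>lborel)"
        using True by (intro nn_integral_scale) measurable
      also have "(\<integral>\<^sup>+x. k (t *\<^sub>R x) * indicator {x. G x < t} (t *\<^sub>R x) \<partial>lborel) = (\<integral>\<^sup>+x. ennreal (t ^ d) * (k x * indicator {x. G x < 1} x) \<partial>lborel)"
        using True G k by (intro nn_integral_cong) (auto simp: indicator_def)
      also have "\<dots> = ennreal (t ^ d) * (\<integral>\<^sup>+x. k x * indicator {x. G x < 1} x \<partial>lborel)"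
        by (rule nn_integral_cmult) measurable
      finally show ?thesis using True
        by (simp add: power_add ennreal_mult' mult_ac)
    qed
  qed
  also have "\<dots> = radial_gaussian_moment (DIM('a) + d) * (\<integral>\<^sup>+x. k x * indicator {x. G x < 1} x \<partial>lborel)"
    unfolding radial_gaussian_moment_def by (rule nn_integral_multc) measurable
  finally show ?thesis .
qed

lemma omega_pos: "0 < omega n"
  by (auto simp: omega_def intro!: divide_pos_pos Gamma_real_pos)

text \<open>The Euclidean norm calibrates the constant: both its Gaussian integral and the volume of
  its unit ball are known.\<close>

lemma radial_gaussian_moment_omega:
  "radial_gaussian_moment DIM('a::euclidean_space) * ennreal (omega DIM('a)) = ennreal (sqrt (2 * pi) ^ DIM('a))"
proof -
  have "ennreal (sqrt (2 * pi) ^ DIM('a)) = (\<integral>\<^sup>+(x::'a). ennreal (exp (- ((norm x)\<^sup>2 / 2))) * 1 \<partial>lborel)"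
    by (simp add: nn_integral_gaussian)
  also have "\<dots> = radial_gaussian_moment (DIM('a) + 0) * (\<integral>\<^sup>+(x::'a). 1 * indicator {x. norm x < 1} x \<partial>lborel)"
    by (rule nn_integral_exp_homogeneous) auto
  also have "(\<integral>\<^sup>+(x::'a). 1 * indicator {x. norm x < 1} x \<partial>lborel) = emeasure lborel (ball (0::'a) 1)"
    by (simp add: ball_def)
  also have "\<dots> = ennreal (omega DIM('a))"
    by (subst emeasure_ball) (auto simp: unit_ball_vol_def omega_def add_divide_distrib)
  finally show ?thesis by simp
qed

section \<open>Linear algebra of positive definite matrices\<close>

lemma linear_axis_expansion:
  fixes f :: "real^'n \<Rightarrow> real"
  assumes "linear f"
  shows "f u = (\<Sum>i\<in>UNIV. u $ i * f (axis i 1))"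
proof -
  have "f u = f (\<Sum>i\<in>UNIV. u $ i *s axis i 1)" by (simp add: basis_expansion)
  then show ?thesis using assms by (simp add: linear_sum scalar_mult_eq_scaleR linear_scale)
qed

text \<open>Gram-Schmidt for the inner product of A. Fewer than CARD('n) vectors A w_i leave a
  nonzero x orthogonal to all of them, and positive definiteness allows x to be normalised. The rows
  of W are the resulting frame.\<close>

lemma posdef_frame_exists:
  fixes A :: "real^'n^'n"
  assumes sym: "transpose A = A" and pos: "\<And>x. x \<noteq> 0 \<Longrightarrow> 0 < x \<bullet> (A *v x)"
  shows "\<exists>W :: real^'n^'n. W ** A ** transpose W = mat 1"
proof -
  have symm: "x \<bullet> (A *v y) = y \<bullet> (A *v x)" for x y
    by (metis sym dot_lmul_matrix inner_commute vector_transpose_matrix)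
  have "\<exists>w :: 'n \<Rightarrow> real^'n. \<forall>i\<in>S. \<forall>j\<in>S. w i \<bullet> (A *v w j) = (if i = j then 1 else 0)" for S :: "'n set"
  proof (induction S rule: finite_induct[OF finite])
    case 1
    then show ?case by simp
  next
    case (2 k S)
    then obtain w :: "'n \<Rightarrow> real^'n" where w: "\<forall>i\<in>S. \<forall>j\<in>S. w i \<bullet> (A *v w j) = (if i = j then 1 else 0)" by blast
    let ?T = "(\<lambda>i. A *v w i) ` S"
    have "card ?T \<le> card S" by (intro card_image_le) (simp add: 2)
    also have "\<dots> < CARD('n)" using 2 by (intro psubset_card_mono) auto
    finally have "dim ?T < DIM(real^'n)"
      using dim_le_card'[of ?T] 2 by simp
    then obtain x where x: "x \<noteq> 0" "\<And>y. y \<in> span ?T \<Longrightarrow> orthogonal x y"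
      using orthogonal_to_subspace_exists by blast
    define z where "z = (1 / sqrt (x \<bullet> (A *v x))) *\<^sub>R x"
    have zz: "z \<bullet> (A *v z) = 1"
      using pos[OF x(1)] by (simp add: z_def matrix_vector_mult_scaleR)
    have zw: "z \<bullet> (A *v w i) = 0" if "i \<in> S" for i
      using x(2)[of "A *v w i"] that by (simp add: z_def orthogonal_def span_base)
    have "\<forall>i\<in>insert k S. \<forall>j\<in>insert k S. (w(k := z)) i \<bullet> (A *v (w(k := z)) j) = (if i = j then 1 else 0)"
    proof (intro ballI)
      fix i j assume "i \<in> insert k S" "j \<in> insert k S"
      then consider "i = k" "j = k" | "i = k" "j \<in> S" "j \<noteq> k" | "j = k" "i \<in> S" "i \<noteq> k" | "i \<in> S" "j \<in> S" "i \<noteq> k" "j \<noteq> k"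
        using 2 by auto
      then show "(w(k := z)) i \<bullet> (A *v (w(k := z)) j) = (if i = j then 1 else 0)"
        by cases (simp_all add: zz zw w symm[of "w i" z])
    qed
    then show ?case by blast
  qed
  then obtain w :: "'n \<Rightarrow> real^'n" where w: "\<And>i j. w i \<bullet> (A *v w j) = (if i = j then 1 else 0)"
    by (metis UNIV_I)
  have "((\<chi> i. w i) ** A ** transpose (\<chi> i. w i)) $ i $ j = w i \<bullet> (A *v w j)" for i j
  proof -
    let ?W = "(\<chi> i. w i) :: real^'n^'n"
    have "transpose ?W *v axis j 1 = w j"
      by (simp add: matrix_vector_mult_basis column_def transpose_def vec_eq_iff)
    then have "(?W ** A ** transpose ?W) *v axis j 1 = ?W *v (A *v w j)"
      by (simp add: matrix_vector_mul_assoc[symmetric])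
    moreover have "((?W ** A ** transpose ?W) *v axis j 1) $ i = (?W ** A ** transpose ?W) $ i $ j"
      by (simp add: matrix_vector_mult_basis column_def)
    ultimately show ?thesis by (simp add: matrix_vector_mul_component)
  qed
  then have "(\<chi> i. w i) ** A ** transpose (\<chi> i. w i) = mat 1"
    using w by (simp add: vec_eq_iff mat_def)
  then show ?thesis by blast
qed

lemma det_posdef_pos:
  fixes A :: "real^'n^'n"
  assumes "transpose A = A" "\<And>x. x \<noteq> 0 \<Longrightarrow> 0 < x \<bullet> (A *v x)"
  shows "0 < det A"
proof -
  obtain W :: "real^'n^'n" where "W ** A ** transpose W = mat 1" using posdef_frame_exists assms by blast
  then have "det W * det A * det W = 1" by (metis det_I det_mul det_transpose)
  then have "(det W)\<^sup>2 * det A = 1" by (simp add: power2_eq_square mult_ac)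
  then show ?thesis by (metis zero_less_mult_pos zero_less_one zero_le_power2 less_eq_real_def mult_zero_left zero_neq_one)
qed

section \<open>Density of the affine volume\<close>

lemma det_scale_entries:
  fixes M :: "real^'n^'n"
  shows "det (\<chi> i j. c i * c j * M $ i $ j) = (\<Prod>i\<in>UNIV. c i)\<^sup>2 * det M"
proof -
  have rows: "det (\<chi> i j. c i * B $ i $ j) = prod c UNIV * det B" for B :: "real^'n^'n"
    by (simp add: det_def prod.distrib sum_distrib_left mult.left_commute)
  have "(\<chi> i j. c i * c j * M $ i $ j) = (\<chi> i j. c i * (transpose (\<chi> i j. c i * transpose M $ i $ j)) $ i $ j)"
    by (simp add: vec_eq_iff transpose_def)
  then have "det (\<chi> i j. c i * c j * M $ i $ j) = prod c UNIV * det (transpose (\<chi> i j. c i * transpose M $ i $ j))"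
    by (simp only: rows)
  also have "\<dots> = prod c UNIV * (prod c UNIV * det M)" by (simp only: det_transpose rows)
  finally show ?thesis by (simp add: power2_eq_square)
qed

lemma det_gram:
  fixes A :: "real^'n^'n" and w :: "'n \<Rightarrow> real^'n"
  shows "det (\<chi> i j. w i \<bullet> (A *v w j)) = (det (\<chi> i. w i))\<^sup>2 * det A"
proof -
  let ?W = "(\<chi> i. w i) :: real^'n^'n"
  have "(?W ** A ** transpose ?W) $ i $ j = w i \<bullet> (A *v w j)" for i j
  proof -
    have "transpose ?W *v axis j 1 = w j"
      by (simp add: matrix_vector_mult_basis column_def transpose_def vec_eq_iff)
    then have "(?W ** A ** transpose ?W) *v axis j 1 = ?W *v (A *v w j)"
      by (simp add: matrix_vector_mul_assoc[symmetric])
    moreover have "((?W ** A ** transpose ?W) *v axis j 1) $ i = (?W ** A ** transpose ?W) $ i $ j"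
      by (simp add: matrix_vector_mult_basis column_def)
    ultimately show ?thesis by (simp add: matrix_vector_mul_component)
  qed
  then have "(\<chi> i j. w i \<bullet> (A *v w j)) = ?W ** A ** transpose ?W" by (simp add: vec_eq_iff)
  then show ?thesis by (simp add: det_mul power2_eq_square)
qed

context minkowski
begin

abbreviation gm :: "real^'n \<Rightarrow> real^'n^'n" where "gm \<equiv> g_matrix F"

definition g_det :: "real^'n \<Rightarrow> real" where "g_det y = det (gm y)"

lemma gm_mult_component: "y \<noteq> 0 \<Longrightarrow> (gm y *v v) $ A = fund_g F y (axis A 1) v"
proof -
  assume y: "y \<noteq> 0"
  have "fund_g F y (axis A 1) v = (\<Sum>i\<in>UNIV. v $ i * fund_g F y (axis A 1) (axis i 1))"
    by (rule linear_axis_expansion[OF linear_fund_g_right[OF y]])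
  then show ?thesis by (simp add: matrix_vector_mult_def g_matrix_def mult.commute)
qed

lemma gm_inner: "y \<noteq> 0 \<Longrightarrow> u \<bullet> (gm y *v v) = fund_g F y u v"
proof -
  assume y: "y \<noteq> 0"
  have "fund_g F y u v = (\<Sum>i\<in>UNIV. u $ i * fund_g F y (axis i 1) v)"
    by (rule linear_axis_expansion[OF linear_fund_g_left[OF y]])
  then show ?thesis by (simp add: inner_vec_def gm_mult_component[OF y])
qed

lemma gm_symmetric: "y \<noteq> 0 \<Longrightarrow> transpose (gm y) = gm y"
  by (simp add: transpose_def g_matrix_def vec_eq_iff fund_g_commute)

lemma g_det_pos: "y \<noteq> 0 \<Longrightarrow> 0 < g_det y"
  unfolding g_det_def by (intro det_posdef_pos gm_symmetric) (auto simp: gm_inner fund_g_pos)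

lemma g_det_scale: "0 < c \<Longrightarrow> y \<noteq> 0 \<Longrightarrow> g_det (c *\<^sub>R y) = g_det y"
  by (simp add: g_det_def g_matrix_def fund_g_scale)

lemma continuous_on_g_det: "continuous_on U g_det"
proof -
  have "continuous_on U (\<lambda>y. gm y $ i $ j)" for i j
    unfolding g_matrix_def fund_g_dirder
    by (auto intro!: continuous_intros smooth_on_set_continuous_on[OF smooth_on_set_dirder[OF smooth_on_set_dirder[OF smooth_q]]])
  then show ?thesis
    unfolding g_det_def det_def
    by (intro continuous_on_sum continuous_on_mult continuous_on_const continuous_on_prod)
qed

lemma borel_U [measurable]: "U \<in> sets borel" by simp

lemma borel_g_det [measurable]: "(\<lambda>y. indicator U y * g_det y) \<in> borel_measurable borel"
  using borel_measurable_continuous_on_indicator[OF borel_U continuous_on_g_det] by simp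

lemma sigma_BH_pos: "0 < sigma_BH F" and sigma_BH_eq: "sigma_BH F = omega CARD('n) / measure lborel K"
proof -
  have "measure lebesgue {y. F y < 1} = measure lborel K"
    using borel_K by (simp add: K_def)
  then show "sigma_BH F = omega CARD('n) / measure lborel K" by (simp add: sigma_BH_def)
  then show "0 < sigma_BH F" using omega_pos emeasure_K(2) by simp
qed

text \<open>A rotation carries the axis \<open>i0\<close> to the gradient of F at y. The other
  rotated axes span the tangent space, and y is transversal to it because
  \<open>dF F y y = F y = 1\<close>.\<close>

lemma adapted_frame_exists:
  assumes "F y = 1"
  shows "\<exists>w. adapted_frame F y i0 w"
proof -
  have y: "y \<noteq> 0" using assms by auto
  define d :: "real^'n" where "d = (\<chi> i. dF F y (axis i 1))"
  have d: "dF F y u = u \<bullet> d" for u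
    unfolding linear_axis_expansion[OF linear_dF[OF y], of u] by (simp add: d_def inner_vec_def)
  have yd: "y \<bullet> d = 1" using dF_self[OF y] assms by (simp add: d)
  then have d0: "d \<noteq> 0" by auto
  obtain R :: "real^'n \<Rightarrow> real^'n" where R: "orthogonal_transformation R" "R (axis i0 1) = (1 / norm d) *\<^sub>R d"
    using orthogonal_transformation_exists[of "axis i0 (1::real)" "(1 / norm d) *\<^sub>R d"] d0 by auto
  define w where "w = (\<lambda>i. if i = i0 then y else R (axis i 1))"
  have Rd: "R (axis i 1) \<bullet> d = 0" if "i \<noteq> i0" for i
  proof -
    have "R (axis i 1) \<bullet> R (axis i0 1) = axis i 1 \<bullet> axis i0 (1::real)"
      using R(1) by (simp add: orthogonal_transformation_def)
    also have "\<dots> = 0" using that by (simp add: inner_axis_axis)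
    finally show ?thesis using R(2) d0 by simp
  qed
  have "x = 0" if x: "(\<chi> i. w i) *v x = 0" for x
  proof -
    have wx: "w i \<bullet> x = 0" for i
      using x by (metis matrix_vector_mul_component vec_lambda_beta zero_index)
    obtain x' where x': "x = R x'"
      using orthogonal_transformation_surj[OF R(1)] by (metis surjD)
    have "x' $ i = 0" if "i \<noteq> i0" for i
    proof -
      have "0 = R (axis i 1) \<bullet> R x'" using wx[of i] that x' by (simp add: w_def)
      also have "\<dots> = axis i 1 \<bullet> x'" using R(1) by (simp add: orthogonal_transformation_def)
      finally show ?thesis by (simp add: inner_axis' )
    qed
    then have "x' = (x' $ i0) *\<^sub>R axis i0 1" by (auto simp: vec_eq_iff axis_def)
    then have xe: "x = (x' $ i0 / norm d) *\<^sub>R d"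
      using x' R(2) linear_scale[OF orthogonal_transformation_linear[OF R(1)]] by (metis scaleR_scaleR times_divide_eq_right mult.right_neutral)
    have "0 = y \<bullet> x" using wx[of i0] by (simp add: w_def)
    also have "\<dots> = x' $ i0 / norm d" using yd by (subst xe) simp
    finally show "x = 0" using xe by simp
  qed
  then have "det (\<chi> i. w i) \<noteq> 0"
    by (metis invertible_det_nz invertible_left_inverse matrix_left_invertible_ker)
  moreover have "dF F y (w i) = 0" if "i \<noteq> i0" for i using that Rd by (simp add: w_def d)
  ultimately show ?thesis by (intro exI[of _ w]) (simp add: adapted_frame_def w_def)
qed

text \<open>For g the position vector y is a unit vector orthogonal to the tangent space, and on
  tangent vectors g and h agree. The Blaschke determinant is thus a rescaled Gram determinant of g
  in the frame; it contains the square of det w, so the chosen frame drops out.\<close>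

lemma affine_density_eq:
  assumes Fy: "F y = 1"
  shows "affine_density F y
    = sigma_BH F powr ((real CARD('n) - 1) / (real CARD('n) + 1)) * g_det y powr (1 / (real CARD('n) + 1))"
proof -
  define N where "N = real CARD('n)"
  have N: "1 \<le> N" by (simp add: N_def Suc_leI)
  have y: "y \<noteq> 0" using Fy by auto
  define i0 where "i0 = (SOME i::'n. True)"
  define w where "w = (SOME w. adapted_frame F y i0 w)"
  have "adapted_frame F y i0 w" unfolding w_def using adapted_frame_exists[OF Fy] by (rule someI_ex)
  then have w: "w i0 = y" "\<And>i. i \<noteq> i0 \<Longrightarrow> dF F y (w i) = 0" "det (\<chi> i. w i) \<noteq> 0" by (auto simp: adapted_frame_def)
  define D s where "D = g_det y" and "s = sigma_BH F"
  have D: "0 < D" and s: "0 < s" using g_det_pos[OF y] sigma_BH_pos by (auto simp: D_def s_def)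
  define c where "c = (s\<^sup>2 / D) powr (1 / (N + 1))"
  have c: "0 < c" using D s by (simp add: c_def)
  \<comment> \<open>These weights put the conformal factor c on the tangent entries and leave the
    unit entry in the slot \<open>i0\<close> alone, which gives c^((N-1)/2) in the square root of
    the determinant.\<close>
  define e where "e = (\<lambda>i. if i = i0 then 1 else sqrt c)"
  have g0: "fund_g F y y y = 1" "i \<noteq> i0 \<Longrightarrow> fund_g F y (w i) y = 0" "i \<noteq> i0 \<Longrightarrow> fund_g F y y (w i) = 0" for i
    using w(2) fund_g_self[OF y] dF_self[OF y] Fy by (auto simp: fund_g_commute[OF y, of y "w i"])
  have "(\<chi> i j. if i = i0 \<or> j = i0 then (if i = j then 1 else 0) else blaschke_metric F y (w i) (w j))
      = (\<chi> i j. e i * e j * (\<chi> i j. w i \<bullet> (gm y *v w j)) $ i $ j)"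
    using g0 c w(1,2)
    by (intro arg_cong[where f=vec_lambda] ext)
       (auto simp: e_def gm_inner[OF y] blaschke_metric_def h_form_def c_def N_def s_def D_def g_det_def)
  then have "blaschke_gram_det F y i0 w = (\<Prod>i\<in>UNIV. e i)\<^sup>2 * ((det (\<chi> i. w i))\<^sup>2 * D)"
    unfolding blaschke_gram_det_def by (simp only: det_scale_entries det_gram D_def g_det_def)
  moreover have "(\<Prod>i\<in>UNIV. e i) = sqrt c ^ (CARD('n) - 1)"
  proof -
    have "(\<Prod>i\<in>UNIV. e i) = e i0 * (\<Prod>i\<in>UNIV - {i0}. e i)" by (simp add: prod.remove)
    also have "(\<Prod>i\<in>UNIV - {i0}. e i) = (\<Prod>i\<in>UNIV - {i0}. sqrt c)" by (intro prod.cong) (auto simp: e_def)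
    finally show ?thesis by (simp add: e_def)
  qed
  ultimately have "sqrt (blaschke_gram_det F y i0 w) / \<bar>det (\<chi> i. w i)\<bar> = sqrt c ^ (CARD('n) - 1) * sqrt D"
    using w(3) c by (simp add: real_sqrt_mult)
  also have "sqrt c ^ (CARD('n) - 1) = c powr ((N - 1) / 2)"
    using c by (simp add: powr_half_sqrt[symmetric] powr_powr N_def of_nat_diff Suc_leI flip: powr_realpow)
  also have "c powr ((N - 1) / 2) * sqrt D = s powr ((N - 1) / (N + 1)) * D powr (1 / (N + 1))"
  proof -
    have "c powr ((N - 1) / 2) = (s\<^sup>2 / D) powr ((N - 1) / (2 * (N + 1)))"
      by (simp add: c_def powr_powr mult.commute)
    also have "\<dots> = (s\<^sup>2) powr ((N - 1) / (2 * (N + 1))) / D powr ((N - 1) / (2 * (N + 1)))"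
      using s D by (simp add: powr_divide)
    also have "(s\<^sup>2) powr ((N - 1) / (2 * (N + 1))) = s powr ((N - 1) / (N + 1))"
    proof -
      have "2 * ((N - 1) / (2 * (N + 1))) = (N - 1) / (N + 1)" using N by (simp add: field_simps)
      then show ?thesis using s by (simp only: powr_powr flip: powr_numeral)
    qed
    finally have "c powr ((N - 1) / 2) * sqrt D = s powr ((N - 1) / (N + 1)) * (D powr (1/2) / D powr ((N - 1) / (2 * (N + 1))))"
      using D by (simp add: powr_half_sqrt)
    also have "D powr (1/2) / D powr ((N - 1) / (2 * (N + 1))) = D powr (1/2 - (N - 1) / (2 * (N + 1)))"
      by (simp add: powr_diff)
    also have "1/2 - (N - 1) / (2 * (N + 1)) = 1 / (N + 1)" using N by (simp add: field_simps)
    finally show ?thesis .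
  qed
  finally show ?thesis
    unfolding affine_density_def Let_def i0_def[symmetric] w_def[symmetric] by (simp add: s_def D_def N_def)
qed

text \<open>Up to the factor CARD('n) this is the equiaffine surface area of the indicatrix, written
  as an integral over its interior. The origin is left out because g has no meaning there.\<close>

definition centro_affine_area :: ennreal where
  "centro_affine_area = (\<integral>\<^sup>+y. ennreal (g_det y powr (1 / (real CARD('n) + 1))) * indicator (K - {0}) y \<partial>lborel)"

lemma borel_powr_g_det [measurable]:
  "(\<lambda>y. indicator (K - {0}) y * g_det y powr a) \<in> borel_measurable borel"
proof -
  have [measurable]: "K - {0} \<in> sets borel" by measurable
  have "(\<lambda>y. indicator (K - {0}) y * (indicator U y * g_det y) powr a) \<in> borel_measurable borel" by measurable
  moreover have "indicator (K - {0}) y * (indicator U y * g_det y) powr a = indicator (K - {0}) y * g_det y powr a" for y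
    by (auto simp: indicator_def)
  ultimately show ?thesis by simp
qed

text \<open>The determinant of g is homogeneous of degree 0, so the projection of y to the
  indicatrix disappears from the density. The origin, where this projection divides by 0, is
  negligible.\<close>

lemma affine_volume_eq:
  assumes fin: "centro_affine_area < \<infinity>"
  shows "affine_volume F = real CARD('n) * (sigma_BH F powr ((real CARD('n) - 1) / (real CARD('n) + 1)) * enn2real centro_affine_area)"
proof -
  let ?a = "1 / (real CARD('n) + 1)" and ?s = "sigma_BH F powr ((real CARD('n) - 1) / (real CARD('n) + 1))"
  let ?f = "\<lambda>y. indicator (K - {0}) y * g_det y powr ?a"
  have "centro_affine_area = (\<integral>\<^sup>+y. ennreal (?f y) \<partial>lborel)"
    unfolding centro_affine_area_def by (intro nn_integral_cong) (auto simp: indicator_def)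
  then have "(?f has_integral (enn2real centro_affine_area)) UNIV"
    using fin by (intro nn_integral_has_integral) auto
  then have 1: "((\<lambda>y. ?s * ?f y) has_integral (?s * enn2real centro_affine_area)) UNIV"
    by (rule has_integral_mult_right)
  have "((\<lambda>y. if y \<in> K then affine_density F ((1 / F y) *\<^sub>R y) else 0) has_integral (?s * enn2real centro_affine_area)) UNIV"
  proof (rule has_integral_spike[OF negligible_sing[of 0] _ 1])
    fix y :: "real^'n" assume "y \<in> UNIV - {0}"
    then have y: "y \<noteq> 0" by simp
    then have "0 < F y" by (rule F_pos)
    then have "affine_density F ((1 / F y) *\<^sub>R y) = ?s * g_det y powr ?a"
      using y by (subst affine_density_eq) (auto simp: F_scale_pos g_det_scale)
    then show "(if y \<in> K then affine_density F ((1 / F y) *\<^sub>R y) else 0) = ?s * ?f y"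
      using y by (auto simp: indicator_def)
  qed
  then have "((\<lambda>y. affine_density F ((1 / F y) *\<^sub>R y)) has_integral (?s * enn2real centro_affine_area)) K"
    by (subst (asm) has_integral_restrict_UNIV)
  then show ?thesis unfolding affine_volume_def K_def[symmetric] by (simp add: integral_unique)
qed

section \<open>The Legendre transformation and the integral of det g\<close>

definition legendre :: "real^'n \<Rightarrow> real^'n" where
  "legendre y = (\<chi> i. (1/2) * dirder (axis i 1) q y)"

lemma legendre_inner: "y \<noteq> 0 \<Longrightarrow> x \<bullet> legendre y = F y * dF F y x"
proof -
  assume y: "y \<noteq> 0"
  have "dF F y x = (\<Sum>i\<in>UNIV. x $ i * dF F y (axis i 1))"
    by (rule linear_axis_expansion[OF linear_dF[OF y]])
  then show ?thesis
    by (simp add: legendre_def inner_vec_def dirder_q[OF y] sum_distrib_left mult.left_commute)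
qed

lemma legendre_has_derivative: "y \<noteq> 0 \<Longrightarrow> (legendre has_derivative (\<lambda>v. gm y *v v)) (at y)"
proof -
  assume y: "y \<noteq> 0"
  have "((\<lambda>x. (1/2) * dirder (axis i 1) q x) has_derivative (\<lambda>v. (gm y *v v) $ i)) (at y)" for i
    unfolding gm_mult_component[OF y] fund_g_dirder
    using y by (intro has_derivative_mult_right smooth_on_set_has_derivative[OF smooth_on_set_dirder[OF smooth_q]]) auto
  then have "((\<lambda>x. legendre x \<bullet> b) has_derivative (\<lambda>v. (gm y *v v) \<bullet> b)) (at y)" if "b \<in> Basis" for b
    using that by (auto simp: Basis_vec_def inner_axis legendre_def)
  then show ?thesis by (subst has_derivative_componentwise_within) blast
qed

text \<open>Pairing the common image with x and with y, the fundamental inequality gives F x \<le> F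
  y and F y \<le> F x. Then it is an equality, so x is a multiple of y, and equal norms make the
  factor 1.\<close>

lemma legendre_inj: "inj_on legendre U"
proof (rule inj_onI)
  fix x y assume xy: "x \<in> U" "y \<in> U" "legendre x = legendre y"
  then have x: "x \<noteq> 0" and y: "y \<noteq> 0" by auto
  have 1: "F x * F x = F y * dF F y x" using legendre_inner[OF x, of x] legendre_inner[OF y, of x] xy by (simp add: dF_self)
  have 2: "F y * F y = F x * dF F x y" using legendre_inner[OF x, of y] legendre_inner[OF y, of y] xy by (simp add: dF_self)
  have "F x * F x \<le> F y * F x" unfolding 1 using dF_le[OF y] F_nonneg by (intro mult_left_mono) auto
  moreover have "F y * F y \<le> F x * F y" unfolding 2 using dF_le[OF x] F_nonneg by (intro mult_left_mono) auto
  ultimately have eq: "F x = F y" using F_pos[OF x] F_pos[OF y] by simp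
  then have "dF F y x = F x" using 1 F_pos[OF y] by simp
  then obtain c where c: "0 \<le> c" "x = c *\<^sub>R y" using dF_eq_imp[OF y] by blast
  then have "c = 1" using eq F_scale[OF c(1), of y] F_pos[OF y] by simp
  then show "x = y" using c by simp
qed

lemma integrable_exp_F: "integrable lborel (\<lambda>x. exp (- ((F x)\<^sup>2 / 2)))"
  and nn_integral_exp_F: "(\<integral>\<^sup>+x. ennreal (exp (- ((F x)\<^sup>2 / 2))) \<partial>lborel) = radial_gaussian_moment CARD('n) * emeasure lborel K"
proof -
  have "(\<integral>\<^sup>+x. ennreal (exp (- ((F x)\<^sup>2 / 2))) * 1 \<partial>lborel)
      = radial_gaussian_moment (DIM(real^'n) + 0) * (\<integral>\<^sup>+x. 1 * indicator {x. F x < 1} x \<partial>lborel)"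
    by (rule nn_integral_exp_homogeneous) (auto simp: F_nonneg F_scale_pos)
  then show *: "(\<integral>\<^sup>+x. ennreal (exp (- ((F x)\<^sup>2 / 2))) \<partial>lborel) = radial_gaussian_moment CARD('n) * emeasure lborel K"
    by (simp add: K_def)
  show "integrable lborel (\<lambda>x. exp (- ((F x)\<^sup>2 / 2)))"
    using radial_gaussian_moment_finite[of "CARD('n)"]
    by (intro integrableI_nonneg) (auto simp: * emeasure_K ennreal_mult_less_top)
qed

lemma integrable_K: "integrable lborel (\<lambda>x. indicator K x *\<^sub>R x)"
proof -
  obtain R where R: "\<And>x. x \<in> K \<Longrightarrow> norm x \<le> R" using bounded_K by (auto simp: bounded_iff)
  have "integrable lborel (\<lambda>x. R * indicator K x)"
    using emeasure_K by (intro integrable_mult_right integrable_real_indicator) auto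
  then show ?thesis
    by (rule Bochner_Integration.integrable_bound) (use R in \<open>auto simp: indicator_def intro!: AE_I2 order_trans[OF _ abs_ge_self]\<close>)
qed

text \<open>By homogeneity of degree 1 the first moment of the Gaussian is a constant times that of
  K. The conversion concerns nonnegative integrands; it is applied to x . b and to x . (- b), of
  which \<open>ennreal\<close> keeps the positive parts.\<close>

lemma first_moment_exp_F:
  assumes centered: "(\<integral>x. indicator K x *\<^sub>R x \<partial>lborel) = 0"
  shows "integrable lborel (\<lambda>x. exp (- ((F x)\<^sup>2 / 2)) *\<^sub>R x)"
    and "(\<integral>x. exp (- ((F x)\<^sup>2 / 2)) *\<^sub>R x \<partial>lborel) = 0"
proof -
  let ?e = "\<lambda>x. exp (- ((F x)\<^sup>2 / 2))"
  let ?C = "radial_gaussian_moment (CARD('n) + 1)"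
  have hom: "(\<integral>\<^sup>+x. ennreal (?e x) * k x \<partial>lborel) = ?C * (\<integral>\<^sup>+x. k x * indicator K x \<partial>lborel)"
    if "k \<in> borel_measurable borel" "\<And>c x. 0 < c \<Longrightarrow> k (c *\<^sub>R x) = ennreal c * k x" for k
    using nn_integral_exp_homogeneous[of F k 1] that by (simp add: F_nonneg F_scale_pos K_def)
  show int: "integrable lborel (\<lambda>x. ?e x *\<^sub>R x)"
  proof (rule integrableI_bounded)
    have "(\<integral>\<^sup>+x. ennreal (norm (?e x *\<^sub>R x)) \<partial>lborel) = (\<integral>\<^sup>+x. ennreal (?e x) * ennreal (norm x) \<partial>lborel)"
      by (simp add: ennreal_mult)
    also have "\<dots> = ?C * (\<integral>\<^sup>+x. ennreal (norm x) * indicator K x \<partial>lborel)"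
      by (rule hom) (auto simp: ennreal_mult)
    also have "(\<integral>\<^sup>+x. ennreal (norm x) * indicator K x \<partial>lborel) = (\<integral>\<^sup>+x. ennreal (norm (indicator K x *\<^sub>R x)) \<partial>lborel)"
      by (intro nn_integral_cong) (auto simp: indicator_def)
    also have "?C * \<dots> < \<infinity>"
      using radial_gaussian_moment_finite[of "CARD('n) + 1"] integrableD(2)[OF integrable_norm[OF integrable_K]] integrable_K
      by (auto simp: ennreal_mult_less_top integrable_iff_bounded simp del: norm_scaleR)
    finally show "(\<integral>\<^sup>+x. ennreal (norm (?e x *\<^sub>R x)) \<partial>lborel) < \<infinity>" .
  qed measurable
  show "(\<integral>x. ?e x *\<^sub>R x \<partial>lborel) = 0"
  proof (rule euclidean_eqI)
    fix b :: "real^'n" assume "b \<in> Basis"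
    have part: "(\<integral>\<^sup>+x. ennreal (?e x * (x \<bullet> c)) \<partial>lborel) = ?C * (\<integral>\<^sup>+x. ennreal (indicator K x * (x \<bullet> c)) \<partial>lborel)" for c
    proof -
      have "(\<integral>\<^sup>+x. ennreal (?e x * (x \<bullet> c)) \<partial>lborel) = (\<integral>\<^sup>+x. ennreal (?e x) * ennreal (x \<bullet> c) \<partial>lborel)"
        by (simp add: ennreal_mult')
      also have "\<dots> = ?C * (\<integral>\<^sup>+x. ennreal (x \<bullet> c) * indicator K x \<partial>lborel)"
        by (rule hom) (auto simp: ennreal_mult')
      also have "(\<integral>\<^sup>+x. ennreal (x \<bullet> c) * indicator K x \<partial>lborel) = (\<integral>\<^sup>+x. ennreal (indicator K x * (x \<bullet> c)) \<partial>lborel)"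
        by (intro nn_integral_cong) (auto simp: indicator_def)
      finally show ?thesis .
    qed
    have iK: "integrable lborel (\<lambda>x. indicator K x * (x \<bullet> b))"
      using integrable_inner_left[OF integrable_K, of b] by simp
    have "(\<integral>x. indicator K x * (x \<bullet> b) \<partial>lborel) = 0"
      using integral_inner_left[of b lborel "\<lambda>x. indicator K x *\<^sub>R x"] integrable_K centered by simp
    then have "enn2real (\<integral>\<^sup>+x. ennreal (indicator K x * (x \<bullet> b)) \<partial>lborel) = enn2real (\<integral>\<^sup>+x. ennreal (indicator K x * (x \<bullet> - b)) \<partial>lborel)"
      using real_lebesgue_integral_def[OF iK] by simp
    then have eq: "enn2real (\<integral>\<^sup>+x. ennreal (?e x * (x \<bullet> b)) \<partial>lborel) = enn2real (\<integral>\<^sup>+x. ennreal (?e x * (x \<bullet> - b)) \<partial>lborel)"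
      by (simp only: part enn2real_mult)
    have ie: "integrable lborel (\<lambda>x. ?e x * (x \<bullet> b))"
      using integrable_inner_left[OF int, of b] by simp
    have "(\<integral>x. ?e x * (x \<bullet> b) \<partial>lborel) = 0"
      using real_lebesgue_integral_def[OF ie] eq by simp
    then show "(\<integral>x. ?e x *\<^sub>R x \<partial>lborel) \<bullet> b = 0 \<bullet> b"
      using integral_inner_left[of b lborel "\<lambda>x. ?e x *\<^sub>R x"] int by simp
  qed
qed

lemma nn_integral_g_det_le:
  assumes centered: "(\<integral>x. indicator K x *\<^sub>R x \<partial>lborel) = 0"
  shows "(\<integral>\<^sup>+y. ennreal (g_det y) * indicator (K - {0}) y \<partial>lborel) * emeasure lborel K \<le> ennreal ((omega CARD('n))\<^sup>2)"
proof -
  let ?e = "\<lambda>x. exp (- ((F x)\<^sup>2 / 2))"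
  let ?C = "radial_gaussian_moment CARD('n)"
  \<comment> \<open>This is the Gaussian of the dual norm on the image of the Legendre map, extended
    by 0.\<close>
  define f where "f = (\<lambda>p. if p \<in> legendre ` U then ?e (inv_into U legendre p) else 0)"
  have f_leg: "f (legendre y) = ?e y" if "y \<noteq> 0" for y
    using that inv_into_f_f[OF legendre_inj, of y] by (auto simp: f_def)
  have contl: "continuous_on U legendre"
    by (intro continuous_at_imp_continuous_on ballI) (auto intro: has_derivative_continuous[OF legendre_has_derivative])
  \<comment> \<open>For t \<ge> 0 the set where f exceeds t is the image of an open set under an
    injective continuous map, hence open by invariance of domain.\<close>
  have [measurable]: "f \<in> borel_measurable borel"
  proof (rule borel_measurable_iff_greater[THEN iffD2], rule allI)
    fix t :: real
    show "{p \<in> space borel. t < f p} \<in> sets borel"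
    proof (cases "t < 0")
      case True
      then have "t < f p" for p by (auto simp: f_def intro: less_trans)
      then show ?thesis by simp
    next
      case False
      let ?S = "{y \<in> U. t < ?e y}"
      have "{p \<in> space borel. t < f p} = legendre ` ?S"
      proof (intro set_eqI iffI)
        fix p assume "p \<in> {p \<in> space borel. t < f p}"
        then have t: "t < f p" by simp
        then have "p \<in> legendre ` U" using False by (auto simp: f_def split: if_splits)
        then obtain y where "y \<in> U" "p = legendre y" by blast
        then show "p \<in> legendre ` ?S" using t f_leg by auto
      qed (use f_leg in auto)
      moreover have "open ?S"
      proof -
        have "open {y. t < ?e y}"
          by (intro open_Collect_less) (auto intro!: continuous_intros continuous_F)
        then have "open ({y. t < ?e y} \<inter> U)" by (intro open_Int) auto
        then show ?thesis by (simp add: Int_def conj_commute)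
      qed
      then have "open (legendre ` ?S)"
        by (intro invariance_of_domain continuous_on_subset[OF contl] inj_on_subset[OF legendre_inj]) auto
      ultimately show ?thesis by simp
    qed
  qed
  have "(\<integral>\<^sup>+p. ennreal (f p) \<partial>lborel) = (\<integral>\<^sup>+p. ennreal (f p) * indicator (legendre ` U) p \<partial>lborel)"
    by (intro nn_integral_cong) (auto simp: f_def)
  also have "\<dots> = (\<integral>\<^sup>+y. ennreal (f (legendre y)) * ennreal \<bar>det (matrix (\<lambda>v. gm y *v v))\<bar> * indicator U y \<partial>lborel)"
  proof (rule nn_integral_change_of_variables(2))
    show "continuous_on U (\<lambda>x. det (matrix (\<lambda>v. gm x *v v)))"
      using continuous_on_g_det by (simp add: g_det_def[abs_def])
  qed (auto intro: legendre_inj legendre_has_derivative)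
  also have "\<dots> = (\<integral>\<^sup>+y. ennreal (?e y) * ennreal (indicator U y * g_det y) \<partial>lborel)"
  proof (intro nn_integral_cong)
    fix y
    show "ennreal (f (legendre y)) * ennreal \<bar>det (matrix (\<lambda>v. gm y *v v))\<bar> * indicator U y = ennreal (?e y) * ennreal (indicator U y * g_det y)"
      using f_leg[of y] g_det_pos[of y] by (auto simp: indicator_def g_det_def)
  qed
  also have "\<dots> = radial_gaussian_moment (DIM(real^'n) + 0) * (\<integral>\<^sup>+y. ennreal (indicator U y * g_det y) * indicator {x. F x < 1} y \<partial>lborel)"
  proof (rule nn_integral_exp_homogeneous)
    show "(\<lambda>y. ennreal (indicator U y * g_det y)) \<in> borel_measurable borel" using borel_g_det by (rule measurable_compose) simp
  qed (auto simp: F_nonneg F_scale_pos g_det_scale indicator_def)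
  also have "(\<integral>\<^sup>+y. ennreal (indicator U y * g_det y) * indicator {x. F x < 1} y \<partial>lborel)
      = (\<integral>\<^sup>+y. ennreal (g_det y) * indicator (K - {0}) y \<partial>lborel)"
    by (intro nn_integral_cong) (auto simp: indicator_def K_def)
  finally have If: "(\<integral>\<^sup>+p. ennreal (f p) \<partial>lborel) = ?C * (\<integral>\<^sup>+y. ennreal (g_det y) * indicator (K - {0}) y \<partial>lborel)" by simp
  have "(\<integral>\<^sup>+p. ennreal (f p) \<partial>lborel) * (\<integral>\<^sup>+x. ennreal (?e x) \<partial>lborel) \<le> ennreal ((2 * pi) ^ DIM(real^'n))"
  proof (rule functional_santalo)
    fix x p :: "real^'n"
    have "f p * ?e x \<le> exp (- (x \<bullet> p))"
    proof (cases "p \<in> legendre ` U")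
      case True
      then obtain y where y: "y \<noteq> 0" "p = legendre y" by auto
      have "x \<bullet> p = F y * dF F y x" using y legendre_inner by simp
      also have "\<dots> \<le> F y * F x" using dF_le[OF y(1)] F_nonneg by (intro mult_left_mono) auto
      also have "\<dots> \<le> (F y)\<^sup>2 / 2 + (F x)\<^sup>2 / 2" using sum_squares_bound[of "F y" "F x"] by simp
      finally show ?thesis using y by (simp add: f_leg exp_add[symmetric])
    qed (simp add: f_def)
    then show "ennreal (f p) * ennreal (?e x) \<le> ennreal (exp (- (x \<bullet> p)))"
      by (simp add: ennreal_mult''[symmetric] ennreal_leI)
  qed (use integrable_exp_F first_moment_exp_F[OF centered] in auto)
  then have 1: "(?C * ?C) * ((\<integral>\<^sup>+y. ennreal (g_det y) * indicator (K - {0}) y \<partial>lborel) * emeasure lborel K) \<le> ennreal ((2 * pi) ^ CARD('n))"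
    by (simp add: If nn_integral_exp_F mult_ac)
  \<comment> \<open>The constant is the square of the moment times \<open>omega\<close>, so the two
    moments on the left cancel and omega^2 remains.\<close>
  have "ennreal ((2 * pi) ^ CARD('n)) = ennreal (sqrt (2 * pi) ^ CARD('n)) * ennreal (sqrt (2 * pi) ^ CARD('n))"
  proof -
    have "(2 * pi) ^ CARD('n) = sqrt (2 * pi) ^ CARD('n) * sqrt (2 * pi) ^ CARD('n)"
      unfolding power_mult_distrib[symmetric] by simp
    moreover have "0 \<le> sqrt (2 * pi) ^ CARD('n)" by simp
    ultimately show ?thesis using ennreal_mult by metis
  qed
  also have "\<dots> = (?C * ?C) * ennreal ((omega CARD('n))\<^sup>2)"
  proof -
    have eq: "ennreal (sqrt (2 * pi) ^ CARD('n)) = ?C * ennreal (omega CARD('n))"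
      using radial_gaussian_moment_omega[where 'a="real^'n"] by simp
    show ?thesis
      unfolding eq power2_eq_square ennreal_mult[OF less_imp_le[OF omega_pos] less_imp_le[OF omega_pos]]
      by (simp only: mult_ac)
  qed
  finally have 2: "(?C * ?C) * ((\<integral>\<^sup>+y. ennreal (g_det y) * indicator (K - {0}) y \<partial>lborel) * emeasure lborel K) \<le> (?C * ?C) * ennreal ((omega CARD('n))\<^sup>2)"
    using 1 by simp
  have "0 < sqrt (2 * pi) ^ CARD('n)" by simp
  then have "?C \<noteq> 0" using radial_gaussian_moment_omega[where 'a="real^'n"] by (auto simp: not_le[symmetric])
  then have "?C * ?C \<noteq> 0" "?C * ?C < top"
    using radial_gaussian_moment_finite[of "CARD('n)"] by (auto simp: ennreal_mult_less_top)
  then show ?thesis using 2 by (simp add: ennreal_mult_le_mult_iff less_top[symmetric])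
qed

end

section \<open>Translating the unit ball\<close>

text \<open>In an orthonormal basis with one vector along p the matrix differs from the identity in
  a single column, and Cramer's rule reads off the determinant.\<close>

lemma det_rank_one_update:
  fixes d p :: "real^'n"
  shows "det (\<chi> i j. (if i = j then 1 else 0) + d $ i * p $ j) = 1 + d \<bullet> p"
proof (cases "p = 0")
  case True
  have "(\<chi> i j. (if i = j then 1 else 0) + d $ i * p $ j) = (mat 1 :: real^'n^'n)"
    using True by (simp add: mat_def)
  then show ?thesis using True by simp
next
  case False
  let ?M = "(\<chi> i j. (if i = j then 1 else 0) + d $ i * p $ j) :: real^'n^'n"
  fix k :: 'n
  obtain Q :: "real^'n \<Rightarrow> real^'n" where Q: "orthogonal_transformation Q" "Q (axis k 1) = (1 / norm p) *\<^sub>R p"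
    using orthogonal_transformation_exists[of "axis k (1::real)" "(1 / norm p) *\<^sub>R p"] False by auto
  define w where "w = (\<lambda>i. Q (axis i 1))"
  have ww: "w i \<bullet> w j = (if i = j then 1 else 0)" for i j
    using Q(1) by (simp add: w_def orthogonal_transformation_def inner_axis_axis)
  have "p = norm p *\<^sub>R w k" using Q(2) False by (simp add: w_def)
  then have pw: "p \<bullet> w j = (if j = k then norm p else 0)" for j
    using ww[of k j] by (metis inner_scaleR_left mult.right_neutral mult_zero_right)
  have Mv: "?M *v v = v + (p \<bullet> v) *\<^sub>R d" for v
  proof (intro vec_eq_iff[THEN iffD2] allI)
    fix i
    have "(?M *v v) $ i = (\<Sum>j\<in>UNIV. (if i = j then v $ j else 0) + d $ i * (p $ j * v $ j))"
      unfolding matrix_vector_mult_def by (auto intro!: sum.cong simp: algebra_simps)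
    also have "\<dots> = v $ i + d $ i * (p \<bullet> v)"
      by (simp add: sum.distrib sum_distrib_left[symmetric] inner_vec_def)
    finally show "(?M *v v) $ i = (v + (p \<bullet> v) *\<^sub>R d) $ i" by simp
  qed
  have detw: "(det (\<chi> i. w i))\<^sup>2 = 1"
  proof -
    have "(\<chi> i j. w i \<bullet> (mat 1 *v w j)) = (mat 1 :: real^'n^'n)"
      by (simp only: matrix_vector_mul_lid ww, simp only: mat_def)
    then have "det (mat 1 :: real^'n^'n) = (det (\<chi> i. w i))\<^sup>2 * det (mat 1 :: real^'n^'n)"
      using det_gram[of w "mat 1"] by simp
    then show ?thesis by simp
  qed
  define x :: "real^'n" where "x = (\<chi> i. (if i = k then 1 else 0) + norm p * (w i \<bullet> d))"
  have "det ?M = det (\<chi> i j. w i \<bullet> (?M *v w j))"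
    using det_gram[of w ?M] detw by simp
  also have "(\<chi> i j. w i \<bullet> (?M *v w j)) = (\<chi> i j. if j = k then x $ i else (mat 1 :: real^'n^'n) $ i $ j)"
    by (intro arg_cong[where f=vec_lambda] ext) (auto simp: Mv ww pw inner_add_right x_def mat_def)
  also have "det \<dots> = x $ k" using cramer_lemma[of k "mat 1" x] unfolding matrix_vector_mul_lid by simp
  also have "x $ k = 1 + d \<bullet> (norm p *\<^sub>R w k)" by (simp add: x_def inner_commute)
  finally show ?thesis using \<open>p = norm p *\<^sub>R w k\<close> by simp
qed

context minkowski
begin

text \<open>Cauchy-Schwarz for g at y, applied to u and y: g(u, y) = F y * dF u and g(y, y) = (F
  y)^2. It says that the angular form h is nonnegative.\<close>

lemma dF_sq_le: "y \<noteq> 0 \<Longrightarrow> (dF F y u)\<^sup>2 \<le> fund_g F y u u"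
proof -
  assume y: "y \<noteq> 0"
  define c where "c = dF F y u / F y"
  note lin = linear_fund_g_left[OF y] linear_fund_g_right[OF y]
  have "0 \<le> fund_g F y (u - c *\<^sub>R y) (u - c *\<^sub>R y)"
    using fund_g_pos[OF y, of "u - c *\<^sub>R y"] linear_0[OF lin(2)] by (cases "u - c *\<^sub>R y = 0") auto
  also have "\<dots> = fund_g F y u u - 2 * c * (F y * dF F y u) + c * c * (F y * F y)"
    using fund_g_self[OF y] fund_g_commute[OF y, of y u] dF_self[OF y]
    by (simp add: linear_diff[OF lin(1)] linear_diff[OF lin(2)] linear_scale[OF lin(1)] linear_scale[OF lin(2)]
        linear_diff[OF linear_dF[OF y]] linear_scale[OF linear_dF[OF y]] algebra_simps)
  also have "\<dots> = fund_g F y u u - (dF F y u)\<^sup>2"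
    using F_pos[OF y] by (simp add: c_def power2_eq_square)
  finally show ?thesis by simp
qed

end

section \<open>The norm whose unit ball is the translate of K by -z\<close>

locale minkowski_translate = minkowski F for F :: "real^'n \<Rightarrow> real" +
  fixes z :: "real^'n"
  assumes F_center: "F z < 1"
begin

lemma dF_center: "y \<noteq> 0 \<Longrightarrow> dF F y z < 1"
  using dF_le[of y z] F_center by linarith

text \<open>The reciprocal of the Jacobian of the map \<open>\<Phi>\<close> below, finite and
  positive because dF z \<le> F z < 1.\<close>

definition \<tau> :: "real^'n \<Rightarrow> real" where "\<tau> y = inverse (1 - dF F y z)"

lemma \<tau>_pos: "y \<noteq> 0 \<Longrightarrow> 0 < \<tau> y"
  using dF_center[of y] by (simp add: \<tau>_def)

lemma \<tau>_dF: "y \<noteq> 0 \<Longrightarrow> \<tau> y * dF F y z = \<tau> y - 1"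
  using dF_center[of y] by (simp add: \<tau>_def field_simps)

text \<open>On the level F = t this is the translation by -t z. It carries the spheres of F to the
  spheres of the translated norm with the same radius, so the new norm is F composed with the
  inverse \<open>\<Psi>\<close>.\<close>

definition \<Phi> :: "real^'n \<Rightarrow> real^'n" where "\<Phi> y = y - F y *\<^sub>R z"

lemma \<Phi>_nonzero: "y \<noteq> 0 \<Longrightarrow> \<Phi> y \<noteq> 0"
proof
  assume y: "y \<noteq> 0" and "\<Phi> y = 0"
  then have "F y = F (F y *\<^sub>R z)" by (simp add: \<Phi>_def)
  then show False using F_scale_pos[OF F_pos[OF y], of z] F_pos[OF y] F_center by simp
qed

lemma \<Phi>_le: assumes "\<Phi> y = \<Phi> y'" shows "F y \<le> F y'"
proof (rule ccontr)
  assume n: "\<not> F y \<le> F y'"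
  define c where "c = F y - F y'"
  have c: "0 \<le> c" using n by (simp add: c_def)
  have "y = (y' - F y' *\<^sub>R z) + F y *\<^sub>R z" using assms unfolding \<Phi>_def by (metis diff_add_cancel)
  also have "\<dots> = y' + c *\<^sub>R z" by (simp add: c_def scaleR_diff_left)
  finally have y: "y = y' + c *\<^sub>R z" .
  have "F y = F (y' + c *\<^sub>R z)" by (rule arg_cong[OF y])
  also have "\<dots> \<le> F y' + F (c *\<^sub>R z)" by (rule F_triangle)
  also have "F (c *\<^sub>R z) = c * F z" by (rule F_scale[OF c])
  finally have "c \<le> c * F z" unfolding c_def by linarith
  moreover have "0 < c" using n by (simp add: c_def)
  ultimately show False using F_center by simp
qed

lemma \<Phi>_inj: assumes "\<Phi> y = \<Phi> y'" shows "y = y'"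
proof -
  have "F y = F y'" using \<Phi>_le[OF assms] \<Phi>_le[OF assms[symmetric]] by (rule antisym)
  then show ?thesis using assms unfolding \<Phi>_def by (metis diff_add_cancel)
qed

lemma \<Phi>_surj: assumes x: "x \<noteq> 0" shows "\<exists>t>0. F (x + t *\<^sub>R z) = t"
proof -
  define h where "h = (\<lambda>t. t - F (x + t *\<^sub>R z))"
  \<comment> \<open>The triangle inequality gives h T \<ge> T * (1 - F z) - F x = 1 for this
    T.\<close>
  define T where "T = (F x + 1) / (1 - F z)"
  have T: "0 \<le> T" using F_center F_nonneg[of x] by (simp add: T_def)
  have "h 0 \<le> 0" using F_nonneg by (simp add: h_def)
  moreover have "0 \<le> h T"
  proof -
    have "F (x + T *\<^sub>R z) \<le> F x + T * F z" using F_triangle[of x "T *\<^sub>R z"] F_scale[OF T, of z] by simp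
    moreover have "T * (1 - F z) = F x + 1" using F_center by (simp add: T_def)
    ultimately show ?thesis by (simp add: h_def algebra_simps)
  qed
  moreover have "continuous_on {0..T} h"
    unfolding h_def by (intro continuous_intros continuous_on_compose2[OF continuous_F]) auto
  ultimately obtain t where t: "0 \<le> t" "h t = 0" using IVT'[of h 0 0 T] T by auto
  then have "t \<noteq> 0" using F_pos[OF x] by (auto simp: h_def)
  then show ?thesis using t by (intro exI[of _ t]) (auto simp: h_def)
qed

definition \<Psi> :: "real^'n \<Rightarrow> real^'n" where "\<Psi> x = (SOME y. \<Phi> y = x)"

lemma \<Psi>_\<Phi> [simp]: "\<Psi> (\<Phi> y) = y"
  unfolding \<Psi>_def by (rule some_equality) (auto dest: \<Phi>_inj)

lemma \<Phi>_line: "F (x + t *\<^sub>R z) = t \<Longrightarrow> \<Phi> (x + t *\<^sub>R z) = x"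
  by (simp add: \<Phi>_def)

lemma \<Phi>_\<Psi>: "x \<noteq> 0 \<Longrightarrow> \<Phi> (\<Psi> x) = x"
  using \<Phi>_surj[of x] \<Phi>_line by (metis \<Psi>_\<Phi>)

lemma \<Psi>_nonzero: "x \<noteq> 0 \<Longrightarrow> \<Psi> x \<noteq> 0"
  using \<Phi>_\<Psi>[of x] by (auto simp: \<Phi>_def)

definition \<Phi>' :: "real^'n \<Rightarrow> real^'n \<Rightarrow> real^'n" where "\<Phi>' y v = v - dF F y v *\<^sub>R z"

lemma \<Phi>_has_derivative: "y \<noteq> 0 \<Longrightarrow> (\<Phi> has_derivative \<Phi>' y) (at y)"
  unfolding \<Phi>_def[abs_def] \<Phi>'_def[abs_def]
  by (intro has_derivative_diff has_derivative_ident has_derivative_scaleR_left F_has_derivative)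

lemma det_\<Phi>': "y \<noteq> 0 \<Longrightarrow> det (matrix (\<Phi>' y)) = inverse (\<tau> y)"
proof -
  assume y: "y \<noteq> 0"
  let ?p = "(\<chi> j. - dF F y (axis j 1)) :: real^'n"
  have "matrix (\<Phi>' y) = (\<chi> i j. (if i = j then 1 else 0) + z $ i * ?p $ j)"
    by (auto simp: matrix_def \<Phi>'_def vec_eq_iff axis_def)
  then have "det (matrix (\<Phi>' y)) = 1 + z \<bullet> ?p" by (simp only: det_rank_one_update)
  also have "z \<bullet> ?p = - dF F y z"
    unfolding linear_axis_expansion[OF linear_dF[OF y], of z] by (simp add: inner_vec_def sum_negf)
  finally show ?thesis by (simp add: \<tau>_def)
qed

text \<open>The inverse of \<open>\<Phi>' y\<close>, and thus the derivative of
  \<open>\<Psi>\<close>: the solution w of w - dF(w) z = v has dF(w) = \<tau> dF(v).\<close>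

definition lift :: "real^'n \<Rightarrow> real^'n \<Rightarrow> real^'n" where "lift y v = v + (\<tau> y * dF F y v) *\<^sub>R z"

lemma dF_lift: "y \<noteq> 0 \<Longrightarrow> dF F y (lift y v) = \<tau> y * dF F y v"
proof -
  assume y: "y \<noteq> 0"
  have "dF F y (lift y v) = dF F y v + dF F y v * (\<tau> y * dF F y z)"
    using linear_dF[OF y] by (simp add: lift_def linear_add linear_scale)
  also have "\<dots> = \<tau> y * dF F y v" by (simp only: \<tau>_dF[OF y]) (simp add: algebra_simps)
  finally show ?thesis .
qed

lemma \<Psi>_has_derivative: "y \<noteq> 0 \<Longrightarrow> (\<Psi> has_derivative lift y) (at (\<Phi> y))"
proof (rule has_derivative_inverse_on[where S=U and f=\<Phi> and f'=\<Phi>'])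
  assume y: "y \<noteq> 0"
  show "\<Phi>' y \<circ> lift y = id"
    by (rule ext) (simp add: \<Phi>'_def dF_lift[OF y], simp add: lift_def)
qed (auto simp: \<Phi>_has_derivative)

lemma comp_\<Psi>_has_derivative:
  assumes k: "smooth_on_set k U" and x: "x \<noteq> 0"
  shows "((\<lambda>x. k (\<Psi> x)) has_derivative (\<lambda>u. dirder (lift (\<Psi> x) u) k (\<Psi> x))) (at x)"
proof -
  have "(\<Psi> has_derivative lift (\<Psi> x)) (at x)"
    using \<Psi>_has_derivative[OF \<Psi>_nonzero[OF x]] \<Phi>_\<Psi>[OF x] by simp
  then show ?thesis
    by (rule has_derivative_compose[where f=\<Psi> and g=k and g'="\<lambda>u. dirder u k (\<Psi> x)"])
       (use x \<Psi>_nonzero in \<open>auto intro: smooth_on_set_has_derivative[OF k]\<close>)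
qed

lemma dirder_lift:
  assumes "smooth_on_set k U" "y \<noteq> 0"
  shows "dirder (lift y u) k y = dirder u k y + \<tau> y * dF F y u * dirder z k y"
  using dirder_linear[OF smooth_on_set_differentiable[OF assms(1)]] assms(2)
  by (simp add: lift_def linear_add linear_scale)

lemma smooth_\<tau>: "smooth_on_set \<tau> U"
proof -
  have "smooth_on_set (\<lambda>y. 1 + (-1) * dF F y z) U"
    by (intro smooth_on_set_add smooth_on_set_mult smooth_on_set_const smooth_dF) auto
  then have "smooth_on_set (\<lambda>y. inverse (1 + (-1) * dF F y z)) U"
    by (rule smooth_on_set_inverse) (use dF_center in force)
  then show ?thesis by (simp add: \<tau>_def[abs_def])
qed

text \<open>A derivative of a composition with \<open>\<Psi>\<close> is again a composition with
  \<open>\<Psi>\<close>, the outer function being built from derivatives of k, \<open>\<tau>\<close>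
  and dF. Coinduction over such compositions avoids higher derivatives of \<open>\<Psi>\<close>
  itself.\<close>

lemma smooth_comp_\<Psi>:
  assumes "smooth_on_set k U" and h: "\<And>x. x \<noteq> 0 \<Longrightarrow> h x = k (\<Psi> x)"
  shows "smooth_on_set h U"
proof (rule smooth_on_set_coinduct[where H="{h. \<exists>k. smooth_on_set k U \<and> (\<forall>x\<in>U. h x = k (\<Psi> x))}"])
  show "open U" by auto
  show "h \<in> {h. \<exists>k. smooth_on_set k U \<and> (\<forall>x\<in>U. h x = k (\<Psi> x))}" using assms by auto
next
  fix h x assume "h \<in> {h. \<exists>k. smooth_on_set k U \<and> (\<forall>x\<in>U. h x = k (\<Psi> x))}" and x: "x \<in> U"
  then obtain k where k: "smooth_on_set k U" "\<forall>x\<in>U. h x = k (\<Psi> x)" by auto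
  have "(\<lambda>x. k (\<Psi> x)) differentiable (at x)"
    using comp_\<Psi>_has_derivative[OF k(1)] x by (auto simp: differentiable_def)
  then show "h differentiable (at x)"
    using dirder_cong_open(2)[of U h "\<lambda>x. k (\<Psi> x)" x] k(2) x by auto
next
  fix h u assume "h \<in> {h. \<exists>k. smooth_on_set k U \<and> (\<forall>x\<in>U. h x = k (\<Psi> x))}"
  then obtain k where k: "smooth_on_set k U" "\<forall>x\<in>U. h x = k (\<Psi> x)" by auto
  define k' where "k' = (\<lambda>y. dirder u k y + \<tau> y * dF F y u * dirder z k y)"
  have "smooth_on_set k' U"
    unfolding k'_def by (intro smooth_on_set_add smooth_on_set_mult smooth_\<tau> smooth_dF smooth_on_set_dirder k)
  moreover have "dirder u h x = k' (\<Psi> x)" if x: "x \<in> U" for x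
  proof -
    have "dirder u h x = dirder u (\<lambda>x. k (\<Psi> x)) x"
      using k(2) x by (intro dirder_cong_open(1)[where S=U]) auto
    also have "\<dots> = dirder (lift (\<Psi> x) u) k (\<Psi> x)"
      using x by (intro dirder_eq comp_\<Psi>_has_derivative k) auto
    also have "\<dots> = k' (\<Psi> x)" unfolding k'_def using x \<Psi>_nonzero by (intro dirder_lift k) auto
    finally show ?thesis .
  qed
  ultimately show "\<exists>h'\<in>{h. \<exists>k. smooth_on_set k U \<and> (\<forall>x\<in>U. h x = k (\<Psi> x))}. \<forall>y\<in>U. dirder u h y = h' y"
    by (intro bexI[of _ "\<lambda>x. k' (\<Psi> x)"]) auto
qed

definition Ft :: "real^'n \<Rightarrow> real" where "Ft x = (if x = 0 then 0 else F (\<Psi> x))"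

lemma Ft_\<Phi>: "y \<noteq> 0 \<Longrightarrow> Ft (\<Phi> y) = F y"
  using \<Phi>_nonzero by (simp add: Ft_def)

lemma Ft_eqI: "0 < t \<Longrightarrow> F (x + t *\<^sub>R z) = t \<Longrightarrow> Ft x = t"
  using Ft_\<Phi>[of "x + t *\<^sub>R z"] \<Phi>_line[of x t] by force

lemma Ft_solves: "x \<noteq> 0 \<Longrightarrow> 0 < Ft x \<and> F (x + Ft x *\<^sub>R z) = Ft x"
  using \<Phi>_surj[of x] Ft_eqI by metis

lemma dF_Ft: "y \<noteq> 0 \<Longrightarrow> dF Ft (\<Phi> y) u = \<tau> y * dF F y u"
proof -
  assume y: "y \<noteq> 0"
  have "dirder u Ft (\<Phi> y) = dirder u (\<lambda>x. F (\<Psi> x)) (\<Phi> y)"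
    using \<Phi>_nonzero[OF y] by (intro dirder_cong_open(1)[where S=U]) (auto simp: Ft_def)
  also have "\<dots> = dirder (lift (\<Psi> (\<Phi> y)) u) F (\<Psi> (\<Phi> y))"
    using \<Phi>_nonzero[OF y] by (intro dirder_eq comp_\<Psi>_has_derivative smooth_F) auto
  also have "\<dots> = dF F y (lift y u)" by (simp add: dF_dirder)
  finally show ?thesis using dF_lift[OF y] by (simp add: dF_def)
qed

lemma smooth_Ft: "smooth_on_set Ft U"
  by (rule smooth_comp_\<Psi>[OF smooth_F]) (simp add: Ft_def)

text \<open>In terms of the angular form h = g - dF dF the right side is \<tau> h + dF dF on the
  lifted vectors: the translation multiplies h by \<tau> and keeps the radial part.\<close>

lemma fund_g_Ft:
  assumes y: "y \<noteq> 0"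
  shows "fund_g Ft (\<Phi> y) u v = \<tau> y * fund_g F y (lift y u) (lift y v) + (1 - \<tau> y) * dF F y (lift y u) * dF F y (lift y v)"
proof -
  let ?x = "\<Phi> y" and ?qt = "\<lambda>x. (Ft x)\<^sup>2"
  have x: "?x \<noteq> 0" by (rule \<Phi>_nonzero[OF y])
  define k where "k = (\<lambda>y. 2 * F y * (\<tau> y * dF F y u))"
  have smk: "smooth_on_set k U"
    unfolding k_def by (intro smooth_on_set_mult smooth_on_set_const smooth_F smooth_\<tau> smooth_dF) auto
  have d1: "dirder u ?qt x = k (\<Psi> x)" if "x \<in> U" for x
  proof -
    have x0: "x \<noteq> 0" using that by simp
    have "(?qt has_derivative (\<lambda>u. 2 * Ft x * dirder u Ft x)) (at x)"
      using smooth_on_set_has_derivative[OF smooth_Ft that] by (auto intro!: derivative_eq_intros)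
    then have "dirder u ?qt x = 2 * Ft x * dF Ft x u" by (simp add: dirder_eq dF_def)
    moreover have "dF Ft x u = \<tau> (\<Psi> x) * dF F (\<Psi> x) u" using dF_Ft[OF \<Psi>_nonzero[OF x0]] \<Phi>_\<Psi>[OF x0] by simp
    ultimately show ?thesis using x0 by (simp add: k_def Ft_def)
  qed
  have "dirder v (dirder u ?qt) ?x = dirder v (\<lambda>x. k (\<Psi> x)) ?x"
    using d1 x by (intro dirder_cong_open(1)[where S=U]) auto
  also have "\<dots> = dirder (lift y v) k y"
    using dirder_eq[OF comp_\<Psi>_has_derivative[OF smk x]] by simp
  finally have A: "fund_g Ft ?x u v = (1/2) * dirder (lift y v) k y"
    by (simp add: fund_g_def)
  define V where "V = lift y v"
  define du dz where "du = dirder V (\<lambda>y. dF F y u) y" and "dz = dirder V (\<lambda>y. dF F y z) y"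
  have smooth_on_U_has_derivative: "((\<lambda>y. dF F y w) has_derivative (\<lambda>V. dirder V (\<lambda>y. dF F y w) y)) (at y)" for w
    using smooth_on_set_has_derivative[OF smooth_dF] y by auto
  have h\<tau>: "(\<tau> has_derivative (\<lambda>V. \<tau> y * \<tau> y * dirder V (\<lambda>y. dF F y z) y)) (at y)"
  proof -
    have ne: "1 - dF F y z \<noteq> 0" using dF_center[OF y] by simp
    have "((\<lambda>y. 1 - dF F y z) has_derivative (\<lambda>V. 0 - dirder V (\<lambda>y. dF F y z) y)) (at y)"
      by (intro has_derivative_diff has_derivative_const smooth_on_U_has_derivative)
    from Deriv.has_derivative_inverse[OF ne this] show ?thesis
      by (simp add: \<tau>_def[abs_def] mult_ac)
  qed
  have "(k has_derivative (\<lambda>V. 2 * F y * (\<tau> y * dirder V (\<lambda>y. dF F y u) y + \<tau> y * \<tau> y * dirder V (\<lambda>y. dF F y z) y * dF F y u)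
      + 2 * dF F y V * (\<tau> y * dF F y u))) (at y)"
    unfolding k_def by (intro has_derivative_mult has_derivative_mult_right F_has_derivative[OF y] h\<tau> smooth_on_U_has_derivative)
  then have B: "dirder V k y = 2 * F y * (\<tau> y * du + \<tau> y * \<tau> y * dz * dF F y u) + 2 * dF F y V * (\<tau> y * dF F y u)"
    by (simp add: dirder_eq du_def dz_def)
  define c where "c = \<tau> y * dF F y u"
  \<comment> \<open>The vector \<open>lift y u\<close> is frozen at y, so that only the base point
    of dF varies. This identifies the sum \<open>du + c * dz\<close> with the Hessian of F on the
    lifted vectors.\<close>
  have "dirder V (\<lambda>x. dF F x (lift y u)) y = du + c * dz"
  proof -
    have "dirder V (\<lambda>x. dF F x (lift y u)) y = dirder V (\<lambda>x. dF F x u + c * dF F x z) y"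
      using y by (intro dirder_cong_open(1)[where S=U]) (auto simp: lift_def c_def linear_add[OF linear_dF] linear_scale[OF linear_dF])
    also have "\<dots> = du + c * dz"
      unfolding du_def dz_def by (intro dirder_eq has_derivative_add has_derivative_mult_right smooth_on_U_has_derivative)
    finally show ?thesis .
  qed
  then have C: "F y * (du + c * dz) = fund_g F y (lift y u) V - dF F y (lift y u) * dF F y V"
    by (simp add: fund_g_dF[OF y])
  have dl: "dF F y (lift y u) = c" by (simp add: dF_lift[OF y] c_def)
  have "fund_g Ft ?x u v = \<tau> y * (F y * (du + c * dz)) + dF F y V * c"
    unfolding A V_def[symmetric] B by (simp add: c_def algebra_simps)
  also have "\<dots> = \<tau> y * fund_g F y (lift y u) V + (1 - \<tau> y) * dF F y (lift y u) * dF F y V"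
    unfolding C dl by (simp add: algebra_simps)
  finally show ?thesis by (simp add: V_def)
qed

lemma minkowski_norm_Ft: "minkowski_norm Ft"
  unfolding minkowski_norm_def
proof (intro conjI allI impI)
  show "0 \<le> Ft y" for y by (simp add: Ft_def F_nonneg)
  show "smooth_on_set Ft (UNIV - {0})" by (rule smooth_Ft)
  show "Ft (c *\<^sub>R x) = c * Ft x" if "0 < c" for c x
  proof (cases "x = 0")
    case False
    have "F (c *\<^sub>R x + (c * Ft x) *\<^sub>R z) = c * F (x + Ft x *\<^sub>R z)"
      using F_scale_pos[OF that, of "x + Ft x *\<^sub>R z"] by (simp add: scaleR_add_right)
    then show ?thesis using Ft_solves[OF False] that by (intro Ft_eqI) auto
  qed (simp add: Ft_def)
  show "0 < fund_g Ft x u u" if x: "x \<noteq> 0" and u: "u \<noteq> 0" for x u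
  proof -
    define y where "y = \<Psi> x"
    have y: "y \<noteq> 0" "x = \<Phi> y" using x \<Psi>_nonzero \<Phi>_\<Psi> by (auto simp: y_def)
    define d where "d = dF F y (lift y u)"
    have eq: "fund_g Ft x u u = \<tau> y * (fund_g F y (lift y u) (lift y u) - d\<^sup>2) + d\<^sup>2"
      unfolding y(2) fund_g_Ft[OF y(1)] by (simp add: d_def power2_eq_square algebra_simps)
    show ?thesis
    proof (cases "d = 0")
      case True
      then have "dF F y u = 0" using dF_lift[OF y(1), of u] \<tau>_pos[OF y(1)] by (simp add: d_def)
      then have "lift y u = u" by (simp add: lift_def)
      then show ?thesis using eq True fund_g_pos[OF y(1) u] \<tau>_pos[OF y(1)] by simp
    next
      case False
      have "0 \<le> \<tau> y * (fund_g F y (lift y u) (lift y u) - d\<^sup>2)"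
        using \<tau>_pos[OF y(1)] dF_sq_le[OF y(1), of "lift y u"] by (simp add: d_def)
      then show ?thesis using False eq by (simp add: add_nonneg_pos)
    qed
  qed
qed

sublocale T: minkowski Ft
  by standard (rule minkowski_norm_Ft)

text \<open>Up to the lift, the new metric is g pulled back by a map B that fixes y and multiplies
  the tangent space by sqrt \<tau>. Hence det B = \<tau>^((N-1)/2); the lift has determinant \<tau>,
  and squaring the product gives the exponent N + 1.\<close>

lemma g_det_Ft:
  assumes y: "y \<noteq> 0"
  shows "T.g_det (\<Phi> y) = \<tau> y ^ (CARD('n) + 1) * g_det y"
proof -
  define r where "r = sqrt (\<tau> y)"
  have r: "0 < r" "r * r = \<tau> y" using \<tau>_pos[OF y] by (simp_all add: r_def)
  note lin = linear_fund_g_left[OF y] linear_fund_g_right[OF y]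
  \<comment> \<open>The second term restores the factor 1 in the direction of y, since dF y / F y =
    1 there, and vanishes on tangent vectors.\<close>
  define B where "B = (\<lambda>w. r *\<^sub>R w + ((1 - r) * (dF F y w / F y)) *\<^sub>R y)"
  have gB: "fund_g F y (B u) (B v) = \<tau> y * fund_g F y u v + (1 - \<tau> y) * dF F y u * dF F y v" for u v
  proof -
    have e: "fund_g F y u y = F y * dF F y u" "fund_g F y y u = F y * dF F y u" "fund_g F y y y = F y * F y" for u
      using fund_g_self[OF y] fund_g_commute[OF y, of y u] dF_self[OF y] by simp_all
    have "fund_g F y (B u) (B v) = r * r * fund_g F y u v + (2 * (r * (1 - r)) + (1 - r) * (1 - r)) * dF F y u * dF F y v"
      using F_pos[OF y]
      by (simp add: B_def linear_add[OF lin(1)] linear_add[OF lin(2)] linear_scale[OF lin(1)] linear_scale[OF lin(2)] e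
          linear_add[OF linear_dF[OF y]] linear_scale[OF linear_dF[OF y]] dF_self[OF y] field_simps)
    also have "2 * (r * (1 - r)) + (1 - r) * (1 - r) = 1 - r * r" by (simp add: algebra_simps)
    finally show ?thesis by (simp only: r(2))
  qed
  define w where "w = (\<lambda>i. B (lift y (axis i 1)))"
  have "T.gm (\<Phi> y) = (\<chi> i j. w i \<bullet> (gm y *v w j))"
    unfolding g_matrix_def[of Ft] by (simp add: gm_inner[OF y] fund_g_Ft[OF y] w_def gB)
  then have D: "T.g_det (\<Phi> y) = (det (\<chi> i. w i))\<^sup>2 * g_det y"
    by (simp only: T.g_det_def det_gram g_det_def)
  define d p :: "real^'n" where "d = (\<chi> i. dF F y (axis i 1))" and "p = \<tau> y *\<^sub>R z + ((1 - r) * r / F y) *\<^sub>R y"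
  have wi: "w i $ j = r * ((if i = j then 1 else 0) + d $ i * p $ j)" for i j
  proof -
    have "w i = r *\<^sub>R (axis i 1 + d $ i *\<^sub>R p)"
      unfolding w_def B_def dF_lift[OF y] using r by (simp add: lift_def d_def p_def algebra_simps)
    then show ?thesis by (auto simp: axis_def)
  qed
  have "(\<chi> i. w i) = (\<chi> i j. r * ((\<chi> i j. (if i = j then 1 else 0) + d $ i * p $ j) $ i $ j))"
    by (simp add: vec_eq_iff wi)
  then have "det (\<chi> i. w i) = det (\<chi> i j. r * ((\<chi> i j. (if i = j then 1 else 0) + d $ i * p $ j) $ i $ j :: real))"
    by (simp only:)
  also have "\<dots> = r ^ CARD('n) * det (\<chi> i j. (if i = j then 1 else 0) + d $ i * p $ j)"
    by (simp add: det_def prod.distrib sum_distrib_left mult.left_commute)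
  also have "det (\<chi> i j. (if i = j then 1 else 0) + d $ i * p $ j) = 1 + dF F y p"
    unfolding det_rank_one_update linear_axis_expansion[OF linear_dF[OF y], of p]
    by (simp add: inner_vec_def d_def mult.commute)
  also have "1 + dF F y p = 1 + \<tau> y * dF F y z + (1 - r) * r"
    using F_pos[OF y] linear_dF[OF y] by (simp add: p_def linear_add linear_scale dF_self[OF y])
  also have "\<dots> = 1 + (\<tau> y - 1) + (1 - r) * r" by (simp only: \<tau>_dF[OF y])
  also have "\<dots> = r" using r(2) by (simp add: algebra_simps)
  finally have "(det (\<chi> i. w i))\<^sup>2 = (r * r) ^ (CARD('n) + 1)"
    by (simp add: power2_eq_square power_mult_distrib mult_ac)
  then show ?thesis using D r(2) by simp
qed

text \<open>Both directions compare x + z with the point x + t z for t = Ft x, at which F takes the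
  value t. The triangle inequality and F z < 1 decide whether moving on along z enters or leaves
  K.\<close>

lemma K_Ft: "T.K = {x. x + z \<in> K}"
proof -
  have "Ft x < 1 \<longleftrightarrow> F (x + z) < 1" for x
  proof (cases "x = 0")
    case False
    define t where "t = Ft x"
    define y where "y = x + t *\<^sub>R z"
    have t: "0 < t" "F y = t" using Ft_solves[OF False] by (auto simp: t_def y_def)
    show ?thesis
    proof
      assume "Ft x < 1"
      then have l: "t < 1" by (simp add: t_def)
      have "F (x + z) = F (y + (1 - t) *\<^sub>R z)" by (simp add: y_def algebra_simps)
      also have "\<dots> \<le> t + (1 - t) * F z" using F_triangle[of y "(1 - t) *\<^sub>R z"] F_scale[of "1 - t" z] l t by simp
      also have "\<dots> < t + (1 - t) * 1" using F_center l by (intro add_strict_left_mono mult_strict_left_mono) auto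
      finally show "F (x + z) < 1" by simp
    next
      assume a: "F (x + z) < 1"
      show "Ft x < 1"
      proof (rule ccontr)
        assume "\<not> Ft x < 1"
        then have l: "1 \<le> t" by (simp add: t_def)
        have "t = F ((x + z) + (t - 1) *\<^sub>R z)" using t by (simp add: y_def algebra_simps)
        also have "\<dots> \<le> F (x + z) + (t - 1) * F z" using F_triangle[of "x + z" "(t - 1) *\<^sub>R z"] F_scale[of "t - 1" z] l by simp
        also have "\<dots> < 1 + (t - 1) * 1" using F_center l a by (intro add_less_le_mono mult_left_mono) auto
        finally show False by simp
      qed
    qed
  qed (simp add: Ft_def F_center)
  then show ?thesis by (auto simp: T.K_def K_def)
qed

lemma emeasure_K_Ft: "emeasure lborel T.K = emeasure lborel K"
proof -
  have "emeasure lborel K = emeasure (distr lborel borel ((+) z)) K" by (simp add: lborel_distr_plus)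
  also have "\<dots> = emeasure lborel T.K"
    by (subst emeasure_distr) (auto simp: K_Ft vimage_def add.commute)
  finally show ?thesis ..
qed

lemma centroid_K_Ft: "(\<integral>x. indicator T.K x *\<^sub>R x \<partial>lborel) = (\<integral>x. indicator K x *\<^sub>R x \<partial>lborel) - measure lborel K *\<^sub>R z"
proof -
  have ind: "integrable lborel (\<lambda>x. indicator K x *\<^sub>R z)"
    using emeasure_K by (intro integrable_scaleR_left integrable_real_indicator) auto
  have "(\<integral>x. indicator K x *\<^sub>R x \<partial>lborel) - measure lborel K *\<^sub>R z = (\<integral>x. indicator K x *\<^sub>R x - indicator K x *\<^sub>R z \<partial>lborel)"
  proof -
    have "(\<integral>x. indicator K x *\<^sub>R z \<partial>lborel) = measure lborel K *\<^sub>R z"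
      using emeasure_K by (subst integral_scaleR_left) (auto intro!: integrable_real_indicator)
    then show ?thesis using ind integrable_K by (subst Bochner_Integration.integral_diff) auto
  qed
  also have "\<dots> = (\<integral>x. indicator K x *\<^sub>R (x - z) \<partial>distr lborel borel ((+) z))"
    by (simp add: lborel_distr_plus scaleR_diff_right)
  also have "\<dots> = (\<integral>x. indicator T.K x *\<^sub>R x \<partial>lborel)"
    by (subst integral_distr) (auto simp: K_Ft indicator_def add.commute intro!: Bochner_Integration.integral_cong)
  finally show ?thesis ..
qed

text \<open>The exponent 1 / (N + 1) reduces the factor \<tau>^(N+1) of the determinant to \<tau>,
  which cancels the Jacobian 1 / \<tau> of the substitution by \<open>\<Phi>\<close>.\<close>

lemma centro_affine_area_Ft: "T.centro_affine_area = centro_affine_area"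
proof -
  let ?a = "1 / (real CARD('n) + 1)"
  define f where "f = (\<lambda>x. ennreal (indicator (T.K - {0}) x * T.g_det x powr ?a))"
  have [measurable]: "f \<in> borel_measurable borel" unfolding f_def using T.borel_powr_g_det by measurable
  have img: "\<Phi> ` (K - {0}) = T.K - {0}"
  proof -
    have "T.K - {0} = {x \<in> U. F (\<Psi> x) < 1}" by (auto simp: T.K_def Ft_def)
    also have "\<dots> = \<Phi> ` (K - {0})"
    proof
      show "{x \<in> U. F (\<Psi> x) < 1} \<subseteq> \<Phi> ` (K - {0})"
      proof
        fix x assume "x \<in> {x \<in> U. F (\<Psi> x) < 1}"
        then show "x \<in> \<Phi> ` (K - {0})"
          using \<Phi>_\<Psi>[of x] \<Psi>_nonzero[of x] by (intro image_eqI[of _ _ "\<Psi> x"]) (auto simp: K_def)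
      qed
      show "\<Phi> ` (K - {0}) \<subseteq> {x \<in> U. F (\<Psi> x) < 1}"
      proof (rule image_subsetI)
        fix y assume "y \<in> K - {0}"
        then show "\<Phi> y \<in> {x \<in> U. F (\<Psi> x) < 1}" using \<Phi>_nonzero[of y] by (simp add: K_def)
      qed
    qed
    finally show ?thesis ..
  qed
  have "T.centro_affine_area = (\<integral>\<^sup>+x. f x * indicator (\<Phi> ` (K - {0})) x \<partial>lborel)"
    unfolding T.centro_affine_area_def img f_def by (intro nn_integral_cong) (auto simp: indicator_def)
  also have "\<dots> = (\<integral>\<^sup>+y. f (\<Phi> y) * ennreal \<bar>det (matrix (\<Phi>' y))\<bar> * indicator (K - {0}) y \<partial>lborel)"
  proof (rule nn_integral_change_of_variables(2))
    show "open (K - {0})" using open_K by auto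
    have "continuous_on U (\<lambda>y. inverse (\<tau> y))"
      using \<tau>_pos by (intro continuous_on_inverse smooth_on_set_continuous_on[OF smooth_\<tau>]) (auto simp: less_imp_neq[symmetric])
    then have "continuous_on (K - {0}) (\<lambda>y. inverse (\<tau> y))" by (rule continuous_on_subset) auto
    then show "continuous_on (K - {0}) (\<lambda>y. det (matrix (\<Phi>' y)))"
      by (rule continuous_on_eq) (simp add: det_\<Phi>')
  qed (auto intro: \<Phi>_has_derivative inj_onI dest: \<Phi>_inj)
  also have "\<dots> = centro_affine_area"
    unfolding centro_affine_area_def
  proof (intro nn_integral_cong)
    fix y
    show "f (\<Phi> y) * ennreal \<bar>det (matrix (\<Phi>' y))\<bar> * indicator (K - {0}) y = ennreal (g_det y powr ?a) * indicator (K - {0}) y"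
    proof (cases "y \<in> K - {0}")
      case True
      then have y: "y \<noteq> 0" by simp
      have "\<Phi> y \<in> T.K - {0}" using True img by auto
      moreover have "(\<tau> y ^ (CARD('n) + 1)) powr ?a = \<tau> y"
      proof -
        have "(\<tau> y ^ (CARD('n) + 1)) powr ?a = \<tau> y powr (real (CARD('n) + 1) * ?a)"
          using \<tau>_pos[OF y] by (simp only: powr_powr flip: powr_realpow)
        also have "real (CARD('n) + 1) * ?a = 1" by simp
        finally show ?thesis using \<tau>_pos[OF y] by simp
      qed
      ultimately have "f (\<Phi> y) = ennreal (\<tau> y * g_det y powr ?a)"
        using g_det_Ft[OF y] \<tau>_pos[OF y] g_det_pos[OF y] by (simp add: f_def powr_mult)
      then show ?thesis using \<tau>_pos[OF y] True by (simp add: det_\<Phi>'[OF y] ennreal_mult''[symmetric])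
    qed simp
  qed
  finally show ?thesis .
qed

end

section \<open>Deicke's theorem\<close>

text \<open>By translation invariance every difference quotient of f integrates to 0. With steps at
  most 1 the quotients vanish off a fixed ball and are dominated there through the mean value
  theorem, so the limit may be taken under the integral.\<close>

lemma integral_dirder_zero:
  fixes f :: "real^'n \<Rightarrow> real"
  assumes diff: "\<And>x. f differentiable (at x)" and cont: "continuous_on UNIV (dirder u f)"
    and supp: "\<And>x. R < norm x \<Longrightarrow> f x = 0"
  shows "integrable lborel (dirder u f)" and "(\<integral>x. dirder u f x \<partial>lborel) = 0"
proof -
  have contf: "continuous_on UNIV f"
    using diff by (meson continuous_at_imp_continuous_on differentiable_imp_continuous_within)
  have [measurable]: "f \<in> borel_measurable borel" "dirder u f \<in> borel_measurable borel"
    using contf cont by (auto intro: borel_measurable_continuous_onI)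
  have line: "((\<lambda>s. f (x + s *\<^sub>R u)) has_real_derivative dirder u f (x + s *\<^sub>R u)) (at s)" for x s
  proof -
    have "((\<lambda>s. x + s *\<^sub>R u) has_derivative (\<lambda>s. s *\<^sub>R u)) (at s)"
      using has_derivative_add[OF has_derivative_const has_derivative_scaleR_left[OF has_derivative_ident]] by simp
    moreover have "(f has_derivative (\<lambda>v. dirder v f (x + s *\<^sub>R u))) (at (x + s *\<^sub>R u))"
      using diff frechet_derivative_works by blast
    ultimately have "((\<lambda>s. f (x + s *\<^sub>R u)) has_derivative (\<lambda>t. dirder (t *\<^sub>R u) f (x + s *\<^sub>R u))) (at s)"
      by (rule has_derivative_compose)
    moreover have "(\<lambda>t. dirder (t *\<^sub>R u) f (x + s *\<^sub>R u)) = (\<lambda>t. t * dirder u f (x + s *\<^sub>R u))"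
      using linear_scale[OF dirder_linear[OF diff]] by auto
    ultimately show ?thesis by (simp add: has_field_derivative_def mult_commute_abs)
  qed
  define C where "C = cball (0::real^'n) (R + norm u + 1)"
  have cC: "compact C" by (simp add: C_def)
  have "compact ((\<lambda>x. \<bar>dirder u f x\<bar>) ` C)"
    by (intro compact_continuous_image cC continuous_on_rabs continuous_on_subset[OF cont]) auto
  then obtain B where B: "\<And>x. x \<in> C \<Longrightarrow> \<bar>dirder u f x\<bar> \<le> B"
    using compact_imp_bounded bounded_real by (metis (no_types, lifting) abs_abs imageI)
  define d where "d = (\<lambda>n::nat. 1 / real (Suc n))"
  have d: "0 < d n" "d n \<le> 1" for n by (simp_all add: d_def)
  define D where "D = (\<lambda>n x. (f (x + d n *\<^sub>R u) - f x) / d n)"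
  have [measurable]: "D n \<in> borel_measurable borel" for n unfolding D_def by measurable
  have D_mvt: "\<exists>s. 0 < s \<and> s < d n \<and> D n x = dirder u f (x + s *\<^sub>R u)" for n x
  proof -
    have "\<exists>s. 0 < s \<and> s < d n \<and> f (x + d n *\<^sub>R u) - f (x + 0 *\<^sub>R u) = (d n - 0) * dirder u f (x + s *\<^sub>R u)"
      using d[of n] by (intro MVT2 line) auto
    then show ?thesis using d[of n] by (auto simp: D_def)
  qed
  have D_bound: "\<bar>D n x\<bar> \<le> \<bar>B\<bar> * indicator C x" for n x
  proof (cases "x \<in> cball 0 (R + norm u)")
    case True
    obtain s where s: "0 < s" "s < d n" "D n x = dirder u f (x + s *\<^sub>R u)" using D_mvt by blast
    show ?thesis
    proof (cases "x + s *\<^sub>R u \<in> C")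
      case True
      have "x \<in> C" using \<open>x \<in> cball 0 (R + norm u)\<close> by (simp add: C_def)
      then show ?thesis using B[OF True] s by simp
    next
      case False
      then have n: "R + norm u + 1 < norm (x + s *\<^sub>R u)" by (simp add: C_def)
      have "norm (x + s *\<^sub>R u) \<le> norm x + s * norm u" using norm_triangle_ineq[of x "s *\<^sub>R u"] s(1) by simp
      moreover have "s * norm u \<le> norm u" using s d[of n] by (intro mult_left_le_one_le) auto
      moreover have "norm (x + d n *\<^sub>R u) \<ge> norm (x + s *\<^sub>R u) - (d n - s) * norm u"
      proof -
        have "x + s *\<^sub>R u = (x + d n *\<^sub>R u) - (d n - s) *\<^sub>R u" by (simp add: algebra_simps)
        then have "norm (x + s *\<^sub>R u) \<le> norm (x + d n *\<^sub>R u) + norm ((d n - s) *\<^sub>R u)" by (metis norm_triangle_ineq4)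
        then show ?thesis using s by simp
      qed
      moreover have "(d n - s) * norm u \<le> norm u" using s d[of n] by (intro mult_left_le_one_le) auto
      moreover have "norm x \<ge> norm (x + s *\<^sub>R u) - s * norm u" using calculation(1) by simp
      ultimately have "R < norm (x + d n *\<^sub>R u)" "R < norm x" using n norm_ge_zero[of u] by linarith+
      then have "D n x = 0" using supp by (simp add: D_def)
      then show ?thesis by simp
    qed
  next
    case False
    have "norm (x + d n *\<^sub>R u) \<ge> norm x - d n * norm u"
      using norm_diff_ineq[of x "d n *\<^sub>R u"] d[of n] by simp
    moreover have "d n * norm u \<le> norm u" using d[of n] by (intro mult_left_le_one_le) auto
    moreover have "R + norm u < norm x" using False by simp
    ultimately have "R < norm (x + d n *\<^sub>R u)" "R < norm x" using norm_ge_zero[of u] by linarith+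
    then have "D n x = 0" using supp by (simp add: D_def)
    then show ?thesis by simp
  qed
  have int_bd: "integrable lborel (\<lambda>x. \<bar>B\<bar> * indicator C x)"
    using emeasure_lborel_cball_finite[of 0 "R + norm u + 1"] cC
    by (intro integrable_mult_right integrable_real_indicator) (auto simp: C_def)
  have lim: "(\<lambda>n. D n x) \<longlonglongrightarrow> dirder u f x" for x
  proof -
    have "((\<lambda>s. (f (x + (0 + s) *\<^sub>R u) - f (x + 0 *\<^sub>R u)) / s) \<longlongrightarrow> dirder u f (x + 0 *\<^sub>R u)) (at 0)"
      using line[of x 0] unfolding DERIV_def .
    moreover have "filterlim d (at 0) sequentially"
      unfolding filterlim_at d_def using LIMSEQ_inverse_real_of_nat
      by (auto simp: inverse_eq_divide intro!: always_eventually)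
    ultimately show ?thesis unfolding D_def using filterlim_compose by force
  qed
  have conv: "(\<lambda>n. \<integral>x. D n x \<partial>lborel) \<longlonglongrightarrow> (\<integral>x. dirder u f x \<partial>lborel)"
    by (rule integral_dominated_convergence[OF _ _ int_bd]) (use lim D_bound in auto)
  have intf: "integrable lborel f"
  proof -
    have "integrable lborel (\<lambda>x. indicator (cball 0 R) x *\<^sub>R f x)"
      by (intro borel_integrable_compact continuous_on_subset[OF contf]) auto
    moreover have "(\<lambda>x. indicator (cball 0 R) x *\<^sub>R f x) = f" using supp by (auto simp: indicator_def fun_eq_iff)
    ultimately show ?thesis by (simp only:)
  qed
  have "(\<integral>x. D n x \<partial>lborel) = 0" for n
  proof -
    have shift: "(\<integral>x. f (x + c) \<partial>lborel) = (\<integral>x. f x \<partial>lborel)" "integrable lborel (\<lambda>x. f (x + c))" for c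
    proof -
      have "(\<integral>x. f x \<partial>lborel) = (\<integral>x. f x \<partial>distr lborel borel ((+) c))" by (simp add: lborel_distr_plus)
      also have "\<dots> = (\<integral>x. f (x + c) \<partial>lborel)" by (subst integral_distr) (auto simp: add.commute)
      finally show "(\<integral>x. f (x + c) \<partial>lborel) = (\<integral>x. f x \<partial>lborel)" ..
      have "integrable (distr lborel borel ((+) c)) f" using intf by (simp add: lborel_distr_plus)
      then show "integrable lborel (\<lambda>x. f (x + c))" by (subst (asm) integrable_distr_eq) (auto simp: add.commute)
    qed
    show ?thesis unfolding D_def using shift[of "d n *\<^sub>R u"] intf by simp
  qed
  then show "(\<integral>x. dirder u f x \<partial>lborel) = 0" using conv by (simp add: LIMSEQ_const_iff)
  have out: "dirder u f x = 0" if "R < norm x" for x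
  proof -
    have "dirder u f x = dirder u (\<lambda>_. 0) x"
      using supp that by (intro dirder_cong_open(1)[where S="{x. R < norm x}"])
        (auto intro!: open_Collect_less continuous_intros)
    then show ?thesis by (simp add: dirder_eq[OF has_derivative_const])
  qed
  have "integrable lborel (\<lambda>x. indicator (cball 0 R) x *\<^sub>R dirder u f x)"
    by (intro borel_integrable_compact continuous_on_subset[OF cont]) auto
  moreover have "(\<lambda>x. indicator (cball 0 R) x *\<^sub>R dirder u f x) = dirder u f" using out by (auto simp: indicator_def fun_eq_iff)
  ultimately show "integrable lborel (dirder u f)" by (simp only:)
qed

text \<open>A permutation other than the identity moves at least two indices. After one factor is
  differentiated, another off-diagonal entry of the identity matrix remains, so only the trace
  survives.\<close>

lemma has_field_derivative_det_at_identity: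
  fixes M :: "real \<Rightarrow> real^'n^'n"
  assumes der: "\<And>i j. ((\<lambda>t. M t $ i $ j) has_real_derivative M' $ i $ j) (at a)" and id: "M a = mat 1"
  shows "((\<lambda>t. det (M t)) has_real_derivative (\<Sum>i\<in>UNIV. M' $ i $ i)) (at a)"
proof -
  have prod: "((\<lambda>t. \<Prod>i\<in>UNIV. M t $ i $ p i) has_real_derivative
      (\<Sum>i\<in>UNIV. M' $ i $ p i * (\<Prod>j\<in>UNIV - {i}. (mat 1 :: real^'n^'n) $ j $ p j))) (at a)" for p :: "'n \<Rightarrow> 'n"
    using has_field_derivative_prod[of UNIV "\<lambda>i t. M t $ i $ p i" "\<lambda>i. M' $ i $ p i" a] der id by simp
  have val: "(\<Sum>i\<in>UNIV. M' $ i $ p i * (\<Prod>j\<in>UNIV - {i}. (mat 1 :: real^'n^'n) $ j $ p j)) = (if p = id then (\<Sum>i\<in>UNIV. M' $ i $ i) else 0)"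
    if p: "p permutes UNIV" for p :: "'n \<Rightarrow> 'n"
  proof (cases "p = id")
    case True
    then show ?thesis by (simp add: mat_def)
  next
    case False
    have zero: "(\<Prod>j\<in>UNIV - {i}. (mat 1 :: real^'n^'n) $ j $ p j) = 0" for i
    proof -
      obtain k where k: "p k \<noteq> k" using False by (auto simp: fun_eq_iff)
      have "\<exists>j. j \<noteq> i \<and> p j \<noteq> j"
      proof (cases "k = i")
        case True
        have "p (p k) \<noteq> p k" using k permutes_inj[OF p] by (auto dest: injD)
        then show ?thesis using k True by (intro exI[of _ "p k"]) auto
      qed (use k in blast)
      then obtain j where "j \<noteq> i" "p j \<noteq> j" by blast
      then show ?thesis by (intro prod_zero) (auto simp: mat_def intro!: bexI[of _ j])
    qed
    show ?thesis using False by (simp only: zero) simp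
  qed
  have "((\<lambda>t. \<Sum>p | p permutes UNIV. of_int (sign p) * (\<Prod>i\<in>UNIV. M t $ i $ p i)) has_real_derivative
      (\<Sum>p | p permutes UNIV. of_int (sign p) * (\<Sum>i\<in>UNIV. M' $ i $ p i * (\<Prod>j\<in>UNIV - {i}. (mat 1 :: real^'n^'n) $ j $ p j)))) (at a)"
    by (intro DERIV_sum DERIV_cmult prod)
  also have "(\<Sum>p | p permutes UNIV. of_int (sign p) * (\<Sum>i\<in>UNIV. M' $ i $ p i * (\<Prod>j\<in>UNIV - {i}. (mat 1 :: real^'n^'n) $ j $ p j)))
      = (\<Sum>p | p permutes (UNIV :: 'n set). if p = id then (\<Sum>i\<in>UNIV. M' $ i $ i) else 0)"
    by (intro sum.cong) (auto simp: val sign_id)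
  also have "\<dots> = (\<Sum>i\<in>UNIV. M' $ i $ i)"
    by (subst sum.delta) (auto simp: finite_permutations permutes_id)
  finally show ?thesis by (simp add: det_def)
qed

lemma smooth_on_set_sum:
  "open S \<Longrightarrow> (\<And>i. i \<in> I \<Longrightarrow> smooth_on_set (f i) S) \<Longrightarrow> smooth_on_set (\<lambda>y. \<Sum>i\<in>I. f i y) S"
  by (induction I rule: infinite_finite_induct) (auto intro: smooth_on_set_add smooth_on_set_const)

lemma smooth_on_set_prod:
  "open S \<Longrightarrow> (\<And>i. i \<in> I \<Longrightarrow> smooth_on_set (f i) S) \<Longrightarrow> smooth_on_set (\<lambda>y. \<Prod>i\<in>I. f i y) S"
  by (induction I rule: infinite_finite_induct) (auto intro: smooth_on_set_mult smooth_on_set_const)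

lemma smooth_on_set_det:
  assumes "open S" "\<And>i j. smooth_on_set (\<lambda>y. A y $ i $ j) S"
  shows "smooth_on_set (\<lambda>y. det (A y)) S"
  unfolding det_def
  by (intro smooth_on_set_sum smooth_on_set_mult smooth_on_set_const smooth_on_set_prod assms)

text \<open>The inverse of A factors as B = W^T W, so the trace is that of Z^2 for the symmetric
  matrix Z = W S W^T, which is the sum of its squared entries.\<close>

lemma trace_square_posdef:
  fixes A B S :: "real^'n^'n"
  assumes A: "transpose A = A" "\<And>x. x \<noteq> 0 \<Longrightarrow> 0 < x \<bullet> (A *v x)" and B: "A ** B = mat 1"
    and S: "transpose S = S"
  shows "0 \<le> trace (B ** S ** B ** S)" and "trace (B ** S ** B ** S) = 0 \<Longrightarrow> S = 0"
proof -
  obtain W :: "real^'n^'n" where W: "W ** A ** transpose W = mat 1" using posdef_frame_exists A by blast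
  have WA: "A ** transpose W ** W = mat 1"
    using W by (metis matrix_left_right_inverse matrix_mul_assoc)
  have "B = B ** (A ** transpose W ** W)" by (simp add: WA)
  also have "\<dots> = (B ** A) ** (transpose W ** W)" by (simp add: matrix_mul_assoc)
  also have "B ** A = mat 1" using B by (simp add: matrix_left_right_inverse)
  finally have BW: "B = transpose W ** W" by simp
  define Z where "Z = W ** S ** transpose W"
  have Zsym: "transpose Z = Z" by (simp add: Z_def matrix_transpose_mul S matrix_mul_assoc)
  have "trace (B ** S ** B ** S) = trace (transpose W ** (W ** S ** transpose W ** W ** S))"
    by (simp add: BW matrix_mul_assoc)
  also have "\<dots> = trace (Z ** Z)"
    by (subst trace_mul_sym) (simp add: Z_def matrix_mul_assoc)
  also have "\<dots> = (\<Sum>i\<in>UNIV. \<Sum>j\<in>UNIV. (Z $ i $ j)\<^sup>2)"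
  proof -
    have "Z $ j $ i = Z $ i $ j" for i j
      using arg_cong[OF Zsym, of "\<lambda>M. M $ i $ j"] by (simp add: transpose_def)
    then show ?thesis by (simp add: trace_def matrix_matrix_mult_def power2_eq_square)
  qed
  finally have tr: "trace (B ** S ** B ** S) = (\<Sum>i\<in>UNIV. \<Sum>j\<in>UNIV. (Z $ i $ j)\<^sup>2)" .
  then show "0 \<le> trace (B ** S ** B ** S)" by (simp add: sum_nonneg)
  assume "trace (B ** S ** B ** S) = 0"
  then have "(\<Sum>i\<in>UNIV. \<Sum>j\<in>UNIV. (Z $ i $ j)\<^sup>2) = 0" using tr by simp
  then have "Z $ i $ j = 0" for i j
    by (simp add: sum_nonneg_eq_0_iff sum_nonneg)
  then have Z0: "Z = 0" by (simp add: vec_eq_iff)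
  have "W ** (A ** transpose W) = mat 1" using W by (simp add: matrix_mul_assoc)
  then have "(A ** transpose W) ** W = mat 1" by (simp add: matrix_left_right_inverse)
  then have "S = ((A ** transpose W) ** W) ** S ** (transpose W ** (W ** A))"
    by (metis W matrix_left_right_inverse matrix_mul_assoc matrix_mul_lid matrix_mul_rid)
  also have "\<dots> = (A ** transpose W) ** Z ** (W ** A)" by (simp add: Z_def matrix_mul_assoc)
  also have "\<dots> = 0" by (simp add: Z0)
  finally show "S = 0" .
qed

lemma continuous_integral_zero_nonneg:
  fixes f :: "'a::euclidean_space \<Rightarrow> real"
  assumes "continuous_on UNIV f" "\<And>x. 0 \<le> f x" "integrable lborel f" "(\<integral>x. f x \<partial>lborel) = 0"
  shows "f x = 0"
proof (rule ccontr)
  assume "f x \<noteq> 0"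
  then have x: "x \<in> {x. 0 < f x}" using assms(2)[of x] by simp
  have "AE x in lborel. f x = 0"
    using integral_nonneg_eq_0_iff_AE[OF assms(3)] assms(2,4) by simp
  then obtain N where N: "{x. f x \<noteq> 0} \<subseteq> N" "N \<in> null_sets lborel"
    unfolding eventually_ae_filter by auto
  then have "negligible N" by (simp add: negligible_iff_null_sets null_sets_completionI)
  then have "negligible {x. 0 < f x}" by (rule negligible_subset) (use N in force)
  moreover have "open {x. 0 < f x}" using assms(1) by (intro open_Collect_less continuous_intros)
  ultimately show False using x open_not_negligible by blast
qed

text \<open>A nonnegative C^1 function that is positive exactly on (1, 2).\<close>

definition cutoff :: "real \<Rightarrow> real" where
  "cutoff t = (let p = (t - 1) * (2 - t) in p * p + p * \<bar>p\<bar>)"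

definition cutoff' :: "real \<Rightarrow> real" where
  "cutoff' t = (let p = (t - 1) * (2 - t) in (2 * p + 2 * \<bar>p\<bar>) * (3 - 2 * t))"

lemma mult_abs_has_derivative: "((\<lambda>p::real. p * \<bar>p\<bar>) has_real_derivative 2 * \<bar>p\<bar>) (at p)"
proof -
  consider "0 < p" | "p < 0" | "p = 0" by linarith
  then show ?thesis
  proof cases
    case 1
    have "((\<lambda>p::real. p * p) has_real_derivative 2 * \<bar>p\<bar>) (at p)"
      using 1 by (auto intro!: derivative_eq_intros)
    then show ?thesis
      by (rule has_field_derivative_transform_within_open[where S="{0<..}"]) (use 1 in auto)
  next
    case 2
    have "((\<lambda>p::real. - (p * p)) has_real_derivative 2 * \<bar>p\<bar>) (at p)"
      using 2 by (auto intro!: derivative_eq_intros)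
    then show ?thesis
      by (rule has_field_derivative_transform_within_open[where S="{..<0}"]) (use 2 in auto)
  next
    case 3
    have "((\<lambda>h::real. \<bar>h\<bar>) \<longlongrightarrow> 0) (at 0)" by (auto intro!: tendsto_eq_intros)
    then have "((\<lambda>h::real. ((0 + h) * \<bar>0 + h\<bar> - 0 * \<bar>0\<bar>) / h) \<longlongrightarrow> 0) (at 0)"
      by (rule Lim_transform_within[where d=1]) auto
    then show ?thesis using 3 by (simp add: DERIV_def)
  qed
qed

lemma cutoff_has_derivative: "(cutoff has_real_derivative cutoff' t) (at t)"
proof -
  have p: "((\<lambda>t::real. (t - 1) * (2 - t)) has_real_derivative (3 - 2 * t)) (at t)"
    by (auto intro!: derivative_eq_intros)
  have "((\<lambda>p::real. p * p + p * \<bar>p\<bar>) has_real_derivative (2 * p + 2 * \<bar>p\<bar>)) (at p)" for p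
    by (rule DERIV_add[OF _ mult_abs_has_derivative]) (auto intro!: derivative_eq_intros)
  from DERIV_chain2[OF this p] show ?thesis
    by (simp add: cutoff_def[abs_def] cutoff'_def Let_def)
qed

lemma cutoff_nonneg: "0 \<le> cutoff t" and cutoff_pos: "1 < t \<Longrightarrow> t < 2 \<Longrightarrow> 0 < cutoff t"
  and cutoff_zero: "t \<le> 1 \<or> 2 \<le> t \<Longrightarrow> cutoff t = 0"
proof -
  have nn: "0 \<le> p * p + p * \<bar>p\<bar>" for p :: real by (cases "0 \<le> p") auto
  then show "0 \<le> cutoff t" by (simp add: cutoff_def Let_def)
  show "0 < cutoff t" if "1 < t" "t < 2"
  proof -
    have "0 < (t - 1) * (2 - t)" using that by simp
    moreover have "0 < p * p + p * \<bar>p\<bar>" if "0 < p" for p :: real using that by (simp add: add_pos_pos)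
    ultimately show ?thesis unfolding cutoff_def Let_def by blast
  qed
  show "cutoff t = 0" if "t \<le> 1 \<or> 2 \<le> t"
  proof -
    have "(t - 1) * (2 - t) \<le> 0" using that by (auto simp: mult_le_0_iff)
    moreover have "p * p + p * \<bar>p\<bar> = 0" if "p \<le> 0" for p :: real using that by (simp add: abs_of_nonpos)
    ultimately show ?thesis unfolding cutoff_def Let_def by blast
  qed
qed

lemma continuous_cutoff': "continuous_on S cutoff'"
  unfolding cutoff'_def Let_def by (intro continuous_intros)

section \<open>First and second derivatives of the fundamental tensor\<close>

context minkowski
begin

text \<open>Twice the Cartan tensor contracted with w. As a third derivative of F^2 / 2 it is
  symmetric in all three arguments.\<close>

definition dgm :: "real^'n \<Rightarrow> real^'n \<Rightarrow> real^'n^'n" where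
  "dgm w y = (\<chi> i j. dirder w (\<lambda>y. gm y $ i $ j) y)"

definition ddgm :: "real^'n \<Rightarrow> real^'n \<Rightarrow> real^'n^'n" where
  "ddgm w y = (\<chi> i j. dirder w (\<lambda>y. dgm w y $ i $ j) y)"

text \<open>The inverse of g by Cramer's rule; in this form its entries inherit smoothness from
  those of g.\<close>

definition ginv :: "real^'n \<Rightarrow> real^'n^'n" where
  "ginv y = (\<chi> k l. det (\<chi> i j. if j = k then axis l 1 $ i else gm y $ i $ j) * inverse (det (gm y)))"

lemma open_U: "open U" by auto

lemma smooth_fund_g: "smooth_on_set (\<lambda>y. fund_g F y u v) U"
  unfolding fund_g_dirder
  by (intro smooth_on_set_mult smooth_on_set_const open_U smooth_on_set_dirder smooth_q)

lemma smooth_gm: "smooth_on_set (\<lambda>y. gm y $ i $ j) U"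
  using smooth_fund_g by (simp add: g_matrix_def)

lemma smooth_ginv: "smooth_on_set (\<lambda>y. ginv y $ k $ l) U"
proof -
  have "smooth_on_set (\<lambda>y. (\<chi> i j. if j = k then axis l 1 $ i else gm y $ i $ j) $ i $ j) U" for i j
    by (cases "j = k") (simp_all add: smooth_gm smooth_on_set_const open_U)
  moreover have "det (gm y) \<noteq> 0" if "y \<in> U" for y using g_det_pos[of y] that by (simp add: g_det_def)
  ultimately show ?thesis
    unfolding ginv_def by (simp, intro smooth_on_set_mult smooth_on_set_det smooth_on_set_inverse smooth_gm open_U) auto
qed

lemma gm_ginv: "y \<noteq> 0 \<Longrightarrow> gm y ** ginv y = mat 1"
proof -
  assume y: "y \<noteq> 0"
  have d: "det (gm y) \<noteq> 0" using g_det_pos[OF y] by (simp add: g_det_def)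
  have "(gm y ** ginv y) $ i $ l = mat 1 $ i $ l" for i l
  proof -
    have "column l (ginv y) = (\<chi> k. det (\<chi> i j. if j = k then axis l 1 $ i else gm y $ i $ j) / det (gm y))"
      by (simp add: column_def ginv_def divide_inverse)
    then have "gm y *v column l (ginv y) = axis l 1" using cramer[OF d, of "column l (ginv y)" "axis l 1"] by simp
    moreover have "(gm y ** ginv y) $ i $ l = (gm y *v column l (ginv y)) $ i"
      by (simp add: matrix_matrix_mult_def matrix_vector_mult_def column_def)
    ultimately show ?thesis by (simp add: mat_def axis_def)
  qed
  then show ?thesis by (simp add: vec_eq_iff)
qed

lemma ginv_gm: "y \<noteq> 0 \<Longrightarrow> ginv y ** gm y = mat 1"
  using gm_ginv matrix_left_right_inverse by blast

lemma gm_dirder: "gm y $ i $ j = (1/2) * dirder (axis j 1) (dirder (axis i 1) q) y"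
  by (simp add: g_matrix_def fund_g_dirder)

lemma dirder_half: 
  assumes "smooth_on_set f U" "y \<noteq> 0"
  shows "dirder w (\<lambda>y. (1/2) * f y) y = (1/2) * dirder w f y"
  using smooth_on_set_has_derivative[OF assms(1)] assms(2) by (intro dirder_eq has_derivative_mult_right) auto

lemma dgm_eq: "y \<noteq> 0 \<Longrightarrow> dgm w y $ i $ j = (1/2) * dirder w (dirder (axis j 1) (dirder (axis i 1) q)) y"
proof -
  assume y: "y \<noteq> 0"
  have "dgm w y $ i $ j = dirder w (\<lambda>y. (1/2) * dirder (axis j 1) (dirder (axis i 1) q) y) y"
    by (simp only: dgm_def vec_lambda_beta gm_dirder)
  also have "\<dots> = (1/2) * dirder w (dirder (axis j 1) (dirder (axis i 1) q)) y"
    by (rule dirder_half[OF _ y]) (intro smooth_on_set_dirder smooth_q)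
  finally show ?thesis .
qed

lemma dgm_symmetric: "y \<noteq> 0 \<Longrightarrow> transpose (dgm w y) = dgm w y"
proof -
  assume y: "y \<noteq> 0"
  have "dirder w (\<lambda>y. gm y $ j $ i) y = dirder w (\<lambda>y. gm y $ i $ j) y" for i j
    using y by (intro dirder_cong_open(1)[OF open_U]) (auto simp: g_matrix_def fund_g_commute)
  then show ?thesis by (simp add: transpose_def dgm_def vec_eq_iff)
qed

lemma dgm_swap: "y \<noteq> 0 \<Longrightarrow> dgm (axis k 1) y $ i $ j = dgm (axis j 1) y $ k $ i"
proof -
  assume y: "y \<noteq> 0"
  have "dgm (axis k 1) y $ i $ j = dgm (axis j 1) y $ i $ k"
    unfolding dgm_eq[OF y] using dirder_commute[OF smooth_on_set_dirder[OF smooth_q], of y] y by simp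
  also have "\<dots> = dgm (axis j 1) y $ k $ i"
    using arg_cong[OF dgm_symmetric[OF y, of "axis j 1"], of "\<lambda>M. M $ k $ i"] by (simp add: transpose_def)
  finally show ?thesis .
qed

end

locale minkowski_constant_det = minkowski F for F :: "real^'n \<Rightarrow> real" +
  fixes c :: real
  assumes g_det_const: "\<And>y. y \<noteq> 0 \<Longrightarrow> g_det y = c"
begin

text \<open>The determinant of g(y)^(-1) g(y + t w) is constant for small t, and its derivative at t
  = 0 is this trace. In other words, the mean Cartan torsion vanishes.\<close>

lemma trace_ginv_dgm: assumes y: "y \<noteq> 0" shows "trace (ginv y ** dgm w y) = 0"
proof -
  define M where "M = (\<lambda>t. ginv y ** gm (y + t *\<^sub>R w))"
  have "((\<lambda>t. det (M t)) has_real_derivative (\<Sum>i\<in>UNIV. (ginv y ** dgm w y) $ i $ i)) (at 0)"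
  proof (rule has_field_derivative_det_at_identity)
    show "M 0 = mat 1" using ginv_gm[OF y] by (simp add: M_def)
    have "((\<lambda>t. gm (y + t *\<^sub>R w) $ k $ j) has_real_derivative dgm w y $ k $ j) (at 0)" for k j
      using smooth_on_set_line_derivative[OF smooth_gm, of y 0 w] y by (simp add: dgm_def)
    then show "((\<lambda>t. M t $ i $ j) has_real_derivative (ginv y ** dgm w y) $ i $ j) (at 0)" for i j
      unfolding M_def matrix_matrix_mult_def by (auto intro!: DERIV_sum DERIV_cmult)
  qed
  moreover have "((\<lambda>t. det (M t)) has_real_derivative 0) (at 0)"
  proof (rule has_field_derivative_transform_within_open)
    show "((\<lambda>t. det (ginv y) * c) has_real_derivative 0) (at 0)" by auto
    have "open ((\<lambda>t. y + t *\<^sub>R w) -` U)" by (intro open_vimage open_U continuous_intros)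
    then show "open {t. y + t *\<^sub>R w \<noteq> 0}" by (simp add: vimage_def)
    show "0 \<in> {t. y + t *\<^sub>R w \<noteq> 0}" using y by simp
    show "det (ginv y) * c = det (M t)" if "t \<in> {t. y + t *\<^sub>R w \<noteq> 0}" for t
      using that g_det_const by (simp add: M_def det_mul g_det_def)
  qed
  ultimately show ?thesis using DERIV_unique by (fastforce simp: trace_def)
qed

lemma smooth_on_U_has_derivative: "smooth_on_set f U \<Longrightarrow> y \<noteq> 0 \<Longrightarrow> (f has_derivative (\<lambda>w. dirder w f y)) (at y)"
  using smooth_on_set_has_derivative by auto

lemma smooth_dgm: "smooth_on_set (\<lambda>y. dgm w y $ i $ j) U"
  unfolding dgm_def by (simp add: smooth_on_set_dirder smooth_gm)

lemma dirder_ginv: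
  assumes y: "y \<noteq> 0"
  shows "(\<chi> k l. dirder w (\<lambda>y. ginv y $ k $ l) y) = - (ginv y ** dgm w y ** ginv y)"
proof -
  let ?X = "(\<chi> k l. dirder w (\<lambda>y. ginv y $ k $ l) y) :: real^'n^'n"
  have "(?X ** gm y + ginv y ** dgm w y) $ i $ j = 0" for i j
  proof -
    have "((\<lambda>y. \<Sum>k\<in>UNIV. ginv y $ i $ k * gm y $ k $ j) has_derivative
        (\<lambda>w. \<Sum>k\<in>UNIV. ginv y $ i $ k * dirder w (\<lambda>y. gm y $ k $ j) y + dirder w (\<lambda>y. ginv y $ i $ k) y * gm y $ k $ j)) (at y)"
      by (intro has_derivative_sum has_derivative_mult smooth_on_U_has_derivative[OF smooth_ginv y] smooth_on_U_has_derivative[OF smooth_gm y])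
    then have "dirder w (\<lambda>y. \<Sum>k\<in>UNIV. ginv y $ i $ k * gm y $ k $ j) y
        = (\<Sum>k\<in>UNIV. ginv y $ i $ k * dirder w (\<lambda>y. gm y $ k $ j) y + dirder w (\<lambda>y. ginv y $ i $ k) y * gm y $ k $ j)"
      by (rule dirder_eq)
    moreover have "dirder w (\<lambda>y. \<Sum>k\<in>UNIV. ginv y $ i $ k * gm y $ k $ j) y = dirder w (\<lambda>y. (mat 1 :: real^'n^'n) $ i $ j) y"
    proof (rule dirder_cong_open(1)[OF open_U])
      fix x :: "real^'n" assume "x \<in> U"
      then have "(ginv x ** gm x) $ i $ j = (mat 1 :: real^'n^'n) $ i $ j" using ginv_gm[of x] by simp
      then show "(\<Sum>k\<in>UNIV. ginv x $ i $ k * gm x $ k $ j) = (mat 1 :: real^'n^'n) $ i $ j"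
        by (simp add: matrix_matrix_mult_def)
    qed (use y in simp)
    ultimately have "(\<Sum>k\<in>UNIV. ginv y $ i $ k * dirder w (\<lambda>y. gm y $ k $ j) y + dirder w (\<lambda>y. ginv y $ i $ k) y * gm y $ k $ j) = 0"
      by (simp add: dirder_eq[OF has_derivative_const])
    then show ?thesis by (simp add: matrix_matrix_mult_def dgm_def sum.distrib add.commute)
  qed
  then have "?X ** gm y + ginv y ** dgm w y = 0" by (simp add: vec_eq_iff)
  then have "?X ** gm y = - (ginv y ** dgm w y)" by (simp add: eq_neg_iff_add_eq_0)
  then have "?X ** gm y ** ginv y = - (ginv y ** dgm w y) ** ginv y" by simp
  moreover have "?X ** gm y ** ginv y = ?X" using gm_ginv[OF y] by (simp add: matrix_mul_assoc[symmetric])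
  moreover have "- A ** B = - (A ** B)" for A B :: "real^'n^'n"
    by (simp add: matrix_matrix_mult_def vec_eq_iff sum_negf)
  ultimately show ?thesis by simp
qed

text \<open>The identity trace (g^(-1) dg(w)) = 0 is differentiated once more along w; the
  derivative of the inverse supplies the quadratic term.\<close>

lemma trace_ginv_ddgm:
  assumes y: "y \<noteq> 0"
  shows "trace (ginv y ** ddgm w y) = trace (ginv y ** dgm w y ** ginv y ** dgm w y)"
proof -
  let ?X = "(\<chi> k l. dirder w (\<lambda>y. ginv y $ k $ l) y) :: real^'n^'n"
  have "((\<lambda>y. \<Sum>i\<in>UNIV. \<Sum>l\<in>UNIV. ginv y $ i $ l * dgm w y $ l $ i) has_derivative
      (\<lambda>v. \<Sum>i\<in>UNIV. \<Sum>l\<in>UNIV. ginv y $ i $ l * dirder v (\<lambda>y. dgm w y $ l $ i) y + dirder v (\<lambda>y. ginv y $ i $ l) y * dgm w y $ l $ i)) (at y)"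
    by (intro has_derivative_sum has_derivative_mult smooth_on_U_has_derivative[OF smooth_ginv y] smooth_on_U_has_derivative[OF smooth_dgm y])
  then have "dirder w (\<lambda>y. \<Sum>i\<in>UNIV. \<Sum>l\<in>UNIV. ginv y $ i $ l * dgm w y $ l $ i) y
      = (\<Sum>i\<in>UNIV. \<Sum>l\<in>UNIV. ginv y $ i $ l * dirder w (\<lambda>y. dgm w y $ l $ i) y + dirder w (\<lambda>y. ginv y $ i $ l) y * dgm w y $ l $ i)"
    by (rule dirder_eq)
  moreover have "dirder w (\<lambda>y. \<Sum>i\<in>UNIV. \<Sum>l\<in>UNIV. ginv y $ i $ l * dgm w y $ l $ i) y = dirder w (\<lambda>y. 0) y"
    using trace_ginv_dgm y by (intro dirder_cong_open(1)[OF open_U]) (auto simp: trace_def matrix_matrix_mult_def)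
  ultimately have "trace (ginv y ** ddgm w y) + trace (?X ** dgm w y) = 0"
    by (simp add: trace_def matrix_matrix_mult_def ddgm_def sum.distrib dirder_eq[OF has_derivative_const])
  moreover have "trace (- A ** B) = - trace (A ** B)" for A B :: "real^'n^'n"
    by (simp add: trace_def matrix_matrix_mult_def sum_negf)
  ultimately show ?thesis by (simp add: dirder_ginv[OF y] matrix_mul_assoc)
qed

text \<open>The flux is the g-gradient of g(u, u). Differentiating log det g twice shows that its divergence
  is the nonnegative trace of (g^-1 dg(u))^2; its radial component vanishes by homogeneity, so that
  the divergence integrates to zero against any cutoff depending on F only.\<close>

definition flux :: "real^'n \<Rightarrow> 'n \<Rightarrow> real^'n \<Rightarrow> real" where
  "flux u i y = (\<Sum>l\<in>UNIV. ginv y $ i $ l * dirder (axis l 1) (\<lambda>y. fund_g F y u u) y)"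

lemma smooth_flux: "smooth_on_set (flux u i) U"
  unfolding flux_def[abs_def]
  by (intro smooth_on_set_sum smooth_on_set_mult open_U smooth_ginv smooth_on_set_dirder smooth_fund_g)

lemma sum_dirder_flux:
  assumes y: "y \<noteq> 0"
  shows "(\<Sum>i\<in>UNIV. dirder (axis i 1) (flux u i) y) = trace (ginv y ** dgm u y ** ginv y ** dgm u y)"
proof -
  let ?\<psi> = "\<lambda>y. fund_g F y u u"
  have D: "dirder v (flux u i) y = (\<Sum>l\<in>UNIV. ginv y $ i $ l * dirder v (dirder (axis l 1) ?\<psi>) y + dirder v (\<lambda>y. ginv y $ i $ l) y * dirder (axis l 1) ?\<psi> y)" for v i
    unfolding flux_def[abs_def]
    by (intro dirder_eq has_derivative_sum has_derivative_mult smooth_on_U_has_derivative[OF smooth_ginv y] smooth_on_U_has_derivative[OF smooth_on_set_dirder[OF smooth_fund_g] y])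
  have X: "dirder v (\<lambda>y. ginv y $ i $ l) y = - (\<Sum>b\<in>UNIV. (\<Sum>a\<in>UNIV. ginv y $ i $ a * dgm v y $ a $ b) * ginv y $ b $ l)" for v i l
    using arg_cong[OF dirder_ginv[OF y, of v], of "\<lambda>M. M $ i $ l"] by (simp add: matrix_matrix_mult_def)
  \<comment> \<open>The columns of g^(-1) are divergence free: by symmetry of the third derivatives
    the contraction becomes a sum of traces of g^(-1) dg, which vanish.\<close>
  have piola: "(\<Sum>i\<in>UNIV. dirder (axis i 1) (\<lambda>y. ginv y $ i $ l) y) = 0" for l
  proof -
    have "(\<Sum>i\<in>UNIV. dirder (axis i 1) (\<lambda>y. ginv y $ i $ l) y)
        = - (\<Sum>i\<in>UNIV. \<Sum>b\<in>UNIV. (\<Sum>a\<in>UNIV. ginv y $ i $ a * dgm (axis b 1) y $ a $ i) * ginv y $ b $ l)"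
    proof -
      have sw: "dgm (axis i 1) y $ a $ b = dgm (axis b 1) y $ a $ i" for i a b
        using dgm_swap[OF y, of i a b] arg_cong[OF dgm_symmetric[OF y, of "axis b 1"], of "\<lambda>M. M $ a $ i"]
        by (simp add: transpose_def)
      have "(\<Sum>i\<in>UNIV. dirder (axis i 1) (\<lambda>y. ginv y $ i $ l) y)
          = (\<Sum>i\<in>UNIV. - (\<Sum>b\<in>UNIV. (\<Sum>a\<in>UNIV. ginv y $ i $ a * dgm (axis i 1) y $ a $ b) * ginv y $ b $ l))"
        by (simp only: X)
      also have "\<dots> = (\<Sum>i\<in>UNIV. - (\<Sum>b\<in>UNIV. (\<Sum>a\<in>UNIV. ginv y $ i $ a * dgm (axis b 1) y $ a $ i) * ginv y $ b $ l))"
        by (intro sum.cong refl arg_cong[where f=uminus] arg_cong2[where f="(*)"] sw)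
      finally show ?thesis by (simp only: sum_negf)
    qed
    also have "(\<Sum>i\<in>UNIV. \<Sum>b\<in>UNIV. (\<Sum>a\<in>UNIV. ginv y $ i $ a * dgm (axis b 1) y $ a $ i) * ginv y $ b $ l)
        = (\<Sum>b\<in>UNIV. \<Sum>i\<in>UNIV. (\<Sum>a\<in>UNIV. ginv y $ i $ a * dgm (axis b 1) y $ a $ i) * ginv y $ b $ l)"
      by (rule sum.swap)
    also have "\<dots> = (\<Sum>b\<in>UNIV. trace (ginv y ** dgm (axis b 1) y) * ginv y $ b $ l)"
      by (simp add: trace_def matrix_matrix_mult_def sum_distrib_right)
    also have "\<dots> = 0" by (simp add: trace_ginv_dgm[OF y])
    finally show ?thesis by simp
  qed
  \<comment> \<open>Fourth derivatives of F^2 / 2 commute, so the Hessian of g(u, u) is the second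
    derivative of the matrix g along u.\<close>
  have four: "dirder (axis i 1) (dirder (axis l 1) ?\<psi>) y = ddgm u y $ l $ i" for i l
  proof -
    note sq = smooth_on_set_dirder smooth_q
    have "dirder (axis i 1) (dirder (axis l 1) ?\<psi>) y = dirder (axis i 1) (\<lambda>y. (1/2) * dirder (axis l 1) (dirder u (dirder u q)) y) y"
      using y unfolding fund_g_dirder
      by (intro dirder_cong_open(1)[OF open_U] dirder_half) (auto intro: sq)
    also have "\<dots> = (1/2) * dirder (axis i 1) (dirder (axis l 1) (dirder u (dirder u q))) y"
      using y by (intro dirder_half) (auto intro: sq)
    also have "dirder (axis i 1) (dirder (axis l 1) (dirder u (dirder u q))) y = dirder (axis i 1) (dirder u (dirder u (dirder (axis l 1) q))) y"
    proof (rule dirder_cong_open(1)[OF open_U])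
      fix x assume x: "x \<in> U"
      have "dirder (axis l 1) (dirder u (dirder u q)) x = dirder u (dirder (axis l 1) (dirder u q)) x"
        by (rule dirder_commute[OF _ x]) (intro sq)
      also have "\<dots> = dirder u (dirder u (dirder (axis l 1) q)) x"
        by (rule dirder_cong_open(1)[OF open_U _ x]) (rule dirder_commute[OF smooth_q])
      finally show "dirder (axis l 1) (dirder u (dirder u q)) x = dirder u (dirder u (dirder (axis l 1) q)) x" .
    qed (use y in simp)
    also have "\<dots> = dirder u (dirder (axis i 1) (dirder u (dirder (axis l 1) q))) y"
      by (rule dirder_commute) (use y in \<open>auto intro: sq\<close>)
    also have "\<dots> = dirder u (dirder u (dirder (axis i 1) (dirder (axis l 1) q))) y"
      using y by (intro dirder_cong_open(1)[OF open_U] dirder_commute[of _ U]) (auto intro: sq)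
    also have "(1/2) * \<dots> = dirder u (\<lambda>y. (1/2) * dirder u (dirder (axis i 1) (dirder (axis l 1) q)) y) y"
      using y by (intro dirder_half[symmetric]) (auto intro: sq)
    also have "\<dots> = dirder u (\<lambda>y. dgm u y $ l $ i) y"
      using y by (intro dirder_cong_open(1)[OF open_U]) (auto simp: dgm_eq)
    finally show ?thesis by (simp add: ddgm_def)
  qed
  have "(\<Sum>i\<in>UNIV. dirder (axis i 1) (flux u i) y)
      = (\<Sum>i\<in>UNIV. \<Sum>l\<in>UNIV. ginv y $ i $ l * ddgm u y $ l $ i)
        + (\<Sum>i\<in>UNIV. \<Sum>l\<in>UNIV. dirder (axis i 1) (\<lambda>y. ginv y $ i $ l) y * dirder (axis l 1) ?\<psi> y)"
    by (simp add: D four sum.distrib)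
  also have "(\<Sum>i\<in>UNIV. \<Sum>l\<in>UNIV. dirder (axis i 1) (\<lambda>y. ginv y $ i $ l) y * dirder (axis l 1) ?\<psi> y)
      = (\<Sum>l\<in>UNIV. (\<Sum>i\<in>UNIV. dirder (axis i 1) (\<lambda>y. ginv y $ i $ l) y) * dirder (axis l 1) ?\<psi> y)"
    by (subst sum.swap) (simp add: sum_distrib_right)
  also have "\<dots> = 0" by (simp add: piola)
  also have "(\<Sum>i\<in>UNIV. \<Sum>l\<in>UNIV. ginv y $ i $ l * ddgm u y $ l $ i) = trace (ginv y ** ddgm u y)"
    by (simp add: trace_def matrix_matrix_mult_def)
  finally show ?thesis by (simp add: trace_ginv_ddgm[OF y])
qed

text \<open>The gradient of F^2 is 2 g y, so g^(-1) in the flux cancels and the radial derivative of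
  g(u, u) is left, which is 0 by homogeneity of degree 0.\<close>

lemma sum_dirder_q_flux:
  assumes y: "y \<noteq> 0"
  shows "(\<Sum>i\<in>UNIV. dirder (axis i 1) q y * flux u i y) = 0"
proof -
  let ?\<psi> = "\<lambda>y. fund_g F y u u"
  have sym: "ginv y $ i $ l = ginv y $ l $ i" for i l
  proof -
    have "gm y ** transpose (ginv y) = transpose (ginv y ** gm y)"
      by (simp add: matrix_transpose_mul gm_symmetric[OF y])
    also have "\<dots> = mat 1" by (simp add: ginv_gm[OF y])
    finally have "ginv y ** (gm y ** transpose (ginv y)) = ginv y" by simp
    then have "transpose (ginv y) = ginv y" by (simp add: matrix_mul_assoc ginv_gm[OF y])
    then have "transpose (ginv y) $ l $ i = ginv y $ l $ i" by (simp only:)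
    then show ?thesis by (simp add: transpose_def)
  qed
  have dq: "dirder (axis i 1) q y = 2 * (gm y *v y) $ i" for i
    by (simp add: gm_mult_component[OF y] fund_g_self[OF y] dirder_q[OF y])
  have "(\<Sum>i\<in>UNIV. dirder (axis i 1) q y * flux u i y)
      = (\<Sum>i\<in>UNIV. \<Sum>l\<in>UNIV. 2 * (ginv y $ l $ i * (gm y *v y) $ i) * dirder (axis l 1) ?\<psi> y)"
    by (simp add: dq flux_def sum_distrib_left sym mult_ac)
  also have "\<dots> = (\<Sum>l\<in>UNIV. \<Sum>i\<in>UNIV. 2 * (ginv y $ l $ i * (gm y *v y) $ i) * dirder (axis l 1) ?\<psi> y)"
    by (rule sum.swap)
  also have "\<dots> = (\<Sum>l\<in>UNIV. 2 * (ginv y *v (gm y *v y)) $ l * dirder (axis l 1) ?\<psi> y)"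
    by (simp add: matrix_vector_mult_def[of "ginv y"] sum_distrib_left sum_distrib_right mult_ac)
  also have "ginv y *v (gm y *v y) = y" by (simp add: matrix_vector_mul_assoc ginv_gm[OF y])
  also have "(\<Sum>l\<in>UNIV. 2 * y $ l * dirder (axis l 1) ?\<psi> y) = 2 * dirder y ?\<psi> y"
  proof -
    have "linear (\<lambda>v. dirder v ?\<psi> y)"
      using y by (intro dirder_linear smooth_on_set_differentiable[OF smooth_fund_g]) auto
    then have "dirder y ?\<psi> y = (\<Sum>l\<in>UNIV. y $ l * dirder (axis l 1) ?\<psi> y)" by (rule linear_axis_expansion)
    then show ?thesis by (simp add: sum_distrib_left mult.assoc)
  qed
  also have "dirder y ?\<psi> y = 0"
  proof -
    have "((\<lambda>s. ?\<psi> (0 + s *\<^sub>R y)) has_real_derivative dirder y ?\<psi> (0 + 1 *\<^sub>R y)) (at 1)"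
      using y by (intro smooth_on_set_line_derivative[OF smooth_fund_g]) auto
    then have "((\<lambda>s. ?\<psi> (s *\<^sub>R y)) has_real_derivative dirder y ?\<psi> y) (at 1)" by simp
    moreover have "((\<lambda>s. ?\<psi> (s *\<^sub>R y)) has_real_derivative 0) (at 1)"
    proof (rule has_field_derivative_transform_within_open)
      show "((\<lambda>s. ?\<psi> y) has_real_derivative 0) (at 1)" by auto
      show "open {0::real<..}" "(1::real) \<in> {0<..}" by auto
    qed (use y in \<open>simp add: fund_g_scale\<close>)
    ultimately show ?thesis using DERIV_unique by blast
  qed
  finally show ?thesis by simp
qed

text \<open>The cutoff vanishes for q < 1 and for q \<ge> 2. The product therefore extends by 0 to a
  compactly supported C^1 function on the whole space, although s is smooth off the origin
  only.\<close>

lemma cutoff_mult: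
  assumes s: "smooth_on_set s U"
  defines "f \<equiv> (\<lambda>x. if x = 0 then 0 else cutoff (q x) * s x)"
  shows "f differentiable (at x)" and "continuous_on UNIV (dirder v f)"
    and "x \<noteq> 0 \<Longrightarrow> dirder v f x = cutoff' (q x) * dirder v q x * s x + cutoff (q x) * dirder v s x"
    and "dirder v f 0 = 0" and "\<exists>R. \<forall>x. R < norm x \<longrightarrow> f x = 0" and "continuous_on UNIV f"
proof -
  let ?B = "{x. q x < 1}"
  have B: "open ?B" "0 \<in> ?B"
    by (auto intro!: open_Collect_less continuous_intros continuous_F)
  have B0: "f x = 0" if "x \<in> ?B" for x using that by (simp add: f_def cutoff_zero)
  have dB: "dirder v f x = 0 \<and> f differentiable (at x)" if "x \<in> ?B" for x v
    using dirder_cong_open(1)[OF B(1), of f "\<lambda>_. 0" x v] dirder_cong_open(2)[OF B(1), of f "\<lambda>_. 0" x] B0 that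
    by (simp add: dirder_eq[OF has_derivative_const])
  have D: "(f has_derivative (\<lambda>v. cutoff' (q x) * dirder v q x * s x + cutoff (q x) * dirder v s x)) (at x)" if x: "x \<noteq> 0" for x
  proof (rule has_derivative_transform_within_open[OF _ open_U])
    have "((\<lambda>x. cutoff (q x)) has_derivative (\<lambda>v. cutoff' (q x) * dirder v q x)) (at x)"
      using has_derivative_compose[OF smooth_on_U_has_derivative[OF smooth_q x] cutoff_has_derivative[unfolded has_field_derivative_def]] by (simp add: o_def)
    then have "((\<lambda>x. cutoff (q x) * s x) has_derivative (\<lambda>v. cutoff (q x) * dirder v s x + cutoff' (q x) * dirder v q x * s x)) (at x)"
      by (rule has_derivative_mult[OF _ smooth_on_U_has_derivative[OF s x]])
    then show "((\<lambda>x. cutoff (q x) * s x) has_derivative (\<lambda>v. cutoff' (q x) * dirder v q x * s x + cutoff (q x) * dirder v s x)) (at x)"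
      by (simp add: add.commute)
  qed (use x in \<open>auto simp: f_def\<close>)
  have diff: "f differentiable (at x)" for x
    using D[of x] dB[of 0] B(2) by (cases "x = 0") (auto simp: differentiable_def)
  then show "f differentiable (at x)" .
  show dx: "dirder v f x = cutoff' (q x) * dirder v q x * s x + cutoff (q x) * dirder v s x" if "x \<noteq> 0" for x
    using D[OF that] by (rule dirder_eq)
  show "dirder v f 0 = 0" using dB B(2) by blast
  show "continuous_on UNIV f" using diff by (meson continuous_at_imp_continuous_on differentiable_imp_continuous_within)
  have "continuous_on U (dirder v f)"
  proof (rule continuous_on_eq)
    have cc: "continuous_on UNIV cutoff" by (meson DERIV_continuous_on cutoff_has_derivative has_field_derivative_at_within)
    note qc = smooth_on_set_continuous_on[OF smooth_q]
    show "continuous_on U (\<lambda>x. cutoff' (q x) * dirder v q x * s x + cutoff (q x) * dirder v s x)"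
      by (intro continuous_on_add continuous_on_mult smooth_on_set_continuous_on smooth_on_set_dirder smooth_q s
          continuous_on_compose2[OF continuous_cutoff'[of UNIV] qc] continuous_on_compose2[OF cc qc]) auto
  qed (simp add: dx)
  moreover have "continuous_on ?B (dirder v f)"
    by (rule continuous_on_eq[where f="\<lambda>_. 0"]) (auto simp: dB)
  ultimately have "continuous_on (U \<union> ?B) (dirder v f)"
    by (intro continuous_on_open_Un open_U B(1))
  moreover have "U \<union> ?B = UNIV" using B(2) by auto
  ultimately show "continuous_on UNIV (dirder v f)" by simp
  obtain m where m: "0 < m" "\<And>y. m * norm y \<le> F y" using F_bounds by blast
  have "f x = 0" if "2 / m < norm x" for x
  proof -
    have "2 < F x" using m(1) m(2)[of x] that by (simp add: divide_less_eq mult.commute)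
    then have "2 * 2 \<le> F x * F x" by (intro mult_mono) auto
    then have "2 \<le> q x" by (simp add: power2_eq_square)
    then show ?thesis by (simp add: f_def cutoff_zero)
  qed
  then show "\<exists>R. \<forall>x. R < norm x \<longrightarrow> f x = 0" by blast
qed

text \<open>The divergence of the cut-off flux is continuous, nonnegative and has integral 0, hence
  vanishes identically. Where the cutoff is positive this makes the trace 0, and definiteness gives
  dg(u) = 0.\<close>

lemma dgm_zero_annulus:
  assumes "1 < q y" "q y < 2"
  shows "dgm u y = 0"
proof -
  have y: "y \<noteq> 0" using assms by auto
  define X where "X = (\<lambda>i x. if x = 0 then 0 else cutoff (q x) * flux u i x)"
  have cm1: "X i differentiable (at x)" and cm2: "continuous_on UNIV (dirder v (X i))"
    and cm3: "x \<noteq> 0 \<Longrightarrow> dirder v (X i) x = cutoff' (q x) * dirder v q x * flux u i x + cutoff (q x) * dirder v (flux u i) x"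
    and cm4: "dirder v (X i) 0 = 0" and cm5: "\<exists>R. \<forall>x. R < norm x \<longrightarrow> X i x = 0" for i x v
    unfolding X_def by (rule cutoff_mult[OF smooth_flux]; assumption?)+
  define f where "f = (\<lambda>x. \<Sum>i\<in>UNIV. dirder (axis i 1) (X i) x)"
  have Xi: "integrable lborel (dirder (axis i 1) (X i))" "(\<integral>x. dirder (axis i 1) (X i) x \<partial>lborel) = 0" for i
  proof -
    obtain R where R: "\<forall>x. R < norm x \<longrightarrow> X i x = 0" using cm5[of i] by blast
    show "integrable lborel (dirder (axis i 1) (X i))" "(\<integral>x. dirder (axis i 1) (X i) x \<partial>lborel) = 0"
      using integral_dirder_zero[OF cm1 cm2, of R i] R by blast+
  qed
  have f: "f x = cutoff (q x) * trace (ginv x ** dgm u x ** ginv x ** dgm u x)" if "x \<noteq> 0" for x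
  proof -
    have "f x = cutoff' (q x) * (\<Sum>i\<in>UNIV. dirder (axis i 1) q x * flux u i x) + cutoff (q x) * (\<Sum>i\<in>UNIV. dirder (axis i 1) (flux u i) x)"
      unfolding f_def cm3[OF that] by (simp add: sum.distrib sum_distrib_left mult.assoc)
    then show ?thesis by (simp add: sum_dirder_q_flux[OF that] sum_dirder_flux[OF that])
  qed
  note tp = trace_square_posdef[OF gm_symmetric _ gm_ginv dgm_symmetric]
  have "f y = 0"
  proof (rule continuous_integral_zero_nonneg[where f=f])
    show "continuous_on UNIV f" unfolding f_def by (intro continuous_on_sum cm2)
    show "integrable lborel f" unfolding f_def by (intro Bochner_Integration.integrable_sum Xi)
    show "(\<integral>x. f x \<partial>lborel) = 0" unfolding f_def using Xi by (simp add: Bochner_Integration.integral_sum)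
    show "0 \<le> f x" for x
    proof (cases "x = 0")
      case True
      then show ?thesis using cm4 by (simp add: f_def)
    next
      case False
      then show ?thesis using tp(1)[OF False _ False False, of u] by (simp add: f cutoff_nonneg gm_inner fund_g_pos)
    qed
  qed
  then have "trace (ginv y ** dgm u y ** ginv y ** dgm u y) = 0"
    using f[OF y] cutoff_pos[OF assms] by simp
  then show ?thesis using tp(2)[OF y _ y y, of u] y by (simp add: gm_inner fund_g_pos)
qed

lemma dgm_zero: assumes y: "y \<noteq> 0" shows "dgm u y = 0"
proof -
  \<comment> \<open>This factor moves y to F^2 = 3/2, inside the annulus. The vector u is scaled
    along with y, since g is homogeneous of degree 0.\<close>
  define r where "r = sqrt (3/2) / F y"
  have r: "0 < r" using F_pos[OF y] by (simp add: r_def)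
  have "F (r *\<^sub>R y) = sqrt (3/2)"
    unfolding F_scale_pos[OF r] using F_pos[OF y] by (simp add: r_def)
  then have "q (r *\<^sub>R y) = 3/2" by simp
  then have "dgm (r *\<^sub>R u) (r *\<^sub>R y) = 0" by (intro dgm_zero_annulus) auto
  moreover have "dgm (r *\<^sub>R u) (r *\<^sub>R y) $ i $ j = dgm u y $ i $ j" for i j
  proof -
    let ?k = "\<lambda>y. gm y $ i $ j"
    have ry: "r *\<^sub>R y \<noteq> 0" using r y by simp
    have "((\<lambda>x. ?k (r *\<^sub>R x)) has_derivative (\<lambda>v. dirder (r *\<^sub>R v) ?k (r *\<^sub>R y))) (at y)"
      by (rule has_derivative_compose[OF has_derivative_scaleR_right[OF has_derivative_ident] smooth_on_U_has_derivative[OF smooth_gm ry]])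
    then have "dirder u (\<lambda>x. ?k (r *\<^sub>R x)) y = dirder (r *\<^sub>R u) ?k (r *\<^sub>R y)" by (rule dirder_eq)
    moreover have "dirder u (\<lambda>x. ?k (r *\<^sub>R x)) y = dirder u ?k y"
      using y r by (intro dirder_cong_open(1)[OF open_U]) (auto simp: g_matrix_def fund_g_scale)
    ultimately show ?thesis by (simp add: dgm_def)
  qed
  ultimately show ?thesis by (simp add: vec_eq_iff)
qed

text \<open>Vanishing derivatives make g constant on connected sets. In dimension 1 the punctured
  space is disconnected, but there the single entry of g is its determinant.\<close>

theorem g_matrix_constant: "\<exists>Q. \<forall>y. y \<noteq> 0 \<longrightarrow> gm y = Q"
proof (cases "CARD('n) = 1")
  case True
  then obtain k :: 'n where k: "UNIV = {k}" by (metis card_1_singletonE)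
  have all: "i = k" for i :: 'n using k by auto
  have "gm y = (\<chi> i j. c)" if "y \<noteq> 0" for y
  proof -
    have "p = id" for p :: "'n \<Rightarrow> 'n" by (rule ext) (metis all)
    then have p: "{p. p permutes (UNIV :: 'n set)} = {id}" using permutes_id by blast
    have "g_det y = (\<Sum>p | p permutes (UNIV :: 'n set). of_int (sign p) * (\<Prod>i\<in>UNIV. gm y $ i $ p i))"
      by (simp add: g_det_def det_def)
    also have "\<dots> = gm y $ k $ k" unfolding p by (simp add: k sign_id)
    finally have "gm y $ k $ k = c" using g_det_const[OF that] by simp
    then show ?thesis using all by (metis (mono_tags, lifting) vec_eq_iff vec_lambda_beta)
  qed
  then show ?thesis by blast
next
  case False
  moreover have "0 < CARD('n)" by simp
  ultimately have "2 \<le> CARD('n)" by linarith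
  then have two: "2 \<le> DIM(real^'n)" by simp
  have conn: "connected U"
    using connected_punctured_universe[OF two, of 0] by (simp add: Compl_eq_Diff_UNIV)
  obtain y0 :: "real^'n" where y0: "y0 \<noteq> 0" using zero_neq_one by (metis axis_eq_0_iff)
  have "gm y = gm y0" if y: "y \<noteq> 0" for y
  proof -
    have "gm y $ i $ j = gm y0 $ i $ j" for i j
    proof (rule has_derivative_zero_unique_connected[OF open_U conn, of "\<lambda>y. gm y $ i $ j" y y0])
      fix x assume x: "x \<in> U"
      have "dirder w (\<lambda>y. gm y $ i $ j) x = dgm w x $ i $ j" for w by (simp add: dgm_def)
      then have "(\<lambda>w. dirder w (\<lambda>y. gm y $ i $ j) x) = (\<lambda>_. 0)" using dgm_zero x by auto
      then show "((\<lambda>y. gm y $ i $ j) has_derivative (\<lambda>h. 0)) (at x)"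
        using smooth_on_U_has_derivative[OF smooth_gm, of x i j] x by simp
    qed (use y y0 in auto)
    then show ?thesis by (simp add: vec_eq_iff)
  qed
  then show ?thesis by blast
qed

end

section \<open>The affine isoperimetric inequality\<close>

text \<open>The exponent n + 2 starts at 2, the first one for which the inequality is
  strict.\<close>

lemma strict_bernoulli:
  fixes x :: real
  shows "-1 < x \<Longrightarrow> x \<noteq> 0 \<Longrightarrow> 1 + real (n + 2) * x < (1 + x) ^ (n + 2)"
proof (induction n)
  case 0
  then have "0 < x * x" using not_real_square_gt_zero by blast
  then show ?case by (simp add: power2_eq_square algebra_simps)
next
  case (Suc n)
  have "1 + real (Suc n + 2) * x < (1 + real (n + 2) * x) * (1 + x)"
  proof -
    have "0 < x * x" using Suc.prems not_real_square_gt_zero by blast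
    then have "0 < real (n + 2) * (x * x)" by (rule mult_pos_pos[rotated]) simp
    then show ?thesis by (simp add: algebra_simps)
  qed
  also have "\<dots> < (1 + x) ^ (n + 2) * (1 + x)" using Suc by (intro mult_strict_right_mono) auto
  finally show ?case by (simp add: mult.commute)
qed

text \<open>This is the tangent at t = 1 of a strictly concave power. It is Bernoulli's inequality
  for t^a = 1 + x, raised to the power 1 / a = n + 1.\<close>

lemma powr_tangent:
  fixes t :: real
  assumes t: "0 < t" and n: "0 < n"
  defines "a \<equiv> 1 / (real n + 1)"
  shows "t powr a \<le> 1 + a * (t - 1)" and "t powr a = 1 + a * (t - 1) \<Longrightarrow> t = 1"
proof -
  obtain m where m: "n = Suc m" using n gr0_conv_Suc by auto
  define x where "x = t powr a - 1"
  have x: "-1 < x" using t by (simp add: x_def)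
  have "(t powr a) ^ (m + 2) = t powr (a * real (m + 2))"
    using powr_realpow[of "t powr a" "m + 2"] t by (simp only: powr_powr powr_gt_zero)
  also have "a * real (m + 2) = 1" by (simp add: a_def m)
  finally have pw: "(1 + x) ^ (m + 2) = t" using t by (simp add: x_def)
  have rm: "real (m + 2) = 1 / a" by (simp add: a_def m)
  have a0: "0 < a" by (simp add: a_def)
  have strict: "t powr a < 1 + a * (t - 1)" if "t powr a \<noteq> 1"
  proof -
    have "1 + real (m + 2) * x < t" using strict_bernoulli[OF x, of m] that pw by (simp add: x_def)
    then have "a * (1 + (1 / a) * x) < a * t" unfolding rm using a0 by (rule mult_strict_left_mono)
    then show ?thesis using a0 by (simp add: x_def algebra_simps)
  qed
  have eq1: "t = 1" if "t powr a = 1" using pw that by (simp add: x_def)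
  show "t powr a \<le> 1 + a * (t - 1)" using strict eq1 by (cases "t powr a = 1") auto
  show "t powr a = 1 + a * (t - 1) \<Longrightarrow> t = 1" using strict eq1 by fastforce
qed

lemma matrix_vector_mult_minus: "A *v (- x) = - (A *v x)" for A :: "real^'n^'m"
  by (simp add: linear_neg)

lemma quadratic_cauchy_schwarz:
  fixes Q :: "real^'n^'n"
  assumes sym: "transpose Q = Q" and pos: "\<And>x. x \<noteq> 0 \<Longrightarrow> 0 < x \<bullet> (Q *v x)"
  shows "(y \<bullet> (Q *v z))\<^sup>2 \<le> (y \<bullet> (Q *v y)) * (z \<bullet> (Q *v z))"
proof (cases "z = 0")
  case False
  have symm: "x \<bullet> (Q *v y) = y \<bullet> (Q *v x)" for x y
    by (metis sym dot_lmul_matrix inner_commute vector_transpose_matrix)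
  define c where "c = (y \<bullet> (Q *v z)) / (z \<bullet> (Q *v z))"
  have zz: "0 < z \<bullet> (Q *v z)" using pos[OF False] .
  have "0 \<le> (y - c *\<^sub>R z) \<bullet> (Q *v (y - c *\<^sub>R z))"
    using pos[of "y - c *\<^sub>R z"] by (cases "y - c *\<^sub>R z = 0") auto
  also have "\<dots> = y \<bullet> (Q *v y) - 2 * c * (y \<bullet> (Q *v z)) + c * c * (z \<bullet> (Q *v z))"
    by (simp add: matrix_vector_mult_diff_distrib matrix_vector_mult_scaleR inner_diff_left inner_diff_right symm[of z y] algebra_simps)
  also have "\<dots> = y \<bullet> (Q *v y) - (y \<bullet> (Q *v z))\<^sup>2 / (z \<bullet> (Q *v z))"
    using zz by (simp add: c_def power2_eq_square)
  finally show ?thesis using zz by (simp add: divide_le_eq)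
qed simp

context minkowski
begin

abbreviation (input) V :: real where "V \<equiv> measure lborel K"
abbreviation (input) sig :: real where "sig \<equiv> sigma_BH F"

text \<open>The tangent of D^a at D = \<kappa> is integrated with the Santalo bound \<kappa> V for
  the integral of D. Equality makes the tangent inequality an equality almost everywhere, so D =
  \<kappa> there; continuity and homogeneity extend this to all nonzero y.\<close>

lemma centered_bound:
  assumes centered: "(\<integral>x. indicator K x *\<^sub>R x \<partial>lborel) = 0"
  shows "centro_affine_area \<le> ennreal ((sig\<^sup>2) powr (1 / (real CARD('n) + 1)) * V)"
    and "centro_affine_area = ennreal ((sig\<^sup>2) powr (1 / (real CARD('n) + 1)) * V) \<Longrightarrow> y \<noteq> 0 \<Longrightarrow> g_det y = sig\<^sup>2"
proof -
  let ?a = "1 / (real CARD('n) + 1)"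
  define \<kappa> where "\<kappa> = sig\<^sup>2"
  have V: "0 < V" and \<kappa>: "0 < \<kappa>" using emeasure_K sigma_BH_pos by (auto simp: \<kappa>_def)
  have a: "0 < ?a" "?a < 1" by (simp_all add: Suc_leI)
  let ?S = "K - {0}"
  have [measurable]: "?S \<in> sets borel" by measurable
  have mS: "emeasure lborel ?S = ennreal V"
  proof -
    have "emeasure lborel ?S = emeasure lborel K" by (intro emeasure_Diff_null_set) auto
    then show ?thesis using emeasure_K by simp
  qed
  define d where "d = (\<lambda>y. indicator ?S y * g_det y)"
  have dm [measurable]: "d \<in> borel_measurable borel"
  proof -
    have "(\<lambda>y. indicator ?S y * (indicator U y * g_det y)) \<in> borel_measurable borel" by measurable
    moreover have "indicator ?S y * (indicator U y * g_det y) = d y" for y by (auto simp: d_def indicator_def)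
    ultimately show ?thesis by simp
  qed
  have d0: "0 \<le> d y" for y using g_det_pos[of y] by (auto simp: d_def indicator_def intro: less_imp_le)
  have nd: "(\<integral>\<^sup>+y. ennreal (d y) \<partial>lborel) \<le> ennreal (\<kappa> * V)"
  proof -
    have eq: "(\<integral>\<^sup>+y. ennreal (d y) \<partial>lborel) = (\<integral>\<^sup>+y. ennreal (g_det y) * indicator ?S y \<partial>lborel)"
      by (intro nn_integral_cong) (auto simp: d_def indicator_def)
    have "(\<integral>\<^sup>+y. ennreal (d y) \<partial>lborel) * ennreal V \<le> ennreal ((omega CARD('n))\<^sup>2)"
      using nn_integral_g_det_le[OF centered] emeasure_K(1) unfolding eq by simp
    also have "(omega CARD('n))\<^sup>2 = \<kappa> * V * V" using V by (simp add: \<kappa>_def sigma_BH_eq power2_eq_square)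
    finally have "(\<integral>\<^sup>+y. ennreal (d y) \<partial>lborel) * ennreal V \<le> ennreal (\<kappa> * V) * ennreal V"
      using V \<kappa> by (simp add: ennreal_mult'')
    then show ?thesis using V by (simp add: mult.commute[of _ "ennreal V"] ennreal_mult_le_mult_iff)
  qed
  then have dI: "integrable lborel d"
    using d0 by (intro integrableI_nonneg) (auto intro: le_less_trans)
  have dle: "(\<integral>y. d y \<partial>lborel) \<le> \<kappa> * V"
    using nd dI d0 V \<kappa> by (simp add: nn_integral_eq_integral)
  have SI: "integrable lborel (indicator ?S :: _ \<Rightarrow> real)" using mS by (intro integrable_real_indicator) auto
  have Sm: "(\<integral>y. indicator ?S y \<partial>lborel) = V" using mS V by (simp add: measure_def)
  \<comment> \<open>The tangent line of D^a at D = \<kappa>, restricted to the punctured ball and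
    split into its constant and its linear part.\<close>
  define tn where "tn = (\<lambda>y. \<kappa> powr ?a * ((1 - ?a) * indicator ?S y + (?a / \<kappa>) * d y))"
  have tnI: "integrable lborel tn"
    unfolding tn_def using SI dI by (intro integrable_mult_right Bochner_Integration.integrable_add) auto
  have tnle: "(\<integral>y. tn y \<partial>lborel) \<le> \<kappa> powr ?a * V"
  proof -
    have "(\<integral>y. tn y \<partial>lborel) = \<kappa> powr ?a * ((1 - ?a) * V + (?a / \<kappa>) * (\<integral>y. d y \<partial>lborel))"
      unfolding tn_def using SI dI Sm by simp
    also have "\<dots> \<le> \<kappa> powr ?a * ((1 - ?a) * V + (?a / \<kappa>) * (\<kappa> * V))"
      using dle a \<kappa> by (intro mult_left_mono add_left_mono) auto
    also have "\<dots> = \<kappa> powr ?a * V" using \<kappa> by (simp add: left_diff_distrib)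
    finally show ?thesis .
  qed
  define p where "p = (\<lambda>y. indicator ?S y * g_det y powr ?a)"
  have [measurable]: "p \<in> borel_measurable borel" unfolding p_def by (rule borel_powr_g_det)
  have tang: "p y \<le> tn y" "y \<in> ?S \<Longrightarrow> p y = tn y \<Longrightarrow> g_det y = \<kappa>" for y
  proof -
    have *: "p y = \<kappa> powr ?a * (g_det y / \<kappa>) powr ?a" "tn y = \<kappa> powr ?a * (1 + ?a * (g_det y / \<kappa> - 1))" if "y \<in> ?S"
      using that \<kappa> g_det_pos[of y] by (auto simp: p_def tn_def d_def powr_divide right_diff_distrib)
    have pt: "0 < g_det y / \<kappa>" if "y \<in> ?S" using that \<kappa> g_det_pos[of y] by auto
    show "p y \<le> tn y"
    proof (cases "y \<in> ?S")
      case True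
      then show ?thesis unfolding *[OF True] using powr_tangent(1)[OF pt[OF True], of "CARD('n)"] by (intro mult_left_mono) auto
    qed (simp add: p_def tn_def d_def)
    assume S: "y \<in> ?S" and "p y = tn y"
    then have "(g_det y / \<kappa>) powr ?a = 1 + ?a * (g_det y / \<kappa> - 1)" using \<kappa> unfolding *[OF S] by simp
    then have "g_det y / \<kappa> = 1" by (intro powr_tangent(2)[OF pt[OF S], of "CARD('n)"]) auto
    then show "g_det y = \<kappa>" using \<kappa> by simp
  qed
  have p0: "0 \<le> p y" for y by (simp add: p_def)
  have pI: "integrable lborel p"
    by (rule Bochner_Integration.integrable_bound[OF tnI]) (use p0 tang(1) in \<open>auto intro!: AE_I2 order_trans[OF _ abs_ge_self]\<close>)
  have area: "centro_affine_area = ennreal (\<integral>y. p y \<partial>lborel)"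
  proof -
    have "centro_affine_area = (\<integral>\<^sup>+y. ennreal (p y) \<partial>lborel)"
      unfolding centro_affine_area_def by (intro nn_integral_cong) (auto simp: p_def indicator_def)
    then show ?thesis using pI p0 by (simp add: nn_integral_eq_integral)
  qed
  have "(\<integral>y. p y \<partial>lborel) \<le> (\<integral>y. tn y \<partial>lborel)" by (intro integral_mono pI tnI tang)
  then have pV: "(\<integral>y. p y \<partial>lborel) \<le> \<kappa> powr ?a * V" using tnle by linarith
  then show "centro_affine_area \<le> ennreal ((sig\<^sup>2) powr ?a * V)" unfolding area \<kappa>_def by (rule ennreal_leI)
  assume eq: "centro_affine_area = ennreal ((sig\<^sup>2) powr ?a * V)" and y: "y \<noteq> 0"
  have "0 \<le> (\<integral>y. p y \<partial>lborel)" by (intro Bochner_Integration.integral_nonneg p0)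
  then have "(\<integral>y. p y \<partial>lborel) = \<kappa> powr ?a * V" using eq V unfolding area \<kappa>_def by simp
  then have zero: "(\<integral>y. tn y - p y \<partial>lborel) = 0"
    using tnle \<open>(\<integral>y. p y \<partial>lborel) \<le> (\<integral>y. tn y \<partial>lborel)\<close> pI tnI by simp
  have "AE y in lborel. tn y - p y = 0"
    using zero integral_nonneg_eq_0_iff_AE[of lborel "\<lambda>y. tn y - p y"] pI tnI tang(1) by (auto intro: Bochner_Integration.integrable_diff)
  then obtain N where N: "{y. tn y - p y \<noteq> 0} \<subseteq> N" "N \<in> null_sets lborel"
    unfolding eventually_ae_filter by auto
  \<comment> \<open>The exceptional set is open by continuity and contained in a null set, hence
    empty.\<close>
  have contK: "g_det y = \<kappa>" if y: "y \<in> ?S" for y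
  proof (rule ccontr)
    assume ne: "g_det y \<noteq> \<kappa>"
    let ?W = "{y \<in> ?S. g_det y \<noteq> \<kappa>}"
    have "?W \<subseteq> N" using N(1) tang(2) by force
    moreover have "negligible N" using N(2) by (simp add: negligible_iff_null_sets null_sets_completionI)
    ultimately have "negligible ?W" using negligible_subset by blast
    moreover have "open ?W"
    proof -
      have "open ?S" using open_K by auto
      then have "open (?S \<inter> g_det -` (- {\<kappa>}))"
        using continuous_on_subset[OF continuous_on_g_det, of ?S]
        by (intro continuous_open_preimage) auto
      then show ?thesis by (simp add: Int_def vimage_def)
    qed
    ultimately show False using open_not_negligible[of ?W] y ne by blast
  qed
  \<comment> \<open>The factor moves y to F = 1/2, inside the punctured ball.\<close>
  define r where "r = 1 / (2 * F y)"
  have r: "0 < r" using F_pos[OF y] by (simp add: r_def)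
  have "F (r *\<^sub>R y) = 1/2" unfolding F_scale_pos[OF r] using F_pos[OF y] by (simp add: r_def)
  then have "g_det (r *\<^sub>R y) = \<kappa>" using y r by (intro contK) (auto simp: K_def)
  then show "g_det y = sig\<^sup>2" using g_det_scale[OF r y] by (simp add: \<kappa>_def)
qed

text \<open>The exponents (N - 1) / (N + 1) and 2 / (N + 1) of sigma add up to 1, and sigma V =
  omega by the Busemann-Hausdorff normalisation. The comparison is thus a multiplication by positive
  constants, which preserves equality as well.\<close>

lemma affine_volume_compare:
  assumes fin: "centro_affine_area \<le> ennreal ((sig\<^sup>2) powr (1 / (real CARD('n) + 1)) * V)"
  shows "affine_volume F \<le> real CARD('n) * omega CARD('n)"
    and "affine_volume F = real CARD('n) * omega CARD('n) \<longleftrightarrow> centro_affine_area = ennreal ((sig\<^sup>2) powr (1 / (real CARD('n) + 1)) * V)"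
proof -
  let ?a = "1 / (real CARD('n) + 1)"
  define A where "A = enn2real centro_affine_area"
  define N where "N = real CARD('n)"
  have N: "1 \<le> N" by (simp add: N_def Suc_leI)
  have V: "0 < V" and s: "0 < sig" using emeasure_K sigma_BH_pos by auto
  have "centro_affine_area < \<infinity>" using fin by (rule le_less_trans) simp
  then have A: "centro_affine_area = ennreal A" "0 \<le> A" by (simp_all add: A_def)
  have le: "A \<le> (sig\<^sup>2) powr ?a * V" using fin A V by (simp add: ennreal_le_iff)
  have av: "affine_volume F = N * (sig powr ((N - 1) / (N + 1)) * A)"
    using affine_volume_eq \<open>centro_affine_area < \<infinity>\<close> by (simp add: N_def A_def)
  define C where "C = sig powr ((N - 1) / (N + 1))"
  have C: "0 < C" using s by (simp add: C_def)
  have "C * ((sig\<^sup>2) powr ?a * V) = sig powr ((N - 1) / (N + 1) + 2 * ?a) * V"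
    using s by (simp add: C_def powr_add powr_powr flip: powr_numeral)
  also have "(N - 1) / (N + 1) + 2 * ?a = 1"
    using N by (simp add: N_def[symmetric] add_divide_distrib[symmetric])
  finally have om: "C * ((sig\<^sup>2) powr ?a * V) = omega CARD('n)" using V omega_pos[of "CARD('n)"] by (simp add: sigma_BH_eq)
  have "C * A \<le> omega CARD('n)" unfolding om[symmetric] using C le by (intro mult_left_mono) auto
  then show "affine_volume F \<le> real CARD('n) * omega CARD('n)"
    unfolding av C_def[symmetric] N_def[symmetric] using N by (intro mult_left_mono) auto
  have "affine_volume F = real CARD('n) * omega CARD('n) \<longleftrightarrow> C * A = omega CARD('n)"
    unfolding av C_def[symmetric] N_def[symmetric] using N by simp
  also have "\<dots> \<longleftrightarrow> A = (sig\<^sup>2) powr ?a * V" unfolding om[symmetric] using C by simp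
  also have "\<dots> \<longleftrightarrow> centro_affine_area = ennreal ((sig\<^sup>2) powr ?a * V)" using A V by (simp add: ennreal_inj)
  finally show "affine_volume F = real CARD('n) * omega CARD('n) \<longleftrightarrow> centro_affine_area = ennreal ((sig\<^sup>2) powr ?a * V)" .
qed

text \<open>The differential of F at z is a supporting functional: F z is its value at z, hence its
  mean over K, which is at most the mean of F, and F < 1 on K.\<close>

lemma centroid_in_K:
  defines "z \<equiv> (1 / V) *\<^sub>R (\<integral>x. indicator K x *\<^sub>R x \<partial>lborel)"
  shows "F z < 1"
proof (cases "z = 0")
  case False
  have V: "0 < V" by (rule emeasure_K)
  have bl: "bounded_linear (dF F z)" using linear_dF[OF False] by (simp add: linear_conv_bounded_linear)
  have KI: "integrable lborel (indicator K :: _ \<Rightarrow> real)" using emeasure_K by (intro integrable_real_indicator) auto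
  have FI: "integrable lborel (\<lambda>x. indicator K x * F x)"
    by (rule Bochner_Integration.integrable_bound[OF KI]) (auto simp: indicator_def K_def F_nonneg intro!: AE_I2)
  have int1: "integrable lborel (\<lambda>x. indicator K x * dF F z x)"
    using integrable_bounded_linear[OF bl integrable_K] linear_scale[OF linear_dF[OF False]] by simp
  have "V * F z = V * dF F z z" by (simp add: dF_self[OF False])
  also have "\<dots> = dF F z (V *\<^sub>R z)" using linear_scale[OF linear_dF[OF False]] by simp
  also have "V *\<^sub>R z = (\<integral>x. indicator K x *\<^sub>R x \<partial>lborel)" using V by (simp add: z_def)
  also have "dF F z \<dots> = (\<integral>x. dF F z (indicator K x *\<^sub>R x) \<partial>lborel)"
    by (rule integral_bounded_linear[OF bl integrable_K, symmetric])
  also have "\<dots> = (\<integral>x. indicator K x * dF F z x \<partial>lborel)" using linear_scale[OF linear_dF[OF False]] by simp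
  also have "\<dots> \<le> (\<integral>x. indicator K x * F x \<partial>lborel)"
    by (intro integral_mono int1 FI mult_left_mono dF_le False) auto
  finally have le: "V * F z \<le> (\<integral>x. indicator K x * F x \<partial>lborel)" .
  have "(\<integral>x. indicator K x * F x \<partial>lborel) < (\<integral>x. indicator K x \<partial>lborel)"
  proof (rule ccontr)
    assume n: "\<not> ?thesis"
    have nn: "0 \<le> indicator K x - indicator K x * F x" for x by (auto simp: indicator_def K_def)
    have i: "integrable lborel (\<lambda>x. indicator K x - indicator K x * F x)" using KI FI by (rule Bochner_Integration.integrable_diff)
    have "0 \<le> (\<integral>x. indicator K x - indicator K x * F x \<partial>lborel)" by (intro Bochner_Integration.integral_nonneg nn)
    then have "(\<integral>x. indicator K x - indicator K x * F x \<partial>lborel) = 0" using n KI FI by simp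
    then have "AE x in lborel. indicator K x - indicator K x * F x = 0"
      using integral_nonneg_eq_0_iff_AE[OF i] nn by simp
    then have "AE x in lborel. x \<notin> K" by eventually_elim (auto simp: indicator_def K_def split: if_splits)
    then have "K \<in> null_sets lborel" by (subst (asm) AE_iff_null_sets[symmetric]) auto
    then show False using emeasure_K V by auto
  qed
  also have "(\<integral>x. indicator K x \<partial>lborel) = V" using emeasure_K by (simp add: measure_def)
  finally have "V * F z < V * 1" using le by simp
  then show ?thesis using V by simp
qed simp

text \<open>For a Euclidean norm g is the constant matrix Q. The transpose of the frame W maps the
  unit ball onto K, so V = |det W| omega and sigma^2 = det Q; the integrand is then
  constant.\<close>

lemma quadratic_norm_area:
  assumes Q: "transpose Q = Q" "\<And>x. x \<noteq> 0 \<Longrightarrow> 0 < x \<bullet> (Q *v x)" and F: "\<And>x. F x = sqrt (x \<bullet> (Q *v x))"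
  shows "centro_affine_area = ennreal ((sig\<^sup>2) powr (1 / (real CARD('n) + 1)) * V)"
proof -
  have symm: "x \<bullet> (Q *v y) = y \<bullet> (Q *v x)" for x y
    by (metis Q(1) dot_lmul_matrix inner_commute vector_transpose_matrix)
  have q: "q = (\<lambda>x. x \<bullet> (Q *v x))"
  proof
    fix x
    have "0 \<le> x \<bullet> (Q *v x)" using Q(2)[of x] by (cases "x = 0") auto
    then show "q x = x \<bullet> (Q *v x)" by (simp add: F)
  qed
  have bl: "bounded_linear ((*v) Q)" by (rule matrix_vector_mul_bounded_linear)
  have d1: "dirder u q x = 2 * (u \<bullet> (Q *v x))" for u x
  proof -
    have "(q has_derivative (\<lambda>u. x \<bullet> (Q *v u) + u \<bullet> (Q *v x))) (at x)"
      unfolding q by (intro has_derivative_inner has_derivative_ident bounded_linear_imp_has_derivative bl)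
    then show ?thesis by (simp add: dirder_eq symm[of x u])
  qed
  have d2: "dirder v (dirder u q) x = 2 * (u \<bullet> (Q *v v))" for u v x
  proof -
    have "(dirder u q has_derivative (\<lambda>v. 2 * (u \<bullet> (Q *v v)))) (at x)"
      unfolding d1 by (intro has_derivative_mult_right bounded_linear_imp_has_derivative 
          bounded_linear_compose[OF bounded_linear_inner_right bl])
    then show ?thesis by (rule dirder_eq)
  qed
  have "gm y = Q" for y
  proof -
    have "axis i 1 \<bullet> (Q *v axis j 1) = Q $ i $ j" for i j
      by (simp add: matrix_vector_mult_basis inner_axis' column_def)
    then show ?thesis by (simp add: g_matrix_def fund_g_dirder d2 vec_eq_iff)
  qed
  then have gd: "g_det y = det Q" for y by (simp add: g_det_def)
  obtain W :: "real^'n^'n" where W: "W ** Q ** transpose W = mat 1" using posdef_frame_exists Q by blast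
  have "det W * det Q * det W = 1" using W by (metis det_I det_mul det_transpose)
  then have dW: "(det W)\<^sup>2 * det Q = 1" by (simp add: power2_eq_square mult_ac)
  have W0: "det W \<noteq> 0" using dW by auto
  let ?T = "(*v) (transpose W)"
  have lin: "linear ?T" by (rule matrix_vector_mul_linear)
  have TF: "F (?T x) = norm x" for x
  proof -
    have "?T x \<bullet> (Q *v ?T x) = x \<bullet> ((W ** Q ** transpose W) *v x)"
      by (simp add: matrix_vector_mul_assoc[symmetric] dot_lmul_matrix[symmetric] vector_transpose_matrix)
    then show ?thesis by (simp add: F W norm_eq_sqrt_inner)
  qed
  have dT: "det (transpose W) \<noteq> 0" using W0 by simp
  have inj: "inj ?T" using dT lin by (metis det_nz_iff_inj matrix_of_matrix_vector_mul)
  have surj: "surj ?T" by (rule linear_injective_imp_surjective[OF lin inj refl])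
  have Kimg: "K = ?T ` ball 0 1"
  proof
    show "K \<subseteq> ?T ` ball 0 1"
    proof
      fix y assume y: "y \<in> K"
      obtain x where "y = ?T x" using surj by (metis surjD)
      then show "y \<in> ?T ` ball 0 1" using y TF[of x] by (auto simp: K_def)
    qed
    show "?T ` ball 0 1 \<subseteq> K" using TF by (auto simp: K_def)
  qed
  have detT: "det (matrix ?T) = det W" by (simp only: matrix_of_matrix_vector_mul det_transpose)
  have "(\<integral>\<^sup>+y. 1 * indicator (?T ` ball 0 1) y \<partial>lborel)
      = (\<integral>\<^sup>+x. 1 * ennreal \<bar>det (matrix ?T)\<bar> * indicator (ball (0::real^'n) 1) x \<partial>lborel)"
  proof (rule nn_integral_change_of_variables(2))
    show "(?T has_derivative ?T) (at x)" for x by (intro bounded_linear_imp_has_derivative matrix_vector_mul_bounded_linear)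
    show "inj_on ?T (ball 0 1)" using inj by (rule inj_on_subset) auto
  qed auto
  also have "\<dots> = ennreal \<bar>det W\<bar> * emeasure lborel (ball (0::real^'n) 1)" 
    unfolding detT mult_1 by (rule nn_integral_cmult_indicator) simp
  also have "emeasure lborel (ball (0::real^'n) 1) = ennreal (omega CARD('n))"
    by (subst emeasure_ball) (auto simp: unit_ball_vol_def omega_def add_divide_distrib)
  finally have "ennreal V = ennreal (\<bar>det W\<bar> * omega CARD('n))"
    unfolding Kimg[symmetric] using emeasure_K(1) by (simp add: ennreal_mult')
  then have VW: "V = \<bar>det W\<bar> * omega CARD('n)" using omega_pos[of "CARD('n)"] by (simp add: ennreal_inj)
  have "sig = 1 / \<bar>det W\<bar>" using omega_pos[of "CARD('n)"] W0 by (simp add: sigma_BH_eq VW)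
  then have "sig\<^sup>2 = 1 / (det W)\<^sup>2" by (simp add: power_divide)
  also have "\<dots> = det Q" using dW W0 by (simp add: field_simps)
  finally have sQ: "sig\<^sup>2 = det Q" .
  have "centro_affine_area = (\<integral>\<^sup>+y. ennreal (det Q powr (1 / (real CARD('n) + 1))) * indicator (K - {0}) y \<partial>lborel)"
    unfolding centro_affine_area_def gd ..
  also have "\<dots> = ennreal (det Q powr (1 / (real CARD('n) + 1))) * emeasure lborel (K - {0})"
    by (rule nn_integral_cmult_indicator) measurable
  also have "emeasure lborel (K - {0}) = emeasure lborel K" by (intro emeasure_Diff_null_set) auto
  finally show ?thesis using emeasure_K by (simp add: sQ ennreal_mult'')
qed

end

section \<open>Randers norms as translates of Euclidean norms\<close>

context minkowski_translate
begin

lemma sigma_BH_Ft: "sigma_BH Ft = sigma_BH F" and measure_K_Ft: "measure lborel T.K = measure lborel K"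
proof -
  show "measure lborel T.K = measure lborel K" using emeasure_K_Ft by (simp add: measure_def)
  then show "sigma_BH Ft = sigma_BH F" by (simp add: T.sigma_BH_eq sigma_BH_eq)
qed

text \<open>F y is the positive root t of the quadratic equation (y - t z) . Q (y - t z) = t^2. With
  s = y . c it is (sqrt (s^2 + \<mu> y . Q y) - s) / \<mu>; the square root is the Euclidean part A,
  the term -s / \<mu> the linear form b.\<close>

lemma randers_norm_of_quadratic_translate:
  assumes Q: "transpose Q = Q" "\<And>x. x \<noteq> 0 \<Longrightarrow> 0 < x \<bullet> (Q *v x)" and Ft: "\<And>x. Ft x = sqrt (x \<bullet> (Q *v x))"
  shows "randers_norm F"
proof -
  have symm: "x \<bullet> (Q *v y) = y \<bullet> (Q *v x)" for x y
    by (metis Q(1) dot_lmul_matrix inner_commute vector_transpose_matrix)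
  have Qnn: "0 \<le> x \<bullet> (Q *v x)" for x using Q(2)[of x] by (cases "x = 0") auto
  define c where "c = Q *v z"
  define \<mu> where "\<mu> = 1 - z \<bullet> c"
  \<comment> \<open>The translate contains -z because K contains the origin.\<close>
  have "- z \<in> T.K" by (simp add: K_Ft K_def)
  then have "sqrt (z \<bullet> c) < 1" using Ft[of "-z"] by (simp add: T.K_def c_def matrix_vector_mult_minus)
  then have \<mu>: "0 < \<mu>" by (simp add: \<mu>_def)
  have zc: "0 \<le> z \<bullet> c" using Qnn by (simp add: c_def)
  define A :: "real^'n^'n" where "A = (\<chi> i j. (c $ i * c $ j + \<mu> * Q $ i $ j) / \<mu>\<^sup>2)"
  define b where "b = (- 1 / \<mu>) *\<^sub>R c"
  have AQ: "y \<bullet> (A *v y) = ((y \<bullet> c)\<^sup>2 + \<mu> * (y \<bullet> (Q *v y))) / \<mu>\<^sup>2" for y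
  proof -
    have "A *v y = (1 / \<mu>\<^sup>2) *\<^sub>R ((y \<bullet> c) *\<^sub>R c + \<mu> *\<^sub>R (Q *v y))"
      by (auto simp: vec_eq_iff A_def matrix_vector_mult_def inner_vec_def sum_distrib_left sum_distrib_right sum.distrib sum_divide_distrib algebra_simps add_divide_distrib)
    then show ?thesis by (simp add: inner_add_right power2_eq_square)
  qed
  have Apos: "0 < y \<bullet> (A *v y)" if "y \<noteq> 0" for y
    unfolding AQ using Q(2)[OF that] \<mu> by (intro divide_pos_pos add_nonneg_pos) auto
  \<comment> \<open>Cauchy-Schwarz for Q bounds the dual norm of b by the Q-norm of z, which is less
    than 1.\<close>
  have bound: "\<bar>b \<bullet> y\<bar> \<le> sqrt (z \<bullet> c)" if "sqrt (y \<bullet> (A *v y)) = 1" for y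
  proof -
    define s2 where "s2 = (y \<bullet> c)\<^sup>2"
    define Qy where "Qy = y \<bullet> (Q *v y)"
    have "y \<bullet> (A *v y) = 1" using that by simp
    then have e: "s2 + \<mu> * Qy = \<mu>\<^sup>2" unfolding AQ using \<mu> by (simp add: s2_def Qy_def field_simps)
    have "s2 \<le> Qy * (z \<bullet> c)"
      using quadratic_cauchy_schwarz[OF Q, of y z] by (simp add: s2_def Qy_def c_def)
    then have "\<mu> * s2 \<le> \<mu> * (Qy * (z \<bullet> c))" using \<mu> by (intro mult_left_mono) auto
    moreover have "(s2 + \<mu> * Qy) * (z \<bullet> c) = s2 - \<mu> * s2 + \<mu> * (Qy * (z \<bullet> c))"
      by (simp add: \<mu>_def algebra_simps)
    ultimately have "s2 \<le> \<mu>\<^sup>2 * (z \<bullet> c)" unfolding e by linarith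
    then have "s2 / \<mu>\<^sup>2 \<le> z \<bullet> c" using \<mu> by (simp add: divide_le_eq mult.commute)
    moreover have "(b \<bullet> y)\<^sup>2 = s2 / \<mu>\<^sup>2" by (simp add: b_def s2_def power_mult_distrib power_divide inner_commute)
    ultimately have "(b \<bullet> y)\<^sup>2 \<le> z \<bullet> c" by simp
    then show ?thesis by (metis real_sqrt_abs real_sqrt_le_iff)
  qed
  have "Sup {\<bar>b \<bullet> y\<bar> | y. sqrt (y \<bullet> (A *v y)) = 1} \<le> sqrt (z \<bullet> c)"
  proof (rule cSup_least)
    obtain y0 :: "real^'n" where y0: "y0 \<noteq> 0" using zero_neq_one by (metis axis_eq_0_iff)
    define y1 where "y1 = (1 / sqrt (y0 \<bullet> (A *v y0))) *\<^sub>R y0"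
    have "sqrt (y1 \<bullet> (A *v y1)) = 1"
      using Apos[OF y0] by (simp add: y1_def matrix_vector_mult_scaleR)
    then show "{\<bar>b \<bullet> y\<bar> | y. sqrt (y \<bullet> (A *v y)) = 1} \<noteq> {}" by blast
  qed (use bound in auto)
  then have sup: "Sup {\<bar>b \<bullet> y\<bar> | y. sqrt (y \<bullet> (A *v y)) = 1} < 1"
    using \<mu> by (simp add: \<mu>_def) (meson le_less_trans real_sqrt_lt_1_iff)
  have Feq: "F y = sqrt (y \<bullet> (A *v y)) + b \<bullet> y" for y
  proof (cases "y = 0")
    case False
    define t where "t = F y"
    have t: "0 < t" using F_pos[OF False] by (simp add: t_def)
    define s where "s = y \<bullet> c"
    define Qy where "Qy = y \<bullet> (Q *v y)"
    have Qy: "0 < Qy" using Q(2)[OF False] by (simp add: Qy_def)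
    have "Ft (y - t *\<^sub>R z) = t" using Ft_\<Phi>[OF False] by (simp add: t_def \<Phi>_def)
    then have "t\<^sup>2 = (y - t *\<^sub>R z) \<bullet> (Q *v (y - t *\<^sub>R z))" using Ft Qnn by (metis real_sqrt_pow2)
    also have "\<dots> = Qy - 2 * t * s + t * t * (z \<bullet> c)"
      by (simp add: matrix_vector_mult_diff_distrib matrix_vector_mult_scaleR inner_diff_left inner_diff_right symm[of z y] algebra_simps
          c_def s_def Qy_def)
    finally have quad: "\<mu> * t * t + 2 * t * s - Qy = 0" by (simp add: \<mu>_def power2_eq_square algebra_simps)
    define w where "w = \<mu> * t + s"
    have "w\<^sup>2 = s\<^sup>2 + \<mu> * (\<mu> * t * t + 2 * t * s)" by (simp add: w_def power2_eq_square algebra_simps)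
    also have "\<mu> * t * t + 2 * t * s = Qy" using quad by simp
    finally have w2: "w\<^sup>2 = s\<^sup>2 + \<mu> * Qy" .
    have "s\<^sup>2 < w\<^sup>2" using w2 \<mu> Qy by simp
    then have "\<bar>s\<bar> < \<bar>w\<bar>" by (simp add: abs_le_square_iff not_le[symmetric])
    moreover have "s < w" using \<mu> t by (simp add: w_def)
    ultimately have "0 < w" by linarith
    then have ws: "w = sqrt (s\<^sup>2 + \<mu> * Qy)" using w2 by (metis less_imp_le real_sqrt_unique)
    have "sqrt (y \<bullet> (A *v y)) = sqrt (s\<^sup>2 + \<mu> * Qy) / \<mu>"
      unfolding AQ s_def[symmetric] Qy_def[symmetric] using \<mu> by (simp add: real_sqrt_divide)
    then have "sqrt (y \<bullet> (A *v y)) + b \<bullet> y = (w - s) / \<mu>"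
      using ws by (simp add: b_def s_def inner_commute diff_divide_distrib)
    also have "\<dots> = t" using \<mu> by (simp add: w_def)
    finally show ?thesis by (simp add: t_def)
  qed simp
  have "transpose A = A"
    using arg_cong[OF Q(1), of "\<lambda>M. M $ _ $ _"] by (simp add: transpose_def A_def vec_eq_iff mult.commute)
  then show ?thesis unfolding randers_norm_def using Apos sup Feq by blast
qed

end

context minkowski
begin

text \<open>Squaring sqrt (y . A y) = 1 - b . y on F = 1 gives y . Q0 y + 2 b . y = 1 with Q0 = A -
  b b^T. Completing the square, the center z solves Q0 z = -b and the right side becomes 1 + k,
  which is divided out in Q.\<close>

lemma randers_translate_quadratic:
  assumes "randers_norm F"
  shows "\<exists>z Q. F z < 1 \<and> transpose Q = Q \<and> (\<forall>x. x \<noteq> 0 \<longrightarrow> 0 < x \<bullet> (Q *v x)) \<and>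
    (\<forall>x. x \<noteq> 0 \<longrightarrow> F (x + sqrt (x \<bullet> (Q *v x)) *\<^sub>R z) = sqrt (x \<bullet> (Q *v x)))"
proof -
  obtain A :: "real^'n^'n" and b where A: "transpose A = A" "\<And>y. y \<noteq> 0 \<Longrightarrow> 0 < y \<bullet> (A *v y)"
    and F: "\<And>y. F y = sqrt (y \<bullet> (A *v y)) + b \<bullet> y"
    using assms unfolding randers_norm_def by blast
  define \<alpha> where "\<alpha> = (\<lambda>y. sqrt (y \<bullet> (A *v y)))"
  have Ann: "0 \<le> y \<bullet> (A *v y)" for y using A(2)[of y] by (cases "y = 0") auto
  have \<alpha>2: "(\<alpha> y)\<^sup>2 = y \<bullet> (A *v y)" for y using Ann by (simp add: \<alpha>_def)
  \<comment> \<open>Positivity of F at y and at -y is the strict bound on the linear part.\<close>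
  have \<alpha>b: "\<bar>b \<bullet> y\<bar> < \<alpha> y" if "y \<noteq> 0" for y
  proof -
    have "0 < F y" "0 < F (- y)" using F_pos that by auto
    then show ?thesis unfolding F \<alpha>_def by (simp add: matrix_vector_mult_minus)
  qed
  define Q0 :: "real^'n^'n" where "Q0 = (\<chi> i j. A $ i $ j - b $ i * b $ j)"
  have Q0v: "Q0 *v y = A *v y - (b \<bullet> y) *\<^sub>R b" for y
    by (auto simp: vec_eq_iff Q0_def matrix_vector_mult_def inner_vec_def sum_distrib_left sum_subtractf algebra_simps)
  have Q0i: "x \<bullet> (Q0 *v y) = x \<bullet> (A *v y) - (b \<bullet> x) * (b \<bullet> y)" for x y
    by (simp add: Q0v inner_diff_right inner_commute)
  have Q0sym: "transpose Q0 = Q0"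
  proof -
    have "A $ j $ i = A $ i $ j" for i j
      using arg_cong[OF A(1), of "\<lambda>M. M $ i $ j"] by (simp add: transpose_def)
    then show ?thesis by (simp add: transpose_def Q0_def vec_eq_iff mult.commute)
  qed
  have Q0pos: "0 < y \<bullet> (Q0 *v y)" if "y \<noteq> 0" for y
  proof -
    have "\<bar>b \<bullet> y\<bar>\<^sup>2 < (\<alpha> y)\<^sup>2" using \<alpha>b[OF that] by (intro power_strict_mono) auto
    then have "(b \<bullet> y)\<^sup>2 < y \<bullet> (A *v y)" by (simp add: \<alpha>2)
    then show ?thesis by (simp add: Q0i power2_eq_square)
  qed
  have symm: "x \<bullet> (Q0 *v y) = y \<bullet> (Q0 *v x)" for x y
    by (metis Q0sym dot_lmul_matrix inner_commute vector_transpose_matrix)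
  have "det Q0 \<noteq> 0" using det_posdef_pos[OF Q0sym Q0pos] by simp
  then obtain B where "Q0 ** B = mat 1" using invertible_det_nz invertible_right_inverse by blast
  define z where "z = B *v (- b)"
  have z: "Q0 *v z = - b" using \<open>Q0 ** B = mat 1\<close> by (simp add: z_def matrix_vector_mul_assoc)
  define k where "k = z \<bullet> (Q0 *v z)"
  have k: "0 \<le> k" using Q0pos[of z] by (cases "z = 0") (auto simp: k_def)
  have bz: "b \<bullet> z = - k" by (simp add: k_def z inner_commute)
  have xz: "x \<bullet> (Q0 *v z) = - (b \<bullet> x)" for x by (simp add: z inner_commute)
  have Fz: "F z < 1"
  proof -
    have "(\<alpha> z)\<^sup>2 = k + k * k" using Q0i[of z z] by (simp add: \<alpha>2 k_def[symmetric] bz)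
    moreover have "k + k * k < (1 + k)\<^sup>2" using k unfolding power2_eq_square by (simp add: algebra_simps)
    ultimately have "(\<alpha> z)\<^sup>2 < (1 + k)\<^sup>2" by (simp only:)
    moreover have "0 \<le> 1 + k" using k by simp
    ultimately have "\<alpha> z < 1 + k" by (rule power2_less_imp_less)
    then show ?thesis using F[of z] \<alpha>_def bz by simp
  qed
  define Q :: "real^'n^'n" where "Q = (1 / (1 + k)) *\<^sub>R Q0"
  have Qv: "x \<bullet> (Q *v y) = (x \<bullet> (Q0 *v y)) / (1 + k)" for x y
    by (simp add: Q_def scaleR_matrix_vector_assoc[symmetric])
  have "F (x + sqrt (x \<bullet> (Q *v x)) *\<^sub>R z) = sqrt (x \<bullet> (Q *v x))" if x: "x \<noteq> 0" for x
  proof -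
    define t where "t = sqrt (x \<bullet> (Q *v x))"
    have t: "0 < t" using Q0pos[OF x] k by (simp add: t_def Qv)
    have t2: "t * t * (1 + k) = x \<bullet> (Q0 *v x)"
      using Q0pos[OF x] k by (simp add: t_def Qv)
    define y where "y = x + t *\<^sub>R z"
    have by': "b \<bullet> y = b \<bullet> x - t * k" by (simp add: y_def inner_add_right bz)
    have "y \<bullet> (Q0 *v y) = x \<bullet> (Q0 *v x) + 2 * t * (x \<bullet> (Q0 *v z)) + t * t * k"
      by (simp add: y_def matrix_vector_right_distrib matrix_vector_mult_scaleR inner_add_left inner_add_right symm[of z x] k_def algebra_simps)
    then have "(\<alpha> y)\<^sup>2 = x \<bullet> (Q0 *v x) - 2 * t * (b \<bullet> x) + t * t * k + (b \<bullet> y) * (b \<bullet> y)"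
      using Q0i[of y y] by (simp add: \<alpha>2 xz)
    also have "\<dots> = (t - b \<bullet> y)\<^sup>2" unfolding t2[symmetric] by' by (simp add: power2_eq_square algebra_simps)
    finally have sq: "(\<alpha> y)\<^sup>2 = (t - b \<bullet> y)\<^sup>2" .
    have \<alpha>nn: "0 \<le> \<alpha> y" using Ann by (simp add: \<alpha>_def)
    \<comment> \<open>Squaring admits a second sign; it would give t = b . y - \<alpha> y \<le> 0,
      contrary to t > 0.\<close>
    have "\<alpha> y = t - b \<bullet> y"
    proof (rule ccontr)
      assume "\<alpha> y \<noteq> t - b \<bullet> y"
      then have "\<alpha> y = - (t - b \<bullet> y)" using sq by (simp add: power2_eq_iff)
      then have "t = b \<bullet> y - \<alpha> y" by simp
      moreover have "b \<bullet> y - \<alpha> y \<le> 0" using \<alpha>b[of y] \<alpha>nn by (cases "y = 0") auto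
      ultimately show False using t by linarith
    qed
    then show ?thesis unfolding t_def[symmetric] y_def[symmetric] F by (simp add: \<alpha>_def)
  qed
  moreover have "transpose Q = Q" using Q0sym by (simp add: Q_def transpose_scalar)
  moreover have "0 < x \<bullet> (Q *v x)" if "x \<noteq> 0" for x using Q0pos[OF that] k by (simp add: Qv)
  ultimately show ?thesis using Fz by blast
qed

lemma affine_isoperimetric:
  shows "centro_affine_area \<le> ennreal ((sig\<^sup>2) powr (1 / (real CARD('n) + 1)) * V)"
    and "centro_affine_area = ennreal ((sig\<^sup>2) powr (1 / (real CARD('n) + 1)) * V) \<longleftrightarrow> randers_norm F"
proof -
  define z where "z = (1 / V) *\<^sub>R (\<integral>x. indicator K x *\<^sub>R x \<partial>lborel)"
  interpret Z: minkowski_translate F z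
    by unfold_locales (use centroid_in_K in \<open>simp add: z_def\<close>)
  have centered: "(\<integral>x. indicator Z.T.K x *\<^sub>R x \<partial>lborel) = 0"
    unfolding Z.centroid_K_Ft using emeasure_K(2) by (simp add: z_def)
  note inv = Z.sigma_BH_Ft Z.measure_K_Ft Z.centro_affine_area_Ft
  show "centro_affine_area \<le> ennreal ((sig\<^sup>2) powr (1 / (real CARD('n) + 1)) * V)"
    using Z.T.centered_bound(1)[OF centered] unfolding inv .
  show "centro_affine_area = ennreal ((sig\<^sup>2) powr (1 / (real CARD('n) + 1)) * V) \<longleftrightarrow> randers_norm F"
  proof
    assume "centro_affine_area = ennreal ((sig\<^sup>2) powr (1 / (real CARD('n) + 1)) * V)"
    then have "Z.T.g_det y = sig\<^sup>2" if "y \<noteq> 0" for y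
      using Z.T.centered_bound(2)[OF centered _ that] unfolding inv by blast
    then interpret D: minkowski_constant_det Z.Ft "sig\<^sup>2" by unfold_locales
    obtain Q where Q: "\<And>y. y \<noteq> 0 \<Longrightarrow> g_matrix Z.Ft y = Q" using D.g_matrix_constant by blast
    obtain y0 :: "real^'n" where y0: "y0 \<noteq> 0" using zero_neq_one by (metis axis_eq_0_iff)
    show "randers_norm F"
    proof (rule Z.randers_norm_of_quadratic_translate)
      show "transpose Q = Q" using Z.T.gm_symmetric[OF y0] Q[OF y0] by simp
      show "0 < x \<bullet> (Q *v x)" if "x \<noteq> 0" for x
        using Z.T.gm_inner[OF y0, of x x] Z.T.fund_g_pos[OF y0 that] Q[OF y0] by simp
      show "Z.Ft x = sqrt (x \<bullet> (Q *v x))" for x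
      proof (cases "x = 0")
        case False
        have "x \<bullet> (Q *v x) = (Z.Ft x)\<^sup>2"
          using Z.T.gm_inner[OF False, of x x] Z.T.fund_g_self[OF False, of x] Z.T.dF_self[OF False] Q[OF False]
          by (simp add: power2_eq_square)
        then show ?thesis using Z.T.F_nonneg[of x] by simp
      qed simp
    qed
  next
    assume "randers_norm F"
    then obtain z' Q where Q: "F z' < 1" "transpose Q = Q" "\<And>x. x \<noteq> 0 \<Longrightarrow> 0 < x \<bullet> (Q *v x)"
      "\<And>x. x \<noteq> 0 \<Longrightarrow> F (x + sqrt (x \<bullet> (Q *v x)) *\<^sub>R z') = sqrt (x \<bullet> (Q *v x))"
      using randers_translate_quadratic by blast
    interpret Y: minkowski_translate F z' by unfold_locales (rule Q(1))
    have "Y.Ft x = sqrt (x \<bullet> (Q *v x))" for x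
    proof (cases "x = 0")
      case False
      then show ?thesis using Q(3,4)[OF False] by (intro Y.Ft_eqI) auto
    qed simp
    from Y.T.quadratic_norm_area[OF Q(2,3) this]
    show "centro_affine_area = ennreal ((sig\<^sup>2) powr (1 / (real CARD('n) + 1)) * V)"
      unfolding Y.sigma_BH_Ft Y.measure_K_Ft Y.centro_affine_area_Ft .
  qed
qed

end

theorem theorem8:
  fixes F :: "real^'n \<Rightarrow> real"
  assumes "minkowski_norm F"
  shows "affine_volume F \<le> real CARD('n) * omega CARD('n)
         \<and> (affine_volume F = real CARD('n) * omega CARD('n) \<longleftrightarrow> randers_norm F)"
proof -
  interpret minkowski F by standard (rule assms)
  show ?thesis
    using affine_isoperimetric affine_volume_compare by blast
qed

end
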